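(* Let $G$ be a non-trivial finite group and $P(T,Y)\in\mathbb{Q}[T][Y]$ a monic separable polynomial of group $G$ and splitting field $F$ over $\mathbb{Q}(T)$. Then $P(T,Y)$ is generic if and only if there is a Möbius transformation $\mu(T)=(aT+b)/(cT+d)$, with $a,b,c,d\in\mathbb{Q}$ and $ad-bc\neq 0$, such that one of the following conditions holds: (1) $G=\mathbb{Z}/2\mathbb{Z}$ and $F$ is the splitting field over $\mathbb{Q}(T)$ of $Y^2-\mu(T)$; (2) $G=\mathbb{Z}/3\mathbb{Z}$ and $F$ is the splitting field over $\mathbb{Q}(T)$ of $Y^3-\mu(T)Y^2+(\mu(T)-3)Y+1$; (3) $G=S_3$ and $F$ is the splitting field over $\mathbb{Q}(T)$ of $Y^3+\mu(T)Y+\mu(T)$.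
   Context: "Monic separable polynomial $P(T,Y)\in k[T][Y]$" means monic in $Y$ and separable as a polynomial in $Y$ over $k(T)$; its group $G$ is the Galois group over $k(T)$ of its splitting field over $k(T)$. For a field $L$, ${\sf R}_G(L)$ is the set of all finite Galois field extensions $E/L$ with Galois group (isomorphic to) $G$. Given an overfield $L\supseteq k$, a monic separable polynomial $P(T,Y)\in k[T][Y]$ of group $G$ over $k(T)$ is $L$-parametric if, for every $E/L\in{\sf R}_G(L)$, there exists $t_0\in L$ such that $E$ is the splitting field over $L$ of $P(t_0,Y)$. It is generic if it is $L$-parametric for every overfield $L\supseteq k$. Here $k=\mathbb{Q}$. *)

theory Defs
  imports
    "HOL-Algebra.Algebraic_Closure_Type"
    "HOL-Algebra.Bij"
    "HOL-Algebra.Elementary_Groups"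
    "HOL-Algebra.Finite_Extensions"
    "HOL-Algebra.Generated_Fields"
    "HOL-Algebra.Sym_Groups"
begin

text \<open>
  Fields over which one quantifies are HOL-Algebra records. An extension of \<open>L\<close> is a field \<open>E\<close>
  together with a structure map \<open>\<iota>\<close> from \<open>L\<close> to \<open>E\<close>; the base field inside \<open>E\<close> is
  \<open>\<iota> ` carrier L\<close>.
\<close>

definition field_extension ::
    "('a, 'm) ring_scheme \<Rightarrow> ('b, 'n) ring_scheme \<Rightarrow> ('a \<Rightarrow> 'b) \<Rightarrow> bool" where
  "field_extension L E \<iota> \<longleftrightarrow> field L \<and> field E \<and> \<iota> \<in> ring_hom L E"

definition galois_group ::
    "('a, 'm) ring_scheme \<Rightarrow> ('b, 'n) ring_scheme \<Rightarrow> ('a \<Rightarrow> 'b) \<Rightarrow> ('b \<Rightarrow> 'b) monoid" where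
  "galois_group L E \<iota> = (BijGroup (carrier E))
     \<lparr>carrier := {\<sigma> \<in> Bij (carrier E). \<sigma> \<in> ring_hom E E \<and> (\<forall>x\<in>carrier L. \<sigma> (\<iota> x) = \<iota> x)}\<rparr>"

definition finite_galois_extension ::
    "('a, 'm) ring_scheme \<Rightarrow> ('b, 'n) ring_scheme \<Rightarrow> ('a \<Rightarrow> 'b) \<Rightarrow> bool" where
  "finite_galois_extension L E \<iota> \<longleftrightarrow>
     field_extension L E \<iota> \<and>
     ring.finite_dimension E (\<iota> ` carrier L) (carrier E) \<and>
     {x \<in> carrier E. \<forall>\<sigma>\<in>carrier (galois_group L E \<iota>). \<sigma> x = x} = \<iota> ` carrier L"

text \<open>
  Univariate polynomials over a record \<open>L\<close> are coefficient lists in the sense of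
  \<^theory>\<open>HOL-Algebra.Polynomials\<close>: leading coefficient first, and nonzero.
\<close>

definition splitting_field ::
    "('a, 'm) ring_scheme \<Rightarrow> ('b, 'n) ring_scheme \<Rightarrow> ('a \<Rightarrow> 'b) \<Rightarrow> 'a list \<Rightarrow> bool" where
  "splitting_field L E \<iota> p \<longleftrightarrow>
     field_extension L E \<iota> \<and>
     ring.splitted E (map \<iota> p) \<and>
     generate_field E (\<iota> ` carrier L \<union> set_mset (ring.roots E (map \<iota> p))) = carrier E"

definition coeff_list :: "'a::zero poly \<Rightarrow> 'a list" where
  "coeff_list p = rev (coeffs p)"

definition separable_poly :: "'a::field poly \<Rightarrow> bool" where
  "separable_poly p \<longleftrightarrow> rsquarefree (map_poly to_ac p)"

text \<open>
  A bivariate polynomial in $k[T][Y]$ is a polynomial in \<open>Y\<close> whose coefficients are polynomials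
  in \<open>T\<close>. The following is $P(t_0,Y)$ over \<open>L\<close>, where \<open>\<epsilon>\<close> embeds \<open>k\<close> into \<open>L\<close>. If \<open>P\<close> is monic
  in \<open>Y\<close> then the list is again monic, so it needs no normalization.
\<close>

definition specialize ::
    "('l, 'm) ring_scheme \<Rightarrow> ('k::zero \<Rightarrow> 'l) \<Rightarrow> 'k poly poly \<Rightarrow> 'l \<Rightarrow> 'l list" where
  "specialize L \<epsilon> P t\<^sub>0 = map (\<lambda>p. ring.eval L (map \<epsilon> (coeff_list p)) t\<^sub>0) (coeff_list P)"

text \<open>
  The overfield \<open>L\<close> of \<open>k\<close> is given with its embedding \<open>\<epsilon>\<close>. The extensions \<open>E\<close> of \<open>L\<close> are carried by
  the same type as \<open>L\<close>. As they need not contain \<open>L\<close> as a subset, every finite extension of an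
  infinite \<open>L\<close> occurs among them up to \<open>L\<close>-isomorphism, even if the carrier of \<open>L\<close> is the whole type.
\<close>

definition parametric_poly ::
    "'l ring \<Rightarrow> ('k::field \<Rightarrow> 'l) \<Rightarrow> ('g, 'x) monoid_scheme \<Rightarrow> 'k poly poly \<Rightarrow> bool" where
  "parametric_poly L \<epsilon> G P \<longleftrightarrow>
     (\<forall>(E :: 'l ring) \<iota>.
        finite_galois_extension L E \<iota> \<and> galois_group L E \<iota> \<cong> G \<longrightarrow>
        (\<exists>t\<^sub>0\<in>carrier L. splitting_field L E \<iota> (specialize L \<epsilon> P t\<^sub>0)))"

text \<open>
  HOL cannot quantify over fields of all cardinalities at once: \<open>L\<close> ranges over all overfields of the
  rationals whose carrier is a subset of the type \<open>'l\<close>. The type has to be infinite for any to exist.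
\<close>

definition generic_poly ::
    "'l itself \<Rightarrow> ('g, 'x) monoid_scheme \<Rightarrow> rat poly poly \<Rightarrow> bool" where
  "generic_poly (_ :: 'l itself) G P \<longleftrightarrow>
     (\<forall>(L :: 'l ring) \<epsilon>. field_extension (ring_of_type_algebra :: rat ring) L \<epsilon> \<longrightarrow>
        parametric_poly L \<epsilon> G P)"

abbreviation QT :: "rat poly fract ring" where
  "QT \<equiv> ring_of_type_algebra"

definition moebius :: "rat \<Rightarrow> rat \<Rightarrow> rat \<Rightarrow> rat \<Rightarrow> rat poly fract" where
  "moebius a b c d = Fract [:b, a:] [:d, c:]"

end

theory Submission
  imports Defs "HOL-Library.Countable_Set"
begin

text \<open>
  Suppose $P$ is generic. Let $G$ permute the coordinates of the field $E_0$ of rational functions in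
  $|G|$ variables regularly. Genericity applied to $E_0/E_0^G$ and restriction to a general line put
  a splitting field of $P$ inside some $\<rat>(s)$; by Lueroth it is a rational function field, so
  $F \cong \<rat>(X)$ over $\<rat>(T)$, with $T$ mapped to some $R \in \<rat>(X)$. The group $G$ is then a
  finite group of rational Moebius transformations fixing $R$. A root of $R = t$ in $E_0$ is permuted by
  $G$ through these transformations, which forces each involution among them to have a rational fixed point.
  Up to conjugation the group is therefore generated by $-X$, by $-1/(1+X)$, or by $-1/(1+X)$ and $1/X$, and
  $R$ differs by a Moebius transformation from an invariant $J$ of degree 2, 3 or 6, for which $\<rat>(X)$
  is the splitting field of the listed polynomial.

  Conversely, a $G$-extension $E/L$ contains infinitely many $w$ on which the Galois group acts through
  the same Moebius transformations; for all but finitely many of them $E = L(w)$ is the splitting field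
  of $P(R(w), Y)$, and $R(w) \in L$ by invariance.
\<close>

text \<open>Genericity can only be tested on fields carried by the type \<open>'l\<close>, of which
  nothing is known except that it is infinite. The test field must therefore be countable: E_0 is
  realized as the fraction field of the polynomial functions in countably many variables over Q, of
  which G moves only |G|, and it is copied into \<open>'l\<close> along an injection.

  The rational fixed points keep the list short. A traceless rational matrix with a rational fixed
  point has negative determinant. A power of a matrix of order 4 or 6 would be traceless with
  positive determinant, so these orders do not occur, and neither do the involutions d/X with d not
  a square.

  That the degree of R equals |G| comes from two opposite bounds: substitutions fixing R are
  automorphisms of F over Q(T), and G acts faithfully on a root of R = t in E_0.

  In the converse the points w are written down explicitly, as rational multiples of an element that
  changes sign or as quotients of differences of three conjugates. A rational parameter makes them
  infinite in number, so the finitely many bad ones can be avoided.\<close>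

section \<open>Ring homomorphisms and field embeddings between type-class rings\<close>

locale rhom =
  fixes h :: "'a::comm_ring_1 \<Rightarrow> 'b::comm_ring_1"
  assumes add: "h (x + y) = h x + h y"
    and mult: "h (x * y) = h x * h y"
    and one [simp]: "h 1 = 1"
begin

lemma zero [simp]: "h 0 = 0"
  using add[of 0 0] by simp

lemma neg: "h (- x) = - h x"
  using add[of x "- x"] by (simp add: eq_neg_iff_add_eq_0 add.commute)

lemma diff: "h (x - y) = h x - h y"
  using add[of x "- y"] by (simp add: neg)

lemma sums: "h (sum f A) = (\<Sum>x\<in>A. h (f x))"
  by (induction A rule: infinite_finite_induct) (auto simp: add)

lemma prods: "h (prod f A) = (\<Prod>x\<in>A. h (f x))"
  by (induction A rule: infinite_finite_induct) (auto simp: mult)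

lemma of_nat [simp]: "h (of_nat n) = of_nat n"
  by (induction n) (auto simp: add)

lemma of_int [simp]: "h (of_int n) = of_int n"
  by (cases n rule: int_cases2) (auto simp: neg)

lemma numeral [simp]: "h (numeral n) = numeral n"
  using of_nat[of "numeral n"] by (simp del: of_nat)

lemma coeff_mp [simp]: "Polynomial.coeff (map_poly h p) i = h (Polynomial.coeff p i)"
  by (simp add: coeff_map_poly)

lemma mp_add: "map_poly h (p + q) = map_poly h p + map_poly h q"
  by (rule poly_eqI) (simp add: add)

lemma mp_mult: "map_poly h (p * q) = map_poly h p * map_poly h q"
  by (rule poly_eqI) (simp add: coeff_mult sums mult)

lemma mp_smult: "map_poly h (Polynomial.smult c q) = Polynomial.smult (h c) (map_poly h q)"
  by (rule poly_eqI) (simp add: mult)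

lemma mp_pCons [simp]: "map_poly h (pCons c q) = pCons (h c) (map_poly h q)"
  by (rule map_poly_pCons) simp

lemma mp_1 [simp]: "map_poly h 1 = 1"
  by (simp add: one_pCons)

lemma mp_rhom: "rhom (map_poly h)"
  by unfold_locales (auto simp: mp_add mp_mult)

lemma mp_prod_list: "map_poly h (\<Prod>b\<leftarrow>bs. [:- b, 1:]) = (\<Prod>b\<leftarrow>bs. [:- h b, 1:])"
  by (induction bs) (simp_all del: mult_pCons_left add: mp_mult neg)

lemma poly_hom: "h (poly p x) = poly (map_poly h p) (h x)"
  by (induction p) (auto simp: add mult)

end

lemma rhom_comp: "rhom f \<Longrightarrow> rhom g \<Longrightarrow> rhom (\<lambda>x. g (f x))"
  unfolding rhom_def by simp

lemma rhom_poly: "rhom (\<lambda>p. poly p x)"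
  by unfold_locales auto

lemma rhom_of_rat: "rhom (of_rat :: rat \<Rightarrow> 'a::field_char_0)"
  by unfold_locales (auto simp: of_rat_add of_rat_mult)

lemma rhom_pCons0: "rhom (\<lambda>c. [:c:])"
  by unfold_locales auto

lemma rhom_to_ac: "rhom (to_ac :: 'a::field \<Rightarrow> _)"
  by unfold_locales auto

lemma rhom_to_fract: "rhom (to_fract :: 'a::idom \<Rightarrow> _)"
  by unfold_locales auto

locale fhom = rhom h for h :: "'a::field \<Rightarrow> 'b::field"
begin

lemma eq_0_iff [simp]: "h x = 0 \<longleftrightarrow> x = 0"
proof
  assume "h x = 0"
  show "x = 0"
  proof (rule ccontr)
    assume "x \<noteq> 0"
    then have "h (x * inverse x) = 1" by simp
    then show False using \<open>h x = 0\<close> by (simp add: mult del: right_inverse)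
  qed
qed simp

lemma eq_iff [simp]: "h x = h y \<longleftrightarrow> x = y"
  using eq_0_iff[of "x - y"] by (simp add: diff)

lemma inject: "inj h"
  by (rule injI) simp

lemma inv: "h (inverse x) = inverse (h x)"
proof (cases "x = 0")
  case False
  then have "h x * h (inverse x) = 1" by (simp flip: mult)
  then show ?thesis by (simp add: inverse_unique)
qed simp

lemma divide: "h (x / y) = h x / h y"
  by (simp add: divide_inverse mult inv)

lemma mp_eq_iff [simp]: "map_poly h p = map_poly h q \<longleftrightarrow> p = q"
  by (metis (no_types) coeff_mp eq_iff poly_eqI)

lemma mp_eq_0_iff [simp]: "map_poly h p = 0 \<longleftrightarrow> p = 0"
  using mp_eq_iff[of p 0] by (simp del: mp_eq_iff)

lemma mp_degree [simp]: "Polynomial.degree (map_poly h p) = Polynomial.degree p"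
  by (rule degree_map_poly) auto

end

lemma fhom_of_rat: "fhom (of_rat :: rat \<Rightarrow> 'a::field_char_0)"
  by (simp add: fhom_def rhom_of_rat)

lemma fhom_to_ac: "fhom (to_ac :: 'a::field \<Rightarrow> _)"
  by (simp add: fhom_def rhom_to_ac)


lemma fhom_of_rat_comm:
  fixes h :: "'a::field_char_0 \<Rightarrow> 'b::field_char_0"
  assumes "fhom h" shows "h (of_rat r) = of_rat r"
proof -
  interpret fhom h by fact
  show ?thesis by (cases r) (simp add: of_rat_rat divide)
qed

section \<open>Substitution of transcendental elements into rational functions\<close>

abbreviation qev :: "rat poly \<Rightarrow> 'a::field_char_0 \<Rightarrow> 'a" where
  "qev p w \<equiv> poly (map_poly of_rat p) w"

lemma rhom_qev: "rhom (\<lambda>p. qev p w)"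
  using rhom_comp[OF rhom.mp_rhom[OF rhom_of_rat] rhom_poly] .

lemma fhom_qev:
  fixes h :: "'a::field_char_0 \<Rightarrow> 'b::field_char_0"
  assumes "fhom h" shows "h (qev p w) = qev p (h w)"
proof -
  interpret fhom h by fact
  show ?thesis by (simp add: poly_hom map_poly_map_poly o_def fhom_of_rat_comm[OF assms])
qed

definition transc :: "'a::field_char_0 \<Rightarrow> bool" where
  "transc w \<longleftrightarrow> (\<forall>p. qev p w = 0 \<longrightarrow> p = 0)"

text \<open>Substitution of \<open>w\<close> for the variable, through the reduced fraction so that
  it is total. It is a field embedding when \<open>w\<close> is transcendental. Between rational
  functions \<open>ev g h\<close> is the composite h(g), inner function first; this order governs
  all later composition formulas.\<close>

definition ev :: "'a::field_char_0 \<Rightarrow> rat poly fract \<Rightarrow> 'a" where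
  "ev w x = qev (fst (quot_of_fract x)) w / qev (snd (quot_of_fract x)) w"

lemma ev_Fract:
  assumes "transc w" "q \<noteq> 0" shows "ev w (Fract p q) = qev p w / qev q w"
proof -
  interpret rhom "\<lambda>p. qev p w" by (rule rhom_qev)
  let ?n = "quot_of_fract (Fract p q)"
  have s: "snd ?n \<noteq> 0" by simp
  have "Fract (fst ?n) (snd ?n) = Fract p q" by (rule Fract_quot_of_fract)
  then have "fst ?n * q = p * snd ?n" by (simp only: eq_fract(1)[OF s assms(2)])
  then have "qev (fst ?n) w * qev q w = qev p w * qev (snd ?n) w"
    by (metis mult)
  moreover have "qev (snd ?n) w \<noteq> 0" "qev q w \<noteq> 0" using assms s by (auto simp: transc_def)
  ultimately show ?thesis by (simp add: ev_def field_simps)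
qed

lemma fhom_ev:
  assumes "transc w" shows "fhom (ev w)"
proof -
  interpret q: rhom "\<lambda>p. qev p w" by (rule rhom_qev)
  have nz: "qev q w \<noteq> 0" if "q \<noteq> 0" for q using assms that by (auto simp: transc_def)
  have "rhom (ev w)"
  proof
    fix x y :: "rat poly fract"
    obtain a b where x: "x = Fract a b" "b \<noteq> 0" by (cases x) auto
    obtain c d where y: "y = Fract c d" "d \<noteq> 0" by (cases y) auto
    show "ev w (x + y) = ev w x + ev w y"
      using x y assms nz by (simp add: ev_Fract q.add q.mult field_simps)
    show "ev w (x * y) = ev w x * ev w y"
      using x y assms nz by (simp add: ev_Fract q.add q.mult field_simps)
  next
    show "ev w 1 = 1" using assms by (simp add: One_fract_def ev_Fract)
  qed
  then show ?thesis by (simp add: fhom_def)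
qed

definition XX :: "rat poly fract" where "XX = Fract [:0, 1:] 1"

lemma qev_X [simp]: "qev [:0, 1:] w = w"
  by (simp add: rhom.mp_pCons[OF rhom_of_rat])

lemma ev_XX: "transc w \<Longrightarrow> ev w XX = w"
  by (simp add: XX_def ev_Fract)

lemma ev_to_fract: "transc w \<Longrightarrow> ev w (to_fract p) = qev p w"
  by (simp add: to_fract_def ev_Fract)

text \<open>The values on Q are forced by those on the integers, so the image of X determines an
  embedding of Q(X). Identities between substitutions are later checked at \<open>XX\<close>
  only.\<close>

lemma fhom_ext:
  assumes "fhom f" "fhom g" "f XX = g XX"
  shows "f x = (g x :: 'a::field_char_0)"
proof -
  interpret f: fhom f by fact
  interpret g: fhom g by fact
  have const: "f (to_fract [:c:]) = g (to_fract [:c:])" for c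
  proof -
    obtain a b where c: "c = of_int a / of_int b" "b \<noteq> 0" by (metis Rat_cases Fract_of_int_quotient less_irrefl)
    have "to_fract [:c:] * of_int b = (of_int a :: rat poly fract)"
    proof -
      have "of_int b = (to_fract (of_int b) :: rat poly fract)" "of_int a = (to_fract (of_int a) :: rat poly fract)"
        by (simp_all add: rhom.of_int[OF rhom_to_fract])
      moreover have "[:c:] * of_int b = (of_int a :: rat poly)"
        using c by (simp add: of_int_poly)
      ultimately show ?thesis by (metis to_fract_mult)
    qed
    then have "f (to_fract [:c:]) * of_int b = of_int a" "g (to_fract [:c:]) * of_int b = of_int a"
      by (metis f.mult f.of_int, metis g.mult g.of_int)
    then show ?thesis using c(2) by (metis mult_cancel_right of_int_eq_0_iff)
  qed
  have pol: "f (to_fract p) = g (to_fract p)" for p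
  proof (induction p)
    case (pCons a p)
    have "pCons a p = [:a:] + [:0,1:] * p" by simp
    moreover have "f (to_fract [:0,1:]) = g (to_fract [:0,1:])" using assms(3) by (simp add: XX_def to_fract_def)
    ultimately show ?case using pCons const
      by (metis (no_types, lifting) f.add f.mult g.add g.mult to_fract_add to_fract_mult)
  qed simp
  obtain a b where x: "x = Fract a b" "b \<noteq> 0" by (cases x) auto
  then have "x = to_fract a / to_fract b" by (simp add: to_fract_def)
  then show ?thesis by (simp add: f.divide g.divide pol)
qed

lemma transc_XX: "transc XX"
proof -
  have "qev p XX = to_fract p" for p
  proof (induction p)
    case (pCons a p)
    have c: "of_rat a = to_fract [:a:]"
    proof -
      obtain m n where a: "a = of_int m / of_int n" "n \<noteq> 0" by (metis Rat_cases Fract_of_int_quotient less_irrefl)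
      have "[:a:] * of_int n = (of_int m :: rat poly)" using a by (simp add: of_int_poly)
      then have "to_fract [:a:] * to_fract (of_int n) = to_fract (of_int m :: rat poly)" by (metis to_fract_mult)
      then have "to_fract [:a:] * of_int n = (of_int m :: rat poly fract)" by (simp only: rhom.of_int[OF rhom_to_fract])
      moreover have "of_rat a * of_int n = (of_int m :: rat poly fract)" using a by (simp add: of_rat_divide)
      moreover have "of_int n \<noteq> (0 :: rat poly fract)" using a by simp
      ultimately show ?thesis by (metis mult_cancel_right)
    qed
    have "pCons a p = [:a:] + [:0,1:] * p" by simp
    then have "to_fract (pCons a p) = to_fract [:a:] + to_fract [:0,1:] * to_fract p"
      by (metis to_fract_add to_fract_mult)
    then show ?case using pCons by (simp add: rhom.mp_pCons[OF rhom_of_rat] c XX_def to_fract_def)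
  qed simp
  then show ?thesis by (auto simp: transc_def)
qed

lemma ev_id: "ev XX x = x"
proof -
  have "fhom (\<lambda>x :: rat poly fract. x)" by unfold_locales auto
  from fhom_ext[OF fhom_ev[OF transc_XX] this] show ?thesis by (simp add: ev_XX transc_XX)
qed

lemma transc_fhom:
  fixes h :: "'a::field_char_0 \<Rightarrow> 'b::field_char_0"
  assumes "fhom h" shows "transc (h w) \<longleftrightarrow> transc w"
  using assms by (simp add: transc_def fhom_qev[OF assms, symmetric] fhom.eq_0_iff)

text \<open>Both sides are embeddings of Q(X) that send X to \<open>h w\<close>.\<close>

lemma fhom_evc:
  fixes h :: "'a::field_char_0 \<Rightarrow> 'b::field_char_0"
  assumes "fhom h" "transc w" shows "h (ev w x) = ev (h w) x"
proof -
  have "fhom (\<lambda>x. h (ev w x))"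
    using rhom_comp[of "ev w" h] assms fhom_ev by (metis fhom_def)
  moreover have "transc (h w)" using assms transc_fhom by blast
  ultimately show ?thesis using fhom_ext[OF _ fhom_ev, of "\<lambda>x. h (ev w x)" "h w" x] assms by (simp add: ev_XX)
qed

lemma ev_ev: "transc w \<Longrightarrow> transc g \<Longrightarrow> ev w (ev g x) = ev (ev w g) x"
  using fhom_evc[OF fhom_ev] by blast

section \<open>Subfields generated by a set\<close>

inductive_set gen :: "'a::field set \<Rightarrow> 'a set" for S where
  one: "1 \<in> gen S"
| incl: "x \<in> S \<Longrightarrow> x \<in> gen S"
| neg: "x \<in> gen S \<Longrightarrow> - x \<in> gen S"
| inv: "x \<in> gen S \<Longrightarrow> inverse x \<in> gen S"
| add: "x \<in> gen S \<Longrightarrow> y \<in> gen S \<Longrightarrow> x + y \<in> gen S"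
| mult: "x \<in> gen S \<Longrightarrow> y \<in> gen S \<Longrightarrow> x * y \<in> gen S"

lemma gen_0: "0 \<in> gen S"
  using gen.add[OF gen.one gen.neg[OF gen.one]] by simp

lemma gen_diff: "x \<in> gen S \<Longrightarrow> y \<in> gen S \<Longrightarrow> x - y \<in> gen S"
  using gen.add[OF _ gen.neg] by fastforce

lemma gen_divide: "x \<in> gen S \<Longrightarrow> y \<in> gen S \<Longrightarrow> x / y \<in> gen S"
  using gen.mult[OF _ gen.inv] by (metis divide_inverse)

lemma gen_of_nat: "of_nat n \<in> gen S"
  by (induction n) (auto intro: gen_0 gen.one gen.add)

lemma gen_of_int: "of_int n \<in> gen S"
  by (cases n rule: int_cases2) (auto intro: gen_of_nat gen.neg)

lemma gen_of_rat: "of_rat r \<in> gen (S :: 'a::field_char_0 set)"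
  by (cases r) (simp add: of_rat_rat gen_divide gen_of_int)

lemma gen_poly: "(\<And>i. Polynomial.coeff p i \<in> gen S) \<Longrightarrow> x \<in> gen S \<Longrightarrow> poly p x \<in> gen S"
proof (induction p)
  case (pCons a p)
  have "Polynomial.coeff p i \<in> gen S" for i using pCons(3)[of "Suc i"] by simp
  moreover have "a \<in> gen S" using pCons(3)[of 0] by simp
  ultimately show ?case using pCons by (auto intro: gen.add gen.mult)
qed (auto intro: gen_0)

lemma gen_qev: "w \<in> gen S \<Longrightarrow> qev p w \<in> gen S"
  by (rule gen_poly) (auto simp: coeff_map_poly gen_of_rat)

lemma gen_ev: "w \<in> gen S \<Longrightarrow> ev w x \<in> gen S"
  unfolding ev_def by (intro gen_divide gen_qev)

lemma gen_least: "S \<subseteq> gen T \<Longrightarrow> gen S \<subseteq> gen T"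
proof
  fix x assume "S \<subseteq> gen T" "x \<in> gen S"
  show "x \<in> gen T" using \<open>x \<in> gen S\<close>
    by induction (use \<open>S \<subseteq> gen T\<close> in \<open>auto intro: gen.intros\<close>)
qed

lemma gen_mono: "S \<subseteq> T \<Longrightarrow> gen S \<subseteq> gen T"
  by (rule gen_least) (auto intro: gen.incl)

lemma gen_image: "fhom h \<Longrightarrow> gen (h ` S) = h ` gen S"
proof (intro equalityI subsetI)
  assume h: "fhom h"
  interpret fhom h by fact
  note hneg = neg and hinv = inv and hadd = add and hmult = mult
  fix x assume "x \<in> gen (h ` S)"
  then show "x \<in> h ` gen S"
  proof induction
    case one then show ?case by (intro image_eqI[of _ _ 1]) (auto intro: gen.one)
  next
    case (neg x) then show ?case 
      by (elim imageE) (simp add: hneg[symmetric] gen.neg imageI)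
  next
    case (inv x) then show ?case 
      by (elim imageE) (simp add: hinv[symmetric] gen.inv imageI)
  next
    case (add x y) then show ?case 
      by (elim imageE) (simp add: hadd[symmetric] gen.add imageI)
  next
    case (mult x y) then show ?case 
      by (elim imageE) (simp add: hmult[symmetric] gen.mult imageI)
  qed (auto intro: gen.incl)
next
  assume h: "fhom h"
  interpret fhom h by fact
  fix x assume "x \<in> h ` gen S"
  then obtain y where y: "y \<in> gen S" "x = h y" by blast
  from y(1) have "h y \<in> gen (h ` S)"
    by induction (auto simp: local.neg local.inv local.add local.mult intro: gen.intros)
  then show "x \<in> gen (h ` S)" by (simp add: y)
qed

lemma gen_XX: "gen {XX} = UNIV"
proof -
  have "x \<in> gen {XX}" for x
    using gen_ev[of XX "{XX}" x] by (simp add: ev_id gen.incl)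
  then show ?thesis by blast
qed

lemma gen_single: "transc w \<Longrightarrow> gen {w} = range (ev w)"
  using gen_image[OF fhom_ev, of w "{XX}"] by (simp add: ev_XX gen_XX)

lemma gen_fix:
  assumes "fhom h" "\<And>x. x \<in> S \<Longrightarrow> h x = x" "x \<in> gen S" shows "h x = x"
proof -
  interpret fhom h by fact
  show ?thesis using assms(3)
    by induction (auto simp: assms(2) local.neg local.inv local.add local.mult)
qed

text \<open>The bridge from type-class fields to records, through which results on
  \<open>generate_field\<close> and on algebraic elements become available for
  \<open>gen\<close>.\<close>

lemma gen_eq_generate_field: "gen S = generate_field ring_of_type_algebra S"
proof -
  interpret F: field "ring_of_type_algebra :: 'a ring" by (rule field_from_type_algebra)
  have c: "carrier ring_of_type_algebra = (UNIV :: 'a set)" by (simp add: ring_of_type_algebra_def)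
  have ops: "x \<oplus>\<^bsub>ring_of_type_algebra\<^esub> y = x + y" "x \<otimes>\<^bsub>ring_of_type_algebra\<^esub> y = x * y"
    "\<one>\<^bsub>ring_of_type_algebra\<^esub> = (1::'a)" "\<zero>\<^bsub>ring_of_type_algebra\<^esub> = (0::'a)" for x y :: 'a
    by (simp_all add: ring_of_type_algebra_def)
  have neg: "\<ominus>\<^bsub>ring_of_type_algebra\<^esub> x = - x" for x :: 'a
    using F.minus_equality[of "- x" x] by (simp add: ops c)
  have inv: "inv\<^bsub>ring_of_type_algebra\<^esub> x = inverse x" if "x \<noteq> 0" for x :: 'a
    using F.comm_inv_char[of x "inverse x"] that by (simp add: ops c)
  show ?thesis
  proof (intro equalityI subsetI)
    fix x assume "x \<in> gen S"
    then show "x \<in> generate_field ring_of_type_algebra S"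
    proof induction
      case one then show ?case using generate_field.one[of ring_of_type_algebra S] by (simp add: ops)
    next
      case (neg x) then show ?case using generate_field.a_inv by (metis \<open>\<And>x. \<ominus>\<^bsub>ring_of_type_algebra\<^esub> x = - x\<close>)
    next
      case (inv x)
      then show ?case using generate_field.m_inv[of x ring_of_type_algebra S] \<open>\<And>x. x \<noteq> 0 \<Longrightarrow> inv\<^bsub>ring_of_type_algebra\<^esub> x = inverse x\<close>
        by (cases "x = 0") (auto simp: ops)
    next
      case (add x y) then show ?case using generate_field.eng_add[of x ring_of_type_algebra S y] by (simp add: ops)
    next
      case (mult x y) then show ?case using generate_field.eng_mult[of x ring_of_type_algebra S y] by (simp add: ops)
    qed (rule generate_field.incl)
  next
    fix x assume "x \<in> generate_field ring_of_type_algebra S"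
    then show "x \<in> gen S"
      by induction (auto simp: ops neg inv intro: gen.intros)
  qed
qed

section \<open>Type-class fields viewed as records, and algebraic elements\<close>

lemma rota_carrier [simp]: "carrier (ring_of_type_algebra :: 'a::ring_1 ring) = UNIV"
  and rota_add [simp]: "x \<oplus>\<^bsub>ring_of_type_algebra\<^esub> y = (x + y :: 'a)"
  and rota_mult [simp]: "x \<otimes>\<^bsub>ring_of_type_algebra\<^esub> y = (x * y :: 'a)"
  and rota_one [simp]: "\<one>\<^bsub>ring_of_type_algebra\<^esub> = (1 :: 'a)"
  and rota_zero [simp]: "\<zero>\<^bsub>ring_of_type_algebra\<^esub> = (0 :: 'a)"
  by (simp_all add: ring_of_type_algebra_def)

lemma rota_pow [simp]: "x [^]\<^bsub>ring_of_type_algebra\<^esub> (n::nat) = (x ^ n :: 'a::comm_ring_1)"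
  by (induction n) (simp_all add: mult.commute)

lemma eval_rota:
  "ring.eval (ring_of_type_algebra :: 'a::comm_ring_1 ring) ls x = poly (Poly (rev ls)) x"
proof -
  interpret R: ring "ring_of_type_algebra :: 'a ring" by (rule ring_from_type_algebra)
  show ?thesis by (induction ls) (auto simp: Poly_append poly_monom algebra_simps)
qed

lemma rota_inv:
  assumes "x \<noteq> 0" shows "inv\<^bsub>ring_of_type_algebra\<^esub> x = inverse (x::'a::field)"
proof -
  interpret F: field "ring_of_type_algebra :: 'a ring" by (rule field_from_type_algebra)
  show ?thesis using F.comm_inv_char[of x "inverse x"] assms by simp
qed

lemma rota_neg: "\<ominus>\<^bsub>ring_of_type_algebra\<^esub> x = (- x::'a::comm_ring_1)"
proof -
  interpret F: ring "ring_of_type_algebra :: 'a ring" by (rule ring_from_type_algebra)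
  show ?thesis using F.minus_equality[of "- x" x] by simp
qed

lemma subfield_rat: "subfield (range (of_rat :: rat \<Rightarrow> 'a::field_char_0)) ring_of_type_algebra"
proof -
  interpret F: field "ring_of_type_algebra :: 'a ring" by (rule field_from_type_algebra)
  show ?thesis
  proof (rule F.subfieldI')
    show "subring (range (of_rat :: rat \<Rightarrow> 'a)) ring_of_type_algebra"
    proof (rule F.subringI)
      show "\<one>\<^bsub>ring_of_type_algebra\<^esub> \<in> range (of_rat :: rat \<Rightarrow> 'a)"
        by (metis of_rat_1 rangeI rota_one)
    qed (auto simp: rota_neg simp flip: of_rat_add of_rat_mult of_rat_minus)
  next
    fix k :: 'a assume "k \<in> range of_rat - {\<zero>\<^bsub>ring_of_type_algebra\<^esub>}"
    then show "inv\<^bsub>ring_of_type_algebra\<^esub> k \<in> range of_rat"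
      by (auto simp: rota_inv simp flip: of_rat_inverse)
  qed
qed

lemma algebraic_iff:
  "\<not> transc (x::'a::field_char_0) \<longleftrightarrow>
    ring.algebraic ring_of_type_algebra (range of_rat) x"
proof -
  interpret F: field "ring_of_type_algebra :: 'a ring" by (rule field_from_type_algebra)
  note sr = subfieldE(1)[OF subfield_rat[where ?'a = 'a]]
  show ?thesis
  proof
    assume "\<not> transc x"
    then obtain p where p: "p \<noteq> 0" "qev p x = 0" by (auto simp: transc_def)
    let ?l = "rev (coeffs (map_poly of_rat p :: 'a poly))"
    have nz: "map_poly of_rat p \<noteq> (0 :: 'a poly)" using p fhom.mp_eq_0_iff[OF fhom_of_rat] by blast
    have "?l \<in> carrier (range of_rat [X]\<^bsub>ring_of_type_algebra\<^esub>)"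
      unfolding univ_poly_carrier[symmetric] polynomial_def
      using nz by (simp add: hd_rev last_coeffs_eq_coeff_degree) (auto simp: coeffs_def coeff_map_poly)
    moreover have "?l \<noteq> []" using nz by simp
    moreover have "F.eval ?l x = \<zero>\<^bsub>ring_of_type_algebra\<^esub>" using p by (simp add: eval_rota)
    ultimately show "F.algebraic (range of_rat) x"
      using F.algebraicI[of ?l "range of_rat" x] by (simp add: over_def)
  next
    assume "F.algebraic (range of_rat) x"
    then obtain p where p: "p \<in> carrier (range of_rat [X]\<^bsub>ring_of_type_algebra\<^esub>)" "p \<noteq> []" "F.eval p x = 0"
      using F.algebraicE[OF sr, of x] by (auto simp: over_def)
    have set: "set p \<subseteq> range of_rat" "hd p \<noteq> 0"
      using p unfolding univ_poly_carrier[symmetric] polynomial_def by auto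
    then obtain q where q: "p = map of_rat q"
      by (metis ex_map_conv subset_iff image_iff)
    have "map_poly of_rat (Poly (rev q)) = (Poly (rev p) :: 'a poly)"
      by (rule poly_eqI) (simp add: coeff_map_poly q rev_map nth_default_def)
    then have "qev (Poly (rev q)) x = 0" using p by (simp add: eval_rota)
    moreover have "Poly (rev q) \<noteq> 0"
    proof
      assume "Poly (rev q) = 0"
      then obtain n where "rev q = replicate n 0" by (auto simp: Poly_eq_0)
      then have "q = replicate n 0" by (metis rev_replicate rev_rev_ident)
      then show False using set q p(2) by (cases n) auto
    qed
    ultimately show "\<not> transc x" by (auto simp: transc_def)
  qed
qed

text \<open>The elements algebraic over Q form a subfield, so algebraic generators never produce a
  transcendental element.\<close>

lemma algebraic_gen:
  fixes S :: "'a::field_char_0 set"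
  assumes "\<And>x. x \<in> S \<Longrightarrow> \<not> transc x" "y \<in> gen S"
  shows "\<not> transc y"
proof -
  interpret F: field "ring_of_type_algebra :: 'a ring" by (rule field_from_type_algebra)
  let ?A = "{x \<in> carrier ring_of_type_algebra. (F.algebraic over (range of_rat)) x}"
  have "subfield ?A ring_of_type_algebra"
    using F.subfield_of_algebraics[OF subfield_rat] by (simp add: over_def)
  moreover have "S \<subseteq> ?A" using assms(1) by (auto simp: algebraic_iff over_def)
  ultimately have "generate_field ring_of_type_algebra S \<subseteq> ?A"
    by (intro F.generate_field_min_subfield1) auto
  then show ?thesis using assms(2) by (auto simp: algebraic_iff gen_eq_generate_field over_def)
qed

lemma transc_nonrat: "transc w \<Longrightarrow> w \<notin> range of_rat"
proof
  assume w: "transc w" "w \<in> range of_rat"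
  then obtain r where "w = of_rat r" by blast
  then have "qev [:- r, 1:] w = 0" by (simp add: rhom.mp_pCons[OF rhom_of_rat] of_rat_minus)
  then show False using w by (auto simp: transc_def)
qed

subsection \<open>Specialization\<close>

text \<open>The partial map on fractions induced by a homomorphism that may have a kernel. It is a
  relation because \<open>f b\<close> can vanish for one representation of a fraction and not for
  another.\<close>

definition tspc :: "('a::idom \<Rightarrow> 'b::field) \<Rightarrow> 'a fract \<Rightarrow> 'b \<Rightarrow> bool" where
  "tspc f x y \<longleftrightarrow> (\<exists>a b. x = Fract a b \<and> f b \<noteq> 0 \<and> y = f a / f b)"

context
  fixes f :: "'a::idom \<Rightarrow> 'b::field"
  assumes f: "rhom f"
begin

interpretation rhom f by (rule f)

lemma nz [simp]: "f b \<noteq> 0 \<Longrightarrow> b \<noteq> 0" by auto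

lemma tspc_Fract: "f b \<noteq> 0 \<Longrightarrow> tspc f (Fract a b) (f a / f b)"
  by (auto simp: tspc_def)

text \<open>Cross-multiplied equality survives \<open>f\<close>, so the value does not depend on the
  representation.\<close>

lemma tspc_unique: "tspc f x y \<Longrightarrow> tspc f x z \<Longrightarrow> y = z"
  unfolding tspc_def
proof (elim exE conjE)
  fix a b c d assume *: "x = Fract a b" "f b \<noteq> 0" "y = f a / f b" "x = Fract c d" "f d \<noteq> 0" "z = f c / f d"
  then have "a * d = c * b" using eq_fract(1)[of b d a c] by auto
  then have "f a * f d = f c * f b" by (metis mult)
  then show "y = z" using *(2,3,5,6) by (simp add: frac_eq_eq)
qed

lemma tspc_add: "tspc f x y \<Longrightarrow> tspc f x' y' \<Longrightarrow> tspc f (x + x') (y + y')"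
  unfolding tspc_def
proof (elim exE conjE)
  fix a b c d assume *: "x = Fract a b" "f b \<noteq> 0" "y = f a / f b" "x' = Fract c d" "f d \<noteq> 0" "y' = f c / f d"
  show "\<exists>a b. x + x' = Fract a b \<and> f b \<noteq> 0 \<and> y + y' = f a / f b"
    by (rule exI[of _ "a * d + c * b"], rule exI[of _ "b * d"]) (use * in \<open>simp add: add mult field_simps\<close>)
qed

lemma tspc_mult: "tspc f x y \<Longrightarrow> tspc f x' y' \<Longrightarrow> tspc f (x * x') (y * y')"
  unfolding tspc_def
proof (elim exE conjE)
  fix a b c d assume *: "x = Fract a b" "f b \<noteq> 0" "y = f a / f b" "x' = Fract c d" "f d \<noteq> 0" "y' = f c / f d"
  show "\<exists>a b. x * x' = Fract a b \<and> f b \<noteq> 0 \<and> y * y' = f a / f b"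
    by (rule exI[of _ "a * c"], rule exI[of _ "b * d"]) (use * in \<open>simp add: mult\<close>)
qed

lemma tspc_neg: "tspc f x y \<Longrightarrow> tspc f (- x) (- y)"
  unfolding tspc_def by (metis minus_divide_left minus_fract neg)

lemma tspc_0: "tspc f 0 0"
  unfolding tspc_def by (rule exI[of _ 0], rule exI[of _ 1]) (simp add: Zero_fract_def)

lemma tspc_1: "tspc f 1 1"
  unfolding tspc_def by (rule exI[of _ 1], rule exI[of _ 1]) (simp add: One_fract_def)

lemma tspc_inv: "tspc f x y \<Longrightarrow> y \<noteq> 0 \<Longrightarrow> tspc f (inverse x) (inverse y)"
  unfolding tspc_def
proof (elim exE conjE)
  fix a b assume *: "x = Fract a b" "f b \<noteq> 0" "y = f a / f b" "y \<noteq> 0"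
  show "\<exists>a b. inverse x = Fract a b \<and> f b \<noteq> 0 \<and> inverse y = f a / f b"
    by (rule exI[of _ b], rule exI[of _ a]) (use * in auto)
qed

lemma tspc_of_nat: "tspc f (of_nat n) (of_nat n)"
  by (induction n) (auto intro: tspc_0 tspc_1 tspc_add)

lemma tspc_of_int: "tspc f (of_int n) (of_int n)"
  by (cases n rule: int_cases2) (auto intro: tspc_of_nat tspc_neg)

lemma tspc_poly:
  assumes "\<And>i. tspc f (Polynomial.coeff p i) (Polynomial.coeff q i)" "tspc f x y"
  shows "tspc f (poly p x) (poly q y)"
  using assms(1)
proof (induction p arbitrary: q)
  case 0
  then have "Polynomial.coeff q i = 0" for i using tspc_unique[OF 0[of i]] tspc_0 by simp
  then have "q = 0" by (simp add: poly_eq_iff)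
  then show ?case by (simp add: tspc_0)
next
  case (pCons a p)
  obtain b q' where q: "q = pCons b q'" by (rule pCons_cases)
  have "tspc f a b" using pCons(3)[of 0] by (simp add: q)
  moreover have "tspc f (poly p x) (poly q' y)" using pCons(3)[of "Suc _"] by (intro pCons(2)) (simp add: q)
  ultimately show ?case using assms(2) by (simp add: q tspc_add tspc_mult)
qed

end

instance fract :: ("{idom,ring_char_0}") field_char_0
proof
  show "inj (of_nat :: nat \<Rightarrow> 'a fract)"
    unfolding inj_def
    by (metis of_nat_eq_iff rhom.of_nat[OF rhom_to_fract] to_fract_eq_iff)
qed

lemma tspc_of_rat:
  fixes f :: "'a::{idom,ring_char_0} \<Rightarrow> 'b::field_char_0"
  assumes "rhom f"
  shows "tspc f (of_rat r) (of_rat r)"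
proof -
  obtain m n where r: "r = of_int m / of_int n" "n \<noteq> 0" by (metis Rat_cases Fract_of_int_quotient less_irrefl)
  then show ?thesis
    using tspc_mult[OF assms tspc_of_int[OF assms, of m] tspc_inv[OF assms tspc_of_int[OF assms, of n]]]
    by (simp add: of_rat_divide flip: divide_inverse)
qed

lemma tspc_qev:
  fixes f :: "'a::{idom,ring_char_0} \<Rightarrow> 'b::field_char_0"
  assumes "rhom f" "tspc f x y"
  shows "tspc f (qev p x) (qev p y)"
  by (rule tspc_poly[OF assms(1) _ assms(2)]) (simp add: rhom.coeff_mp[OF rhom_of_rat] tspc_of_rat assms(1))

text \<open>Let x = a/b be a root of p. At every point where b does not vanish the value of x is one
  of the finitely many rational roots r of p, so b times the product of all a - r b vanishes at
  every point. The points separate elements, hence this product is zero and x equals one of the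
  r.\<close>

lemma algebraic_const:
  fixes e :: "'c \<Rightarrow> 'a::{idom,ring_char_0} \<Rightarrow> rat"
  assumes e: "\<And>c. rhom (e c)" and sep: "\<And>a. (\<And>c. e c a = 0) \<Longrightarrow> a = 0"
    and x: "\<not> transc (x :: 'a fract)"
  shows "x \<in> range of_rat"
proof -
  obtain p where p: "p \<noteq> 0" "qev p x = 0" using x by (auto simp: transc_def)
  obtain a b where ab: "x = Fract a b" "b \<noteq> 0" by (cases x) auto
  define Z where "Z = {r. poly p r = 0}"
  have fin: "finite Z" using p by (simp add: Z_def poly_roots_finite)
  \<comment> \<open>The factor a - r b with the denominator of r cleared, since the ring need not
    contain Q.\<close>
  define u where "u r = of_int (snd (quotient_of r)) * a - of_int (fst (quotient_of r)) * b" for r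
  have "e c (b * (\<Prod>r\<in>Z. u r)) = 0" for c
  proof (cases "e c b = 0")
    case True then show ?thesis by (simp add: rhom.mult[OF e])
  next
    case False
    let ?r = "e c a / e c b"
    have "tspc (e c) (qev p x) (qev p ?r)"
      using tspc_qev[OF e tspc_Fract[OF e False]] ab by blast
    then have "qev p ?r = 0" using tspc_unique[OF e _ tspc_0[OF e]] p by metis
    moreover have "map_poly of_rat p = p" by (simp add: poly_eq_iff coeff_map_poly)
    ultimately have rZ: "?r \<in> Z" by (simp add: Z_def)
    have "?r = of_int (fst (quotient_of ?r)) / of_int (snd (quotient_of ?r))"
      by (metis quotient_of_div surjective_pairing)
    moreover have "of_int (snd (quotient_of ?r)) \<noteq> (0::rat)"
      using quotient_of_denom_pos'[of ?r] by simp
    ultimately have "of_int (snd (quotient_of ?r)) * e c a = of_int (fst (quotient_of ?r)) * e c b"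
      using False by (metis (no_types, lifting) frac_eq_eq mult.commute)
    then have "e c (u ?r) = 0" by (simp add: u_def rhom.diff[OF e] rhom.mult[OF e] rhom.of_int[OF e])
    then show ?thesis using rZ fin by (simp add: rhom.mult[OF e] rhom.prods[OF e]) blast
  qed
  then have "b * (\<Prod>r\<in>Z. u r) = 0" by (rule sep)
  then obtain r where r: "u r = 0" using ab fin by auto
  define m k where "m = fst (quotient_of r)" and "k = snd (quotient_of r)"
  have k: "k \<noteq> 0" using quotient_of_denom_pos'[of r] by (simp add: k_def)
  have "of_int k * a = of_int m * b" using r by (simp add: u_def m_def k_def)
  then have "of_int k * to_fract a = of_int m * to_fract b"
    by (metis to_fract_mult rhom.of_int[OF rhom_to_fract])
  moreover have "x = to_fract a / to_fract b" by (simp add: ab to_fract_def)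
  ultimately have "x = of_int m / of_int k" using k ab(2) by (simp only: frac_eq_eq) (simp add: frac_eq_eq mult.commute)
  also have "\<dots> = of_rat (of_int m / of_int k)" by (simp add: of_rat_divide)
  finally show ?thesis by blast
qed

lemma poly_fract_transc:
  fixes x :: "rat poly fract"
  shows "transc x \<longleftrightarrow> x \<notin> range of_rat"
proof
  assume x: "x \<notin> range of_rat"
  have "p = 0" if "\<And>c. poly p c = 0" for p :: "rat poly"
    using that poly_roots_finite[of p] infinite_UNIV_char_0[where ?'a = rat] by auto
  then show "transc x" using algebraic_const[of "\<lambda>c p. poly p c" x] rhom_poly x by blast
qed (rule transc_nonrat)

subsection \<open>Fibres of rational functions\<close>

definition num :: "rat poly fract \<Rightarrow> rat poly" where "num x = fst (quot_of_fract x)"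
definition den :: "rat poly fract \<Rightarrow> rat poly" where "den x = snd (quot_of_fract x)"
text \<open>The degree of x as a map of the projective line, which for nonconstant x is the degree
  of Q(X) over Q(x).\<close>

definition rdeg :: "rat poly fract \<Rightarrow> nat" where
  "rdeg x = max (Polynomial.degree (num x)) (Polynomial.degree (den x))"

lemma num_den: "Fract (num x) (den x) = x" "den x \<noteq> 0" "coprime (num x) (den x)"
  by (simp_all add: num_def den_def Fract_quot_of_fract coprime_quot_of_fract)

lemma ev_num_den: "ev w x = qev (num x) w / qev (den x) w"
  by (simp add: ev_def num_def den_def)

text \<open>Linear independence over Q: a nontrivial relation would make x a rational
  constant.\<close>

lemma num_den_indep:
  assumes "x \<notin> range of_rat" "Polynomial.smult a (num x) = Polynomial.smult b (den x)"
  shows "a = 0 \<and> b = 0"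
proof -
  have a: "a = 0"
  proof (rule ccontr)
    assume "a \<noteq> 0"
    then have "num x = Polynomial.smult (b / a) (den x)"
      using arg_cong[OF assms(2), of "Polynomial.smult (inverse a)"] by (simp add: field_simps)
    moreover have "qev (num x) XX / qev (den x) XX = x" using ev_num_den[of XX x] by (simp add: ev_id)
    moreover have "qev (den x) XX \<noteq> 0" using transc_XX num_den(2) by (auto simp: transc_def)
    ultimately have "x = of_rat (b / a)" by (simp add: rhom.mp_smult[OF rhom_of_rat])
    then show False using assms(1) by blast
  qed
  then show ?thesis using assms(2) num_den(2)[of x] by simp
qed

text \<open>A Bezout identity over Q stays valid in every overfield and excludes common zeros
  there.\<close>

lemma num_den_coprime_qev:
  assumes "qev (num x) y = 0" "qev (den x) y = 0" shows False
proof -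
  interpret rhom "\<lambda>p. qev p y" by (rule rhom_qev)
  obtain u v where "u * num x + v * den x = 1"
    using num_den(3)[of x] by (metis bezout_coefficients_fst_snd coprime_iff_gcd_eq_1)
  then have "qev (u * num x + v * den x) y = 1" by simp
  then show False using assms by (simp add: add mult)
qed

text \<open>This is the numerator of the derivative of x. If it vanished, coprimality would make
  \<open>num x\<close> and \<open>den x\<close> divide their own derivatives, so both would be
  constant.\<close>

lemma num_den_wronskian:
  assumes "x \<notin> range of_rat"
  shows "pderiv (num x) * den x - num x * pderiv (den x) \<noteq> 0"
proof
  assume 0: "pderiv (num x) * den x - num x * pderiv (den x) = 0"
  then have "num x dvd pderiv (num x) * den x" by (metis dvd_triv_left eq_iff_diff_eq_0)
  then have "num x dvd pderiv (num x)" using num_den(3) coprime_dvd_mult_left_iff by blast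
  then have n: "Polynomial.degree (num x) = 0" using not_dvd_pderiv by blast
  have "den x dvd num x * pderiv (den x)" using 0 by (metis dvd_triv_right eq_iff_diff_eq_0)
  then have "den x dvd pderiv (den x)" using num_den(3) coprime_dvd_mult_right_iff coprime_commute by blast
  then have d: "Polynomial.degree (den x) = 0" using not_dvd_pderiv by blast
  obtain a b where ab: "num x = [:a:]" "den x = [:b:]" using n d degree_eq_zeroE by metis
  have "Polynomial.smult b (num x) = Polynomial.smult a (den x)" by (simp add: ab)
  then have "b = 0" using num_den_indep[OF assms] by blast
  then show False using num_den(2)[of x] ab by simp
qed

text \<open>The solutions w of x(w) = t. Transcendence of w makes \<open>ev w\<close> an embedding
  and costs no solution when t is transcendental. In Q(X) itself, \<open>fibre R R\<close> consists
  of the substitutions that fix R; this set becomes the group of Moebius transformations.\<close>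

definition fibre :: "rat poly fract \<Rightarrow> 'a::field_char_0 \<Rightarrow> 'a set" where
  "fibre x t = {w. transc w \<and> ev w x = t}"

definition fibre_poly :: "rat poly fract \<Rightarrow> 'a::field_char_0 \<Rightarrow> 'a poly" where
  "fibre_poly x t = map_poly of_rat (num x) - Polynomial.smult t (map_poly of_rat (den x))"

lemma coeff_fibre_poly:
  "Polynomial.coeff (fibre_poly x t) i =
    of_rat (Polynomial.coeff (num x) i) - t * of_rat (Polynomial.coeff (den x) i)"
  by (simp add: fibre_poly_def rhom.coeff_mp[OF rhom_of_rat])

lemma poly_fibre_poly: "poly (fibre_poly x t) w = qev (num x) w - t * qev (den x) w"
  by (simp add: fibre_poly_def)

text \<open>By coprimality the denominator does not vanish at a root y, so t is a rational function
  of y; an algebraic y would make t algebraic.\<close>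

lemma fibre_poly_root:
  assumes t: "transc t" and r: "poly (fibre_poly x t) y = 0"
  shows "y \<in> fibre x t"
proof -
  have e: "qev (num x) y = t * qev (den x) y" using r by (simp add: poly_fibre_poly)
  then have d: "qev (den x) y \<noteq> 0" using num_den_coprime_qev[of x y] by auto
  then have t': "t = ev y x" using e by (simp add: ev_num_den)
  have "transc y"
  proof (rule ccontr)
    assume "\<not> transc y"
    moreover have "t \<in> gen {y}" unfolding t' by (rule gen_ev) (simp add: gen.incl)
    ultimately show False using algebraic_gen[of "{y}" t] t by blast
  qed
  then show ?thesis using t' by (simp add: fibre_def)
qed

lemma fibre_iff:
  assumes "transc t"
  shows "y \<in> fibre x t \<longleftrightarrow> poly (fibre_poly x t) y = 0"
proof
  assume "y \<in> fibre x t"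
  then have "transc y" "ev y x = t" by (auto simp: fibre_def)
  moreover have "qev (den x) y \<noteq> 0" using \<open>transc y\<close> num_den(2)[of x] by (auto simp: transc_def)
  ultimately show "poly (fibre_poly x t) y = 0" by (simp add: poly_fibre_poly ev_num_den field_simps)
qed (rule fibre_poly_root[OF assms])

text \<open>A coefficient num_i - t den_i vanishes only if both rationals do, since t is not
  rational; so leading terms cannot cancel.\<close>

lemma fibre_poly_degree:
  assumes x: "x \<notin> range of_rat" and t: "transc t"
  shows "Polynomial.degree (fibre_poly x t) = rdeg x" "fibre_poly x t \<noteq> 0"
proof -
  have nz: "Polynomial.coeff (fibre_poly x t) i \<noteq> 0"
    if "Polynomial.coeff (num x) i \<noteq> 0 \<or> Polynomial.coeff (den x) i \<noteq> 0" for i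
  proof
    assume "Polynomial.coeff (fibre_poly x t) i = 0"
    then have e: "of_rat (Polynomial.coeff (num x) i) = t * of_rat (Polynomial.coeff (den x) i)"
      by (simp add: coeff_fibre_poly)
    then have "Polynomial.coeff (den x) i \<noteq> 0" using that by auto
    then have "t = of_rat (Polynomial.coeff (num x) i / Polynomial.coeff (den x) i)"
      using e by (simp add: of_rat_divide)
    then show False using transc_nonrat[OF t] by blast
  qed
  have le: "Polynomial.degree (fibre_poly x t) \<le> rdeg x"
    by (rule degree_le) (auto simp: coeff_fibre_poly rdeg_def coeff_eq_0)
  have ne: "num x \<noteq> 0 \<or> den x \<noteq> 0" using num_den(2) by blast
  have "Polynomial.coeff (num x) (rdeg x) \<noteq> 0 \<or> Polynomial.coeff (den x) (rdeg x) \<noteq> 0"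
  proof (cases "Polynomial.degree (num x) \<le> Polynomial.degree (den x)")
    case True
    then show ?thesis using num_den(2)[of x] by (simp add: rdeg_def max_def)
  next
    case False
    then have "num x \<noteq> 0" by auto
    then show ?thesis using False by (simp add: rdeg_def max_def)
  qed
  then have "Polynomial.coeff (fibre_poly x t) (rdeg x) \<noteq> 0" by (rule nz)
  then show "Polynomial.degree (fibre_poly x t) = rdeg x" "fibre_poly x t \<noteq> 0"
    using le le_degree by (auto intro: antisym)
qed

text \<open>A double root would be a zero of the Wronskian of numerator and denominator, a nonzero
  rational polynomial, while roots are transcendental.\<close>

lemma fibre_poly_simple:
  assumes x: "x \<notin> range of_rat" and t: "transc t" and y: "poly (fibre_poly x t) y = 0"
  shows "poly (pderiv (fibre_poly x t)) y \<noteq> 0"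
proof
  assume "poly (pderiv (fibre_poly x t)) y = 0"
  interpret q: rhom "\<lambda>p. qev p y" by (rule rhom_qev)
  have pd: "pderiv (map_poly of_rat p) = (map_poly of_rat (pderiv p) :: 'a poly)" for p
    by (rule poly_eqI) (simp add: coeff_pderiv coeff_map_poly of_rat_mult of_rat_add)
  have "qev (pderiv (num x)) y = t * qev (pderiv (den x)) y"
    using \<open>poly (pderiv _) y = 0\<close> by (simp add: fibre_poly_def pderiv_diff pderiv_smult pd)
  moreover have "qev (num x) y = t * qev (den x) y" using y by (simp add: poly_fibre_poly)
  ultimately have "qev (pderiv (num x) * den x - num x * pderiv (den x)) y = 0"
    by (simp only: q.diff q.mult) simp
  moreover have "transc y" using fibre_poly_root[OF t y] by (simp add: fibre_def)
  ultimately show False using num_den_wronskian[OF x] by (auto simp: transc_def)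
qed

lemma card_fibre:
  fixes t :: "'a::{alg_closed_field, field_char_0}"
  assumes x: "x \<notin> range of_rat" and t: "transc t"
  shows "finite (fibre x t)" "card (fibre x t) = rdeg x"
proof -
  let ?p = "fibre_poly x t"
  note deg = fibre_poly_degree[OF x t]
  obtain A where A: "size A = Polynomial.degree ?p"
    "?p = Polynomial.smult (lead_coeff ?p) (\<Prod>x\<in>#A. [:- x, 1:])"
    using alg_closed_imp_factorization[OF deg(2)] by blast
  have lc: "lead_coeff ?p \<noteq> 0" using deg(2) by simp
  have "proots ?p = proots (\<Prod>x\<in>#A. [:- x, 1:])" using A(2) lc by (metis proots_smult)
  also have "\<dots> = (\<Sum>x\<in>#A. proots [:- x, 1:])" 
  proof (induction A)
    case (add a A)
    have "(\<Prod>x\<in>#A. [:- x, 1:]) \<noteq> (0 :: 'a poly)" by (auto simp: prod_mset_zero_iff)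
    then show ?case using add by (simp add: proots_mult del: mult_pCons_left)
  qed simp
  also have "\<dots> = A" by simp
  finally have pr: "proots ?p = A" .
  have "rsquarefree ?p" unfolding rsquarefree_roots using fibre_poly_simple[OF x t] by blast
  then have c: "count A y \<le> 1" for y using deg(2) by (auto simp: rsquarefree_def pr[symmetric] le_Suc_eq)
  have "fibre x t = set_mset A" using deg(2) by (auto simp: fibre_iff[OF t] pr[symmetric])
  moreover have "A = mset_set (set_mset A)"
    by (rule multiset_eqI) (metis c count_mset_set(1) count_mset_set(3) finite_set_mset le_less not_in_iff count_greater_zero_iff less_one nat_less_le)
  ultimately show "finite (fibre x t)" "card (fibre x t) = rdeg x"
    using A(1) deg(1) by (simp, metis size_mset_set)
qed

lemma moebius_fraction:
  "moebius a b c d = (of_rat a * XX + of_rat b) / (of_rat c * XX + of_rat d)"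
proof -
  have p: "qev p XX = to_fract p" for p
    using ev_to_fract[OF transc_XX, of p] by (simp add: ev_id)
  have "moebius a b c d = to_fract [:b, a:] / to_fract [:d, c:]"
    by (simp add: moebius_def Fract_conv_to_fract)
  also have "\<dots> = qev [:b, a:] XX / qev [:d, c:] XX" by (simp add: p)
  finally show ?thesis by (simp add: rhom.mp_pCons[OF rhom_of_rat] algebra_simps)
qed

lemma prod_linear_set_eq:
  fixes as bs :: "'a::field list"
  assumes "(\<Prod>a\<leftarrow>as. [:- a, 1:]) = (\<Prod>b\<leftarrow>bs. [:- b, 1:])"
  shows "mset as = mset bs"
proof -
  have "proots (\<Prod>a\<leftarrow>cs. [:- a, 1:]) = mset cs" for cs :: "'a list"
  proof (induction cs)
    case (Cons a A)
    have "(\<Prod>x\<leftarrow>A. [:- x, 1:]) \<noteq> 0" by (auto simp: prod_list_zero_iff)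
    then show ?case using Cons by (simp add: proots_mult del: mult_pCons_left)
  qed simp
  then show ?thesis using assms by metis
qed

section \<open>Rational function fields as splitting fields\<close>

text \<open>Says that Q(X), regarded as an extension of Q(T) through T |-> R, is a splitting field
  of A with root list \<open>bs\<close>. It is the rational parametrization of F on which both
  directions rest.\<close>

definition model :: "rat poly fract poly \<Rightarrow> rat poly fract \<Rightarrow> rat poly fract list \<Rightarrow> bool" where
  "model A R bs \<longleftrightarrow> R \<notin> range of_rat \<and> map_poly (ev R) A = (\<Prod>b\<leftarrow>bs. [:- b, 1:]) \<and>
     gen (insert R (set bs)) = UNIV"

text \<open>Everything is the image of the model under the embedding X |-> w, which sends R to
  t.\<close>

lemma model_spec:
  assumes m: "model A R bs" and w: "w \<in> fibre R t"
  shows "transc t" "map_poly (ev t) A = (\<Prod>b\<leftarrow>bs. [:- ev w b, 1:])"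
    "gen {w} = gen (insert t (ev w ` set bs))"
proof -
  have tw: "transc w" and t: "t = ev w R" using w by (auto simp: fibre_def)
  have R: "transc R" using m by (simp add: model_def poly_fract_transc)
  interpret fhom "ev w" by (rule fhom_ev[OF tw])
  show tt: "transc t" using transc_fhom[OF fhom_ev[OF tw]] R t by blast
  have "map_poly (ev t) A = map_poly (ev w) (map_poly (ev R) A)"
  proof (rule poly_eqI)
    fix i
    have "ev t 0 = 0" using fhom_ev[OF tt] by (simp add: fhom_def rhom.zero)
    moreover have "ev R 0 = 0" using fhom_ev[OF R] by (simp add: fhom_def rhom.zero)
    ultimately show "Polynomial.coeff (map_poly (ev t) A) i = Polynomial.coeff (map_poly (ev w) (map_poly (ev R) A)) i"
      by (simp add: coeff_map_poly ev_ev[OF tw R] t)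
  qed
  then show "map_poly (ev t) A = (\<Prod>b\<leftarrow>bs. [:- ev w b, 1:])"
    using m by (simp add: model_def mp_prod_list)
  have "gen (insert t (ev w ` set bs)) = ev w ` gen (insert R (set bs))"
    using gen_image[OF fhom_ev[OF tw], of "insert R (set bs)"] by (simp add: t)
  then show "gen {w} = gen (insert t (ev w ` set bs))"
    using m gen_single[OF tw] by (simp add: model_def)
qed

text \<open>A solution y of R(y) = t in the algebraic closure lies in the field generated by t and
  the roots of A at T = t. If A already splits there over the small field, y descends to it.\<close>

lemma model_root:
  fixes t :: "'a::field_char_0"
  assumes m: "model A R bs" and t: "transc t"
    and zs: "map_poly (ev t) A = (\<Prod>z\<leftarrow>zs. [:- z, 1:])"
    and y: "y \<in> fibre R (to_ac t)"
  shows "\<exists>w\<in>fibre R t. y = to_ac w"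
proof -
  have hac: "fhom (to_ac :: 'a \<Rightarrow> _)" by (rule fhom_to_ac)
  interpret fhom "to_ac :: 'a \<Rightarrow> _" by (rule hac)
  have tac: "transc (to_ac t)" using transc_fhom[OF hac] t by blast
  have "map_poly (ev (to_ac t)) A = map_poly to_ac (map_poly (ev t) A)"
  proof (rule poly_eqI)
    fix i
    have "ev t 0 = 0" using fhom_ev[OF t] by (simp add: fhom_def rhom.zero)
    moreover have "ev (to_ac t) 0 = 0" using fhom_ev[OF tac] by (simp add: fhom_def rhom.zero)
    ultimately show "Polynomial.coeff (map_poly (ev (to_ac t)) A) i = Polynomial.coeff (map_poly to_ac (map_poly (ev t) A)) i"
      by (simp add: coeff_map_poly fhom_evc[OF hac t])
  qed
  then have "(\<Prod>z\<leftarrow>map to_ac zs. [:- z, 1:]) = (\<Prod>z\<leftarrow>map (ev y) bs. [:- z, 1:])"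
    using zs model_spec(2)[OF m y] by (simp add: mp_prod_list o_def)
  then have "set (map to_ac zs) = set (map (ev y) bs)" using prod_linear_set_eq by (metis set_mset_mset)
  then have s: "to_ac ` set zs = ev y ` set bs" by simp
  have "y \<in> gen {y}" by (simp add: gen.incl)
  then have "y \<in> gen (to_ac ` insert t (set zs))" using model_spec(3)[OF m y] s by simp
  then obtain w where w: "y = to_ac w" using gen_image[OF hac] by blast
  then have "transc w" "ev w R = t"
    using y transc_fhom[OF hac, of w] fhom_evc[OF hac, of w R] by (auto simp: fibre_def)
  then show ?thesis using w by (auto simp: fibre_def)
qed

text \<open>By \<open>model_root\<close> no solution of R(w) = t is lost on the way down from the
  algebraic closure, so the count is the full degree. All solutions generate one and the same
  subfield, that of t and the roots.\<close>

lemma model_fibre: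
  fixes t :: "'a::field_char_0"
  assumes m: "model A R bs" and t: "transc t"
    and zs: "map_poly (ev t) A = (\<Prod>z\<leftarrow>zs. [:- z, 1:])"
  shows "finite (fibre R t)" "card (fibre R t) = rdeg R"
    and "\<And>w. w \<in> fibre R t \<Longrightarrow> set zs = ev w ` set bs \<and> gen {w} = gen (insert t (set zs))"
proof -
  have hac: "fhom (to_ac :: 'a \<Rightarrow> _)" by (rule fhom_to_ac)
  interpret fhom "to_ac :: 'a \<Rightarrow> _" by (rule hac)
  have tac: "transc (to_ac t)" using transc_fhom[OF hac] t by blast
  have "to_ac ` fibre R t \<subseteq> fibre R (to_ac t)"
  proof clarify
    fix w assume "w \<in> fibre R t"
    then show "to_ac w \<in> fibre R (to_ac t)"
      using transc_fhom[OF hac, of w] fhom_evc[OF hac, of w R] by (simp add: fibre_def)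
  qed
  then have e: "fibre R (to_ac t) = to_ac ` fibre R t" using model_root[OF m t zs] by blast
  have R: "R \<notin> range of_rat" using m by (simp add: model_def)
  note c = card_fibre[OF R tac]
  show "finite (fibre R t)" using c(1) e finite_imageD[OF _ inj_on_subset[OF inj_to_ac]] by auto
  show "card (fibre R t) = rdeg R"
    using c(2) e card_image[OF inj_on_subset[OF inj_to_ac], of "fibre R t"] by auto
  fix w assume w: "w \<in> fibre R t"
  have "(\<Prod>z\<leftarrow>zs. [:- z, 1:]) = (\<Prod>z\<leftarrow>map (ev w) bs. [:- z, 1:])"
    using zs model_spec(2)[OF m w] by (simp add: o_def)
  then have "set zs = ev w ` set bs" using prod_linear_set_eq by (metis set_mset_mset set_map)
  then show "set zs = ev w ` set bs \<and> gen {w} = gen (insert t (set zs))"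
    using model_spec(3)[OF m w] by simp
qed

text \<open>If g generates Q(X), then X = e(g) for some e. Any y in the algebraic closure with g(y)
  = g then equals X, so the fibre has a single point and g has degree 1.\<close>

lemma generator_moebius:
  assumes t: "transc g" and g: "gen {g} = UNIV"
  shows "\<exists>a b c d. a * d - b * c \<noteq> 0 \<and> g = moebius a b c d"
proof -
  have hac: "fhom (to_ac :: rat poly fract \<Rightarrow> _)" by (rule fhom_to_ac)
  have tac: "transc (to_ac g)" using transc_fhom[OF hac] t by blast
  have nr: "g \<notin> range of_rat" using t by (rule transc_nonrat)
  have "XX \<in> range (ev g)" using gen_single[OF t] g by auto
  then obtain e where e: "XX = ev g e" by (rule imageE)
  have "y = to_ac XX" if y: "y \<in> fibre g (to_ac g)" for y
  proof -
    have ty: "transc y" "ev y g = to_ac g" using y by (auto simp: fibre_def)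
    have "y = ev y (ev g e)" by (simp only: ev_XX[OF ty(1)] e[symmetric])
    also have "\<dots> = ev (to_ac g) e" using ev_ev[OF ty(1) t] ty(2) by simp
    also have "\<dots> = to_ac (ev g e)" using fhom_evc[OF hac t] by simp
    finally show ?thesis by (simp only: e[symmetric])
  qed
  then have "fibre g (to_ac g) \<subseteq> {to_ac XX}" by blast
  then have "card (fibre g (to_ac g)) \<le> card {to_ac XX}" by (intro card_mono) auto
  then have "rdeg g \<le> 1" using card_fibre(2)[OF nr tac] by simp
  then have d: "Polynomial.degree (num g) \<le> 1" "Polynomial.degree (den g) \<le> 1" by (auto simp: rdeg_def)
  have lin: "\<exists>a b. p = [:b, a:]" if "Polynomial.degree p \<le> 1" for p :: "rat poly"
  proof -
    have "p = [:Polynomial.coeff p 0, Polynomial.coeff p 1:]"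
    proof (rule poly_eqI)
      fix i show "Polynomial.coeff p i = Polynomial.coeff [:Polynomial.coeff p 0, Polynomial.coeff p 1:] i"
        using that by (simp add: coeff_pCons coeff_eq_0 split: nat.split)
    qed
    then show ?thesis by blast
  qed
  obtain a b where ab: "num g = [:b, a:]" using lin d(1) by blast
  obtain c d where cd: "den g = [:d, c:]" using lin \<open>Polynomial.degree (den g) \<le> 1\<close> by blast
  have "a * d - b * c \<noteq> 0"
  proof
    assume "a * d - b * c = 0"
    then have "Polynomial.smult d (num g) = Polynomial.smult b (den g)"
      "Polynomial.smult c (num g) = Polynomial.smult a (den g)" by (simp_all add: ab cd algebra_simps)
    then have "d = 0" "c = 0" using num_den_indep[OF nr] by blast+
    then show False using cd num_den(2)[of g] by simp
  qed
  moreover have "g = moebius a b c d" using num_den(1)[of g] by (simp add: moebius_def ab cd)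
  ultimately show ?thesis by blast
qed

section \<open>Lueroth's theorem\<close>

definition coeffs_in :: "'a::zero set \<Rightarrow> 'a poly \<Rightarrow> bool" where
  "coeffs_in K p \<longleftrightarrow> (\<forall>i. Polynomial.coeff p i \<in> K)"

lemma gen_sum: "(\<And>i. i \<in> A \<Longrightarrow> f i \<in> gen S) \<Longrightarrow> sum f A \<in> gen S"
  by (induction A rule: infinite_finite_induct) (auto intro: gen_0 gen.add)

lemma coeffs_in_diff: "coeffs_in (gen S) p \<Longrightarrow> coeffs_in (gen S) q \<Longrightarrow> coeffs_in (gen S) (p - q)"
  by (simp add: coeffs_in_def gen_diff)

lemma coeffs_in_add: "coeffs_in (gen S) p \<Longrightarrow> coeffs_in (gen S) q \<Longrightarrow> coeffs_in (gen S) (p + q)"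
  by (simp add: coeffs_in_def gen.add)

lemma coeffs_in_smult: "coeffs_in (gen S) p \<Longrightarrow> c \<in> gen S \<Longrightarrow> coeffs_in (gen S) (Polynomial.smult c p)"
  by (simp add: coeffs_in_def gen.mult)

lemma coeffs_in_mult: "coeffs_in (gen S) p \<Longrightarrow> coeffs_in (gen S) q \<Longrightarrow> coeffs_in (gen S) (p * q)"
  by (simp add: coeffs_in_def coeff_mult gen.mult gen_sum)

lemma coeffs_in_of_rat:
  "coeffs_in (gen S) (map_poly of_rat p :: 'a::field_char_0 poly)"
  by (simp add: coeffs_in_def rhom.coeff_mp[OF rhom_of_rat] gen_of_rat)

lemma coeffs_in_fibre_poly:
  "t \<in> gen S \<Longrightarrow> coeffs_in (gen S) (fibre_poly x t :: 'a::field_char_0 poly)"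
  unfolding fibre_poly_def by (intro coeffs_in_diff coeffs_in_smult coeffs_in_of_rat)

text \<open>Long division never leaves the subfield of the coefficients. It is carried out for the
  set \<open>gen S\<close>, which is not a type of its own.\<close>

lemma coeffs_in_division:
  assumes "coeffs_in (gen S) p" "coeffs_in (gen S) q" "q \<noteq> 0"
  shows "\<exists>d r. coeffs_in (gen S) d \<and> coeffs_in (gen S) r \<and> p = d * q + r \<and>
    (r = 0 \<or> Polynomial.degree r < Polynomial.degree q)"
  using assms(1)
proof (induction "Polynomial.degree p" arbitrary: p rule: less_induct)
  case less
  have 0: "coeffs_in (gen S) 0" by (simp add: coeffs_in_def gen_0)
  show ?case
  proof (cases "p = 0 \<or> Polynomial.degree p < Polynomial.degree q")
    case True
    then show ?thesis using less.prems 0 by (intro exI[of _ 0] exI[of _ p]) auto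
  next
    case False
    define n where "n = Polynomial.degree p - Polynomial.degree q"
    define c where "c = lead_coeff p / lead_coeff q"
    define p' where "p' = p - Polynomial.monom c n * q"
    have c: "c \<in> gen S" using less.prems assms(2) by (auto simp: c_def coeffs_in_def intro: gen_divide)
    have mc: "coeffs_in (gen S) (Polynomial.monom c n)"
      using c by (auto simp: coeffs_in_def gen_0)
    have p': "coeffs_in (gen S) p'" unfolding p'_def
      by (intro coeffs_in_diff coeffs_in_mult less.prems assms mc)
    have cz: "c \<noteq> 0" using False assms(3) by (simp add: c_def)
    have deg: "Polynomial.degree (Polynomial.monom c n * q) = Polynomial.degree p"
      using cz assms(3) False by (simp add: degree_mult_eq degree_monom_eq n_def)
    have lc: "lead_coeff (Polynomial.monom c n * q) = lead_coeff p"
      using assms(3) by (simp only: lead_coeff_mult lead_coeff_monom) (simp add: c_def)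
    have "p' = 0 \<or> Polynomial.degree p' < Polynomial.degree p"
    proof (cases "Polynomial.degree p = 0")
      case True
      then have "Polynomial.degree p' = 0" unfolding p'_def using deg degree_diff_le_max[of p "Polynomial.monom c n * q"] by simp
      moreover have "Polynomial.coeff p' 0 = 0" using lc deg True by (simp add: p'_def)
      ultimately show ?thesis by (metis leading_coeff_0_iff)
    next
      case False
      then have "Polynomial.degree p' < Polynomial.degree p" unfolding p'_def
        by (intro degree_lessI) (use lc deg in \<open>auto simp: coeff_eq_0 le_less\<close>)
      then show ?thesis ..
    qed
    then show ?thesis
    proof
      assume "p' = 0"
      then show ?thesis using mc 0 by (intro exI[of _ "Polynomial.monom c n"] exI[of _ 0]) (simp add: p'_def)
    next
      assume "Polynomial.degree p' < Polynomial.degree p"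
      from less.hyps[OF this p'] obtain d r where
        "coeffs_in (gen S) d" "coeffs_in (gen S) r" "p' = d * q + r" "r = 0 \<or> Polynomial.degree r < Polynomial.degree q" by blast
      then show ?thesis using mc
        by (intro exI[of _ "Polynomial.monom c n + d"] exI[of _ r]) (auto simp: p'_def algebra_simps intro: coeffs_in_add)
    qed
  qed
qed

text \<open>After the exchange of the two variables, \<open>Polynomial.degree\<close> measures the
  degree in X of a polynomial in Q[X][Y].\<close>

definition swap :: "rat poly poly \<Rightarrow> rat poly poly" where
  "swap p = poly (map_poly (map_poly (\<lambda>c. [:c:])) p) [:[:0, 1:]:]"

lemma rhom_swap: "rhom swap"
  unfolding swap_def
  using rhom_comp[OF rhom.mp_rhom[OF rhom.mp_rhom[OF rhom_pCons0]] rhom_poly] .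

lemma coeff_swap: "Polynomial.coeff (Polynomial.coeff (swap p) i) j = Polynomial.coeff (Polynomial.coeff p j) i"
proof (induction p arbitrary: j)
  case (pCons c p)
  have "swap (pCons c p) = map_poly (\<lambda>c. [:c:]) c + [:[:0, 1:]:] * swap p"
    by (simp add: swap_def rhom.mp_pCons[OF rhom.mp_rhom[OF rhom_pCons0]])
  then have "Polynomial.coeff (swap (pCons c p)) i = pCons (Polynomial.coeff c i) (Polynomial.coeff (swap p) i)"
    by (simp add: rhom.coeff_mp[OF rhom_pCons0])
  then show ?case by (cases j) (simp_all add: pCons)
qed (simp add: swap_def)

lemma degree_swap_ge: "Polynomial.coeff p i \<noteq> 0 \<Longrightarrow> Polynomial.degree (Polynomial.coeff p i) \<le> Polynomial.degree (swap p)"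
  by (rule le_degree) (metis coeff_swap leading_coeff_0_iff coeff_0)

lemma degree_swap_le: "(\<And>i. Polynomial.degree (Polynomial.coeff p i) \<le> n) \<Longrightarrow> Polynomial.degree (swap p) \<le> n"
proof (rule degree_le, intro allI impI)
  fix i assume "\<And>i. Polynomial.degree (Polynomial.coeff p i) \<le> n" "n < i"
  then have "Polynomial.coeff (Polynomial.coeff (swap p) i) j = 0" for j
    by (simp add: coeff_swap) (meson coeff_eq_0 le_less_trans)
  then show "Polynomial.coeff (swap p) i = 0" by (simp add: poly_eq_iff)
qed

text \<open>Write u = a/b and clear denominators to M * N = B with B = a(Y) b(X) - a(X) b(Y). The
  X-degree of B is at most the degree of u, and M alone already uses it up. Hence N lies in Q[Y],
  and a factor of B of this kind is constant. Comparing Y-degrees gives the claim.\<close>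

theorem lueroth_degree:
  assumes m: "lead_coeff m = 1" and u: "u = Polynomial.coeff m i" "u \<notin> range of_rat"
    and dvd: "m dvd fibre_poly u u"
  shows "Polynomial.degree m = rdeg u"
proof -
  define a b where "a = num u" and "b = den u"
  have b0: "b \<noteq> 0" and cop: "coprime a b" and uab: "u = Fract a b" using num_den[of u] by (auto simp: a_def b_def)
  have u0: "u \<noteq> 0" using u(2) by (metis of_rat_0 rangeI)
  have a0: "a \<noteq> 0" using u0 by (auto simp: uab Fract_conv_to_fract)
  have tu: "transc u" using u(2) poly_fract_transc by blast
  \<comment> \<open>The primitive multiple of m in Q[X][Y]; by Gauss, its divisibility over Q(X)
    descends to Q[X].\<close>
  define M where "M = primitive_part_fract m"
  define c where "c = fract_content m"
  have mM: "m = Polynomial.smult c (fract_poly M)" by (simp add: M_def c_def content_times_primitive_part_fract)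
  have m0: "m \<noteq> 0" using m by auto
  then have c0: "c \<noteq> 0" using mM by auto
  have cM: "content M = 1" using m0 by (simp add: M_def content_primitive_part_fract)
  have degM: "Polynomial.degree M = Polynomial.degree m" by (simp add: M_def)
  \<comment> \<open>The fibre polynomial times b(X), that is a(Y) b(X) - a(X) b(Y) with outer
    variable Y.\<close>
  define B where "B = map_poly (\<lambda>c. [:c:]) a * [:b:] - [:a:] * map_poly (\<lambda>c. [:c:]) b"
  have coefB: "Polynomial.coeff B j = Polynomial.smult (Polynomial.coeff a j) b - Polynomial.smult (Polynomial.coeff b j) a" for j
    by (simp add: B_def rhom.coeff_mp[OF rhom_pCons0])
  have tf: "to_fract [:r:] = of_rat r" for r :: rat
    using ev_to_fract[OF transc_XX, of "[:r:]"] by (simp add: ev_id rhom.mp_pCons[OF rhom_of_rat])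
  have fB: "fract_poly B = Polynomial.smult (to_fract b) (fibre_poly u u)"
  proof (rule poly_eqI)
    fix j
    have "to_fract b * u = to_fract a" using b0 by (simp add: uab Fract_conv_to_fract)
    moreover have "Polynomial.smult r p = [:r:] * p" for r and p :: "rat poly" by simp
    ultimately show "Polynomial.coeff (fract_poly B) j = Polynomial.coeff (Polynomial.smult (to_fract b) (fibre_poly u u)) j"
      by (simp add: coeff_map_poly coefB coeff_fibre_poly a_def[symmetric] b_def[symmetric] tf
          right_diff_distrib del: mult_pCons_left mult_pCons_right)
  qed
  have "fract_poly M dvd fibre_poly u u" using dvd mM c0 by (simp add: smult_dvd_iff)
  then have "fract_poly M dvd fract_poly B" unfolding fB by (rule dvd_smult)
  then have "M dvd B" using cM by (rule fract_poly_dvdD)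
  then obtain N where N: "B = M * N" by blast
  note degF = fibre_poly_degree[OF u(2) tu]
  have B0: "B \<noteq> 0" using fB degF(2) b0 by auto
  have degB: "Polynomial.degree B = rdeg u"
    using arg_cong[OF fB, of Polynomial.degree] degF(1) b0 degree_map_poly[of to_fract B] by simp
  have rd: "rdeg u = max (Polynomial.degree a) (Polynomial.degree b)" by (simp add: rdeg_def a_def b_def)
  have MN0: "M \<noteq> 0" "N \<noteq> 0" using B0 N by auto
  interpret sw: rhom swap by (rule rhom_swap)
  have swB: "Polynomial.degree (swap B) \<le> rdeg u"
    by (rule degree_swap_le) (simp add: coefB rd degree_diff_le)
  \<comment> \<open>Since m is monic, u is the quotient of coefficient i of M by its leading
    coefficient. As a and b are coprime, a divides the former and b the latter, which bounds the
    X-degree of M from below.\<close>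
  have ui: "a * lead_coeff M = Polynomial.coeff M i * b"
  proof -
    have "c * to_fract (lead_coeff M) = 1" using m degM by (simp add: mM c0 coeff_map_poly)
    moreover have "u = c * to_fract (Polynomial.coeff M i)" by (simp add: u(1) mM coeff_map_poly)
    ultimately have "u * to_fract (lead_coeff M) = to_fract (Polynomial.coeff M i)" by simp
    then have "to_fract a * to_fract (lead_coeff M) = to_fract (Polynomial.coeff M i) * to_fract b"
      using b0 by (simp add: uab Fract_conv_to_fract field_simps)
    then show ?thesis by (metis to_fract_eq_iff to_fract_mult)
  qed
  have Mi: "Polynomial.coeff M i \<noteq> 0" using ui a0 MN0 by auto
  have "a dvd Polynomial.coeff M i" using ui cop by (metis coprime_dvd_mult_left_iff dvd_triv_left)
  then have "Polynomial.degree a \<le> Polynomial.degree (Polynomial.coeff M i)" using Mi by (rule dvd_imp_degree_le)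
  then have da: "Polynomial.degree a \<le> Polynomial.degree (swap M)" using degree_swap_ge[OF Mi] by simp
  have "b dvd lead_coeff M" using ui cop by (metis coprime_commute coprime_dvd_mult_right_iff dvd_triv_right)
  then have "Polynomial.degree b \<le> Polynomial.degree (lead_coeff M)" using MN0 by (intro dvd_imp_degree_le) auto
  then have db: "Polynomial.degree b \<le> Polynomial.degree (swap M)" using degree_swap_ge[of M "Polynomial.degree M"] MN0 by simp
  have swnz: "swap p \<noteq> 0" if "p \<noteq> 0" for p
  proof
    assume "swap p = 0"
    then have "Polynomial.coeff (Polynomial.coeff p j) i = 0" for i j using coeff_swap[of p i j] by simp
    then have "p = 0" by (simp add: poly_eq_iff)
    then show False using that by simp
  qed
  have "Polynomial.degree (swap B) = Polynomial.degree (swap M) + Polynomial.degree (swap N)"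
    using swnz MN0 by (simp add: N sw.mult degree_mult_eq)
  then have "Polynomial.degree (swap N) = 0" using da db swB rd by simp
  then obtain e where e: "swap N = [:e:]" by (rule degree_eq_zeroE)
  \<comment> \<open>Read as polynomials in X, B is e(Y) times M, so e divides each coefficient of
    B.\<close>
  have edvd: "e dvd Polynomial.smult (Polynomial.coeff b j) a - Polynomial.smult (Polynomial.coeff a j) b" for j
  proof -
    have "Polynomial.coeff (swap B) j = Polynomial.smult (Polynomial.coeff b j) a - Polynomial.smult (Polynomial.coeff a j) b"
      by (rule poly_eqI) (simp add: coeff_swap coefB mult.commute)
    moreover have "swap B = [:e:] * swap M" by (simp add: N sw.mult e)
    ultimately have "Polynomial.smult (Polynomial.coeff b j) a - Polynomial.smult (Polynomial.coeff a j) b = e * Polynomial.coeff (swap M) j"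
      by simp
    then show ?thesis by simp
  qed
  \<comment> \<open>Two such coefficients with independent pairs (a_j, b_j) combine to nonzero
    multiples of a and of b, which are coprime.\<close>
  have "is_unit e"
  proof -
    obtain k where k: "Polynomial.coeff b k \<noteq> 0" using b0 by (metis leading_coeff_0_iff)
    have "\<exists>j. Polynomial.coeff b j * Polynomial.coeff a k \<noteq> Polynomial.coeff b k * Polynomial.coeff a j"
    proof (rule ccontr)
      assume "\<not> ?thesis"
      then have "Polynomial.smult (Polynomial.coeff b k) a = Polynomial.smult (Polynomial.coeff a k) b"
        by (intro poly_eqI) (simp add: mult.commute)
      then show False using num_den_indep[OF u(2)] k by (auto simp: a_def b_def)
    qed
    then obtain j where j: "Polynomial.coeff b j * Polynomial.coeff a k - Polynomial.coeff b k * Polynomial.coeff a j \<noteq> 0" (is "?w \<noteq> 0") by auto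
    let ?E = "\<lambda>j. Polynomial.smult (Polynomial.coeff b j) a - Polynomial.smult (Polynomial.coeff a j) b"
    have "Polynomial.smult (Polynomial.coeff a k) (?E j) - Polynomial.smult (Polynomial.coeff a j) (?E k) = Polynomial.smult ?w a"
      by (rule poly_eqI) (simp add: algebra_simps)
    then have "e dvd Polynomial.smult ?w a" using edvd by (metis dvd_diff dvd_smult)
    then have 1: "e dvd a" using j by (simp add: dvd_smult_iff)
    have "Polynomial.smult (Polynomial.coeff b k) (?E j) - Polynomial.smult (Polynomial.coeff b j) (?E k) = Polynomial.smult ?w b"
      by (rule poly_eqI) (simp add: algebra_simps)
    then have "e dvd Polynomial.smult ?w b" using edvd by (metis dvd_diff dvd_smult)
    then have "e dvd b" using j by (simp add: dvd_smult_iff)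
    then show ?thesis using 1 cop by (meson coprime_common_divisor)
  qed
  then have "Polynomial.degree e = 0" by (metis is_unit_iff_degree not_is_unit_0)
  then have ez: "Polynomial.coeff e j = 0" if "j > 0" for j using that by (simp add: coeff_eq_0)
  have "Polynomial.coeff N j = 0" if "j > 0" for j
  proof (rule poly_eqI)
    fix l show "Polynomial.coeff (Polynomial.coeff N j) l = Polynomial.coeff 0 l"
      using coeff_swap[of N l j] ez[OF that] by (cases l) (simp_all add: e)
  qed
  then have "Polynomial.degree N = 0" by (metis degree_le le_zero_eq)
  then show ?thesis using degB degM MN0 by (simp add: N degree_mult_eq)
qed

text \<open>Take the minimal polynomial m of X over the subfield and a nonconstant coefficient u of
  m. By \<open>lueroth_degree\<close> the fibre polynomial of u, which has coefficients in Q(u), has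
  the same degree as m. Reducing the numerator and denominator of v modulo it expresses v in
  Q(u).\<close>

theorem lueroth:
  fixes S :: "rat poly fract set"
  assumes t: "t \<in> gen S" "t \<notin> range of_rat"
  shows "\<exists>u. u \<in> gen S \<and> transc u \<and> gen S = gen {u}"
proof -
  define Q where "Q m \<longleftrightarrow> m \<noteq> 0 \<and> coeffs_in (gen S) m \<and> poly m XX = 0" for m
  have XXf: "XX \<in> fibre x x" for x by (simp add: fibre_def transc_XX ev_id)
  have Qf: "Q (fibre_poly x x)" if "x \<in> gen S" "x \<notin> range of_rat" for x
  proof -
    have tx: "transc x" using that poly_fract_transc by blast
    show ?thesis using fibre_iff[OF tx, of XX x] XXf[of x] fibre_poly_degree(2)[OF that(2) tx]
      coeffs_in_fibre_poly[OF that(1)] by (simp add: Q_def)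
  qed
  obtain m0 where m0: "Q m0" "\<And>m'. Q m' \<Longrightarrow> Polynomial.degree m0 \<le> Polynomial.degree m'"
    using ex_has_least_nat[of Q _ Polynomial.degree] Qf[OF t] by blast
  define m where "m = Polynomial.smult (inverse (lead_coeff m0)) m0"
  have lm: "lead_coeff m = 1" using m0(1) by (simp add: m_def Q_def)
  have Qm: "Q m" using m0(1) by (auto simp: m_def Q_def intro!: coeffs_in_smult gen.inv) (simp add: coeffs_in_def)
  have mmin: "Polynomial.degree m \<le> Polynomial.degree m'" if "Q m'" for m'
    using m0(2)[OF that] m0(1) by (simp add: m_def Q_def)
  have zero: "r = 0" if "coeffs_in (gen S) r" "poly r XX = 0" "r = 0 \<or> Polynomial.degree r < Polynomial.degree m" for r
    using mmin[of r] that unfolding Q_def by (metis not_less)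
  have mdvd: "m dvd f" if f: "coeffs_in (gen S) f" "poly f XX = 0" for f
  proof -
    obtain d r where dr: "coeffs_in (gen S) d" "coeffs_in (gen S) r" "f = d * m + r"
      "r = 0 \<or> Polynomial.degree r < Polynomial.degree m"
      using coeffs_in_division[OF f(1), of m] Qm by (auto simp: Q_def)
    have "poly r XX = 0" using f(2) dr(3) Qm by (simp add: Q_def)
    then show ?thesis using zero dr by auto
  qed
  \<comment> \<open>With only rational coefficients m would make X algebraic.\<close>
  have "\<exists>i. Polynomial.coeff m i \<notin> range of_rat"
  proof (rule ccontr)
    assume "\<not> ?thesis"
    then have "\<forall>i. \<exists>r. Polynomial.coeff m i = of_rat r" by auto
    then obtain r where r: "\<And>i. Polynomial.coeff m i = of_rat (r i)" by metis
    define p where "p = Poly (map r [0..<Suc (Polynomial.degree m)])"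
    have "m = map_poly of_rat p"
    proof (rule poly_eqI)
      fix i show "Polynomial.coeff m i = Polynomial.coeff (map_poly of_rat p) i"
        by (cases "i \<le> Polynomial.degree m")
          (auto simp: rhom.coeff_mp[OF rhom_of_rat] p_def nth_default_def r[symmetric] coeff_eq_0 less_Suc_eq_le simp del: upt_Suc)
    qed
    then have "qev p XX = 0" "p \<noteq> 0" using Qm by (auto simp: Q_def)
    then show False using transc_XX by (auto simp: transc_def)
  qed
  then obtain i where i: "Polynomial.coeff m i \<notin> range of_rat" by blast
  define u where "u = Polynomial.coeff m i"
  have uS: "u \<in> gen S" using Qm by (simp add: u_def Q_def coeffs_in_def)
  have ur: "u \<notin> range of_rat" using i by (simp add: u_def)
  then have tu: "transc u" using poly_fract_transc by blast
  let ?B = "fibre_poly u u"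
  have "m dvd ?B" using mdvd Qf[OF uS ur] by (simp add: Q_def)
  then have dm: "Polynomial.degree m = rdeg u" using lueroth_degree[OF lm u_def ur] by blast
  note dB = fibre_poly_degree[OF ur tu]
  have sub: "gen {u} \<subseteq> gen S" using uS by (intro gen_least) simp
  have cin: "coeffs_in (gen S) p" if "coeffs_in (gen {u}) p" for p using that sub by (auto simp: coeffs_in_def)
  have "v \<in> gen {u}" if v: "v \<in> gen S" for v
  proof -
    let ?a = "map_poly of_rat (num v) :: rat poly fract poly" and ?b = "map_poly of_rat (den v) :: rat poly fract poly"
    have uu: "u \<in> gen {u}" by (simp add: gen.incl)
    obtain d1 a' where a': "coeffs_in (gen {u}) a'" "?a = d1 * ?B + a'" "a' = 0 \<or> Polynomial.degree a' < Polynomial.degree ?B"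
      using coeffs_in_division[OF coeffs_in_of_rat coeffs_in_fibre_poly[OF uu] dB(2)] by blast
    obtain d2 b' where b': "coeffs_in (gen {u}) b'" "?b = d2 * ?B + b'" "b' = 0 \<or> Polynomial.degree b' < Polynomial.degree ?B"
      using coeffs_in_division[OF coeffs_in_of_rat coeffs_in_fibre_poly[OF uu] dB(2)] by blast
    have B0: "poly ?B XX = 0" using fibre_iff[OF tu] XXf by blast
    have nb: "qev (den v) XX \<noteq> 0" using transc_XX num_den(2) by (auto simp: transc_def)
    have ra: "poly a' XX = qev (num v) XX" and rb: "poly b' XX = qev (den v) XX"
      using a'(2) b'(2) B0 by simp_all
    have "v = qev (num v) XX / qev (den v) XX" using ev_num_den[of XX v] by (simp add: ev_id)
    \<comment> \<open>The remainders have the values of numerator and denominator at X. By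
      minimality of m the combination a' - v b' is zero, and a nonzero coefficient of b' exhibits v
      as a quotient of elements of Q(u).\<close>
    then have "poly (a' - Polynomial.smult v b') XX = 0" using ra rb nb by (simp add: field_simps)
    moreover have "coeffs_in (gen S) (a' - Polynomial.smult v b')"
      by (intro coeffs_in_diff coeffs_in_smult cin a' b' v)
    moreover have "a' - Polynomial.smult v b' = 0 \<or> Polynomial.degree (a' - Polynomial.smult v b') < Polynomial.degree m"
    proof (cases "Polynomial.degree m = 0")
      case True
      then show ?thesis using a'(3) b'(3) dB(1) dm by auto
    next
      case False
      then have "Polynomial.degree a' < Polynomial.degree m" "Polynomial.degree (Polynomial.smult v b') < Polynomial.degree m"
        using a'(3) b'(3) dB(1) dm by auto
      then show ?thesis using degree_diff_less by blast
    qed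
    ultimately have z: "a' - Polynomial.smult v b' = 0" using zero by blast
    have "b' \<noteq> 0" using rb nb by auto
    then obtain k where k: "Polynomial.coeff b' k \<noteq> 0" by (metis leading_coeff_0_iff)
    have "Polynomial.coeff a' k - v * Polynomial.coeff b' k = 0" using arg_cong[OF z, of "\<lambda>p. Polynomial.coeff p k"] by simp
    then have "v = Polynomial.coeff a' k / Polynomial.coeff b' k" using k by (simp add: field_simps)
    then show ?thesis using a'(1) b'(1) by (simp add: coeffs_in_def gen_divide)
  qed
  then show ?thesis using sub uS tu by blast
qed

subsection \<open>Split polynomials over field records\<close>

text \<open>The coefficient list of the product of the factors Y - y: the normal form of a monic
  split polynomial over a record, from which the roots can be read off.\<close>

definition (in ring) lin_prod :: "'a list \<Rightarrow> 'a list" where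
  "lin_prod ys = foldr (\<lambda>y p. poly_mult [\<one>, \<ominus> y] p) ys [\<one>]"

context field
begin

lemma linear_poly: "y \<in> carrier R \<Longrightarrow> polynomial\<^bsub>R\<^esub> (carrier R) [\<one>, \<ominus> y]"
  by (auto simp: polynomial_def)

lemma coeff_linear_mult:
  assumes y: "y \<in> carrier R" and p: "set p \<subseteq> carrier R"
  shows "coeff (poly_mult [\<one>, \<ominus> y] p) i = (\<ominus> y \<otimes> coeff p i) \<oplus> (if i = 0 then \<zero> else coeff p (i - 1))"
proof -
  have m1: "set (map ((\<otimes>) \<one>) p @ [\<zero>]) \<subseteq> carrier R" "set (map ((\<otimes>) (\<ominus> y)) p) \<subseteq> carrier R"
    using assms by auto
  have e: "set ([] :: 'a list) \<subseteq> carrier R" by simp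
  have "coeff (poly_mult [\<one>, \<ominus> y] p) i =
      coeff (map ((\<otimes>) \<one>) p @ [\<zero>]) i \<oplus> coeff (poly_add (map ((\<otimes>) (\<ominus> y)) p) []) i"
    using poly_add_coeff[OF m1(1) poly_add_in_carrier[OF m1(2) e]] by (simp del: poly_add.simps)
  also have "coeff (poly_add (map ((\<otimes>) (\<ominus> y)) p) []) i = (\<ominus> y \<otimes> coeff p i) \<oplus> \<zero>"
    using poly_add_coeff[OF m1(2) e] scalar_coeff[of "\<ominus> y" p] y by simp
  also have "coeff (map ((\<otimes>) \<one>) p @ [\<zero>]) i = (if i = 0 then \<zero> else coeff p (i - 1))"
    using scalar_coeff[of \<one> p] p by (simp add: append_coeff)
  finally show ?thesis using y p by (simp add: a_comm)
qed

lemma lin_prod: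
  assumes "set ys \<subseteq> carrier R"
  shows "polynomial\<^bsub>R\<^esub> (carrier R) (lin_prod ys)" "hd (lin_prod ys) = \<one>" "length (lin_prod ys) = Suc (length ys)"
    "roots (lin_prod ys) = mset ys"
proof -
  have "polynomial\<^bsub>R\<^esub> (carrier R) (lin_prod ys) \<and> hd (lin_prod ys) = \<one> \<and> length (lin_prod ys) = Suc (length ys) \<and>
    roots (lin_prod ys) = mset ys" using assms
  proof (induction ys)
    case Nil
    have "polynomial\<^bsub>R\<^esub> (carrier R) [\<one>]" by (simp add: polynomial_def)
    then show ?case using degree_zero_imp_empty_roots[of "[\<one>]"] by (simp add: lin_prod_def univ_poly_carrier)
  next
    case (Cons y ys)
    let ?p = "lin_prod ys"
    have e: "lin_prod (y # ys) = poly_mult [\<one>, \<ominus> y] ?p" by (simp add: lin_prod_def del: poly_mult.simps)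
    have y: "y \<in> carrier R" using Cons by simp
    have p: "polynomial\<^bsub>R\<^esub> (carrier R) ?p" "?p \<noteq> []" using Cons by auto
    note cl = poly_mult_closed[OF carrier_is_subring linear_poly[OF y] p(1)]
    have "hd (poly_mult [\<one>, \<ominus> y] ?p) = \<one>"
      using poly_mult_lead_coeff[OF carrier_is_subring linear_poly[OF y] p(1)] p Cons by (simp del: poly_mult.simps)
    moreover have "Polynomials.degree (poly_mult [\<one>, \<ominus> y] ?p) = Suc (length ys)"
      using poly_mult_degree_eq[OF carrier_is_subring linear_poly[OF y] p(1)] p Cons by (simp del: poly_mult.simps)
    moreover have "poly_mult [\<one>, \<ominus> y] ?p \<noteq> []"
      using poly_mult_integral[OF carrier_is_subring linear_poly[OF y] p(1)] p by blast
    moreover have "roots (poly_mult [\<one>, \<ominus> y] ?p) = add_mset y (mset ys)"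
      using poly_mult_degree_one_monic_imp_same_roots[OF y, of ?p] p Cons by (simp add: univ_poly_carrier univ_poly_mult del: poly_mult.simps)
    ultimately show ?case using cl unfolding e by (cases "poly_mult [\<one>, \<ominus> y] ?p") (auto simp del: poly_mult.simps)
  qed
  then show "polynomial\<^bsub>R\<^esub> (carrier R) (lin_prod ys)" "hd (lin_prod ys) = \<one>" "length (lin_prod ys) = Suc (length ys)"
    "roots (lin_prod ys) = mset ys" by auto
qed

lemma lin_prod_splitted: "set ys \<subseteq> carrier R \<Longrightarrow> splitted (lin_prod ys)"
  using lin_prod by (simp add: splitted_def)

lemma splitted_lin_prod:
  assumes "polynomial\<^bsub>R\<^esub> (carrier R) p" "hd p = \<one>" "p \<noteq> []" "splitted p"
  shows "\<exists>ys. set ys \<subseteq> carrier R \<and> p = lin_prod ys"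
  using assms
proof (induction "length p" arbitrary: p rule: less_induct)
  case less
  note pc = less.prems(1)[unfolded univ_poly_carrier]
  show ?case
  proof (cases "Polynomials.degree p = 0")
    case True
    then have "p = [\<one>]" using less.prems by (cases p) auto
    then show ?thesis by (intro exI[of _ "[]"]) (simp add: lin_prod_def)
  next
    case False
    then have "roots p \<noteq> {#}" using less.prems(4) by (auto simp: splitted_def)
    then obtain a where a: "a \<in> carrier R" "[\<one>, \<ominus> a] pdivides p"
      using not_empty_rootsE[OF pc] by metis
    then obtain q where q: "q \<in> carrier (poly_ring R)" "p = [\<one>, \<ominus> a] \<otimes>\<^bsub>poly_ring R\<^esub> q"
      by (auto simp: pdivides_def factor_def)
    then have pq: "p = poly_mult [\<one>, \<ominus> a] q" by (simp add: univ_poly_mult)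
    have qp: "polynomial\<^bsub>R\<^esub> (carrier R) q" using q(1) by (simp add: univ_poly_carrier)
    have qn: "q \<noteq> []"
    proof
      assume "q = []"
      then have "length p \<le> 1" using poly_mult_degree_eq[OF carrier_is_subring linear_poly[OF a(1)] qp] pq by (simp del: poly_mult.simps)
      then show False using False by simp
    qed
    have deg: "Polynomials.degree p = Suc (Polynomials.degree q)"
      using poly_mult_degree_eq[OF carrier_is_subring linear_poly[OF a(1)] qp] qn pq by (simp del: poly_mult.simps)
    have hd: "hd q = \<one>"
    proof -
      have "hd q \<in> carrier R" using qp qn by (cases q) (auto simp: polynomial_def)
      then show ?thesis using poly_mult_lead_coeff[OF carrier_is_subring linear_poly[OF a(1)] qp] qn pq less.prems(2) by (simp del: poly_mult.simps)
    qed
    have "roots p = add_mset a (roots q)" unfolding q(2)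
      by (rule poly_mult_degree_one_monic_imp_same_roots[OF a(1) q(1) qn])
    then have "splitted q" using less.prems(4) deg by (simp add: splitted_def)
    moreover have "length q < length p" using deg less.prems(3) qn by (cases p; cases q) auto
    ultimately obtain ys where "set ys \<subseteq> carrier R" "q = lin_prod ys"
      using less.hyps[OF _ qp hd qn] by blast
    then show ?thesis using a(1) by (intro exI[of _ "a # ys"]) (simp add: lin_prod_def pq del: poly_mult.simps)
  qed
qed

lemma polynomial_eqI:
  assumes "polynomial\<^bsub>R\<^esub> (carrier R) p" "polynomial\<^bsub>R\<^esub> (carrier R) q" "\<And>i. coeff p i = coeff q i"
  shows "p = q"
  using coeff_iff_polynomial_cond[OF assms(1,2)] assms(3) by blast

end

lemma (in ring) coeff_map_coeff_list:
  assumes "f 0 = \<zero>"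
  shows "coeff (map f (coeff_list p)) i = f (Polynomial.coeff p i)"
proof (cases "i < length (coeffs p)")
  case True
  then have "coeff (map f (coeff_list p)) i = map f (coeff_list p) ! (length (coeffs p) - 1 - i)"
    by (subst coeff_nth) (simp_all add: Defs.coeff_list_def)
  also have "\<dots> = f (coeffs p ! i)" using True by (simp add: Defs.coeff_list_def rev_nth)
  also have "coeffs p ! i = Polynomial.coeff p i" using True by (metis nth_default_coeffs_eq nth_default_nth)
  finally show ?thesis .
next
  case False
  then have "Polynomial.coeff p i = 0" by (metis nth_default_beyond nth_default_coeffs_eq not_less)
  then show ?thesis using False assms coeff_length[of "map f (coeff_list p)" i] by (simp add: Defs.coeff_list_def)
qed

lemma set_coeff_list: "p \<noteq> 0 \<Longrightarrow> hd (coeff_list p) = lead_coeff p" "coeff_list p = [] \<longleftrightarrow> p = 0"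
  by (simp_all add: Defs.coeff_list_def hd_rev last_coeffs_eq_coeff_degree)

lemma coeff_list_pCons: "p \<noteq> 0 \<or> a \<noteq> 0 \<Longrightarrow> coeff_list (pCons a p) = coeff_list p @ [a]"
  by (auto simp: Defs.coeff_list_def cCons_def)

subsection \<open>Evaluation in field records\<close>

text \<open>The counterpart of \<open>qev\<close> with values in a record, the coefficients being
  embedded by \<open>e\<close>.\<close>

definition pev :: "('k, 'm) ring_scheme \<Rightarrow> ('a::zero \<Rightarrow> 'k) \<Rightarrow> 'k \<Rightarrow> 'a poly \<Rightarrow> 'k" where
  "pev K e w p = fold_coeffs (\<lambda>a x. e a \<oplus>\<^bsub>K\<^esub> w \<otimes>\<^bsub>K\<^esub> x) p \<zero>\<^bsub>K\<^esub>"

locale frec = field K for K :: "('k, 'm) ring_scheme" (structure) +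
  fixes e :: "'a::idom \<Rightarrow> 'k"
  assumes e: "e \<in> ring_hom ring_of_type_algebra K"
begin

sublocale e: ring_hom_cring "ring_of_type_algebra :: 'a ring" K e
  using e cring_from_type_algebra is_cring
  by (simp add: ring_hom_cring_def ring_hom_cring_axioms_def)

lemma e_carr [simp]: "e x \<in> carrier K" using e.hom_closed by simp
lemma e_0 [simp]: "e 0 = \<zero>" using e.hom_zero by simp
lemma e_1 [simp]: "e 1 = \<one>" using e.hom_one by simp
lemma e_add: "e (x + y) = e x \<oplus> e y" using e.hom_add[of x y] by simp
lemma e_mult: "e (x * y) = e x \<otimes> e y" using e.hom_mult[of x y] by simp
lemma e_neg: "e (- x) = \<ominus> e x" using e.hom_a_inv[of x] by (simp add: rota_neg)

lemma pev_0 [simp]: "pev K e w 0 = \<zero>" by (simp add: pev_def)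

lemma pev_pCons: 
  assumes "w \<in> carrier K" shows "pev K e w (pCons a p) = e a \<oplus> w \<otimes> pev K e w p"
  using assms by (cases "p = 0 \<and> a = 0") (auto simp: pev_def)

lemma pev_carr [simp]: "w \<in> carrier K \<Longrightarrow> pev K e w p \<in> carrier K"
  by (induction p) (auto simp: pev_pCons)

lemma pev_1 [simp]: "w \<in> carrier K \<Longrightarrow> pev K e w 1 = \<one>"
  by (simp add: one_pCons pev_pCons)

lemma pev_add: "w \<in> carrier K \<Longrightarrow> pev K e w (p + q) = pev K e w p \<oplus> pev K e w q"
  by (induction p q rule: poly_induct2) (auto simp: pev_pCons e_add r_distr a_ac)

lemma pev_smult: "w \<in> carrier K \<Longrightarrow> pev K e w (Polynomial.smult a p) = e a \<otimes> pev K e w p"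
  by (induction p) (auto simp: pev_pCons e_mult r_distr m_ac)

lemma pev_mult: "w \<in> carrier K \<Longrightarrow> pev K e w (p * q) = pev K e w p \<otimes> pev K e w q"
proof (induction p)
  case (pCons a p)
  have "(e a \<oplus> w \<otimes> pev K e w p) \<otimes> pev K e w q = e a \<otimes> pev K e w q \<oplus> w \<otimes> (pev K e w p \<otimes> pev K e w q)"
    using pCons by (simp add: l_distr m_assoc)
  then show ?case using pCons by (simp add: pev_pCons pev_add pev_smult)
qed simp

lemma pev_hom: "w \<in> carrier K \<Longrightarrow> pev K e w \<in> ring_hom ring_of_type_algebra K"
  by (rule ring_hom_memI) (auto simp: pev_add pev_mult)

lemma eval_pev: "w \<in> carrier K \<Longrightarrow> eval (map e (coeff_list p)) w = pev K e w p"
proof (induction p)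
  case (pCons a p)
  have "set (map e (coeff_list p)) \<subseteq> carrier K" by auto
  then show ?case using pCons eval_append_aux[of "map e (coeff_list p)" "e a" w]
    by (subst coeff_list_pCons) (auto simp: pev_pCons a_comm m_comm)
qed (simp add: Defs.coeff_list_def)

end

lemma frecI: "field K \<Longrightarrow> e \<in> ring_hom ring_of_type_algebra K \<Longrightarrow> frec K e"
  by (simp add: frec_def frec_axioms_def)

subsection \<open>Specialization relations\<close>

text \<open>Common properties of two ways to pass from a type-class field to a record: embeddings
  (\<open>rspec_hom\<close>), and evaluation at a point that may be a pole
  (\<open>rspec_spec\<close>). Statements about roots and rational coefficients are then proved once
  for both.\<close>

locale rspec = field K for K :: "('k, 'm) ring_scheme" (structure) +
  fixes rl :: "'a::field_char_0 \<Rightarrow> 'k \<Rightarrow> bool"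
  assumes carr: "rl x y \<Longrightarrow> y \<in> carrier K"
    and unique: "rl x y \<Longrightarrow> rl x z \<Longrightarrow> y = z"
    and one: "rl 1 \<one>"
    and add: "rl x y \<Longrightarrow> rl x' y' \<Longrightarrow> rl (x + x') (y \<oplus> y')"
    and mult: "rl x y \<Longrightarrow> rl x' y' \<Longrightarrow> rl (x * x') (y \<otimes> y')"
    and neg: "rl x y \<Longrightarrow> rl (- x) (\<ominus> y)"
    and minv: "rl x y \<Longrightarrow> y \<noteq> \<zero> \<Longrightarrow> rl (inverse x) (inv y)"
begin

lemma zero: "rl 0 \<zero>"
  using add[OF one neg[OF one]] by (simp add: r_neg)

lemma lin_prod_rel:
  assumes "list_all2 rl bs ys"
  shows "rl (Polynomial.coeff (\<Prod>b\<leftarrow>bs. [:- b, 1:]) i) (coeff (lin_prod ys) i)"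
  using assms
proof (induction arbitrary: i rule: list_all2_induct)
  case Nil then show ?case by (simp add: lin_prod_def one zero)
next
  case (Cons b bs y ys)
  have y: "y \<in> carrier K" using Cons carr by blast
  have ys: "set ys \<subseteq> carrier K" using \<open>list_all2 rl bs ys\<close> carr
    by (metis list_all2_conv_all_nth in_set_conv_nth subsetI)
  have p: "set (lin_prod ys) \<subseteq> carrier K" using lin_prod(1)[OF ys] by (auto simp: polynomial_def)
  let ?P = "\<Prod>b\<leftarrow>bs. [:- b, 1:]"
  have "Polynomial.coeff (\<Prod>b\<leftarrow>b # bs. [:- b, 1:]) i = (- b) * Polynomial.coeff ?P i + (if i = 0 then 0 else Polynomial.coeff ?P (i - 1))"
    by (cases i) simp_all
  moreover have "coeff (lin_prod (y # ys)) i = (\<ominus> y \<otimes> coeff (lin_prod ys) i) \<oplus> (if i = 0 then \<zero> else coeff (lin_prod ys) (i - 1))"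
    using coeff_linear_mult[OF y p] by (simp add: lin_prod_def del: poly_mult.simps)
  moreover have "rl (if i = 0 then 0 else Polynomial.coeff ?P (i - 1)) (if i = 0 then \<zero> else coeff (lin_prod ys) (i - 1))"
    using zero Cons by simp
  ultimately show ?case using add[OF mult[OF neg[OF Cons(1)] Cons(3)[of i]]] by metis
qed

lemma of_rat_rel:
  assumes "e \<in> ring_hom ring_of_type_algebra K"
  shows "rl (of_rat r) (e r)"
proof -
  interpret E: frec K e by (rule frecI) (use assms in \<open>auto intro: field_axioms\<close>)
  have n: "rl (of_nat n) (e (of_nat n))" for n
    by (induction n) (auto simp: E.e_add zero intro: one add)
  have i: "rl (of_int k) (e (of_int k))" for k
    by (cases k rule: int_cases2) (auto simp: E.e_neg n intro: neg)
  obtain m k where r: "r = of_int m / of_int k" "k \<noteq> 0" by (metis Rat_cases Fract_of_int_quotient less_irrefl)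
  have "e (of_int k) \<otimes> e (1 / of_int k) = \<one>" using r(2) by (simp flip: E.e_mult)
  then have nz: "e (of_int k) \<noteq> \<zero>" and iv: "e (1 / of_int k) = inv (e (of_int k))"
    using comm_inv_char[of "e (of_int k)" "e (1 / of_int k)"] by auto
  have "rl (inverse (of_int k)) (inv (e (of_int k)))" by (rule minv[OF i nz])
  then have "rl (of_int m * inverse (of_int k)) (e (of_int m) \<otimes> e (1 / of_int k))" using mult[OF i] iv by metis
  moreover have "e r = e (of_int m) \<otimes> e (1 / of_int k)" using r by (simp flip: E.e_mult)
  moreover have "of_rat r = (of_int m * inverse (of_int k) :: 'a)" using r by (simp add: of_rat_divide flip: divide_inverse)
  ultimately show ?thesis by metis
qed

lemma qev_rel:
  assumes "e \<in> ring_hom ring_of_type_algebra K" "rl x t"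
  shows "rl (qev p x) (pev K e t p)"
proof -
  interpret E: frec K e by (rule frecI) (use assms in \<open>auto intro: field_axioms\<close>)
  have t: "t \<in> carrier K" using assms(2) by (rule carr)
  show ?thesis
    by (induction p) (auto simp: E.pev_pCons[OF t] rhom.mp_pCons[OF rhom_of_rat] zero intro!: add mult assms of_rat_rel)
qed

end

lemma rspec_hom:
  assumes "field K" "f \<in> ring_hom ring_of_type_algebra K"
  shows "rspec K (\<lambda>x y. y = f x)"
proof -
  interpret E: frec K f by (rule frecI[OF assms])
  show ?thesis
  proof unfold_locales
    fix x y assume *: "y = f x" "y \<noteq> \<zero>\<^bsub>K\<^esub>"
    then have "x \<noteq> 0" by auto
    then have "f x \<otimes>\<^bsub>K\<^esub> f (inverse x) = \<one>\<^bsub>K\<^esub>" by (simp flip: E.e_mult)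
    then show "inv\<^bsub>K\<^esub> y = f (inverse x)" using * by (metis E.comm_inv_char E.e_carr)
  qed (auto simp: E.e_add E.e_mult E.e_neg)
qed

text \<open>The record version of \<open>tspc\<close>.\<close>

definition spec :: "('k, 'm) ring_scheme \<Rightarrow> ('a::idom \<Rightarrow> 'k) \<Rightarrow> 'a fract \<Rightarrow> 'k \<Rightarrow> bool" where
  "spec K f x y \<longleftrightarrow> (\<exists>a b. x = Fract a b \<and> f b \<noteq> \<zero>\<^bsub>K\<^esub> \<and> y = f a \<otimes>\<^bsub>K\<^esub> inv\<^bsub>K\<^esub> f b)"

lemma rspec_spec:
  fixes f :: "'a::{idom,ring_char_0} \<Rightarrow> 'k"
  assumes "field K" "f \<in> ring_hom ring_of_type_algebra K"
  shows "rspec K (spec K f)"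
proof -
  interpret E: frec K f by (rule frecI[OF assms])
  have U: "f b \<noteq> \<zero>\<^bsub>K\<^esub> \<Longrightarrow> f b \<in> Units K" for b by (simp add: E.field_Units)
  have nz: "f b \<noteq> \<zero>\<^bsub>K\<^esub> \<Longrightarrow> b \<noteq> 0" for b by auto
  have key: "f a \<otimes>\<^bsub>K\<^esub> inv\<^bsub>K\<^esub> f b = y" if "f b \<noteq> \<zero>\<^bsub>K\<^esub>" "y \<in> carrier K" "f a = y \<otimes>\<^bsub>K\<^esub> f b" for a b y
    using that U[OF that(1)] by (simp add: E.m_assoc)
  show ?thesis
  proof unfold_locales
    fix x y assume "spec K f x y" then show "y \<in> carrier K" using U by (auto simp: spec_def)
  next
    fix x y z assume "spec K f x y" "spec K f x z"
    then obtain a b c d where *: "x = Fract a b" "f b \<noteq> \<zero>\<^bsub>K\<^esub>" "y = f a \<otimes>\<^bsub>K\<^esub> inv\<^bsub>K\<^esub> f b"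
      "x = Fract c d" "f d \<noteq> \<zero>\<^bsub>K\<^esub>" "z = f c \<otimes>\<^bsub>K\<^esub> inv\<^bsub>K\<^esub> f d" unfolding spec_def by blast
    have zc: "z \<in> carrier K" using * U by auto
    have "Fract a b = Fract c d" using * by metis
    then have "a * d = c * b" using eq_fract(1)[OF nz[OF *(2)] nz[OF *(5)], of a c] by simp
    then have "f a \<otimes>\<^bsub>K\<^esub> f d = f c \<otimes>\<^bsub>K\<^esub> f b" by (metis E.e_mult)
    also have "f c = z \<otimes>\<^bsub>K\<^esub> f d" using *(5,6) U by (simp add: E.m_assoc)
    finally have "f a \<otimes>\<^bsub>K\<^esub> f d = (z \<otimes>\<^bsub>K\<^esub> f b) \<otimes>\<^bsub>K\<^esub> f d" using zc by (simp add: E.m_ac)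
    then have "f a = z \<otimes>\<^bsub>K\<^esub> f b" using *(5) zc by (meson E.e_carr E.m_closed E.m_rcancel)
    then show "y = z" using key[OF *(2) zc] *(3) by simp
  next
    show "spec K f 1 \<one>\<^bsub>K\<^esub>" unfolding spec_def by (intro exI[of _ 1]) (simp add: One_fract_def)
  next
    fix x y x' y' assume "spec K f x y" "spec K f x' y'"
    then obtain a b c d where *: "x = Fract a b" "f b \<noteq> \<zero>\<^bsub>K\<^esub>" "y = f a \<otimes>\<^bsub>K\<^esub> inv\<^bsub>K\<^esub> f b"
      "x' = Fract c d" "f d \<noteq> \<zero>\<^bsub>K\<^esub>" "y' = f c \<otimes>\<^bsub>K\<^esub> inv\<^bsub>K\<^esub> f d" unfolding spec_def by blast
    have c: "y \<in> carrier K" "y' \<in> carrier K" using * U by auto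
    have a: "f a = y \<otimes>\<^bsub>K\<^esub> f b" "f c = y' \<otimes>\<^bsub>K\<^esub> f d" using * U by (simp_all add: E.m_assoc)
    have bd: "f (b * d) \<noteq> \<zero>\<^bsub>K\<^esub>" using E.integral[of "f b" "f d"] *(2,5) by (auto simp: E.e_mult)
    have "f (a * d + c * b) = (y \<oplus>\<^bsub>K\<^esub> y') \<otimes>\<^bsub>K\<^esub> f (b * d)"
      using c by (simp add: E.e_add E.e_mult a E.l_distr E.r_distr E.m_ac)
    moreover have "x + x' = Fract (a * d + c * b) (b * d)" using * nz by simp
    ultimately show "spec K f (x + x') (y \<oplus>\<^bsub>K\<^esub> y')" unfolding spec_def
      using bd key[OF bd] c by (metis E.a_closed)
    have "f (a * c) = (y \<otimes>\<^bsub>K\<^esub> y') \<otimes>\<^bsub>K\<^esub> f (b * d)"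
      using c by (simp add: E.e_add E.e_mult a E.m_ac)
    moreover have "x * x' = Fract (a * c) (b * d)" using * by simp
    ultimately show "spec K f (x * x') (y \<otimes>\<^bsub>K\<^esub> y')" unfolding spec_def
      using bd key[OF bd] c by (metis E.m_closed)
  next
    fix x y assume "spec K f x y"
    then obtain a b where *: "x = Fract a b" "f b \<noteq> \<zero>\<^bsub>K\<^esub>" "y = f a \<otimes>\<^bsub>K\<^esub> inv\<^bsub>K\<^esub> f b" by (auto simp: spec_def)
    have "\<ominus>\<^bsub>K\<^esub> y = f (- a) \<otimes>\<^bsub>K\<^esub> inv\<^bsub>K\<^esub> f b" using * U by (simp add: E.e_neg E.l_minus)
    then show "spec K f (- x) (\<ominus>\<^bsub>K\<^esub> y)" unfolding spec_def using * by (metis minus_fract)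
  next
    fix x y assume "spec K f x y" and y: "y \<noteq> \<zero>\<^bsub>K\<^esub>"
    then obtain a b where *: "x = Fract a b" "f b \<noteq> \<zero>\<^bsub>K\<^esub>" "y = f a \<otimes>\<^bsub>K\<^esub> inv\<^bsub>K\<^esub> f b" by (auto simp: spec_def)
    have fa: "f a \<noteq> \<zero>\<^bsub>K\<^esub>" using y * U by auto
    have "y \<otimes>\<^bsub>K\<^esub> (f b \<otimes>\<^bsub>K\<^esub> inv\<^bsub>K\<^esub> f a) = \<one>\<^bsub>K\<^esub>"
    proof -
      have "y \<otimes>\<^bsub>K\<^esub> f b = f a" using * U by (simp add: E.m_assoc)
      moreover have "y \<in> carrier K" "inv\<^bsub>K\<^esub> f a \<in> carrier K" using * U[OF fa] U[OF *(2)] by auto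
      ultimately show ?thesis using U[OF fa] by (simp flip: E.m_assoc)
    qed
    then have "inv\<^bsub>K\<^esub> y = f b \<otimes>\<^bsub>K\<^esub> inv\<^bsub>K\<^esub> f a" using * U fa by (intro E.comm_inv_char) auto
    moreover have "inverse x = Fract b a" using * by simp
    ultimately show "spec K f (inverse x) (inv\<^bsub>K\<^esub> y)" unfolding spec_def using fa by blast
  qed
qed

section \<open>Homomorphisms of field records\<close>

lemma field_hom_nonzero:
  assumes "field K1" "field K2" "f \<in> ring_hom K1 K2" "x \<in> carrier K1" "x \<noteq> \<zero>\<^bsub>K1\<^esub>"
  shows "f x \<noteq> \<zero>\<^bsub>K2\<^esub>" "f (inv\<^bsub>K1\<^esub> x) = inv\<^bsub>K2\<^esub> f x"
proof -
  interpret A: field K1 by fact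
  interpret B: field K2 by fact
  interpret h: ring_hom_cring K1 K2 f
    using assms A.is_cring B.is_cring by (simp add: ring_hom_cring_def ring_hom_cring_axioms_def)
  have u: "x \<in> Units K1" using assms by (simp add: A.field_Units)
  have e: "f x \<otimes>\<^bsub>K2\<^esub> f (inv\<^bsub>K1\<^esub> x) = \<one>\<^bsub>K2\<^esub>"
    using ring_hom_mult[OF assms(3) assms(4) A.Units_inv_closed[OF u]] ring_hom_one[OF assms(3)]
    unfolding A.Units_r_inv[OF u] by (rule trans[OF sym])
  then show "f x \<noteq> \<zero>\<^bsub>K2\<^esub>" using u assms by auto
  show "f (inv\<^bsub>K1\<^esub> x) = inv\<^bsub>K2\<^esub> f x" using e u assms B.comm_inv_char[of "f x" "f (inv\<^bsub>K1\<^esub> x)"] by auto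
qed

lemma field_hom_inj_on:
  assumes "field K1" "field K2" "f \<in> ring_hom K1 K2"
  shows "inj_on f (carrier K1)"
proof (rule inj_onI)
  fix x y assume xy: "x \<in> carrier K1" "y \<in> carrier K1" "f x = f y"
  interpret A: field K1 by fact
  interpret B: field K2 by fact
  interpret h: ring_hom_cring K1 K2 f
    using assms A.is_cring B.is_cring by (simp add: ring_hom_cring_def ring_hom_cring_axioms_def)
  have "f (x \<ominus>\<^bsub>K1\<^esub> y) = \<zero>\<^bsub>K2\<^esub>" using xy by (simp add: a_minus_def B.r_neg)
  then have "x \<ominus>\<^bsub>K1\<^esub> y = \<zero>\<^bsub>K1\<^esub>" using field_hom_nonzero(1)[OF assms] xy by blast
  then show "x = y" using xy by simp
qed

lemma generate_field_image:
  assumes "field K1" "field K2" "f \<in> ring_hom K1 K2" "H \<subseteq> carrier K1"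
  shows "f ` generate_field K1 H = generate_field K2 (f ` H)"
proof -
  interpret A: field K1 by fact
  interpret B: field K2 by fact
  interpret h: ring_hom_cring K1 K2 f
    using assms A.is_cring B.is_cring by (simp add: ring_hom_cring_def ring_hom_cring_axioms_def)
  note gc = A.generate_field_in_carrier[OF assms(4)]
  show ?thesis
  proof (intro equalityI subsetI)
    fix y assume "y \<in> f ` generate_field K1 H"
    then obtain x where x: "x \<in> generate_field K1 H" "y = f x" by blast
    from x(1) have "f x \<in> generate_field K2 (f ` H)"
    proof induction
      case one then show ?case by (simp add: generate_field.one)
    next
      case (m_inv h)
      then show ?case using field_hom_nonzero[OF assms(1-3)] gc generate_field.m_inv by metis
    qed (use gc in \<open>auto intro: generate_field.intros\<close>)
    then show "y \<in> generate_field K2 (f ` H)" by (simp add: x)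
  next
    fix y assume "y \<in> generate_field K2 (f ` H)"
    then show "y \<in> f ` generate_field K1 H"
    proof induction
      case one show ?case by (rule image_eqI[of _ _ "\<one>\<^bsub>K1\<^esub>"]) (auto intro: generate_field.one)
    next
      case (a_inv y)
      then obtain x where "x \<in> generate_field K1 H" "y = f x" by blast
      then show ?case using gc by (intro image_eqI[of _ _ "\<ominus>\<^bsub>K1\<^esub> x"]) (auto intro: generate_field.a_inv)
    next
      case (m_inv y)
      then obtain x where x: "x \<in> generate_field K1 H" "y = f x" by blast
      then have "x \<noteq> \<zero>\<^bsub>K1\<^esub>" using m_inv by auto
      then show ?case using x gc field_hom_nonzero(2)[OF assms(1-3)]
        by (intro image_eqI[of _ _ "inv\<^bsub>K1\<^esub> x"]) (auto intro: generate_field.m_inv)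
    next
      case (eng_add y y')
      then obtain x x' where "x \<in> generate_field K1 H" "y = f x" "x' \<in> generate_field K1 H" "y' = f x'" by blast
      then show ?case using gc by (intro image_eqI[of _ _ "x \<oplus>\<^bsub>K1\<^esub> x'"]) (auto intro: generate_field.eng_add)
    next
      case (eng_mult y y')
      then obtain x x' where "x \<in> generate_field K1 H" "y = f x" "x' \<in> generate_field K1 H" "y' = f x'" by blast
      then show ?case using gc by (intro image_eqI[of _ _ "x \<otimes>\<^bsub>K1\<^esub> x'"]) (auto intro: generate_field.eng_mult)
    qed (auto intro: generate_field.incl)
  qed
qed

lemma gen_image_record:
  assumes "field K" "f \<in> ring_hom ring_of_type_algebra K"
  shows "f ` gen S = generate_field K (f ` S)"
  using generate_field_image[OF field_from_type_algebra assms] by (simp add: gen_eq_generate_field)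

lemma fhom_ring_hom: "fhom f \<Longrightarrow> f \<in> ring_hom ring_of_type_algebra ring_of_type_algebra"
  by (rule ring_hom_memI) (auto simp: fhom_def rhom.add rhom.mult rhom.one)

lemma to_fract_qev: "qev p XX = to_fract p"
  using ev_to_fract[OF transc_XX, of p] by (simp add: ev_id)

lemma record_hom_ext:
  fixes f :: "rat poly fract \<Rightarrow> 'k"
  assumes K: "field K" and f: "f \<in> ring_hom ring_of_type_algebra K" and g: "g \<in> ring_hom ring_of_type_algebra K"
    and eq: "f XX = g XX"
  shows "f x = g x"
proof -
  interpret F: rspec K "\<lambda>x y. y = f x" by (rule rspec_hom[OF K f])
  interpret G: rspec K "\<lambda>x y. y = g x" by (rule rspec_hom[OF K g])
  let ?e = "\<lambda>r. g (of_rat r)"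
  have e: "?e \<in> ring_hom ring_of_type_algebra K"
    using ring_hom_trans[OF fhom_ring_hom[OF fhom_of_rat] g] by (simp add: o_def)
  have p: "f (to_fract p) = g (to_fract p)" for p
    using F.qev_rel[OF e refl, where x = XX and p = p] G.qev_rel[OF e refl, where x = XX and p = p] eq by (simp add: to_fract_qev)
  have x: "x = to_fract (num x) / to_fract (den x)" using num_den(1)[of x] by (simp add: Fract_conv_to_fract)
  have d: "to_fract (den x) \<noteq> 0" using num_den(2)[of x] by simp
  have "f (inverse (to_fract (den x))) = g (inverse (to_fract (den x)))"
    using field_hom_nonzero(2)[OF field_from_type_algebra K f, of "to_fract (den x)"]
      field_hom_nonzero(2)[OF field_from_type_algebra K g, of "to_fract (den x)"] d p by (simp add: rota_inv)
  then have "f (to_fract (num x) * inverse (to_fract (den x))) = g (to_fract (num x) * inverse (to_fract (den x)))"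
    using ring_hom_mult[OF f] ring_hom_mult[OF g] p by simp
  then show ?thesis using x by (simp add: divide_inverse)
qed

lemma polynomial_map_coeff_list:
  assumes "field K" "\<And>x. f x \<in> carrier K" "P \<noteq> 0 \<Longrightarrow> f (lead_coeff P) \<noteq> \<zero>\<^bsub>K\<^esub>"
  shows "polynomial\<^bsub>K\<^esub> (carrier K) (map f (coeff_list P))"
  using assms set_coeff_list[of P] by (cases "P = 0") (auto simp: polynomial_def hd_map)

lemma model_record:
  fixes f :: "rat poly fract \<Rightarrow> 'k"
  assumes K: "field K" and f: "f \<in> ring_hom ring_of_type_algebra K" and m: "model A R bs"
  shows "map (\<lambda>x. f (ev R x)) (coeff_list A) = ring.lin_prod K (map f bs)"
    and "range f = generate_field K (insert (f R) (f ` set bs))"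
proof -
  interpret F: rspec K "\<lambda>x y. y = f x" by (rule rspec_hom[OF K f])
  have tR: "transc R" using m by (simp add: model_def poly_fract_transc)
  interpret R: fhom "ev R" by (rule fhom_ev[OF tR])
  have fc: "f x \<in> carrier K" for x using ring_hom_closed[OF f] by simp
  have f0: "f 0 = \<zero>\<^bsub>K\<^esub>" using F.zero by simp
  have nz: "f x \<noteq> \<zero>\<^bsub>K\<^esub>" if "x \<noteq> 0" for x
    using field_hom_nonzero(1)[OF field_from_type_algebra K f, of x] that by simp
  have A0: "lead_coeff A \<noteq> 0" if "A \<noteq> 0" using that by simp
  show "map (\<lambda>x. f (ev R x)) (coeff_list A) = F.lin_prod (map f bs)"
  proof (rule F.polynomial_eqI)
    show "polynomial\<^bsub>K\<^esub> (carrier K) (map (\<lambda>x. f (ev R x)) (coeff_list A))"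
      by (rule polynomial_map_coeff_list[OF K]) (auto simp: fc intro!: nz)
    show "polynomial\<^bsub>K\<^esub> (carrier K) (F.lin_prod (map f bs))"
      by (rule F.lin_prod) (auto simp: fc)
    fix i
    have "F.coeff (F.lin_prod (map f bs)) i = f (Polynomial.coeff (\<Prod>b\<leftarrow>bs. [:- b, 1:]) i)"
      by (rule F.lin_prod_rel) (simp add: list_all2_conv_all_nth)
    also have "(\<Prod>b\<leftarrow>bs. [:- b, 1:]) = map_poly (ev R) A" using m by (simp add: model_def)
    finally show "F.coeff (map (\<lambda>x. f (ev R x)) (coeff_list A)) i = F.coeff (F.lin_prod (map f bs)) i"
      by (simp add: F.coeff_map_coeff_list f0)
  qed
  show "range f = generate_field K (insert (f R) (f ` set bs))"
    using gen_image_record[OF K f, of "insert R (set bs)"] m by (simp add: model_def)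
qed

subsection \<open>Algebraic elements of field records\<close>

lemma (in frec) range_subfield: 
  assumes "\<And>x :: 'a. x \<noteq> 0 \<Longrightarrow> \<exists>y. x * y = 1"
  shows "subfield (range e) K"
proof (rule subfieldI')
  show "subring (range e) K"
  proof (rule subringI)
    show "range e \<subseteq> carrier K" using e_carr by blast
    show "\<one> \<in> range e" using rangeI[of e 1] unfolding e_1 .
    show "\<ominus> h \<in> range e" if "h \<in> range e" for h
      using that e_neg by (metis (no_types) rangeE rangeI)
    show "h \<otimes> h' \<in> range e" if "h \<in> range e" "h' \<in> range e" for h h'
      using that e_mult by (metis (no_types) rangeE rangeI)
    show "h \<oplus> h' \<in> range e" if "h \<in> range e" "h' \<in> range e" for h h'
      using that e_add by (metis (no_types) rangeE rangeI)
  qed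
next
  fix k assume k: "k \<in> range e - {\<zero>}"
  then obtain x where x: "k = e x" by blast
  have "x \<noteq> 0"
  proof
    assume "x = 0"
    then have "k = \<zero>" using x e_0 by simp
    then show False using k by simp
  qed
  from assms[OF this] obtain y where y: "x * y = 1" ..
  have "e x \<otimes> e y = \<one>" using e_mult[of x y] unfolding y e_1 by (rule sym)
  then have "inv k = e y" unfolding x by (rule comm_inv_char[OF e_carr e_carr])
  then show "inv k \<in> range e" by blast
qed

lemma pev_algebraic:
  fixes K :: "('k, 'm) ring_scheme" and e :: "rat \<Rightarrow> 'k"
  assumes K: "field K" and e: "e \<in> ring_hom ring_of_type_algebra K" and x: "x \<in> carrier K"
  shows "ring.algebraic K (range e) x \<longleftrightarrow> (\<exists>p. p \<noteq> 0 \<and> pev K e x p = \<zero>\<^bsub>K\<^esub>)"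
proof -
  interpret E: frec K e by (rule frecI[OF K e])
  have "\<And>x::rat. x \<noteq> 0 \<Longrightarrow> \<exists>y. x * y = 1" by (metis right_inverse)
  note sr = subfieldE(1)[OF E.range_subfield[OF this]]
  have nz: "e r \<noteq> \<zero>\<^bsub>K\<^esub>" if "r \<noteq> 0" for r
    using field_hom_nonzero(1)[OF field_from_type_algebra K e, of r] that by simp
  show ?thesis
  proof
    assume "E.algebraic (range e) x"
    then obtain p where p: "p \<in> carrier (range e [X]\<^bsub>K\<^esub>)" "p \<noteq> []" "E.eval p x = \<zero>\<^bsub>K\<^esub>"
      using E.algebraicE[OF sr x] by (auto simp: over_def)
    have st: "set p \<subseteq> range e" "hd p \<noteq> \<zero>\<^bsub>K\<^esub>"
      using p unfolding univ_poly_carrier[symmetric] polynomial_def by auto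
    then obtain q where q: "p = map e q" by (metis ex_map_conv subset_iff image_iff)
    have h: "hd q \<noteq> 0" "q \<noteq> []" using st p(2) by (auto simp: q hd_map)
    have "coeffs (Poly (rev q)) = rev q" using h by (cases q) simp_all
    then have cl: "coeff_list (Poly (rev q)) = q" by (simp add: Defs.coeff_list_def)
    then have "pev K e x (Poly (rev q)) = \<zero>\<^bsub>K\<^esub>" using E.eval_pev[OF x, of "Poly (rev q)"] p(3) q by simp
    moreover have "Poly (rev q) \<noteq> 0" using cl h by (metis set_coeff_list(2))
    ultimately show "\<exists>p. p \<noteq> 0 \<and> pev K e x p = \<zero>\<^bsub>K\<^esub>" by blast
  next
    assume "\<exists>p. p \<noteq> 0 \<and> pev K e x p = \<zero>\<^bsub>K\<^esub>"
    then obtain p where p: "p \<noteq> 0" "pev K e x p = \<zero>\<^bsub>K\<^esub>" by blast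
    have "map e (coeff_list p) \<in> carrier (range e [X]\<^bsub>K\<^esub>)"
      unfolding univ_poly_carrier[symmetric] polynomial_def
      using p set_coeff_list[of p] by (auto simp: hd_map intro!: nz)
    moreover have "map e (coeff_list p) \<noteq> []" using p by (simp add: set_coeff_list)
    moreover have "E.eval (map e (coeff_list p)) x = \<zero>\<^bsub>K\<^esub>" using p by (simp add: E.eval_pev[OF x])
    ultimately show "E.algebraic (range e) x" using E.algebraicI by (simp add: over_def)
  qed
qed

lemma rdeg_pos: "x \<notin> range of_rat \<Longrightarrow> rdeg x > 0"
proof (rule ccontr)
  assume x: "x \<notin> range of_rat" "\<not> rdeg x > 0"
  then have "Polynomial.degree (num x) = 0" "Polynomial.degree (den x) = 0" by (auto simp: rdeg_def)
  then obtain a b where ab: "num x = [:a:]" "den x = [:b:]" by (metis degree_eq_zeroE)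
  have "Polynomial.smult b (num x) = Polynomial.smult a (den x)" by (simp add: ab)
  then have "b = 0" using num_den_indep[OF x(1)] by blast
  then show False using num_den(2)[of x] ab by simp
qed

text \<open>The argument of \<open>fibre_poly_root\<close> inside a record: the algebraic elements
  form a subfield, so an algebraic w would put t = R(w) into it.\<close>

lemma record_fibre_transc:
  fixes K :: "('k, 'm) ring_scheme" and e :: "rat \<Rightarrow> 'k"
  assumes K: "field K" and e: "e \<in> ring_hom ring_of_type_algebra K" and w: "w \<in> carrier K" and t: "t \<in> carrier K"
    and tt: "\<And>p. p \<noteq> 0 \<Longrightarrow> pev K e t p \<noteq> \<zero>\<^bsub>K\<^esub>"
    and r: "pev K e w (num R) = t \<otimes>\<^bsub>K\<^esub> pev K e w (den R)" and p: "p \<noteq> 0"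
  shows "pev K e w p \<noteq> \<zero>\<^bsub>K\<^esub>"
proof
  assume "pev K e w p = \<zero>\<^bsub>K\<^esub>"
  then have aw: "ring.algebraic K (range e) w" using pev_algebraic[OF K e w] p by blast
  interpret E: frec K e by (rule frecI[OF K e])
  have "\<And>x::rat. x \<noteq> 0 \<Longrightarrow> \<exists>y. x * y = 1" by (metis right_inverse)
  note sf = E.range_subfield[OF this]
  define A where "A = {x \<in> carrier K. (E.algebraic over (range e)) x}"
  have sA: "subfield A K" unfolding A_def by (rule E.subfield_of_algebraics[OF sf])
  note rA = subfieldE(1)[OF sA]
  have wA: "w \<in> A" using aw w by (simp add: over_def A_def)
  have eA: "e r \<in> A" for r
  proof -
    have "pev K e (e r) [:- r, 1:] = \<zero>\<^bsub>K\<^esub>" by (simp add: E.pev_pCons E.e_neg E.l_neg)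
    then have "E.algebraic (range e) (e r)" using pev_algebraic[OF K e, of "e r"] E.e_carr[of r]
      by (metis pCons_eq_0_iff zero_neq_one)
    then show ?thesis by (simp add: over_def A_def)
  qed
  have pA: "pev K e w q \<in> A" for q
  proof (induction q)
    case 0 then show ?case using subringE(2)[OF rA] by simp
  next
    case (pCons a q)
    show ?case unfolding E.pev_pCons[OF w]
      by (rule subringE(7)[OF rA eA subringE(6)[OF rA wA pCons(2)]])
  qed
  interpret q: ring_hom_cring "ring_of_type_algebra :: rat poly ring" K "pev K e w"
    using E.pev_hom[OF w] cring_from_type_algebra E.is_cring by (simp add: ring_hom_cring_def ring_hom_cring_axioms_def)
  have dnz: "pev K e w (den R) \<noteq> \<zero>\<^bsub>K\<^esub>"
  proof
    assume d: "pev K e w (den R) = \<zero>\<^bsub>K\<^esub>"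
    obtain u v where uv: "u * num R + v * den R = 1"
      using num_den(3)[of R] by (metis bezout_coefficients_fst_snd coprime_iff_gcd_eq_1)
    have "pev K e w (u * num R + v * den R) = \<zero>\<^bsub>K\<^esub>"
      using d r t w by (simp add: E.pev_add E.pev_mult)
    then show False using uv w by simp
  qed
  have "t = pev K e w (num R) \<otimes>\<^bsub>K\<^esub> inv\<^bsub>K\<^esub> pev K e w (den R)"
    using r dnz t w by (simp add: E.m_assoc E.field_Units)
  moreover have "inv\<^bsub>K\<^esub> pev K e w (den R) \<in> A"
    using E.subfield_m_inv(1)[OF sA, of "pev K e w (den R)"] pA[of "den R"] dnz by blast
  ultimately have "t \<in> A" using subringE(6)[OF rA pA[of "num R"]] by simp
  then have "E.algebraic (range e) t" by (simp add: over_def A_def)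
  then show False using pev_algebraic[OF K e t] tt by blast
qed

text \<open>Uniqueness of the splitting field, shown inside an algebraic closure K of F. A root w in
  K of R(w) = T makes X |-> w an embedding of Q(X) that extends the one of Q(T). Its image and that
  of F are both generated by T and the roots of the same polynomial, so they coincide.\<close>

theorem splitting_model_iso:
  fixes F :: "'f ring"
  assumes m: "model A R bs" and sp: "splitting_field QT F \<iota> (coeff_list A)" and lc: "lead_coeff A = 1"
  shows "\<exists>f \<in> ring_hom ring_of_type_algebra F. range f = carrier F \<and> (\<forall>x. f (ev R x) = \<iota> x)"
proof -
  have F: "field F" and i: "\<iota> \<in> ring_hom QT F" and spl: "ring.splitted F (map \<iota> (coeff_list A))"
    and gn: "generate_field F (\<iota> ` carrier QT \<union> set_mset (ring.roots F (map \<iota> (coeff_list A)))) = carrier F"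
    using sp by (auto simp: splitting_field_def field_extension_def)
  interpret F: field F by fact
  define K where "K = F.alg_closure"
  define j :: "'f \<Rightarrow> ('f list \<times> nat) multiset \<Rightarrow> 'f" where "j = F.indexed_const"
  interpret K: algebraic_closure K "j ` carrier F" unfolding K_def j_def by (rule F.alg_closureE)
  have Kf: "field K" ..
  have j: "j \<in> ring_hom F K" unfolding K_def j_def by (rule F.alg_closureE)
  define f where "f = (\<lambda>x. j (\<iota> x))"
  have f: "f \<in> ring_hom QT K" using ring_hom_trans[OF i j] by (simp add: f_def o_def)
  interpret f: frec K f by (rule frecI[OF Kf f])
  define e where "e = (\<lambda>r::rat. f (of_rat r))"
  have e: "e \<in> ring_hom ring_of_type_algebra K"
    using ring_hom_trans[OF fhom_ring_hom[OF fhom_of_rat] f] by (simp add: e_def o_def)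
  interpret e: frec K e by (rule frecI[OF Kf e])
  have fe: "f (of_rat r) = e r" for r by (simp add: e_def)
  define t where "t = f XX"
  have t: "t \<in> carrier K" by (simp add: t_def)
  interpret fs: rspec K "\<lambda>x y. y = f x" by (rule rspec_hom[OF Kf f])
  have fnz: "f x \<noteq> \<zero>\<^bsub>K\<^esub>" if "x \<noteq> 0" for x
    using field_hom_nonzero(1)[OF field_from_type_algebra Kf f, of x] that by simp
  have tt: "pev K e t p \<noteq> \<zero>\<^bsub>K\<^esub>" if "p \<noteq> 0" for p
  proof -
    have "pev K e t p = f (to_fract p)" using fs.qev_rel[OF e, where x = XX and t = t and p = p] by (simp add: t_def to_fract_qev)
    then show ?thesis using fnz[of "to_fract p"] that by simp
  qed
  have Rr: "R \<notin> range of_rat" and tR: "transc R" using m by (auto simp: model_def poly_fract_transc)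
  let ?q = "fibre_poly R XX"
  note dq = fibre_poly_degree[OF Rr transc_XX]
  let ?l = "map f (coeff_list ?q)"
  have pl: "polynomial\<^bsub>K\<^esub> (carrier K) ?l"
    by (rule polynomial_map_coeff_list[OF Kf]) (auto intro!: fnz)
  have ql: "?l \<in> carrier (poly_ring K)" using pl by (simp add: univ_poly_carrier)
  have "Polynomials.degree ?l = rdeg R" using dq by (simp add: Defs.coeff_list_def length_coeffs_degree)
  then have "K.roots ?l \<noteq> {#}" using K.roots_over_carrier[OF ql] rdeg_pos[OF Rr] by (auto simp: K.splitted_def)
  \<comment> \<open>R has positive degree, so its fibre polynomial over T has a root in K.\<close>
  then obtain w where "w \<in># K.roots ?l" by blast
  then have "K.is_root ?l w" using K.roots_mem_iff_is_root[OF ql] by blast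
  then have w: "w \<in> carrier K" and rw: "K.eval ?l w = \<zero>\<^bsub>K\<^esub>" by (auto simp: K.is_root_def)
  have pf: "pev K f w (map_poly of_rat p) = pev K e w p" for p
    by (induction p) (simp_all add: f.pev_pCons[OF w] e.pev_pCons[OF w] rhom.mp_pCons[OF rhom_of_rat] fe)
  have "?q + Polynomial.smult XX (map_poly of_rat (den R)) = map_poly of_rat (num R)" by (simp add: fibre_poly_def)
  then have "pev K f w (?q + Polynomial.smult XX (map_poly of_rat (den R))) = pev K e w (num R)"
    by (simp only: pf)
  then have "pev K f w ?q \<oplus>\<^bsub>K\<^esub> t \<otimes>\<^bsub>K\<^esub> pev K e w (den R) = pev K e w (num R)"
    by (simp only: f.pev_add[OF w] f.pev_smult[OF w] pf t_def)
  then have rt: "pev K e w (num R) = t \<otimes>\<^bsub>K\<^esub> pev K e w (den R)"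
    using rw f.eval_pev[OF w] t w by simp
  have wt: "pev K e w p \<noteq> \<zero>\<^bsub>K\<^esub>" if "p \<noteq> 0" for p
    using record_fibre_transc[OF Kf e w t tt rt] that by blast
  note hp = e.pev_hom[OF w]
  interpret s: rspec K "spec K (pev K e w)" by (rule rspec_spec[OF Kf hp])
  \<comment> \<open>In the record K the substitution X |-> w is the relation \<open>spec\<close>; it
    is total because w is transcendental, and \<open>THE\<close> turns it into a function.\<close>
  define g where "g x = (THE y. spec K (pev K e w) x y)" for x
  have ex: "\<exists>y. spec K (pev K e w) x y" for x
    unfolding spec_def using num_den(1)[of x, symmetric] wt[OF num_den(2)[of x]]
    by (intro exI conjI) (assumption | rule refl)+
  have gs: "spec K (pev K e w) x (g x)" for x
    unfolding g_def using ex[of x] by (rule ex_ex1I[THEN theI']) (rule s.unique)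
  have g_eq: "spec K (pev K e w) x y \<Longrightarrow> g x = y" for x y by (rule s.unique[OF gs])
  have g: "g \<in> ring_hom ring_of_type_algebra K"
    by (rule ring_hom_memI) (use s.carr[OF gs] in \<open>auto intro!: g_eq s.add s.mult s.one gs\<close>)
  have gR: "g R = t"
  proof (rule g_eq)
    have "pev K e w (num R) \<otimes>\<^bsub>K\<^esub> inv\<^bsub>K\<^esub> pev K e w (den R) = t"
      using rt t w wt[OF num_den(2)] by (simp add: K.m_assoc K.field_Units)
    then show "spec K (pev K e w) R t" unfolding spec_def
      using num_den(1)[of R, symmetric] wt[OF num_den(2)[of R]] by (intro exI conjI) (assumption | rule sym)+
  qed
  have gev: "g (ev R x) = f x" for x
  proof (rule record_hom_ext[OF Kf _ f])
    show "(\<lambda>x. g (ev R x)) \<in> ring_hom QT K"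
      using ring_hom_trans[OF fhom_ring_hom[OF fhom_ev[OF tR]] g] by (simp add: o_def)
    show "g (ev R XX) = f XX" using gR ev_XX[OF tR] by (simp add: t_def)
  qed
  note mr = model_record[OF Kf g m]
  let ?F = "map \<iota> (coeff_list A)"
  have A0: "A \<noteq> 0" using lc by auto
  have inz: "\<iota> x \<noteq> \<zero>\<^bsub>F\<^esub>" if "x \<noteq> 0" for x
    using field_hom_nonzero(1)[OF field_from_type_algebra F i, of x] that by simp
  have ic: "\<iota> x \<in> carrier F" for x using ring_hom_closed[OF i] by simp
  have pF: "polynomial\<^bsub>F\<^esub> (carrier F) ?F" by (rule polynomial_map_coeff_list[OF F ic], rule inz) simp
  have hF: "hd ?F = \<one>\<^bsub>F\<^esub>" "?F \<noteq> []" using set_coeff_list[of A] A0 lc ring_hom_one[OF i] by (auto simp: hd_map)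
  obtain ys where ys: "set ys \<subseteq> carrier F" "?F = F.lin_prod ys"
    using F.splitted_lin_prod[OF pF hF spl] by blast
  interpret j: ring_hom_ring F K j by (rule ring_hom_ringI2[OF F.ring_axioms K.ring_axioms j])
  have jlin: "map j (F.lin_prod ys) = K.lin_prod (map j ys)" using ys(1)
  proof (induction ys)
    case Nil then show ?case by (simp add: F.lin_prod_def K.lin_prod_def)
  next
    case (Cons y ys)
    have y: "y \<in> carrier F" "set ys \<subseteq> carrier F" using Cons by auto
    have c: "set (F.lin_prod ys) \<subseteq> carrier F" using F.lin_prod(1)[OF y(2)] by (auto simp: polynomial_def)
    have "K.normalize (map j (F.lin_prod (y # ys))) = K.poly_mult (map j [\<one>\<^bsub>F\<^esub>, \<ominus>\<^bsub>F\<^esub> y]) (map j (F.lin_prod ys))"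
      using j.poly_mult_hom'[of "[\<one>\<^bsub>F\<^esub>, \<ominus>\<^bsub>F\<^esub> y]" "F.lin_prod ys"] y c by (simp add: F.lin_prod_def del: F.poly_mult.simps K.poly_mult.simps)
    also have "\<dots> = K.lin_prod (map j (y # ys))" using Cons y by (simp add: K.lin_prod_def del: F.poly_mult.simps K.poly_mult.simps)
    finally have n: "K.normalize (map j (F.lin_prod (y # ys))) = K.lin_prod (map j (y # ys))" .
    have "hd (F.lin_prod (y # ys)) = \<one>\<^bsub>F\<^esub>" "length (F.lin_prod (y # ys)) = Suc (Suc (length ys))"
      using F.lin_prod(2,3)[of "y # ys"] y by auto
    then show ?case using n by (cases "F.lin_prod (y # ys)") auto
  qed
  have "map (\<lambda>x. g (ev R x)) (coeff_list A) = map j ?F" by (simp add: gev f_def)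
  \<comment> \<open>Two factorizations of the image of A over K, hence the same roots.\<close>
  then have "K.lin_prod (map g bs) = K.lin_prod (map j ys)" using mr(1) ys(2) jlin by simp
  moreover have "set (map g bs) \<subseteq> carrier K" "set (map j ys) \<subseteq> carrier K" using ring_hom_closed[OF g] ys(1) by auto
  ultimately have "mset (map g bs) = mset (map j ys)" using K.lin_prod(4) by metis
  then have st: "g ` set bs = j ` set ys" by (metis set_map set_mset_mset)
  let ?G = "generate_field F (insert (\<iota> XX) (set ys))"
  have ysc: "insert (\<iota> XX) (set ys) \<subseteq> carrier F" using ys(1) ic by auto
  have Gsub: "subfield ?G F" by (rule F.generate_field_is_subfield[OF ysc])
  have "\<iota> ` UNIV = generate_field F {\<iota> XX}"
    using gen_image_record[OF F i, of "{XX}"] by (simp add: gen_XX)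
  also have "\<dots> \<subseteq> ?G" by (rule F.mono_generate_field) (use ysc in auto)
  finally have "\<iota> ` carrier QT \<union> set ys \<subseteq> ?G" by (auto intro: generate_field.incl)
  moreover have "set_mset (F.roots ?F) = set ys" using ys F.lin_prod(4)[OF ys(1)] by simp
  ultimately have "carrier F \<subseteq> ?G"
    using F.generate_field_min_subfield1[OF _ Gsub, of "\<iota> ` carrier QT \<union> set ys"] gn ys(1) ic by auto
  then have G: "?G = carrier F" using F.generate_field_in_carrier[OF ysc] by blast
  have rg: "range g = j ` carrier F"
    using mr(2) generate_field_image[OF F Kf j ysc] st gR G by (simp add: t_def f_def)
  have ji: "inj_on j (carrier F)" by (rule field_hom_inj_on[OF F Kf j])
  define h where "h x = the_inv_into (carrier F) j (g x)" for x
  have hc: "h x \<in> carrier F" and jh: "j (h x) = g x" for x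
  proof -
    have gx: "g x \<in> j ` carrier F" using rg by blast
    show "h x \<in> carrier F" unfolding h_def by (rule the_inv_into_into[OF ji gx]) simp
    show "j (h x) = g x" unfolding h_def by (rule f_the_inv_into_f[OF ji gx])
  qed
  have jeq: "x = y" if "j x = j y" "x \<in> carrier F" "y \<in> carrier F" for x y using ji that by (auto dest: inj_onD)
  have "h \<in> ring_hom ring_of_type_algebra F"
  proof (rule ring_hom_memI)
    fix x y :: "rat poly fract"
    show "h (x \<otimes>\<^bsub>ring_of_type_algebra\<^esub> y) = h x \<otimes>\<^bsub>F\<^esub> h y"
      by (rule jeq) (use ring_hom_mult[OF g, of x y] in \<open>simp_all add: jh hc\<close>)
    show "h (x \<oplus>\<^bsub>ring_of_type_algebra\<^esub> y) = h x \<oplus>\<^bsub>F\<^esub> h y"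
      by (rule jeq) (use ring_hom_add[OF g, of x y] in \<open>simp_all add: jh hc\<close>)
  next
    show "h \<one>\<^bsub>ring_of_type_algebra\<^esub> = \<one>\<^bsub>F\<^esub>"
      by (rule jeq) (use ring_hom_one[OF g] in \<open>simp_all add: jh hc\<close>)
  qed (rule hc)
  moreover have "range h = carrier F"
  proof
    show "carrier F \<subseteq> range h"
    proof
      fix y assume y: "y \<in> carrier F"
      then obtain x where "j y = g x" using rg by (metis imageE image_eqI)
      then have "y = h x" by (intro jeq) (simp_all add: jh hc y)
      then show "y \<in> range h" by simp
    qed
  qed (use hc in auto)
  moreover have "h (ev R x) = \<iota> x" for x
    by (rule jeq) (simp_all add: jh hc ic gev f_def)
  ultimately show ?thesis by blast
qed

subsection \<open>Finite groups of field automorphisms\<close>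

lemma gen_agree:
  fixes f g :: "'a::field \<Rightarrow> 'b::field"
  assumes "fhom f" "fhom g" "\<And>x. x \<in> S \<Longrightarrow> f x = g x" "x \<in> gen S"
  shows "f x = g x"
proof -
  interpret f: fhom f by fact
  interpret g: fhom g by fact
  show ?thesis using assms(4)
    by induction (auto simp: assms(3) f.neg g.neg f.inv g.inv f.add g.add f.mult g.mult)
qed

text \<open>A finite group of automorphisms together with an element \<open>\<theta>\<close> on
  whose orbit it acts regularly. Such a \<open>\<theta>\<close> turns out to be primitive over the
  fixed field.\<close>

locale gact = group G for G :: "('g, 'm) monoid_scheme" (structure) +
  fixes \<sigma> :: "'g \<Rightarrow> 'e::field_char_0 \<Rightarrow> 'e" and \<theta> :: 'e
  assumes fin: "finite (carrier G)"
    and hom: "g \<in> carrier G \<Longrightarrow> fhom (\<sigma> g)"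
    and comp: "g \<in> carrier G \<Longrightarrow> h \<in> carrier G \<Longrightarrow> \<sigma> (g \<otimes> h) x = \<sigma> g (\<sigma> h x)"
    and faithful: "g \<in> carrier G \<Longrightarrow> h \<in> carrier G \<Longrightarrow> \<sigma> g \<theta> = \<sigma> h \<theta> \<Longrightarrow> g = h"
begin

lemma one_id: "\<sigma> \<one> x = x"
proof -
  have "\<sigma> \<one> (\<sigma> \<one> x) = \<sigma> \<one> x" using comp[of \<one> \<one> x] by simp
  then show ?thesis using hom[of \<one>] fhom.eq_iff by blast
qed

definition Fix :: "'e set" where "Fix = {x. \<forall>g\<in>carrier G. \<sigma> g x = x}"

definition orbit_poly :: "'e poly" where
  "orbit_poly = (\<Prod>g\<in>carrier G. [:- \<sigma> g \<theta>, 1:])"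

text \<open>The numerator of a Lagrange interpolation on the orbit of \<open>\<theta>\<close>. The
  group only permutes its summands, so the coefficients are fixed, and its value at
  \<open>\<theta>\<close> is v times a factor independent of v.\<close>

definition interp :: "'e \<Rightarrow> 'e poly" where
  "interp v = (\<Sum>g\<in>carrier G. Polynomial.smult (\<sigma> g v) (\<Prod>h\<in>carrier G - {g}. [:- \<sigma> h \<theta>, 1:]))"

lemma translate_bij:
  assumes k: "k \<in> carrier G" and S: "S \<subseteq> carrier G" shows "inj_on (\<lambda>g. k \<otimes> g) S"
  using assms by (meson inj_on_subset inj_on_multc inj_on_cmult)

lemma translate_image: "k \<in> carrier G \<Longrightarrow> (\<lambda>g. k \<otimes> g) ` carrier G = carrier G"
  by (simp add: surj_const_mult)

lemma translate_image_diff: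
  assumes k: "k \<in> carrier G" and g: "g \<in> carrier G"
  shows "(\<lambda>g. k \<otimes> g) ` (carrier G - {g}) = carrier G - {k \<otimes> g}"
  using translate_image[OF k] translate_bij[OF k subset_refl] g
  by (auto simp: inj_on_def)

lemma coeffs_Fix:
  assumes "\<And>k. k \<in> carrier G \<Longrightarrow> map_poly (\<sigma> k) p = p"
  shows "Polynomial.coeff p i \<in> Fix"
proof -
  have "\<sigma> k (Polynomial.coeff p i) = Polynomial.coeff p i" if k: "k \<in> carrier G" for k
    using hom[OF k] rhom.coeff_mp[of "\<sigma> k" p i] assms[OF k] by (simp add: fhom_def)
  then show ?thesis by (simp add: Fix_def)
qed

lemma mp_lin:
  assumes k: "k \<in> carrier G" and S: "S \<subseteq> carrier G"
  shows "map_poly (\<sigma> k) (\<Prod>g\<in>S. [:- \<sigma> g \<theta>, 1:]) = (\<Prod>g\<in>(\<lambda>g. k \<otimes> g) ` S. [:- \<sigma> g \<theta>, 1:])"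
proof -
  interpret fhom "\<sigma> k" by (rule hom[OF k])
  have "map_poly (\<sigma> k) (\<Prod>g\<in>S. [:- \<sigma> g \<theta>, 1:]) = (\<Prod>g\<in>S. map_poly (\<sigma> k) [:- \<sigma> g \<theta>, 1:])"
    by (rule rhom.prods[OF mp_rhom])
  also have "\<dots> = (\<Prod>g\<in>S. [:- \<sigma> (k \<otimes> g) \<theta>, 1:])"
    by (rule prod.cong) (use S k in \<open>auto simp: neg comp subset_iff\<close>)
  also have "\<dots> = (\<Prod>g\<in>(\<lambda>g. k \<otimes> g) ` S. [:- \<sigma> g \<theta>, 1:])"
    using translate_bij[OF k S] by (simp add: prod.reindex)
  finally show ?thesis .
qed

lemma orbit_poly_Fix: "Polynomial.coeff orbit_poly i \<in> Fix"
  by (rule coeffs_Fix) (simp add: orbit_poly_def mp_lin translate_image)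

lemma interp_Fix: "Polynomial.coeff (interp v) i \<in> Fix"
proof (rule coeffs_Fix)
  fix k assume k: "k \<in> carrier G"
  interpret fhom "\<sigma> k" by (rule hom[OF k])
  let ?f = "\<lambda>g. Polynomial.smult (\<sigma> g v) (\<Prod>h\<in>carrier G - {g}. [:- \<sigma> h \<theta>, 1:])"
  have "map_poly (\<sigma> k) (interp v) = (\<Sum>g\<in>carrier G. map_poly (\<sigma> k) (?f g))"
    unfolding interp_def by (rule rhom.sums[OF mp_rhom])
  also have "\<dots> = (\<Sum>g\<in>carrier G. ?f (k \<otimes> g))"
    by (rule sum.cong) (auto simp: mp_smult mp_lin k translate_image_diff comp)
  also have "\<dots> = (\<Sum>g\<in>(\<lambda>g. k \<otimes> g) ` carrier G. ?f g)"
    using translate_bij[OF k subset_refl] by (simp add: sum.reindex)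
  finally show "map_poly (\<sigma> k) (interp v) = interp v" by (simp add: translate_image[OF k] interp_def)
qed

lemma poly_interp: "poly (interp v) \<theta> = v * (\<Prod>h\<in>carrier G - {\<one>}. \<theta> - \<sigma> h \<theta>)"
proof -
  have z: "(\<Prod>h\<in>carrier G - {g}. \<theta> - \<sigma> h \<theta>) = 0" if "g \<in> carrier G - {\<one>}" for g
    using fin that by (auto intro!: bexI[of _ \<one>] simp: one_id)
  have "poly (interp v) \<theta> = (\<Sum>g\<in>carrier G. \<sigma> g v * (\<Prod>h\<in>carrier G - {g}. \<theta> - \<sigma> h \<theta>))"
    by (simp add: interp_def poly_sum poly_prod)
  also have "\<dots> = \<sigma> \<one> v * (\<Prod>h\<in>carrier G - {\<one>}. \<theta> - \<sigma> h \<theta>)"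
  proof -
    have "(\<Sum>g\<in>carrier G - {\<one>}. \<sigma> g v * (\<Prod>h\<in>carrier G - {g}. \<theta> - \<sigma> h \<theta>)) = 0"
      by (rule sum.neutral, rule ballI) (simp only: z mult_zero_right)
    then show ?thesis by (simp only: sum.remove[OF fin one_closed] add_0_right)
  qed
  finally show ?thesis by (simp add: one_id)
qed

lemma disc_nz: "(\<Prod>h\<in>carrier G - {\<one>}. \<theta> - \<sigma> h \<theta>) \<noteq> 0"
proof -
  have "\<theta> \<noteq> \<sigma> h \<theta>" if "h \<in> carrier G - {\<one>}" for h
    using that faithful[of \<one> h] one_id[of \<theta>] by auto
  then show ?thesis using fin by auto
qed

lemma gen_Fix: "gen (insert \<theta> Fix) = UNIV"
proof -
  have i: "poly (interp v) \<theta> \<in> gen (insert \<theta> Fix)" for v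
    by (rule gen_poly) (auto intro: gen.incl interp_Fix)
  \<comment> \<open>The denominator is the common factor, the derivative of the orbit polynomial at
    \<open>\<theta>\<close>; regularity of the orbit keeps it nonzero.\<close>
  have "v = poly (interp v) \<theta> / poly (interp 1) \<theta>" for v
    using disc_nz by (simp add: poly_interp)
  then have "v \<in> gen (insert \<theta> Fix)" for v using gen_divide[OF i i] by metis
  then show ?thesis by blast
qed

lemma orbit_poly_root: "poly orbit_poly x = 0 \<longleftrightarrow> (\<exists>g\<in>carrier G. x = \<sigma> g \<theta>)"
  using fin by (simp add: orbit_poly_def poly_prod)

text \<open>The automorphism fixes the orbit polynomial, so it sends \<open>\<theta>\<close> to some
  \<open>\<sigma> g \<theta>\<close>. Agreement on \<open>\<theta>\<close> and on \<open>Fix\<close>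
  is agreement everywhere by \<open>gen_Fix\<close>.\<close>

lemma automorphism_in_group:
  assumes f: "fhom f" and fx: "\<And>x. x \<in> Fix \<Longrightarrow> f x = x"
  shows "\<exists>g\<in>carrier G. \<forall>x. f x = \<sigma> g x"
proof -
  interpret fhom f by fact
  have "map_poly f orbit_poly = orbit_poly"
    by (rule poly_eqI) (simp add: fx orbit_poly_Fix)
  moreover have "poly orbit_poly \<theta> = 0" using orbit_poly_root one_id by (metis one_closed)
  ultimately have "poly orbit_poly (f \<theta>) = 0" using poly_hom[of orbit_poly \<theta>] by simp
  then obtain g where g: "g \<in> carrier G" "f \<theta> = \<sigma> g \<theta>" using orbit_poly_root by blast
  have "f x = \<sigma> g x" for x
    by (rule gen_agree[OF f hom[OF g(1)], of "insert \<theta> Fix"]) (use g fx gen_Fix in \<open>auto simp: Fix_def\<close>)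
  then show ?thesis using g by blast
qed

lemma Fix_gen: "gen Fix = Fix"
proof
  show "gen Fix \<subseteq> Fix"
  proof
    fix x assume "x \<in> gen Fix"
    then have "\<sigma> g x = x" if "g \<in> carrier G" for g
      by (rule gen_fix[OF hom[OF that], rotated]) (use that in \<open>auto simp: Fix_def\<close>)
    then show "x \<in> Fix" by (simp add: Fix_def)
  qed
qed (auto intro: gen.incl)

end

subsection \<open>Copying a field into another type\<close>

text \<open>Transport of structure to the image of \<open>c\<close>. The test field must have its
  carrier in \<open>'l\<close> to be seen by \<open>generic_poly\<close>.\<close>

definition copy_ring :: "('e::field \<Rightarrow> 'l) \<Rightarrow> 'l ring" where
  "copy_ring c = \<lparr>carrier = range c, monoid.mult = (\<lambda>x y. c (the_inv c x * the_inv c y)), one = c 1,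
     ring.zero = c 0, add = (\<lambda>x y. c (the_inv c x + the_inv c y))\<rparr>"

lemma copy_ring:
  assumes "inj (c :: 'e::field \<Rightarrow> 'l)"
  shows "field (copy_ring c)" "c \<in> ring_hom ring_of_type_algebra (copy_ring c)" "carrier (copy_ring c) = range c"
proof -
  have [simp]: "the_inv c (c x) = x" for x by (rule the_inv_f_f[OF assms])
  show h: "c \<in> ring_hom ring_of_type_algebra (copy_ring c)"
    by (rule ring_hom_memI) (auto simp: copy_ring_def)
  show "carrier (copy_ring c) = range c" by (simp add: copy_ring_def)
  have "c \<in> ring_iso ring_of_type_algebra (copy_ring c)"
    using h assms by (simp add: ring_iso_def bij_betw_def copy_ring_def)
  then have "field (copy_ring c \<lparr>ring.zero := c \<zero>\<^bsub>ring_of_type_algebra\<^esub>\<rparr>)"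
    using field.ring_iso_imp_img_field[OF field_from_type_algebra] by blast
  then show "field (copy_ring c)" by (simp add: copy_ring_def)
qed

text \<open>Artin's theorem for the copied field: over the copy of the fixed field it is finite
  Galois with group G, so genericity applies. The conclusion is then pulled back along
  \<open>c\<close>.\<close>

lemma generic_apply:
  fixes G :: "'g monoid" and \<sigma> :: "'g \<Rightarrow> 'e::field_char_0 \<Rightarrow> 'e" and c :: "'e \<Rightarrow> 'l"
  assumes act: "gact G \<sigma> \<theta>" and c: "inj c" and gp: "generic_poly TYPE('l) G P" and lc: "lead_coeff P = 1"
  shows "\<exists>t\<in>gact.Fix G \<sigma>. \<exists>zs. map_poly (\<lambda>p. qev p t) P = (\<Prod>z\<leftarrow>zs. [:- z, 1:]) \<and>
    gen (gact.Fix G \<sigma> \<union> set zs) = UNIV"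
proof -
  interpret gact G \<sigma> \<theta> by (rule act)
  have [simp]: "the_inv c (c x) = x" for x by (rule the_inv_f_f[OF c])
  have ceq: "c x = c y \<longleftrightarrow> x = y" for x y using c by (simp add: inj_eq)
  define E where "E = copy_ring c"
  have Ef: "field E" and ch: "c \<in> ring_hom ring_of_type_algebra E" and Ec: "carrier E = range c"
    using copy_ring[OF c] by (simp_all add: E_def)
  interpret E: field E by (rule Ef)
  interpret cE: frec E c by (rule frecI[OF Ef ch])
  note [simp del] = cE.e_0 cE.e_1
  have Eops: "c x \<oplus>\<^bsub>E\<^esub> c y = c (x + y)" "c x \<otimes>\<^bsub>E\<^esub> c y = c (x * y)" "\<one>\<^bsub>E\<^esub> = c 1" "\<zero>\<^bsub>E\<^esub> = c 0" for x y
    by (simp_all add: E_def copy_ring_def)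
  have genc: "c ` gen S = generate_field E (c ` S)" for S by (rule gen_image_record[OF Ef ch])
  let ?K = "c ` Fix"
  have K: "subfield ?K E"
    using genc[of Fix] E.generate_field_is_subfield[of "c ` Fix"] by (simp add: Fix_gen Ec image_mono)
  define L where "L = E\<lparr>carrier := ?K\<rparr>"
  have Lf: "field L" unfolding L_def by (rule E.subfield_iff(2)[OF K])
  have Lc: "carrier L = ?K" by (simp add: L_def)
  have fe: "field_extension L E id"
    unfolding field_extension_def using Lf Ef
    by (auto intro!: ring_hom_memI simp: L_def Ec)
  define \<epsilon> where "\<epsilon> = (\<lambda>r::rat. c (of_rat r))"
  have ratF: "of_rat r \<in> Fix" for r using gen_of_rat[of r Fix] by (simp add: Fix_gen)
  have ehE: "\<epsilon> \<in> ring_hom ring_of_type_algebra E"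
    using ring_hom_trans[OF fhom_ring_hom[OF fhom_of_rat] ch] by (simp add: \<epsilon>_def o_def)
  have feQ: "field_extension (ring_of_type_algebra :: rat ring) L \<epsilon>"
    unfolding field_extension_def
    using Lf field_from_type_algebra ring_hom_mult[OF ehE] ring_hom_add[OF ehE] ring_hom_one[OF ehE] ratF
    by (auto intro!: ring_hom_memI simp: L_def \<epsilon>_def)
  \<comment> \<open>The copy of \<open>\<theta>\<close> is a root of the orbit polynomial, so it is
    algebraic over the fixed field, and it generates the whole field.\<close>
  have fd: "E.finite_dimension ?K (carrier E)"
  proof -
    have "map c (coeff_list orbit_poly) \<in> carrier (?K [X]\<^bsub>E\<^esub>)"
    proof -
      have l1: "lead_coeff orbit_poly = 1" by (simp add: orbit_poly_def lead_coeff_prod)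
      then have nz: "orbit_poly \<noteq> 0" by auto
      have "set (coeff_list orbit_poly) \<subseteq> Fix"
        using orbit_poly_Fix by (auto simp: Defs.coeff_list_def coeffs_def)
      then show ?thesis unfolding univ_poly_carrier[symmetric] polynomial_def
        using set_coeff_list[of orbit_poly] nz l1 by (auto simp: hd_map Eops ceq)
    qed
    moreover have "map c (coeff_list orbit_poly) \<noteq> []"
    proof -
      have "lead_coeff orbit_poly = 1" by (simp add: orbit_poly_def lead_coeff_prod)
      then show ?thesis by (auto simp: set_coeff_list)
    qed
    moreover have "E.eval (map c (coeff_list orbit_poly)) (c \<theta>) = \<zero>\<^bsub>E\<^esub>"
    proof -
      have "pev E c (c x) p = c (poly p x)" for p x
        by (induction p) (auto simp: cE.pev_pCons Ec Eops)
      moreover have "poly orbit_poly \<theta> = 0" using orbit_poly_root one_id by (metis one_closed)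
      ultimately show ?thesis by (simp add: cE.eval_pev Eops)
    qed
    ultimately have alg: "(E.algebraic over ?K) (c \<theta>)" by (rule E.algebraicI)
    have ct: "c \<theta> \<in> carrier E" by (simp add: Ec)
    have sf: "subfield (E.simple_extension ?K (c \<theta>)) E" using E.simple_extension_is_subfield[OF K ct] alg by blast
    have "carrier E = c ` gen (insert \<theta> Fix)" by (simp add: gen_Fix Ec)
    also have "\<dots> = generate_field E (insert (c \<theta>) ?K)" by (simp add: genc)
    also have "\<dots> \<subseteq> E.simple_extension ?K (c \<theta>)"
      using E.simple_extension_mem[OF subfieldE(1)[OF K] ct] E.simple_extension_incl[OF _ ct, of ?K]
      by (intro E.generate_field_min_subfield1 sf) (auto simp: Ec)
    finally have "carrier E = E.simple_extension ?K (c \<theta>)" using subringE(1)[OF subfieldE(1)[OF sf]] by blast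
    then show ?thesis using E.finite_dimension_simple_extension[OF K ct] alg by simp
  qed
  \<comment> \<open>\<open>BijGroup\<close> consists of extensional functions, hence the
    restriction.\<close>
  define \<Psi> where "\<Psi> g = restrict (\<lambda>x. c (\<sigma> g (the_inv c x))) (range c)" for g
  have Psi_c: "\<Psi> g (c x) = c (\<sigma> g x)" for g x by (simp add: \<Psi>_def)
  have gc: "\<Psi> g \<in> carrier (galois_group L E id)" if g: "g \<in> carrier G" for g
  proof -
    interpret s: fhom "\<sigma> g" by (rule hom[OF g])
    have "bij_betw (\<Psi> g) (range c) (range c)"
    proof (rule bij_betw_byWitness[of _ "\<Psi> (inv\<^bsub>G\<^esub> g)"])
      show "\<forall>a\<in>range c. \<Psi> (inv\<^bsub>G\<^esub> g) (\<Psi> g a) = a" "\<forall>a\<in>range c. \<Psi> g (\<Psi> (inv\<^bsub>G\<^esub> g) a) = a"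
        using g comp[of "inv\<^bsub>G\<^esub> g" g, symmetric] comp[of g "inv\<^bsub>G\<^esub> g", symmetric] by (auto simp: Psi_c one_id)
    qed (auto simp: \<Psi>_def)
    then have "\<Psi> g \<in> Bij (range c)" by (simp add: Bij_def \<Psi>_def)
    moreover have "\<Psi> g \<in> ring_hom E E"
      by (rule ring_hom_memI) (auto simp: Ec Eops Psi_c s.add s.mult)
    moreover have "\<Psi> g (c x) = c x" if "x \<in> Fix" for x using that g by (simp add: Psi_c Fix_def)
    ultimately show ?thesis by (auto simp: galois_group_def Ec Lc)
  qed
  have gal: "\<exists>g\<in>carrier G. s = \<Psi> g" if s: "s \<in> carrier (galois_group L E id)" for s
  proof -
    have sB: "s \<in> Bij (range c)" and sh: "s \<in> ring_hom E E" and sf: "\<And>x. x \<in> Fix \<Longrightarrow> s (c x) = c x"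
      using s by (auto simp: galois_group_def Ec Lc)
    define f where "f x = the_inv c (s (c x))" for x
    have cf: "s (c x) = c (f x)" for x
    proof -
      have "s (c x) \<in> range c" using ring_hom_closed[OF sh, of "c x"] by (simp add: Ec)
      then show ?thesis by (auto simp: f_def)
    qed
    have "fhom f"
    proof
      fix x y
      have "c (f (x + y)) = c (f x + f y)"
        using ring_hom_add[OF sh, of "c x" "c y"] by (simp add: Ec Eops cf[symmetric]) (simp add: cf Eops)
      then show "f (x + y) = f x + f y" by (simp add: ceq)
      have "c (f (x * y)) = c (f x * f y)"
        using ring_hom_mult[OF sh, of "c x" "c y"] by (simp add: Ec Eops cf[symmetric]) (simp add: cf Eops)
      then show "f (x * y) = f x * f y" by (simp add: ceq)
    next
      have "c (f 1) = c 1" using ring_hom_one[OF sh] cf[of 1] by (simp add: Eops)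
      then show "f 1 = 1" by (simp add: ceq)
    qed
    moreover have "f x = x" if "x \<in> Fix" for x using sf[OF that] by (simp add: f_def)
    ultimately obtain g where g: "g \<in> carrier G" "\<And>x. f x = \<sigma> g x" using automorphism_in_group by blast
    have "s = \<Psi> g"
    proof
      fix y show "s y = \<Psi> g y"
        using sB by (cases "y \<in> range c") (auto simp: cf g Psi_c \<Psi>_def Bij_def extensional_def)
    qed
    then show ?thesis using g by blast
  qed
  have iso: "\<Psi> \<in> iso G (galois_group L E id)"
    unfolding iso_def
  proof (intro CollectI conjI homI)
    show "\<Psi> g \<in> carrier (galois_group L E id)" if "g \<in> carrier G" for g by (rule gc[OF that])
    show "\<Psi> (g \<otimes>\<^bsub>G\<^esub> h) = \<Psi> g \<otimes>\<^bsub>galois_group L E id\<^esub> \<Psi> h" if gh: "g \<in> carrier G" "h \<in> carrier G" for g h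
    proof -
      have "\<Psi> g \<in> Bij (range c)" "\<Psi> h \<in> Bij (range c)" using gc gh by (auto simp: galois_group_def Ec)
      then show ?thesis using gh
        by (auto simp: galois_group_def BijGroup_def Ec compose_def \<Psi>_def comp fun_eq_iff)
    qed
    show "bij_betw \<Psi> (carrier G) (carrier (galois_group L E id))"
      unfolding bij_betw_def
    proof
      show "inj_on \<Psi> (carrier G)"
      proof (rule inj_onI)
        fix g h assume gh: "g \<in> carrier G" "h \<in> carrier G" "\<Psi> g = \<Psi> h"
        then have "c (\<sigma> g \<theta>) = c (\<sigma> h \<theta>)" using Psi_c by metis
        then show "g = h" using faithful gh by (simp add: ceq)
      qed
    qed (use gc gal in auto)
  qed
  have "{x \<in> carrier E. \<forall>s\<in>carrier (galois_group L E id). s x = x} = id ` carrier L"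
  proof (intro equalityI subsetI)
    fix y assume y: "y \<in> {x \<in> carrier E. \<forall>s\<in>carrier (galois_group L E id). s x = x}"
    then obtain x where x: "y = c x" by (auto simp: Ec)
    have "\<sigma> g x = x" if "g \<in> carrier G" for g
      using y gc[OF that] by (auto simp: x Psi_c ceq)
    then show "y \<in> id ` carrier L" by (auto simp: x Lc Fix_def)
  next
    fix y assume "y \<in> id ` carrier L"
    then show "y \<in> {x \<in> carrier E. \<forall>s\<in>carrier (galois_group L E id). s x = x}"
      by (auto simp: Lc galois_group_def Ec)
  qed
  then have fg: "finite_galois_extension L E id"
    using fe fd by (simp add: finite_galois_extension_def Lc)
  have "galois_group L E id \<cong> G" using iso_sym[OF is_isoI[OF iso]] .
  then obtain t0 where t0: "t0 \<in> carrier L" "splitting_field L E id (specialize L \<epsilon> P t0)"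
    using gp fg feQ unfolding generic_poly_def parametric_poly_def by blast
  obtain t where t: "t \<in> Fix" "t0 = c t" using t0(1) by (auto simp: Lc)
  interpret r: rspec E "\<lambda>x y. y = c x" by (rule rspec_hom[OF Ef ch])
  interpret ee: frec E \<epsilon> by (rule frecI[OF Ef ehE])
  note [simp del] = ee.e_0 ee.e_1
  \<comment> \<open>L has the operations of E on a smaller carrier, so polynomials are evaluated
    alike.\<close>
  have "ring.eval L = E.eval" unfolding L_def by (rule E.eval_consistent[OF subfieldE(1)[OF K]])
  then have spc: "specialize L \<epsilon> P t0 = map (\<lambda>p. c (qev p t)) (coeff_list P)"
    using r.qev_rel[OF ehE refl, where x = t] by (simp add: specialize_def t ee.eval_pev Ec)
  let ?l = "map (\<lambda>p. c (qev p t)) (coeff_list P)"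
  have P0: "P \<noteq> 0" using lc by auto
  have hd: "hd ?l = \<one>\<^bsub>E\<^esub>" "?l \<noteq> []" using set_coeff_list[of P] P0 lc by (simp_all add: hd_map Eops rhom.one[OF rhom_qev])
  have pl: "polynomial\<^bsub>E\<^esub> (carrier E) ?l"
    using hd by (auto simp: polynomial_def Ec)
  have sp: "E.splitted ?l" and gn: "generate_field E (?K \<union> set_mset (E.roots ?l)) = carrier E"
    using t0(2) by (simp_all add: splitting_field_def spc Lc)
  obtain ys where ys: "set ys \<subseteq> carrier E" "?l = E.lin_prod ys" using E.splitted_lin_prod[OF pl hd sp] by blast
  define zs where "zs = map (the_inv c) ys"
  have yz: "ys = map c zs" using ys(1) by (auto simp: zs_def Ec o_def intro!: map_idI[symmetric])
  have "map_poly (\<lambda>p. qev p t) P = (\<Prod>z\<leftarrow>zs. [:- z, 1:])"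
  proof (rule poly_eqI)
    fix i
    have "E.coeff (E.lin_prod ys) i = c (Polynomial.coeff (\<Prod>z\<leftarrow>zs. [:- z, 1:]) i)"
      by (rule r.lin_prod_rel) (simp add: yz list_all2_conv_all_nth)
    moreover have "E.coeff ?l i = c (qev (Polynomial.coeff P i) t)"
      by (rule E.coeff_map_coeff_list) (simp add: Eops)
    ultimately have "qev (Polynomial.coeff P i) t = Polynomial.coeff (\<Prod>z\<leftarrow>zs. [:- z, 1:]) i"
      by (simp add: ys(2) ceq)
    then show "Polynomial.coeff (map_poly (\<lambda>p. qev p t) P) i = Polynomial.coeff (\<Prod>z\<leftarrow>zs. [:- z, 1:]) i"
      by (simp add: coeff_map_poly)
  qed
  moreover have "gen (Fix \<union> set zs) = UNIV"
  proof -
    have "set_mset (E.roots ?l) = c ` set zs" using E.lin_prod(4)[OF ys(1)] by (simp add: ys(2)) (simp add: yz)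
    then have "c ` gen (Fix \<union> set zs) = range c" using gn by (simp add: genc image_Un Ec)
    then show ?thesis using c by (simp add: inj_image_eq_iff)
  qed
  ultimately show ?thesis using t by blast
qed

subsection \<open>Polynomial functions in countably many variables\<close>

text \<open>Expressions supply structural induction and countability; the ring itself consists of
  the functions they denote.\<close>

datatype pexp = PConst rat | PVar nat | PAdd pexp pexp | PMult pexp pexp

instance pexp :: countable
  by countable_datatype

primrec peval :: "pexp \<Rightarrow> (nat \<Rightarrow> rat) \<Rightarrow> rat" where
  "peval (PConst c) v = c"
| "peval (PVar i) v = v i"
| "peval (PAdd p q) v = peval p v + peval q v"
| "peval (PMult p q) v = peval p v * peval q v"

primrec prename :: "(nat \<Rightarrow> nat) \<Rightarrow> pexp \<Rightarrow> pexp" where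
  "prename \<pi> (PConst c) = PConst c"
| "prename \<pi> (PVar i) = PVar (\<pi> i)"
| "prename \<pi> (PAdd p q) = PAdd (prename \<pi> p) (prename \<pi> q)"
| "prename \<pi> (PMult p q) = PMult (prename \<pi> p) (prename \<pi> q)"

lemma peval_prename: "peval (prename \<pi> p) v = peval p (\<lambda>i. v (\<pi> i))"
  by (induction p) simp_all

lemma peval_line: "\<exists>q. \<forall>s. poly q s = peval p (\<lambda>i. a i + s * b i)"
proof (induction p)
  case (PConst c) show ?case by (intro exI[of _ "[:c:]"]) simp
next
  case (PVar i) show ?case by (intro exI[of _ "[:a i, b i:]"]) simp
next
  case (PAdd p q)
  then obtain f g where "\<And>s. poly f s = peval p (\<lambda>i. a i + s * b i)" "\<And>s. poly g s = peval q (\<lambda>i. a i + s * b i)" by blast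
  then show ?case by (intro exI[of _ "f + g"]) simp
next
  case (PMult p q)
  then obtain f g where "\<And>s. poly f s = peval p (\<lambda>i. a i + s * b i)" "\<And>s. poly g s = peval q (\<lambda>i. a i + s * b i)" by blast
  then show ?case by (intro exI[of _ "f * g"]) simp
qed

text \<open>Polynomials over Q in countably many variables, represented by their functions on
  rational points. This is faithful because Q is infinite, and it turns restriction to a line,
  renaming of variables and nonvanishing into plain evaluation.\<close>

typedef mpf = "range peval" by blast

setup_lifting type_definition_mpf

lift_definition mval :: "mpf \<Rightarrow> (nat \<Rightarrow> rat) \<Rightarrow> rat" is "\<lambda>f. f" .

lemma mpf_eqI: "(\<And>v. mval p v = mval q v) \<Longrightarrow> p = q"
  by transfer auto

instantiation mpf :: comm_ring_1
begin
lift_definition zero_mpf :: mpf is "\<lambda>v. 0" by (rule image_eqI[of _ _ "PConst 0"]) auto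
lift_definition one_mpf :: mpf is "\<lambda>v. 1" by (rule image_eqI[of _ _ "PConst 1"]) auto
lift_definition plus_mpf :: "mpf \<Rightarrow> mpf \<Rightarrow> mpf" is "\<lambda>f g v. f v + g v"
  by (elim rangeE, rule_tac x = "PAdd x xa" in image_eqI) auto
lift_definition times_mpf :: "mpf \<Rightarrow> mpf \<Rightarrow> mpf" is "\<lambda>f g v. f v * g v"
  by (elim rangeE, rule_tac x = "PMult x xa" in image_eqI) auto
lift_definition uminus_mpf :: "mpf \<Rightarrow> mpf" is "\<lambda>f v. - f v"
  by (elim rangeE, rule_tac x = "PMult (PConst (- 1)) x" in image_eqI) auto
definition minus_mpf :: "mpf \<Rightarrow> mpf \<Rightarrow> mpf" where "minus_mpf p q = p + - q"
instance
proof
  show "(0::mpf) \<noteq> 1" by transfer (metis zero_neq_one)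
qed (simp_all add: minus_mpf_def, (transfer, simp add: algebra_simps fun_eq_iff)+)
end

lemma rhom_mval: "rhom (\<lambda>p. mval p v)"
  by unfold_locales (transfer, simp)+

text \<open>Restriction to the line a + s b. The choice is unambiguous, as a rational polynomial is
  determined by its values.\<close>

definition mline :: "(nat \<Rightarrow> rat) \<Rightarrow> (nat \<Rightarrow> rat) \<Rightarrow> mpf \<Rightarrow> rat poly" where
  "mline a b p = (SOME q. \<forall>s. poly q s = mval p (\<lambda>i. a i + s * b i))"

lemma poly_mline: "poly (mline a b p) s = mval p (\<lambda>i. a i + s * b i)"
proof -
  have "\<exists>q. \<forall>s. poly q s = mval p (\<lambda>i. a i + s * b i)"
    by transfer (use peval_line in fast)
  then show ?thesis unfolding mline_def by (rule someI2_ex) blast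
qed

lemma rat_poly_eqI: "(\<And>s. poly p s = poly q s) \<Longrightarrow> p = (q :: rat poly)"
  using poly_eq_poly_eq_iff by blast

lemma rhom_mline: "rhom (mline a b)"
  by unfold_locales (auto intro!: rat_poly_eqI simp: poly_mline rhom.add[OF rhom_mval] rhom.mult[OF rhom_mval] rhom.one[OF rhom_mval])

lemma mval_nonzero: "p \<noteq> 0 \<Longrightarrow> \<exists>v. mval p v \<noteq> 0"
  using mpf_eqI[of p 0] by (metis rhom.zero[OF rhom_mval])

text \<open>Restrict to the line that passes at s = 0 through a point where p is nonzero and at s =
  1 through one where q is nonzero; Q[s] has no zero divisors.\<close>

instance mpf :: idom
proof
  fix p q :: mpf assume "p \<noteq> 0" "q \<noteq> 0"
  then obtain u v where uv: "mval p u \<noteq> 0" "mval q v \<noteq> 0" using mval_nonzero by meson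
  let ?l = "mline u (\<lambda>i. v i - u i)"
  have "poly (?l p) 0 \<noteq> 0" "poly (?l q) 1 \<noteq> 0" using uv by (simp_all add: poly_mline)
  then have "?l p \<noteq> 0" "?l q \<noteq> 0" by auto
  then have "?l (p * q) \<noteq> 0" by (simp add: rhom.mult[OF rhom_mline])
  then show "p * q \<noteq> 0" using rhom.zero[OF rhom_mline] by metis
qed

instance mpf :: ring_char_0
proof
  show "inj (of_nat :: nat \<Rightarrow> mpf)"
    by (rule injI) (metis of_nat_eq_iff rhom.of_nat[OF rhom_mval])
qed

lemma transc_mpf: "x \<notin> range of_rat \<Longrightarrow> transc (x :: mpf fract)"
  using algebraic_const[of "\<lambda>v p. mval p v" x] rhom_mval mval_nonzero by blast

text \<open>Countability lets this one field be embedded into every infinite type.\<close>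

lemma countable_mpf_fract: "countable (UNIV :: mpf fract set)"
proof -
  have "countable (range (Abs_mpf \<circ> peval))" by simp
  moreover have "range (Abs_mpf \<circ> peval) = UNIV"
    by (metis (no_types) Abs_mpf_cases image_comp rangeE rangeI surjI surj_def image_image o_apply)
  ultimately have c: "countable (UNIV :: mpf set)" by metis
  have "countable ((\<lambda>(a, b). Fract a b) ` (UNIV \<times> UNIV :: (mpf \<times> mpf) set))"
    by (intro countable_image countable_SIGMA c)
  moreover have "(\<lambda>(a, b). Fract a b) ` (UNIV \<times> UNIV :: (mpf \<times> mpf) set) = UNIV"
    by (auto intro: Fract_cases) (metis Fract_cases SigmaI UNIV_I case_prod_conv image_eqI)
  ultimately show ?thesis by simp
qed

lift_definition mvar :: "nat \<Rightarrow> mpf" is "\<lambda>i v. v i"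
  by (rule_tac x = "PVar nat" in image_eqI) auto

lift_definition mconst :: "rat \<Rightarrow> mpf" is "\<lambda>c v. c"
  by (rule_tac x = "PConst rat" in image_eqI) auto

text \<open>The endomorphism that sends the variable i to the variable
  \<open>\<pi> i\<close>.\<close>

lift_definition mact :: "(nat \<Rightarrow> nat) \<Rightarrow> mpf \<Rightarrow> mpf" is "\<lambda>\<pi> f v. f (\<lambda>i. v (\<pi> i))"
proof -
  fix \<pi> :: "nat \<Rightarrow> nat" and f :: "(nat \<Rightarrow> rat) \<Rightarrow> rat" assume "f \<in> range peval"
  then obtain p where "f = peval p" by blast
  then have "(\<lambda>v. f (\<lambda>i. v (\<pi> i))) = peval (prename \<pi> p)" by (simp add: peval_prename fun_eq_iff)
  then show "(\<lambda>v. f (\<lambda>i. v (\<pi> i))) \<in> range peval" by simp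
qed

lemma mval_simps: "mval (mvar i) v = v i" "mval (mconst c) v = c" "mval (mact \<pi> p) v = mval p (\<lambda>i. v (\<pi> i))"
  by (transfer, simp)+

lemma rhom_mact: "rhom (mact \<pi>)"
  by unfold_locales (auto intro!: mpf_eqI simp: mval_simps rhom.add[OF rhom_mval] rhom.mult[OF rhom_mval] rhom.one[OF rhom_mval])

lemma mact_comp: "mact (\<lambda>i. \<pi> (\<rho> i)) p = mact \<pi> (mact \<rho> p)"
  by (rule mpf_eqI) (simp add: mval_simps)

lemma mact_id: "mact (\<lambda>i. i) p = p"
  by (rule mpf_eqI) (simp add: mval_simps)

lemma of_rat_mconst: "of_rat c = to_fract (mconst c)"
proof -
  have "fhom (\<lambda>c. to_fract (mconst c))"
    by unfold_locales (auto simp flip: to_fract_add to_fract_mult to_fract_1 simp del: to_fract_1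
        intro!: arg_cong[of _ _ to_fract] mpf_eqI simp: mval_simps rhom.add[OF rhom_mval] rhom.mult[OF rhom_mval] rhom.one[OF rhom_mval])
  from fhom_of_rat_comm[OF this, of c] show ?thesis by simp
qed

subsection \<open>Extending ring homomorphisms to fraction fields\<close>

definition fmap :: "('a::idom \<Rightarrow> 'b::idom) \<Rightarrow> 'a fract \<Rightarrow> 'b fract" where
  "fmap h x = (THE y. \<exists>a b. b \<noteq> 0 \<and> x = Fract a b \<and> y = Fract (h a) (h b))"

lemma fmap_Fract:
  assumes h: "rhom h" and nz: "\<And>b. b \<noteq> 0 \<Longrightarrow> h b \<noteq> 0" and b: "b \<noteq> 0"
  shows "fmap h (Fract a b) = Fract (h a) (h b)"
  unfolding fmap_def
proof (rule the_equality)
  show "\<exists>a' b'. b' \<noteq> 0 \<and> Fract a b = Fract a' b' \<and> Fract (h a) (h b) = Fract (h a') (h b')"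
    using b by blast
next
  fix y assume "\<exists>a' b'. b' \<noteq> 0 \<and> Fract a b = Fract a' b' \<and> y = Fract (h a') (h b')"
  then obtain a' b' where *: "b' \<noteq> 0" "Fract a b = Fract a' b'" "y = Fract (h a') (h b')" by blast
  then have "a * b' = a' * b" using eq_fract(1)[OF b *(1)] by blast
  then have "h a * h b' = h a' * h b" by (metis rhom.mult[OF h])
  then show "y = Fract (h a) (h b)" using eq_fract(1)[OF nz[OF b] nz[OF *(1)]] *(3) by metis
qed

lemma fhom_fmap:
  assumes h: "rhom h" and nz: "\<And>b. b \<noteq> 0 \<Longrightarrow> h b \<noteq> 0"
  shows "fhom (fmap h)"
proof
  note f = fmap_Fract[OF h nz]
  fix x y :: "'a fract"
  obtain a b where x: "x = Fract a b" "b \<noteq> 0" by (cases x) auto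
  obtain c d where y: "y = Fract c d" "d \<noteq> 0" by (cases y) auto
  show "fmap h (x + y) = fmap h x + fmap h y"
    using x y nz by (simp add: f rhom.add[OF h] rhom.mult[OF h])
  show "fmap h (x * y) = fmap h x * fmap h y"
    using x y nz by (simp add: f rhom.mult[OF h])
next
  show "fmap h 1 = 1"
    using fmap_Fract[OF h nz, of 1 1] by (simp add: One_fract_def rhom.one[OF h])
qed

lemma fmap_comp:
  assumes "rhom h" "\<And>b. b \<noteq> 0 \<Longrightarrow> h b \<noteq> 0" "rhom k" "\<And>b. b \<noteq> 0 \<Longrightarrow> k b \<noteq> 0"
  shows "fmap (\<lambda>x. k (h x)) x = fmap k (fmap h x)"
proof -
  obtain a b where x: "x = Fract a b" "b \<noteq> 0" by (cases x) auto
  have kh: "\<And>b. b \<noteq> 0 \<Longrightarrow> k (h b) \<noteq> 0" using assms(2,4) by blast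
  show ?thesis
    using x fmap_Fract[OF rhom_comp[OF assms(1,3)] kh] fmap_Fract[OF assms(1,2)] fmap_Fract[OF assms(3,4)] assms(2) by simp
qed

subsection \<open>The regular representation\<close>

text \<open>\<open>\<phi>\<close> assigns a variable to each group element.\<close>

locale regular = group G for G :: "('g, 'm) monoid_scheme" (structure) +
  fixes \<phi> :: "'g \<Rightarrow> nat"
  assumes fin: "finite (carrier G)" and \<phi>: "inj_on \<phi> (carrier G)"
begin

text \<open>Left translation on the assigned variables, the identity on the others. The orbit of the
  variable of \<open>\<one>\<close> is therefore regular.\<close>

definition pm :: "'g \<Rightarrow> nat \<Rightarrow> nat" where
  "pm g i = (if i \<in> \<phi> ` carrier G then \<phi> (g \<otimes> inv_into (carrier G) \<phi> i) else i)"

lemma pm_in: "h \<in> carrier G \<Longrightarrow> pm g (\<phi> h) = \<phi> (g \<otimes> h)"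
  using \<phi> by (simp add: pm_def)

lemma pm_mult: "g \<in> carrier G \<Longrightarrow> h \<in> carrier G \<Longrightarrow> pm (g \<otimes> h) i = pm g (pm h i)"
proof (cases "i \<in> \<phi> ` carrier G")
  case True
  assume "g \<in> carrier G" "h \<in> carrier G"
  with True show ?thesis by (auto simp: pm_in m_assoc)
qed (simp add: pm_def)

lemma pm_one: "pm \<one> i = i"
proof (cases "i \<in> \<phi> ` carrier G")
  case True then show ?thesis by (auto simp: pm_in)
qed (simp add: pm_def)

lemma mact_nz:
  assumes g: "g \<in> carrier G" and p: "p \<noteq> 0" shows "mact (pm g) p \<noteq> 0"
proof
  assume 0: "mact (pm g) p = 0"
  have "mact (pm (inv g)) (mact (pm g) p) = mact (\<lambda>i. pm (inv g) (pm g i)) p"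
    by (rule mact_comp[symmetric])
  also have "(\<lambda>i. pm (inv g) (pm g i)) = (\<lambda>i. i)"
    using pm_mult[of "inv g" g] g by (auto simp: pm_one)
  finally have "mact (pm (inv g)) (mact (pm g) p) = p" by (simp add: mact_id)
  then show False using p 0 rhom.zero[OF rhom_mact] by metis
qed

definition act :: "'g \<Rightarrow> mpf fract \<Rightarrow> mpf fract" where "act g = fmap (mact (pm g))"

lemma act_Fract: "g \<in> carrier G \<Longrightarrow> b \<noteq> 0 \<Longrightarrow> act g (Fract a b) = Fract (mact (pm g) a) (mact (pm g) b)"
  unfolding act_def by (rule fmap_Fract[OF rhom_mact mact_nz])

sublocale gact G act "to_fract (mvar (\<phi> \<one>))"
proof (rule gact.intro[OF is_group], rule gact_axioms.intro)
  show "finite (carrier G)" by (rule fin)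
  show "fhom (act g)" if "g \<in> carrier G" for g
    using fhom_fmap[OF rhom_mact mact_nz[OF that]] by (simp add: act_def)
next
  fix g h x assume gh: "g \<in> carrier G" "h \<in> carrier G"
  have "mact (pm (g \<otimes> h)) = (\<lambda>p. mact (pm g) (mact (pm h) p))"
  proof
    fix p
    have "pm (g \<otimes> h) = (\<lambda>i. pm g (pm h i))" using gh by (intro ext) (rule pm_mult)
    then show "mact (pm (g \<otimes> h)) p = mact (pm g) (mact (pm h) p)" by (simp add: mact_comp)
  qed
  then show "act (g \<otimes> h) x = act g (act h x)"
    unfolding act_def using fmap_comp[OF rhom_mact mact_nz[OF gh(2)] rhom_mact mact_nz[OF gh(1)]] by simp
next
  fix g h assume gh: "g \<in> carrier G" "h \<in> carrier G"
    and e: "act g (to_fract (mvar (\<phi> \<one>))) = act h (to_fract (mvar (\<phi> \<one>)))"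
  have a: "act k (to_fract (mvar (\<phi> \<one>))) = to_fract (mvar (\<phi> k))" if "k \<in> carrier G" for k
  proof -
    have "mact (pm k) (mvar (\<phi> \<one>)) = mvar (\<phi> k)"
      using that by (intro mpf_eqI) (simp add: mval_simps pm_in)
    then show ?thesis using that by (simp add: to_fract_def act_Fract rhom.one[OF rhom_mact])
  qed
  have "mvar (\<phi> g) = mvar (\<phi> h)" using e a gh by simp
  then have "mval (mvar (\<phi> g)) (\<lambda>i. of_nat i) = mval (mvar (\<phi> h)) (\<lambda>i. of_nat i)" by simp
  then have "\<phi> g = \<phi> h" by (simp add: mval_simps)
  then show "g = h" using \<phi> gh by (simp add: inj_on_def)
qed

text \<open>An element \<open>g\<close> of order two acts on a line through a point of its fixed space, in the direction
  of its \<open>-1\<close>-eigenspace, by \<open>r \<mapsto> - r\<close>; the value at \<open>r = 0\<close> gives the rational fixed point.\<close>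

lemma involution_fixed_point:
  assumes g: "g \<in> carrier G" "g \<otimes> g = \<one>"
    and x: "act g x * (of_rat c * x + of_rat d) = of_rat a * x + of_rat b"
  shows "\<exists>p q. (p, q) \<noteq> (0, 0) \<and> p * (c * p + d * q) = q * (a * p + b * q)"
proof -
  let ?\<pi> = "pm g"
  have pp: "?\<pi> (?\<pi> i) = i" for i using pm_mult[OF g(1) g(1), of i] g(2) by (simp add: pm_one)
  obtain f h where fh: "x = Fract f h" "h \<noteq> 0" by (cases x) auto
  let ?f = "mact ?\<pi> f" and ?h = "mact ?\<pi> h"
  have h': "?h \<noteq> 0" by (rule mact_nz[OF g(1) fh(2)])
  have "to_fract ?f / to_fract ?h * (to_fract (mconst c) * (to_fract f / to_fract h) + to_fract (mconst d))
      = to_fract (mconst a) * (to_fract f / to_fract h) + to_fract (mconst b)"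
    using x unfolding fh(1) act_Fract[OF g(1) fh(2)] of_rat_mconst unfolding Fract_conv_to_fract .
  note E1 = this
  have cl: "F' / H' * (C * (F / H) + D) * (H' * H) = F' * (C * F + D * H)"
    "(A * (F / H) + B) * (H' * H) = H' * (A * F + B * H)" if "H \<noteq> 0" "H' \<noteq> 0"
    for A B C D F H F' H' :: "mpf fract"
    using that by (simp_all add: field_simps)
  have nzf: "to_fract h \<noteq> 0" "to_fract ?h \<noteq> 0" using fh(2) h' by simp_all
  have "to_fract ?f * (to_fract (mconst c) * to_fract f + to_fract (mconst d) * to_fract h)
      = to_fract ?h * (to_fract (mconst a) * to_fract f + to_fract (mconst b) * to_fract h)"
    using arg_cong[OF E1, of "\<lambda>x. x * (to_fract ?h * to_fract h)"] unfolding cl[OF nzf] .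
  then have "to_fract (?f * (mconst c * f + mconst d * h)) = to_fract (?h * (mconst a * f + mconst b * h))"
    by (simp only: to_fract_add to_fract_mult)
  then have eq: "?f * (mconst c * f + mconst d * h) = ?h * (mconst a * f + mconst b * h)"
    by (simp only: to_fract_eq_iff)
  obtain v where v: "mval h v \<noteq> 0" using mval_nonzero[OF fh(2)] by blast
  \<comment> \<open>The symmetric and antisymmetric parts of the point v under the permutation. The
    line reaches v at s = 1, so h does not vanish identically on it.\<close>
  define A B where "A i = (v i + v (?\<pi> i)) / 2" and "B i = (v i - v (?\<pi> i)) / 2" for i
  have AB: "A (?\<pi> i) = A i" "B (?\<pi> i) = - B i" "A i + B i = v i" for i
    by (simp_all add: A_def B_def pp field_simps)
  interpret l: rhom "mline A B" by (rule rhom_mline)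
  have lc: "mline A B (mconst r) = [:r:]" for r
    by (rule rat_poly_eqI) (simp add: poly_mline mval_simps)
  have la: "poly (mline A B (mact ?\<pi> p)) s = poly (mline A B p) (- s)" for p s
    by (simp add: poly_mline mval_simps AB)
  define F H where "F = mline A B f" and "H = mline A B h"
  have "poly H 1 \<noteq> 0" using v by (simp add: H_def poly_mline AB)
  then have H0: "H \<noteq> 0" by auto
  \<comment> \<open>Without the common factor, F' and H' cannot both vanish at 0. Their values there
    are the homogeneous coordinates of the fixed point.\<close>
  define e where "e = gcd F H"
  have e0: "e \<noteq> 0" using H0 by (simp add: e_def)
  have "gcd F H \<noteq> 0" using H0 by simp
  from gcd_coprime_exists[OF this] obtain F' H' where
    "F = F' * gcd F H \<and> H = H' * gcd F H \<and> coprime F' H'" by blast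
  then have FH: "F = e * F'" "H = e * H'" and cop: "coprime F' H'" by (simp_all only: e_def mult.commute)
  have "poly F (- s) * (c * poly F s + d * poly H s) = poly H (- s) * (a * poly F s + b * poly H s)" for s
  proof -
    have "mline A B (?f * (mconst c * f + mconst d * h)) = mline A B (?h * (mconst a * f + mconst b * h))" by (simp only: eq)
    then have "poly (mline A B (?f * (mconst c * f + mconst d * h))) s = poly (mline A B (?h * (mconst a * f + mconst b * h))) s" by simp
    then show ?thesis by (simp add: l.add l.mult lc la F_def H_def)
  qed
  then have "poly (e \<circ>\<^sub>p [:0, - 1:] * e * ((F' \<circ>\<^sub>p [:0, - 1:]) * (Polynomial.smult c F' + Polynomial.smult d H'))) s =
      poly (e \<circ>\<^sub>p [:0, - 1:] * e * ((H' \<circ>\<^sub>p [:0, - 1:]) * (Polynomial.smult a F' + Polynomial.smult b H'))) s" for s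
    by (simp add: poly_pcompose FH algebra_simps)
  then have "e \<circ>\<^sub>p [:0, - 1:] * e * ((F' \<circ>\<^sub>p [:0, - 1:]) * (Polynomial.smult c F' + Polynomial.smult d H')) =
      e \<circ>\<^sub>p [:0, - 1:] * e * ((H' \<circ>\<^sub>p [:0, - 1:]) * (Polynomial.smult a F' + Polynomial.smult b H'))"
    by (rule rat_poly_eqI)
  moreover have "e \<circ>\<^sub>p [:0, - 1:] \<noteq> 0" using e0 by (simp add: pcompose_eq_0_iff)
  ultimately have "(F' \<circ>\<^sub>p [:0, - 1:]) * (Polynomial.smult c F' + Polynomial.smult d H') =
      (H' \<circ>\<^sub>p [:0, - 1:]) * (Polynomial.smult a F' + Polynomial.smult b H')" using e0 by simp
  then have "poly ((F' \<circ>\<^sub>p [:0, - 1:]) * (Polynomial.smult c F' + Polynomial.smult d H')) 0 =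
      poly ((H' \<circ>\<^sub>p [:0, - 1:]) * (Polynomial.smult a F' + Polynomial.smult b H')) 0" by simp
  then have fp: "poly F' 0 * (c * poly F' 0 + d * poly H' 0) = poly H' 0 * (a * poly F' 0 + b * poly H' 0)"
    by (simp add: poly_pcompose)
  have "(poly F' 0, poly H' 0) \<noteq> (0, 0)"
  proof
    assume "(poly F' 0, poly H' 0) = (0, 0)"
    then have "[:0, 1:] dvd F'" "[:0, 1:] dvd H'" using poly_eq_0_iff_dvd[of _ 0] by auto
    then have "is_unit [:0, 1 :: rat:]" using cop by (meson coprime_common_divisor)
    then show False by (simp add: is_unit_iff_degree)
  qed
  then show ?thesis using fp by blast
qed

end

section \<open>Descent of the splitting data from E_0 to Q(X)\<close>

lemma tspc_prod_linear:
  fixes f :: "'a::idom \<Rightarrow> 'b::field"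
  assumes f: "rhom f" and l: "list_all2 (tspc f) zs ys"
  shows "tspc f (Polynomial.coeff (\<Prod>z\<leftarrow>zs. [:- z, 1:]) i) (Polynomial.coeff (\<Prod>y\<leftarrow>ys. [:- y, 1:]) i)"
  using l
proof (induction arbitrary: i rule: list_all2_induct)
  case Nil then show ?case by (simp add: tspc_1[OF f] tspc_0[OF f])
next
  case (Cons z zs y ys)
  have c: "Polynomial.coeff (\<Prod>z\<leftarrow>x # xs. [:- z, 1:]) i = (- x) * Polynomial.coeff (\<Prod>z\<leftarrow>xs. [:- z, 1:]) i +
      (if i = 0 then 0 else Polynomial.coeff (\<Prod>z\<leftarrow>xs. [:- z, 1:]) (i - 1))" for x and xs :: "'c::idom list"
    by (cases i) simp_all
  have "tspc f (if i = 0 then 0 else Polynomial.coeff (\<Prod>z\<leftarrow>zs. [:- z, 1:]) (i - 1))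
      (if i = 0 then 0 else Polynomial.coeff (\<Prod>z\<leftarrow>ys. [:- z, 1:]) (i - 1))"
    using Cons tspc_0[OF f] by simp
  from tspc_add[OF f tspc_mult[OF f tspc_neg[OF f Cons(1)] Cons(3)] this]
  show ?case unfolding c by blast
qed

text \<open>Restrict to a line on which the denominators survive and t stays nonconstant; t and the
  roots then take values in Q(s). By Lueroth the field they generate is some Q(w), and rewriting
  them as rational functions of w gives the model.\<close>

lemma exists_model:
  fixes t :: "mpf fract"
  assumes t: "t \<notin> range of_rat" and zs: "map_poly (\<lambda>p. qev p t) P = (\<Prod>z\<leftarrow>zs. [:- z, 1:])"
  shows "\<exists>R bs. model (fract_poly P) R bs"
proof -
  obtain f h where fh: "t = Fract f h" "h \<noteq> 0" by (cases t) auto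
  have "\<exists>a b. z = Fract a b \<and> b \<noteq> 0" for z :: "mpf fract" by (cases z) auto
  then obtain nu de where nd: "\<And>z :: mpf fract. z = Fract (nu z) (de z)" "\<And>z. de z \<noteq> 0" by metis
  \<comment> \<open>All denominators at once: t and every root are defined wherever D is
    nonzero.\<close>
  define D where "D = h * (\<Prod>z\<leftarrow>zs. de z)"
  have D0: "D \<noteq> 0" using fh nd(2) by (auto simp: D_def prod_list_zero_iff)
  obtain u where u: "mval D u \<noteq> 0" using mval_nonzero[OF D0] by blast
  have D_h: "mval h v \<noteq> 0" if "mval D v \<noteq> 0" for v using that by (auto simp: D_def rhom.mult[OF rhom_mval])
  \<comment> \<open>A second point at which t has a different value; if there were none, t would be
    constant.\<close>
  have "\<exists>v. mval D v \<noteq> 0 \<and> mval f v * mval h u \<noteq> mval f u * mval h v"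
  proof (rule ccontr)
    assume c: "\<not> ?thesis"
    have "D * (f * mconst (mval h u) - mconst (mval f u) * h) = 0"
      by (rule mpf_eqI) (use c in \<open>auto simp: rhom.mult[OF rhom_mval] rhom.diff[OF rhom_mval] rhom.zero[OF rhom_mval] mval_simps\<close>)
    then have "f * mconst (mval h u) = mconst (mval f u) * h" using D0 by simp
    then have "to_fract f * of_rat (mval h u) = of_rat (mval f u) * to_fract h" by (simp add: of_rat_mconst flip: to_fract_mult)
    moreover have "of_rat (mval h u) \<noteq> (0 :: mpf fract)" using D_h[OF u] by simp
    ultimately have "t = of_rat (mval f u) / of_rat (mval h u)" using fh by (simp add: Fract_conv_to_fract frac_eq_eq)
    also have "\<dots> = of_rat (mval f u / mval h u)" by (simp add: of_rat_divide)
    finally show False using t by blast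
  qed
  then obtain v where v: "mval D v \<noteq> 0" "mval f v * mval h u \<noteq> mval f u * mval h v" by blast
  define l where "l = mline u (\<lambda>i. v i - u i)"
  interpret l: rhom l unfolding l_def by (rule rhom_mline)
  have l01: "poly (l p) 0 = mval p u" "poly (l p) 1 = mval p v" for p by (simp_all add: l_def poly_mline)
  have "l D \<noteq> 0" using l01(1)[of D] u by auto
  then have lh: "l h \<noteq> 0" and "l (\<Prod>z\<leftarrow>zs. de z) \<noteq> 0" by (auto simp: D_def l.mult)
  moreover have "l (\<Prod>z\<leftarrow>xs. de z) = (\<Prod>z\<leftarrow>xs. l (de z))" for xs by (induction xs) (simp_all add: l.mult)
  ultimately have lz: "l (de z) \<noteq> 0" if "z \<in> set zs" for z using that by (auto simp: prod_list_zero_iff)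
  define k where "k p = to_fract (l p)" for p
  have k: "rhom k" unfolding k_def using rhom_comp[OF l.rhom_axioms rhom_to_fract] by simp
  define t' where "t' = k f / k h"
  define y where "y z = k (nu z) / k (de z)" for z
  have tt: "tspc k t t'" unfolding t'_def fh(1) by (rule tspc_Fract[OF k]) (simp add: k_def lh)
  have "list_all2 (tspc k) zs (map y zs)"
    unfolding list_all2_conv_all_nth
  proof (intro conjI allI impI)
    fix i assume "i < length zs"
    then have "k (de (zs ! i)) \<noteq> 0" by (simp add: k_def lz)
    from tspc_Fract[OF k this, of "nu (zs ! i)"] show "tspc k (zs ! i) (map y zs ! i)"
      using \<open>i < length zs\<close> nd(1)[of "zs ! i"] by (simp add: y_def)
  qed simp
  note tl = tspc_prod_linear[OF k this]
  have id: "qev (Polynomial.coeff P i) t' = Polynomial.coeff (\<Prod>b\<leftarrow>map y zs. [:- b, 1:]) i" for i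
  proof (rule tspc_unique[OF k])
    show "tspc k (qev (Polynomial.coeff P i) t) (qev (Polynomial.coeff P i) t')" by (rule tspc_qev[OF k tt])
    have "qev (Polynomial.coeff P i) t = Polynomial.coeff (map_poly (\<lambda>p. qev p t) P) i" by (simp add: coeff_map_poly)
    then show "tspc k (qev (Polynomial.coeff P i) t) (Polynomial.coeff (\<Prod>b\<leftarrow>map y zs. [:- b, 1:]) i)"
      using tl[of i] by (simp add: zs)
  qed
  have t'r: "t' \<notin> range of_rat"
  proof
    assume "t' \<in> range of_rat"
    then obtain r where "t' = of_rat r" by blast
    then have "k f = of_rat r * k h" using lh by (simp add: t'_def k_def field_simps)
    also have "of_rat r = to_fract [:r:]" using to_fract_qev[of "[:r:]"] by (simp add: rhom.mp_pCons[OF rhom_of_rat])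
    finally have "l f = [:r:] * l h" unfolding k_def to_fract_mult[symmetric] to_fract_eq_iff .
    then have "poly (l f) 0 = r * poly (l h) 0" "poly (l f) 1 = r * poly (l h) 1" by simp_all
    then show False using v(2) by (simp add: l01)
  qed
  let ?S = "insert t' (y ` set zs)"
  have "t' \<in> gen ?S" by (simp add: gen.incl)
  \<comment> \<open>The field generated by t' and the roots may be smaller than Q(s). Taking its
    generator w as the new variable makes the roots, with R, generate all of Q(X), as
    \<open>model\<close> demands.\<close>
  from lueroth[OF this t'r] obtain w where w: "transc w" "gen ?S = gen {w}" by blast
  interpret w: fhom "ev w" by (rule fhom_ev[OF w(1)])
  have sub: "?S \<subseteq> range (ev w)" using w gen_single[OF w(1)] by (metis gen.incl subsetI)
  then obtain R where R: "t' = ev w R" by auto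
  have "\<exists>b. y z = ev w b" if "z \<in> set zs" for z using sub that by auto
  then obtain b where b: "\<And>z. z \<in> set zs \<Longrightarrow> y z = ev w (b z)" by metis
  have Rr: "R \<notin> range of_rat"
  proof
    assume "R \<in> range of_rat"
    then have "t' \<in> range of_rat" using R fhom_of_rat_comm[OF fhom_ev[OF w(1)]] by (metis imageE rangeI)
    then show False using t'r by blast
  qed
  have tR: "transc R" "transc t'" using Rr t'r poly_fract_transc by blast+
  have "map_poly (ev R) (fract_poly P) = (\<Prod>x\<leftarrow>map b zs. [:- x, 1:])"
  proof -
    have "map_poly (ev w) (map_poly (ev R) (fract_poly P)) = map_poly (ev w) (\<Prod>x\<leftarrow>map b zs. [:- x, 1:])"
    proof (rule poly_eqI)
      fix i
      have e0: "ev R 0 = 0" using fhom_ev[OF tR(1)] by (simp add: fhom_def rhom.zero)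
      have "Polynomial.coeff (map_poly (ev w) (map_poly (ev R) (fract_poly P))) i = ev w (ev R (to_fract (Polynomial.coeff P i)))"
        by (simp add: coeff_map_poly e0)
      also have "\<dots> = qev (Polynomial.coeff P i) t'"
        using ev_to_fract[OF tR(2)] ev_ev[OF w(1) tR(1)] R by simp
      also have "\<dots> = Polynomial.coeff (\<Prod>x\<leftarrow>map y zs. [:- x, 1:]) i" by (rule id)
      also have "map y zs = map (ev w) (map b zs)" using b by simp
      also have "(\<Prod>x\<leftarrow>map (ev w) (map b zs). [:- x, 1:]) = map_poly (ev w) (\<Prod>x\<leftarrow>map b zs. [:- x, 1:])"
        by (subst w.mp_prod_list) (simp add: o_def)
      finally show "Polynomial.coeff (map_poly (ev w) (map_poly (ev R) (fract_poly P))) i =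
        Polynomial.coeff (map_poly (ev w) (\<Prod>x\<leftarrow>map b zs. [:- x, 1:])) i" .
    qed
    then show ?thesis by (simp only: w.mp_eq_iff)
  qed
  moreover have "gen (insert R (set (map b zs))) = UNIV"
  proof -
    have "ev w ` insert R (set (map b zs)) = ?S" using R b by (auto simp: image_iff)
    then have "ev w ` gen (insert R (set (map b zs))) = range (ev w)"
      using gen_image[OF fhom_ev[OF w(1)], of "insert R (set (map b zs))"] w gen_single[OF w(1)] by simp
    then show ?thesis using w.inject by (simp add: inj_image_eq_iff)
  qed
  ultimately have "model (fract_poly P) R (map b zs)" using Rr unfolding model_def by blast
  then show ?thesis by blast
qed

subsection \<open>Moebius transformations\<close>

type_synonym mat2 = "rat \<times> rat \<times> rat \<times> rat"

fun mm :: "mat2 \<Rightarrow> mat2 \<Rightarrow> mat2" where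
  "mm (a, b, c, d) (a', b', c', d') = (a * a' + b * c', a * b' + b * d', c * a' + d * c', c * b' + d * d')"

fun dt :: "mat2 \<Rightarrow> rat" where "dt (a, b, c, d) = a * d - b * c"
fun tr :: "mat2 \<Rightarrow> rat" where "tr (a, b, c, d) = a + d"
fun sc :: "rat \<Rightarrow> mat2 \<Rightarrow> mat2" where "sc k (a, b, c, d) = (k * a, k * b, k * c, k * d)"
fun adj :: "mat2 \<Rightarrow> mat2" where "adj (a, b, c, d) = (d, - b, - c, a)"
fun mob :: "mat2 \<Rightarrow> rat poly fract" where "mob (a, b, c, d) = moebius a b c d"

lemma dt_mm: "dt (mm M N) = dt M * dt N"
  by (cases M; cases N) (simp add: algebra_simps)

lemma dt_sc: "dt (sc k M) = k ^ 2 * dt M"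
  by (cases M) (simp add: algebra_simps power2_eq_square)

lemma mm_sc: "mm M (sc k N) = sc k (mm M N)"
  by (cases M; cases N) (simp add: algebra_simps)

lemma of_rat_lin_nz:
  assumes t: "transc (g :: 'a::field_char_0)" and "c \<noteq> 0 \<or> d \<noteq> 0"
  shows "of_rat c * g + of_rat d \<noteq> 0"
proof
  assume "of_rat c * g + of_rat d = 0"
  then have "qev [:d, c:] g = 0" by (simp add: rhom.mp_pCons[OF rhom_of_rat] algebra_simps)
  then have "[:d, c:] = 0" using t unfolding transc_def by blast
  then show False using assms(2) by simp
qed

lemma ev_moebius:
  assumes t: "transc (g :: 'a::field_char_0)" and cd: "c \<noteq> 0 \<or> d \<noteq> 0"
  shows "ev g (moebius a b c d) = (of_rat a * g + of_rat b) / (of_rat c * g + of_rat d)"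
proof -
  interpret fhom "ev g" by (rule fhom_ev[OF t])
  show ?thesis
    by (simp add: moebius_fraction divide add mult ev_XX[OF t] fhom_of_rat_comm[OF fhom_ev[OF t]])
qed

lemma moebius_eq_iff:
  assumes "a * d - b * c \<noteq> 0" "a' * d' - b' * c' \<noteq> 0"
  shows "moebius a b c d = moebius a' b' c' d' \<longleftrightarrow>
    a * c' = a' * c \<and> a * d' + b * c' = a' * d + b' * c \<and> b * d' = b' * d"
proof -
  have nz: "[:d, c:] \<noteq> (0 :: rat poly)" "[:d', c':] \<noteq> (0 :: rat poly)" using assms by auto
  have "moebius a b c d = moebius a' b' c' d' \<longleftrightarrow> [:b, a:] * [:d', c':] = [:b', a':] * [:d, c:]"
    unfolding moebius_def by (rule eq_fract(1)[OF nz])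
  then show ?thesis by (auto simp: algebra_simps)
qed

lemma mob_nonrat:
  assumes "dt M \<noteq> 0" shows "mob M \<notin> range of_rat" "transc (mob M)"
proof -
  obtain a b c d where M: "M = (a, b, c, d)" by (cases M)
  show "mob M \<notin> range of_rat"
  proof
    assume "mob M \<in> range of_rat"
    then obtain r where r: "mob M = of_rat r" by blast
    have cd: "c \<noteq> 0 \<or> d \<noteq> 0" using assms M by auto
    have "of_rat a * XX + of_rat b = of_rat r * (of_rat c * XX + of_rat d)"
      using r of_rat_lin_nz[OF transc_XX cd] by (simp add: M moebius_fraction field_simps)
    then have "of_rat (a - r * c) * XX + of_rat (b - r * d) = 0"
      by (simp add: of_rat_diff of_rat_mult algebra_simps)
    then have "a - r * c = 0" "b - r * d = 0" using of_rat_lin_nz[OF transc_XX, of "a - r * c" "b - r * d"] by blast+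
    then show False using assms by (simp add: M algebra_simps)
  qed
  then show "transc (mob M)" using poly_fract_transc by blast
qed

lemma ev_mob_mob:
  assumes "dt M \<noteq> 0" "dt N \<noteq> 0"
  shows "ev (mob N) (mob M) = mob (mm M N)"
proof -
  obtain a b c d where M: "M = (a, b, c, d)" by (cases M)
  obtain a' b' c' d' where N: "N = (a', b', c', d')" by (cases N)
  have cd: "c \<noteq> 0 \<or> d \<noteq> 0" and cd': "c' \<noteq> 0 \<or> d' \<noteq> 0" using assms M N by auto
  have "dt (mm M N) \<noteq> 0" using assms by (simp add: dt_mm)
  then have cd2: "c * a' + d * c' \<noteq> 0 \<or> c * b' + d * d' \<noteq> 0" unfolding M N by (simp; fastforce)
  have n1: "of_rat c' * XX + of_rat d' \<noteq> 0" by (rule of_rat_lin_nz[OF transc_XX cd'])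
  have n2: "of_rat c * mob N + of_rat d \<noteq> 0" by (rule of_rat_lin_nz[OF mob_nonrat(2)[OF assms(2)] cd])
  have n3: "of_rat (c * a' + d * c') * XX + of_rat (c * b' + d * d') \<noteq> 0" by (rule of_rat_lin_nz[OF transc_XX cd2])
  have "ev (mob N) (mob M) = (of_rat a * mob N + of_rat b) / (of_rat c * mob N + of_rat d)"
    using ev_moebius[OF mob_nonrat(2)[OF assms(2)] cd] by (simp add: M)
  also have "\<dots> = (of_rat (a * a' + b * c') * XX + of_rat (a * b' + b * d')) / (of_rat (c * a' + d * c') * XX + of_rat (c * b' + d * d'))"
  proof -
    have q: "(of_rat x * mob N + of_rat y) * (of_rat c' * XX + of_rat d') = of_rat (x * a' + y * c') * XX + of_rat (x * b' + y * d')" for x y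
      using n1 by (simp add: N moebius_fraction of_rat_add of_rat_mult distrib_right) (simp add: algebra_simps)
    show ?thesis unfolding frac_eq_eq[OF n2 n3] q[symmetric] by (simp add: n1)
  qed
  finally show ?thesis by (simp add: M N moebius_fraction)
qed

lemma mob_sc: "k \<noteq> 0 \<Longrightarrow> dt M \<noteq> 0 \<Longrightarrow> mob (sc k M) = mob M"
proof (cases M)
  case (fields a b c d)
  assume "k \<noteq> 0" "dt M \<noteq> 0"
  moreover have "k * a * (k * d) - k * b * (k * c) = k ^ 2 * dt M" by (simp add: fields algebra_simps power2_eq_square)
  ultimately show ?thesis unfolding fields mob.simps sc.simps
    by (subst moebius_eq_iff) (auto simp: fields algebra_simps)
qed

lemma mob_eqD:
  assumes "dt M \<noteq> 0" "dt N \<noteq> 0" "mob M = mob N"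
  shows "\<exists>k. k \<noteq> 0 \<and> N = sc k M"
proof -
  obtain a b c d where M: "M = (a, b, c, d)" by (cases M)
  obtain a' b' c' d' where N: "N = (a', b', c', d')" by (cases N)
  have e: "a * c' = a' * c" "a * d' + b * c' = a' * d + b' * c" "b * d' = b' * d"
    using assms moebius_eq_iff[of a d b c a' d' b' c'] by (simp_all add: M N)
  define D where "D = a * d - b * c"
  have D: "D \<noteq> 0" using assms by (simp add: M D_def)
  \<comment> \<open>If N = k M, then a' d - b' c = k D; this reads off the scalar.\<close>
  define k where "k = (a' * d - b' * c) / D"
  \<comment> \<open>Equality of the two fractions gives three relations bilinear in the entries. The
    remaining minors, multiplied by D, are combinations of these three.\<close>
  have ab: "a' * b = a * b'"
  proof -
    have "D * (a' * b - a * b') = b * b * (a * c' - a' * c) - a * b * (a * d' + b * c' - (a' * d + b' * c)) + a * a * (b * d' - b' * d)"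
      by (simp add: D_def algebra_simps)
    then show ?thesis using D e by simp
  qed
  have cd: "c' * d = c * d'"
  proof -
    have "D * (c' * d - c * d') = d * d * (a * c' - a' * c) - c * d * (a * d' + b * c' - (a' * d + b' * c)) + c * c * (b * d' - b' * d)"
      by (simp add: D_def algebra_simps)
    then show ?thesis using D e by simp
  qed
  have "a' * D - (a' * d - b' * c) * a = c * (a * b' - a' * b)" "b' * D - (a' * d - b' * c) * b = d * (a * b' - a' * b)"
    by (simp_all add: D_def algebra_simps)
  then have ad: "a' * D = (a' * d - b' * c) * a" "b' * D = (a' * d - b' * c) * b" using ab by simp_all
  then have 1: "a' = k * a" using ad D by (simp add: k_def field_simps)
  have 2: "b' = k * b" using ad D by (simp add: k_def field_simps)
  have "D * (c' - k * c) = 2 * d * (a * c' - a' * c) - c * (a * d' + b * c' - (a' * d + b' * c)) + a * (c * d' - c' * d)"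
    "D * (d' - k * d) = d * (a * d' + b * c' - (a' * d + b' * c)) - 2 * c * (b * d' - b' * d) + b * (c * d' - c' * d)"
    unfolding 1 2 by (simp_all add: D_def algebra_simps)
  moreover have z: "a * c' - a' * c = 0" "a * d' + b * c' - (a' * d + b' * c) = 0" "b * d' - b' * d = 0" "c * d' - c' * d = 0"
    using e cd by simp_all
  ultimately have "D * (c' - k * c) = 0" "D * (d' - k * d) = 0" unfolding z by simp_all
  then have 3: "c' = k * c" and 4: "d' = k * d" using D by simp_all
  have "k \<noteq> 0" using assms(2) 1 2 by (auto simp: N)
  then show ?thesis using 1 2 3 4 by (auto simp: M N)
qed

lemma mob_XX: "mob (1, 0, 0, 1) = XX"
  by (simp add: moebius_fraction)

subsection \<open>Traces of elements of finite order\<close>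

text \<open>For x = tr^2/det of a matrix, (x - 2)^2 is the same quantity for its square. The map
  squares denominators, so a finite set stable under it consists of integers. Its maximum m
  satisfies (m - 2)^2 \<le> m, hence m \<le> 4, and a negative element would be sent above
  4.\<close>

lemma square_shift_periodic:
  fixes V :: "rat set"
  assumes fin: "finite V" and cl: "\<And>x. x \<in> V \<Longrightarrow> (x - 2) ^ 2 \<in> V" and x: "x \<in> V"
  shows "x \<in> {0, 1, 2, 3, 4}"
proof -
  let ?q = "\<lambda>x. snd (quotient_of x)"
  have ne: "V \<noteq> {}" using x by blast
  have q_sq: "?q ((x - 2) ^ 2) = ?q x ^ 2" for x
  proof -
    obtain m n where mn: "quotient_of x = (m, n)" by (cases "quotient_of x")
    have n: "n > 0" and c: "coprime m n" using quotient_of_denom_pos[OF mn] quotient_of_coprime[OF mn] by auto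
    have "x = of_int m / of_int n" by (rule quotient_of_div[OF mn])
    then have "x - 2 = of_int (m - 2 * n) / of_int n" using n by (simp add: field_simps)
    then have "(x - 2) ^ 2 = of_int ((m - 2 * n) ^ 2) / of_int (n ^ 2)" by (simp add: power_divide)
    then have "(x - 2) ^ 2 = Rat.Fract ((m - 2 * n) ^ 2) (n ^ 2)" by (simp only: Fract_of_int_quotient)
    moreover have "coprime ((m - 2 * n) ^ 2) (n ^ 2)"
    proof -
      have "coprime (m - 2 * n) n"
      proof (rule coprimeI)
        fix d assume d: "d dvd m - 2 * n" "d dvd n"
        then have "d dvd (m - 2 * n) + 2 * n" by (intro dvd_add) simp_all
        then have "d dvd m" by simp
        then show "is_unit d" using c d(2) coprime_common_divisor by blast
      qed
      then show ?thesis by simp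
    qed
    ultimately have "quotient_of ((x - 2) ^ 2) = ((m - 2 * n) ^ 2, n ^ 2)"
      using n by (simp add: quotient_of_Fract normalize_stable)
    then show ?thesis using mn by simp
  qed
  have "Max (?q ` V) \<in> ?q ` V" using fin ne by (intro Max_in) auto
  then obtain y where y0: "y \<in> V" "Max (?q ` V) = ?q y" by blast
  have y: "y \<in> V" "\<And>z. z \<in> V \<Longrightarrow> ?q z \<le> ?q y" using y0 fin by (auto simp flip: y0(2))
  have "?q y ^ 2 \<le> ?q y" using y(2)[OF cl[OF y(1)]] by (simp add: q_sq)
  moreover have "?q y > 0" by (metis quotient_of_denom_pos')
  ultimately have "?q y \<le> 1" by (simp add: power2_eq_square)
  then have q1: "?q z = 1" if "z \<in> V" for z using y(2)[OF that] quotient_of_denom_pos'[of z] by simp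
  have le4: "z \<le> 4" if "z \<in> V" for z
  proof -
    let ?m = "Max V"
    have m: "?m \<in> V" "z \<le> ?m" using fin ne that by auto
    have "(?m - 2) ^ 2 \<le> ?m" using fin cl[OF m(1)] by simp
    then have "(?m - 1) * (?m - 4) \<le> 0" by (simp add: power2_eq_square algebra_simps)
    then have m14: "(?m - 1) * (?m - 4) \<le> 0" .
    have "?m \<le> 4"
    proof (rule ccontr)
      assume "\<not> ?m \<le> 4"
      then have "?m - 1 > 0" "?m - 4 > 0" by linarith+
      from mult_pos_pos[OF this] m14 show False by linarith
    qed
    then show ?thesis using m by simp
  qed
  have ge0: "x \<ge> 0"
  proof (rule ccontr)
    assume "\<not> x \<ge> 0"
    then have "x * (x - 4) > 0" by (simp add: mult_neg_neg)
    then have "(x - 2) ^ 2 > 4" by (simp add: power2_eq_square algebra_simps)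
    then show False using le4[OF cl[OF x]] by simp
  qed
  obtain m where m: "x = of_int m" using q1[OF x] by (metis quotient_of_div div_by_1 of_int_1 surjective_pairing)
  have "0 \<le> m" "m \<le> 4" using ge0 le4[OF x] by (simp_all add: m)
  then have "m = 0 \<or> m = 1 \<or> m = 2 \<or> m = 3 \<or> m = 4" by linarith
  then show ?thesis by (auto simp: m)
qed

section \<open>Finite groups of rational Moebius transformations\<close>

text \<open>The last axiom gives each involution a rational fixed point (p : q) on the projective
  line, infinity included.\<close>

locale moebius_group =
  fixes \<Gamma> :: "rat poly fract set"
  assumes fin: "finite \<Gamma>"
    and moeb: "g \<in> \<Gamma> \<Longrightarrow> \<exists>M. dt M \<noteq> 0 \<and> g = mob M"
    and closed: "g \<in> \<Gamma> \<Longrightarrow> h \<in> \<Gamma> \<Longrightarrow> ev g h \<in> \<Gamma>"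
    and ident: "XX \<in> \<Gamma>"
    and involution: "a * d - b * c \<noteq> 0 \<Longrightarrow> moebius a b c d \<in> \<Gamma> \<Longrightarrow>
      ev (moebius a b c d) (moebius a b c d) = XX \<Longrightarrow>
      \<exists>p q. (p, q) \<noteq> (0, 0) \<and> p * (c * p + d * q) = q * (a * p + b * q)"
begin

text \<open>All representing matrices with their nonzero multiples, so that trace and determinant
  can be normalized inside the set.\<close>

definition S :: "mat2 set" where "S = {M. dt M \<noteq> 0 \<and> mob M \<in> \<Gamma>}"

lemma S_mm: "M \<in> S \<Longrightarrow> N \<in> S \<Longrightarrow> mm M N \<in> S"
  by (auto simp: S_def dt_mm closed simp flip: ev_mob_mob)

lemma S_sc: "M \<in> S \<Longrightarrow> k \<noteq> 0 \<Longrightarrow> sc k M \<in> S"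
  by (auto simp: S_def dt_sc mob_sc)

text \<open>The square of a traceless matrix is scalar, so M acts as an involution. Its fixed points
  solve a quadratic whose discriminant is, up to squares, a^2 + bc = -det M; a rational fixed point
  makes this a square.\<close>

lemma S_tr0:
  assumes M: "M \<in> S" and t: "tr M = 0"
  shows "\<exists>r. r \<noteq> 0 \<and> dt M = - (r ^ 2)"
proof -
  obtain a b c d where m: "M = (a, b, c, d)" by (cases M)
  have d: "d = - a" using t by (simp add: m)
  have D: "a * a + b * c \<noteq> 0" using M by (simp add: S_def m d)
  have "mm M M = sc (a * a + b * c) (1, 0, 0, 1)" by (simp add: m d)
  then have "ev (mob M) (mob M) = XX"
    using M D ev_mob_mob[of M M] mob_sc[of "a * a + b * c" "(1, 0, 0, 1)"] by (simp add: S_def moebius_fraction)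
  then obtain p q where pq: "(p, q) \<noteq> (0, 0)" "p * (c * p + d * q) = q * (a * p + b * q)"
    using involution[of a d b c] M by (auto simp: m S_def)
  have "\<exists>r. a * a + b * c = r ^ 2"
  proof (cases "c = 0")
    case True then show ?thesis by (auto simp: power2_eq_square)
  next
    case False
    have q: "q \<noteq> 0" using pq False by auto
    \<comment> \<open>The fixed point equation with the square completed.\<close>
    have "(c * p - a * q) ^ 2 - (a * a + b * c) * q ^ 2 = c * (p * (c * p + d * q) - q * (a * p + b * q))"
      by (simp add: d power2_eq_square algebra_simps)
    then have "(c * p - a * q) ^ 2 = (a * a + b * c) * q ^ 2" using pq(2) by simp
    then have "a * a + b * c = ((c * p - a * q) / q) ^ 2" using q by (simp add: field_simps)
    then show ?thesis by blast
  qed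
  then obtain r where r: "a * a + b * c = r ^ 2" by blast
  then have "r \<noteq> 0" "dt M = - (r ^ 2)" using D by (auto simp: m d)
  then show ?thesis by blast
qed

lemma S_tr0_neg: "M \<in> S \<Longrightarrow> tr M = 0 \<Longrightarrow> dt M < 0"
  using S_tr0 by fastforce

text \<open>With a double eigenvalue M is a multiple of 1 + N where N^2 = 0. The powers 1 + nN
  represent infinitely many transformations unless N = 0.\<close>

lemma S_scalar:
  assumes M: "M \<in> S" and f: "tr M ^ 2 = 4 * dt M"
  shows "\<exists>k. k \<noteq> 0 \<and> M = (k, 0, 0, k)"
proof -
  obtain a b c d where m: "M = (a, b, c, d)" by (cases M)
  define k where "k = (a + d) / 2"
  have D: "a * d - b * c \<noteq> 0" using M by (simp add: S_def m)
  have k0: "k \<noteq> 0" using f D by (auto simp: m k_def)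
  define x y z where "x = (a - d) / (2 * k)" and "y = b / k" and "z = c / k"
  have xyz: "x * x + y * z = 0"
  proof -
    have "(a - d) * (a - d) + 4 * b * c = 0" using f by (simp add: m power2_eq_square algebra_simps)
    moreover have "x * x + y * z = ((a - d) * (a - d) + 4 * b * c) / (4 * k * k)" using k0 by (simp add: x_def y_def z_def field_simps)
    ultimately show ?thesis by simp
  qed
  have mk: "sc (1 / k) M = (1 + x, y, z, 1 - x)"
    using k0 by (simp add: m x_def y_def z_def k_def field_simps)
  \<comment> \<open>The n-th power of the normalized matrix.\<close>
  define P where "P n = (1 + of_nat n * x, of_nat n * y, of_nat n * z, 1 - of_nat n * x)" for n :: nat
  have P1: "P 1 \<in> S" using S_sc[OF M, of "1 / k"] k0 by (simp add: mk P_def)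
  have Pm: "mm (P n) (P 1) = P (Suc n)" for n
  proof -
    define N :: rat where "N = of_nat n"
    have "(1 + N * x) * (1 + x) + (N * y) * z = 1 + (1 + N) * x + N * (x * x + y * z)" "(1 + N * x) * y + (N * y) * (1 - x) = (1 + N) * y"
      "(N * z) * (1 + x) + (1 - N * x) * z = (1 + N) * z" "(N * z) * y + (1 - N * x) * (1 - x) = 1 - (1 + N) * x + N * (x * x + y * z)"
      by (simp_all add: algebra_simps)
    then show ?thesis unfolding xyz P_def N_def of_nat_Suc of_nat_1 mm.simps prod.inject mult_1 mult_zero_right add_0_right by blast
  qed
  have PS: "P (Suc n) \<in> S" for n
  proof (induction n)
    case 0 then show ?case using P1 by simp
  next
    case (Suc n) then show ?case using S_mm[OF Suc P1] by (simp only: Pm)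
  qed
  have "\<not> inj (\<lambda>n. mob (P (Suc n)))"
  proof
    assume "inj (\<lambda>n. mob (P (Suc n)))"
    moreover have "range (\<lambda>n. mob (P (Suc n))) \<subseteq> \<Gamma>" using PS by (auto simp: S_def)
    ultimately show False using fin by (metis finite_imageD finite_subset infinite_UNIV_nat)
  qed
  then obtain n n' where n: "n \<noteq> n'" "mob (P (Suc n)) = mob (P (Suc n'))" by (auto simp: inj_def)
  obtain j where j: "j \<noteq> 0" "P (Suc n') = sc j (P (Suc n))"
    using mob_eqD[OF _ _ n(2)] PS by (auto simp: S_def)
  \<comment> \<open>Both matrices have trace 2.\<close>
  have j1: "j = 1"
  proof -
    have "1 + of_nat (Suc n') * x = j * (1 + of_nat (Suc n) * x)" "1 - of_nat (Suc n') * x = j * (1 - of_nat (Suc n) * x)"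
      using j(2) by (simp_all add: P_def)
    then have "(1 + of_nat (Suc n') * x) + (1 - of_nat (Suc n') * x) = j * (1 + of_nat (Suc n) * x) + j * (1 - of_nat (Suc n) * x)" by simp
    then show ?thesis by (simp add: algebra_simps)
  qed
  have "of_nat (Suc n') * x = of_nat (Suc n) * x" "of_nat (Suc n') * y = of_nat (Suc n) * y" "of_nat (Suc n') * z = of_nat (Suc n) * z"
    using j(2) by (simp_all add: j1 P_def)
  then have "x = 0" "y = 0" "z = 0" using n(1) by (metis mult_cancel_right nat.inject of_nat_eq_iff)+
  then have "a = d" "b = 0" "c = 0" using k0 by (auto simp: x_def y_def z_def)
  then show ?thesis using k0 by (auto simp: m k_def)
qed

text \<open>\<open>square_shift_periodic\<close> leaves the values 0 to 4. The values 2 and 3 belong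
  to orders 4 and 6: there M^2, respectively M^3, is traceless with positive determinant, which
  \<open>S_tr0_neg\<close> forbids.\<close>

lemma S_trace: assumes M: "M \<in> S" shows "tr M ^ 2 / dt M \<in> {0, 1, 4}"
proof -
  let ?f = "\<lambda>M. tr M ^ 2 / dt M"
  have sc: "?f (sc k N) = ?f N" if "k \<noteq> 0" for k N
  proof -
    have "tr (sc k N) = k * tr N" by (cases N) (simp add: algebra_simps)
    then show ?thesis using that by (simp add: dt_sc power_mult_distrib)
  qed
  have sq: "tr (mm N N) = tr N ^ 2 - 2 * dt N" for N by (cases N) (simp add: power2_eq_square algebra_simps)
  have fsq: "?f (mm N N) = (?f N - 2) ^ 2" if "dt N \<noteq> 0" for N
    using that by (simp add: sq dt_mm field_simps power2_eq_square)
  let ?V = "?f ` S"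
  have "finite ?V"
  proof (rule finite_surj[OF fin])
    \<comment> \<open>The invariant ignores scalars, so one representative for each group element
      produces all its values.\<close>
    define rep where "rep g = (SOME M. M \<in> S \<and> mob M = g)" for g
    show "?V \<subseteq> (\<lambda>g. ?f (rep g)) ` \<Gamma>"
    proof
      fix v assume "v \<in> ?V"
      then obtain N where N: "N \<in> S" "v = ?f N" by blast
      have "rep (mob N) \<in> S \<and> mob (rep (mob N)) = mob N" unfolding rep_def by (rule someI[of _ N]) (use N in simp)
      then obtain k where "k \<noteq> 0" "N = sc k (rep (mob N))" using mob_eqD[of "rep (mob N)" N] N by (auto simp: S_def)
      then have "v = ?f (rep (mob N))" using N(2) sc by metis
      then show "v \<in> (\<lambda>g. ?f (rep g)) ` \<Gamma>" using N(1) by (auto simp: S_def)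
    qed
  qed
  moreover have "(v - 2) ^ 2 \<in> ?V" if "v \<in> ?V" for v
  proof -
    obtain N where N: "N \<in> S" "v = ?f N" using \<open>v \<in> ?V\<close> by blast
    have "dt N \<noteq> 0" using N by (simp add: S_def)
    then have "(v - 2) ^ 2 = ?f (mm N N)" using fsq N by simp
    then show ?thesis using S_mm[OF N(1) N(1)] by blast
  qed
  ultimately have f: "?f M \<in> {0, 1, 2, 3, 4}" using square_shift_periodic M by blast
  have D: "dt M \<noteq> 0" using M by (simp add: S_def)
  have "?f M \<noteq> 2"
  proof
    assume "?f M = 2"
    then have "tr (mm M M) = 0" using D by (simp add: sq field_simps)
    then have "dt (mm M M) < 0" using S_tr0_neg S_mm[OF M M] by blast
    then have "dt M * dt M < 0" by (simp only: dt_mm)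
    then show False using not_square_less_zero by blast
  qed
  moreover have "?f M \<noteq> 3"
  proof
    assume "?f M = 3"
    then have 3: "tr M ^ 2 = 3 * dt M" using D by (simp add: field_simps)
    have "0 \<le> tr M ^ 2" by simp
    then have pos: "dt M > 0" using D unfolding 3 by simp
    have "tr (mm (mm M M) M) = tr M * (tr M ^ 2 - 3 * dt M)"
      by (cases M) (simp add: power2_eq_square algebra_simps)
    then have "tr (mm (mm M M) M) = 0" by (simp add: 3)
    then have "dt (mm (mm M M) M) < 0" using S_tr0_neg S_mm[OF S_mm[OF M M] M] by blast
    then have "dt M * dt M * dt M < 0" by (simp only: dt_mm)
    moreover have "dt M * dt M * dt M > 0" using pos by simp
    ultimately show False by simp
  qed
  ultimately show ?thesis using f by blast
qed

lemma S_det1: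
  assumes M: "M \<in> S" and d: "dt M = 1"
  shows "tr M \<in> {1, - 1, 2, - 2}" "tr M = 2 \<Longrightarrow> M = (1, 0, 0, 1)" "tr M = - 2 \<Longrightarrow> M = (- 1, 0, 0, - 1)"
proof -
  have "tr M ^ 2 \<in> {0, 1, 4}" using S_trace[OF M] d by simp
  moreover have "tr M \<noteq> 0" using S_tr0_neg[OF M] d by auto
  ultimately have "tr M ^ 2 = 1 ^ 2 \<or> tr M ^ 2 = 2 ^ 2" by auto
  then show "tr M \<in> {1, - 1, 2, - 2}" by (auto simp only: power2_eq_iff insert_iff)
  show "tr M = 2 \<Longrightarrow> M = (1, 0, 0, 1)" using S_scalar[OF M] d by auto
  show "tr M = - 2 \<Longrightarrow> M = (- 1, 0, 0, - 1)" using S_scalar[OF M] d by auto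
qed

text \<open>The values 4, 1 and 0 of tr^2/det belong to the identity, to order three and to order
  two. Scaling then normalizes trace and determinant, in the last case by the square root of -det
  that \<open>S_tr0\<close> supplies.\<close>

lemma elements:
  assumes g: "g \<in> \<Gamma>"
  shows "g = XX \<or> (\<exists>M\<in>S. g = mob M \<and> dt M = 1 \<and> tr M = - 1) \<or> (\<exists>M\<in>S. g = mob M \<and> dt M = - 1 \<and> tr M = 0)"
proof -
  obtain M where M: "dt M \<noteq> 0" "g = mob M" using moeb[OF g] by blast
  then have MS: "M \<in> S" using g by (simp add: S_def)
  from S_trace[OF MS] consider "tr M = 0" | "tr M ^ 2 = dt M" | "tr M ^ 2 = 4 * dt M"
    using M(1) by (auto simp: field_simps)
  then show ?thesis
  proof cases
    case 1
    then obtain r where r: "r \<noteq> 0" "dt M = - (r ^ 2)" using S_tr0[OF MS] by blast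
    have "dt (sc (1 / r) M) = - 1" using r by (simp add: dt_sc power2_eq_square)
    moreover have "tr (sc (1 / r) M) = 0" using 1 r by (cases M) (simp add: field_simps)
    moreover have "g = mob (sc (1 / r) M)" using M mob_sc[of "1 / r" M] r by simp
    moreover have "sc (1 / r) M \<in> S" using S_sc[OF MS, of "1 / r"] r by simp
    ultimately show ?thesis by blast
  next
    case 2
    then have t: "tr M \<noteq> 0" using M(1) by auto
    have "dt (sc (- 1 / tr M) M) = 1" using t by (simp add: dt_sc 2[symmetric] power2_eq_square)
    moreover have "tr (sc k M) = k * tr M" for k by (cases M) (simp add: algebra_simps)
    then have "tr (sc (- 1 / tr M) M) = - 1" using t by simp
    moreover have "g = mob (sc (- 1 / tr M) M)" using M mob_sc[of "- 1 / tr M" M] t by simp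
    moreover have "sc (- 1 / tr M) M \<in> S" using S_sc[OF MS, of "- 1 / tr M"] t by simp
    ultimately show ?thesis by blast
  next
    case 3
    then obtain k where "k \<noteq> 0" "M = (k, 0, 0, k)" using S_scalar[OF MS] by blast
    then have "g = XX" using M(2) mob_sc[of k "(1, 0, 0, 1)"] mob_XX by simp
    then show ?thesis by blast
  qed
qed

text \<open>By Cayley-Hamilton N^2 + N + 1 = 0, so tr(MN) + tr(MN^2) = -tr M = 1. Both traces lie in
  {1, -1, 2, -2}, so one of them is 2 and the corresponding product is the identity: N is the
  inverse M^2 of M, or M itself.\<close>

lemma order3_unique:
  assumes "M \<in> S" "dt M = 1" "tr M = - 1" "N \<in> S" "dt N = 1" "tr N = - 1"
  shows "N = M \<or> N = mm M M"
proof -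
  obtain a b c d where M: "M = (a, b, c, d)" by (cases M)
  obtain a' b' c' d' where N: "N = (a', b', c', d')" by (cases N)
  have q: "a + d = - 1" "a * d - b * c = 1" "a' + d' = - 1" "a' * d' - b' * c' = 1"
    using assms by (simp_all add: M N)
  have m: "d = - 1 - a" "a * d - b * c = 1" and n: "d' = - 1 - a'" "a' * d' - b' * c' = 1"
    using q by linarith+
  let ?P = "mm M N" and ?Q = "mm M (mm N N)"
  have P: "?P \<in> S" "dt ?P = 1" and Q: "?Q \<in> S" "dt ?Q = 1" using assms S_mm by (simp_all add: dt_mm)
  have bc': "b' * c' = a' * (- 1 - a') - 1" and bc: "b * c = a * (- 1 - a) - 1"
    using q(2,4) unfolding m(1) n(1) by linarith+
  have "a' * a' + b' * c' = d'" "a' * b' + b' * d' = - b'" "c' * a' + d' * c' = - c'" "c' * b' + d' * d' = a'"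
    unfolding n(1) by (simp_all add: bc' algebra_simps)
  then have N2: "mm N N = (d', - b', - c', a')" by (simp add: N)
  have "(a * a' + b * c') + (c * b' + d * d') + ((a * d' - b * c') + (d * a' - c * b')) = (a + d) * (a' + d')"
    by (simp add: algebra_simps)
  also have "\<dots> = 1" using m(1) n(1) by simp
  finally have s: "tr ?P + tr ?Q = 1" unfolding N2 by (simp add: M N)
  from S_det1(1)[OF P] S_det1(1)[OF Q] s have "tr ?P = 2 \<or> tr ?Q = 2" by auto
  then show ?thesis
  proof
    assume "tr ?P = 2"
    then have "?P = (1, 0, 0, 1)" using S_det1(2)[OF P] by blast
    then have e: "a * a' + b * c' = 1" "a * b' + b * d' = 0" "c * a' + d * c' = 0" "c * b' + d * d' = 1" by (auto simp: M N)
    have "(a * d - b * c) * a' = d * (a * a' + b * c') - b * (c * a' + d * c')"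
      "(a * d - b * c) * b' = d * (a * b' + b * d') - b * (c * b' + d * d')"
      "(a * d - b * c) * c' = a * (c * a' + d * c') - c * (a * a' + b * c')"
      "(a * d - b * c) * d' = a * (c * b' + d * d') - c * (a * b' + b * d')"
      by (simp_all add: algebra_simps)
    then have "a' = d" "b' = - b" "c' = - c" "d' = a" unfolding e m(2) by simp_all
    moreover have "a * a + b * c = d" "a * b + b * d = - b" "c * a + d * c = - c" "c * b + d * d = a"
      unfolding m(1) by (simp_all add: bc algebra_simps)
    ultimately have "N = mm M M" by (simp add: M N)
    then show ?thesis by blast
  next
    assume "tr ?Q = 2"
    then have Q1: "?Q = (1, 0, 0, 1)" using S_det1(2)[OF Q] by blast
    have e: "a * d' - b * c' = 1" "b * a' - a * b' = 0" "c * d' - d * c' = 0" "d * a' - c * b' = 1" using Q1 unfolding N2 by (auto simp: M algebra_simps)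
    have "(a * d - b * c) * a' = a * (d * a' - c * b') - c * (b * a' - a * b')"
      "(a * d - b * c) * b' = b * (d * a' - c * b') - d * (b * a' - a * b')"
      "(a * d - b * c) * c' = c * (a * d' - b * c') - a * (c * d' - d * c')"
      "(a * d - b * c) * d' = d * (a * d' - b * c') - b * (c * d' - d * c')"
      by (simp_all add: algebra_simps)
    then have "a' = a" "b' = b" "c' = c" "d' = d" unfolding e m(2) by simp_all
    then show ?thesis by (simp add: M N)
  qed
qed

text \<open>MN has determinant 1 and M(MN) = N. If its trace is 1 or -1, then MN has order three
  after a change of sign; if it is 2 or -2, then MN is scalar and N represents the same
  transformation as M.\<close>

lemma involution_product:
  assumes "M \<in> S" "dt M = - 1" "tr M = 0" "N \<in> S" "dt N = - 1" "tr N = 0"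
  shows "mob N = mob M \<or> (\<exists>Q\<in>S. dt Q = 1 \<and> tr Q = - 1 \<and> mob N = mob (mm M Q))"
proof -
  obtain a b c d where M: "M = (a, b, c, d)" by (cases M)
  obtain a' b' c' d' where N: "N = (a', b', c', d')" by (cases N)
  have q: "a + d = 0" "a * d - b * c = - 1" using assms by (simp_all add: M)
  have m1: "d = - a" using q by linarith
  have "a * (- a) - b * c = - 1" using q(2) unfolding m1 .
  then have m: "d = - a" "a * a + b * c = 1" using m1 by simp_all
  let ?P = "mm M N"
  have P: "?P \<in> S" "dt ?P = 1" using assms S_mm by (simp_all add: dt_mm)
  have MP: "mm M ?P = N"
  proof -
    have "a * (a * a' + b * c') + b * (c * a' + d * c') = (a * a + b * c) * a'" "a * (a * b' + b * d') + b * (c * b' + d * d') = (a * a + b * c) * b'"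
      "c * (a * a' + b * c') + d * (c * a' + d * c') = (a * a + b * c) * c'" "c * (a * b' + b * d') + d * (c * b' + d * d') = (a * a + b * c) * d'"
      unfolding m(1) by (simp_all add: algebra_simps)
    then have "a * (a * a' + b * c') + b * (c * a' + d * c') = a'" "a * (a * b' + b * d') + b * (c * b' + d * d') = b'"
      "c * (a * a' + b * c') + d * (c * a' + d * c') = c'" "c * (a * b' + b * d') + d * (c * b' + d * d') = d'"
      unfolding m(2) by simp_all
    then show ?thesis by (simp add: M N)
  qed
  have D: "dt M \<noteq> 0" "dt N \<noteq> 0" using assms by simp_all
  have scm: "mm M (sc k ?P) = sc k N" for k by (simp only: mm_sc MP)
  from S_det1(1)[OF P] consider "tr ?P = 1" | "tr ?P = - 1" | "tr ?P = 2" | "tr ?P = - 2" by auto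
  then show ?thesis
  proof cases
    case 1
    have "tr (sc (- 1) ?P) = - 1" "dt (sc (- 1) ?P) = 1" using 1 P by (cases ?P, simp, simp add: dt_sc)
    moreover have "mob N = mob (mm M (sc (- 1) ?P))" unfolding scm using mob_sc[of "- 1" N] D by simp
    ultimately show ?thesis using S_sc[OF P(1), of "- 1"] by auto
  next
    case 2
    then show ?thesis using P MP by metis
  next
    case 3
    then have "?P = (1, 0, 0, 1)" using S_det1(2)[OF P] by blast
    then have "N = M" using MP by (simp add: M)
    then show ?thesis by simp
  next
    case 4
    then have "?P = (- 1, 0, 0, - 1)" using S_det1(3)[OF P] by blast
    then have "N = sc (- 1) M" using MP by (auto simp: M)
    then show ?thesis using mob_sc[of "- 1" M] D by simp
  qed
qed

end

section \<open>Normal forms of the groups up to conjugation\<close>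

context moebius_group
begin

text \<open>Some group element g satisfies A g = N A, that is, g becomes N in the coordinate
  A.\<close>

definition conj_to :: "mat2 \<Rightarrow> mat2 \<Rightarrow> bool" where
  "conj_to A N \<longleftrightarrow> (\<exists>g\<in>\<Gamma>. transc g \<and> ev g (mob A) = ev (mob A) (mob N))"

lemma conj_toI:
  assumes M: "M \<in> S" and A: "dt A \<noteq> 0" and N: "dt N \<noteq> 0" and k: "k \<noteq> 0" and e: "mm A M = sc k (mm N A)"
  shows "conj_to A N"
proof -
  have dM: "dt M \<noteq> 0" using M by (simp add: S_def)
  have "ev (mob M) (mob A) = mob (mm A M)" by (rule ev_mob_mob[OF A dM])
  also have "\<dots> = mob (mm N A)" unfolding e by (rule mob_sc[OF k]) (simp add: dt_mm A N)
  also have "\<dots> = ev (mob A) (mob N)" by (rule ev_mob_mob[OF N A, symmetric])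
  finally show ?thesis using M mob_nonrat(2)[OF dM] by (auto simp: conj_to_def S_def)
qed

lemma card_le_set: "\<Gamma> \<subseteq> set l \<Longrightarrow> card \<Gamma> \<le> length l"
  using card_mono[of "set l" \<Gamma>] card_length[of l] by simp

lemma det_minus1_tr: 
  assumes "M \<in> S" "dt M = - 1" shows "tr M = 0"
proof -
  have "- (tr M ^ 2) \<in> {0, 1, 4}" using S_trace[OF assms(1)] assms(2) by simp
  moreover have "tr M ^ 2 \<ge> 0" by simp
  ultimately have "tr M ^ 2 = 0" by auto
  then show ?thesis by simp
qed

text \<open>This is the determinant with rows v = (p, q) and vM. It vanishes only if v is an
  eigenvector, and the characteristic polynomial x^2 + x + 1 has discriminant -3, hence no rational
  root.\<close>

lemma order3_form_nonzero:
  fixes a b c d p q :: rat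
  assumes m: "a + d = - 1" "a * d - b * c = 1" and pq: "p \<noteq> 0 \<or> q \<noteq> 0"
  shows "p * (p * b + q * d) - q * (p * a + q * c) \<noteq> 0"
proof
  assume z: "p * (p * b + q * d) - q * (p * a + q * c) = 0"
  have "(d - a) ^ 2 + 4 * b * c = (a + d) ^ 2 - 4 * (a * d - b * c)" by (simp add: power2_eq_square algebra_simps)
  then have disc: "(d - a) ^ 2 + 4 * b * c = - 3" by (simp add: m)
  have "(2 * b * p + (d - a) * q) ^ 2 + 3 * q ^ 2 = 4 * b * (p * (p * b + q * d) - q * (p * a + q * c)) + ((d - a) ^ 2 + 4 * b * c + 3) * q ^ 2"
    by (simp add: power2_eq_square algebra_simps)
  then have "(2 * b * p + (d - a) * q) ^ 2 + 3 * q ^ 2 = 0" by (simp only: z disc) simp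
  then have q: "q = 0" and "2 * b * p + (d - a) * q = 0"
    by (auto simp: add_nonneg_eq_0_iff)
  then have "b = 0" using pq by simp
  then have "(d - a) ^ 2 = - 3" using disc by simp
  moreover have "(d - a) ^ 2 \<ge> 0" by simp
  ultimately show False by linarith
qed

text \<open>The rows of A are left vectors adapted to the group: eigenvectors of the involution if
  nothing has order three, otherwise v and vM for an M of order three. If there is also an
  involution W, then v is chosen fixed by MW. The bounds hold because the elements of order three
  are M and M^2, and two distinct involutions differ by one of them.\<close>

theorem normal_form:
  assumes ne: "\<Gamma> \<noteq> {XX}"
  shows "\<exists>A. dt A \<noteq> 0 \<and> ((card \<Gamma> \<le> 2 \<and> conj_to A (- 1, 0, 0, 1)) \<or>
    (card \<Gamma> \<le> 3 \<and> conj_to A (0, - 1, 1, 1)) \<or>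
    (card \<Gamma> \<le> 6 \<and> conj_to A (0, - 1, 1, 1) \<and> conj_to A (0, 1, 1, 0)))"
proof (cases "\<exists>M\<in>S. dt M = 1 \<and> tr M = - 1")
  case False
  obtain g where g: "g \<in> \<Gamma>" "g \<noteq> XX" using ne ident by blast
  then obtain W where W: "W \<in> S" "g = mob W" "dt W = - 1" "tr W = 0" using elements[of g] False by blast
  have "h = XX \<or> h = g" if "h \<in> \<Gamma>" for h
    using elements[OF that] False involution_product[OF W(1,3,4)] W(2) by metis
  then have "\<Gamma> \<subseteq> set [XX, g]" by auto
  then have card: "card \<Gamma> \<le> 2" using card_le_set[of "[XX, g]"] by simp
  obtain e f g' h where We: "W = (e, f, g', h)" by (cases W)
  have sums: "e + h = 0" "e * h - f * g' = - 1" using W by (simp_all add: We)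
  have h: "h = - e" using sums(1) by linarith
    have "e * (- e) - f * g' = - 1" using sums(2) unfolding h .
    then have ef: "f * g' = 1 - e * e" by (simp only: mult_minus_right)
  have D2: "dt (- 1, 0, 0, 1) \<noteq> 0" by simp
  \<comment> \<open>Since W^2 = 1, the rows of W - 1 and W + 1 are left eigenvectors of W for -1 and
    1. The first rows serve if f is nonzero, the second rows if g' is; otherwise W is
    diagonal.\<close>
  consider "f \<noteq> 0" | "g' \<noteq> 0" | "f = 0" "g' = 0" by blast
  then have "\<exists>A. dt A \<noteq> 0 \<and> conj_to A (- 1, 0, 0, 1)"
  proof cases
    case 1
    have "dt (e - 1, f, e + 1, f) \<noteq> 0" using 1 by (simp add: algebra_simps)
    moreover have "mm (e - 1, f, e + 1, f) W = sc 1 (mm (- 1, 0, 0, 1) (e - 1, f, e + 1, f))"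
      by (simp add: We h ef algebra_simps)
    ultimately show ?thesis using conj_toI[OF W(1) _ D2, of _ 1] by (metis zero_neq_one)
  next
    case 2
    have "dt (g', h - 1, g', h + 1) \<noteq> 0" using 2 by (simp add: algebra_simps)
    moreover have "g' * f = 1 - e * e" using ef by (simp add: mult.commute)
    then have "mm (g', h - 1, g', h + 1) W = sc 1 (mm (- 1, 0, 0, 1) (g', h - 1, g', h + 1))"
      by (simp add: We h algebra_simps)
    ultimately show ?thesis using conj_toI[OF W(1) _ D2, of _ 1] by (metis zero_neq_one)
  next
    case 3
    then have "e \<noteq> 0" using ef by auto
    then have "conj_to (1, 0, 0, 1) (- 1, 0, 0, 1)"
      using conj_toI[OF W(1) _ D2, of "(1, 0, 0, 1)" "- e"] 3 by (simp add: We h)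
    then show ?thesis by (intro exI[of _ "(1, 0, 0, 1)"]) simp
  qed
  then show ?thesis using card by blast
next
  case True
  then obtain M where M: "M \<in> S" "dt M = 1" "tr M = - 1" by blast
  obtain a b c d where Me: "M = (a, b, c, d)" by (cases M)
  have ad: "a + d = - 1" "a * d - b * c = 1" using M by (simp_all add: Me)
  have D3: "dt (0, - 1, 1, 1) \<noteq> 0" by simp
  \<comment> \<open>Since M^2 = -1 - M, right multiplication by M acts on the rows v and vM as the
    companion matrix; this is -1 times the matrix of -1/(1+X).\<close>
  have conj3: "dt (p, q, p * a + q * c, p * b + q * d) \<noteq> 0 \<and> conj_to (p, q, p * a + q * c, p * b + q * d) (0, - 1, 1, 1)"
    if pq: "p \<noteq> 0 \<or> q \<noteq> 0" for p q
  proof -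
    let ?A = "(p, q, p * a + q * c, p * b + q * d)"
    have A: "dt ?A \<noteq> 0" using order3_form_nonzero[OF ad pq] by simp
    have d: "d = - 1 - a" using ad by linarith
    have bc: "b * c = a * (- 1 - a) - 1" using ad(2) unfolding d by linarith
    have "(p * a + q * c) * a + (p * b + q * d) * c = - p - (p * a + q * c)"
    proof -
      have "(p * a + q * c) * a + (p * b + q * d) * c = p * (a * a + b * c) + q * c * (a + d)" by (simp add: algebra_simps)
      also have "a * a + b * c = - 1 - a" unfolding bc by (simp add: algebra_simps)
      finally show ?thesis by (simp add: ad algebra_simps)
    qed
    moreover have "(p * a + q * c) * b + (p * b + q * d) * d = - q - (p * b + q * d)"
    proof -
      have "(p * a + q * c) * b + (p * b + q * d) * d = q * (b * c + d * d) + p * b * (a + d)" by (simp add: algebra_simps)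
      also have "b * c + d * d = - 1 - d" unfolding bc d by (simp add: algebra_simps)
      finally show ?thesis by (simp add: ad algebra_simps)
    qed
    ultimately have "mm ?A M = sc (- 1) (mm (0, - 1, 1, 1) ?A)" by (simp add: Me)
    then show ?thesis using A conj_toI[OF M(1) A D3, of "- 1"] by simp
  qed
  have o3: "N = M \<or> N = mm M M" if "N \<in> S" "dt N = 1" "tr N = - 1" for N
    using order3_unique[OF M that] .
  show ?thesis
  proof (cases "\<exists>W\<in>S. dt W = - 1 \<and> tr W = 0")
    case False
    have "\<Gamma> \<subseteq> set [XX, mob M, mob (mm M M)]"
    proof
      fix g assume "g \<in> \<Gamma>"
      from elements[OF this] False consider "g = XX" | N where "N \<in> S" "g = mob N" "dt N = 1" "tr N = - 1" by blast
      then show "g \<in> set [XX, mob M, mob (mm M M)]"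
      proof cases
        case 2
        from o3[OF 2(1,3,4)] show ?thesis unfolding 2(2) by (elim disjE) simp_all
      qed simp
    qed
    then have "card \<Gamma> \<le> 3" using card_le_set by fastforce
    then show ?thesis using conj3[of 1 0, OF disjI1[OF one_neq_zero]] by (intro exI[of _ "(1, 0, 1 * a + 0 * c, 1 * b + 0 * d)"]) blast
  next
    case True
    then obtain W where W: "W \<in> S" "dt W = - 1" "tr W = 0" by blast
    let ?l = "[XX, mob M, mob (mm M M), mob W, mob (mm W M), mob (mm W (mm M M))]"
    have "\<Gamma> \<subseteq> set ?l"
    proof
      fix g assume "g \<in> \<Gamma>"
      from elements[OF this] consider "g = XX" | N where "N \<in> S" "g = mob N" "dt N = 1" "tr N = - 1"
        | N where "N \<in> S" "g = mob N" "dt N = - 1" "tr N = 0" by blast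
      then show "g \<in> set ?l"
      proof cases
        case 2
        from o3[OF 2(1,3,4)] show ?thesis unfolding 2(2) by (elim disjE) simp_all
      next
        case 3
        from involution_product[OF W 3(1,3,4)] show ?thesis
        proof
          assume "\<exists>Q\<in>S. dt Q = 1 \<and> tr Q = - 1 \<and> mob N = mob (mm W Q)"
          then obtain Q where Q: "Q \<in> S" "dt Q = 1" "tr Q = - 1" "mob N = mob (mm W Q)" by blast
          from o3[OF Q(1,2,3)] show ?thesis unfolding 3(2) Q(4) by (elim disjE) simp_all
        qed (simp add: 3(2))
      qed simp
    qed
    then have card: "card \<Gamma> \<le> 6" using card_le_set by fastforce
    obtain e f g h where We: "W = (e, f, g, h)" by (cases W)
    have sums: "e + h = 0" "e * h - f * g = - 1" using W by (simp_all add: We)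
  have h: "h = - e" using sums(1) by linarith
    have "e * (- e) - f * g = - 1" using sums(2) unfolding h .
    then have fg: "f * g = 1 - e * e" by (simp only: mult_minus_right)
    have MW: "mm M W \<in> S" "dt (mm M W) = - 1" using S_mm M W by (simp_all add: dt_mm)
    then have MW0: "tr (mm M W) = 0" by (rule det_minus1_tr)
    obtain x y z w where V: "mm M W = (x, y, z, w)" by (cases "mm M W")
    have sums: "x + w = 0" "x * w - y * z = - 1" using MW MW0 by (simp_all add: V)
  have w: "w = - x" using sums(1) by linarith
    have "x * (- x) - y * z = - 1" using sums(2) unfolding w .
    then have yz: "y * z = 1 - x * x" by (simp only: mult_minus_right)
    \<comment> \<open>MW has trace 0 and determinant -1, hence eigenvalue 1. Any nonzero row of MW +
      1 is a left eigenvector for it.\<close>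
    have "\<exists>p q. (p \<noteq> 0 \<or> q \<noteq> 0) \<and> p * x + q * z = p \<and> p * y + q * w = q"
    proof (cases "x + 1 = 0 \<and> y = 0")
      case True
      then have "x = - 1" "y = 0" by linarith+
      then have "z * x + (w + 1) * z = z \<and> z * y + (w + 1) * w = w + 1" "w + 1 \<noteq> 0" by (simp_all add: w)
      then show ?thesis by blast
    next
      case False
      have "(x + 1) * x + y * z = x + 1 \<and> (x + 1) * y + y * w = y" unfolding yz w by (simp add: algebra_simps)
      moreover have "x + 1 \<noteq> 0 \<or> y \<noteq> 0" using False by blast
      ultimately show ?thesis by blast
    qed
    then obtain p q where pq: "p \<noteq> 0 \<or> q \<noteq> 0" and u: "p * x + q * z = p" "p * y + q * w = q" by blast
    let ?s = "p * a + q * c" and ?t = "p * b + q * d"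
    have xy: "x = a * e + b * g" "y = a * f + b * h" "z = c * e + d * g" "w = c * f + d * h" using V by (simp_all add: Me We)
    have st: "?s * e + ?t * g = p" "?s * f + ?t * h = q" using u unfolding xy by (simp_all add: algebra_simps)
    have pe: "p * e + q * g = ?s"
    proof -
      have "p * e + q * g = (?s * e + ?t * g) * e + (?s * f + ?t * h) * g" by (simp only: st)
      also have "\<dots> = ?s * (e * e + f * g) + ?t * (g * e + h * g)" by (simp add: algebra_simps)
      also have "\<dots> = ?s" by (simp only: fg h) simp
      finally show ?thesis .
    qed
    have pf: "p * f + q * h = ?t"
    proof -
      have "p * f + q * h = (?s * e + ?t * g) * f + (?s * f + ?t * h) * h" by (simp only: st)
      also have "\<dots> = ?s * (e * f + f * h) + ?t * (f * g + h * h)" by (simp add: algebra_simps)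
      also have "\<dots> = ?t" by (simp only: fg h) simp
      finally show ?thesis .
    qed
    let ?A = "(p, q, ?s, ?t)"
    \<comment> \<open>From vMW = v and W^2 = 1 follows vW = vM: the involution W exchanges the two
      rows.\<close>
    have "mm ?A W = sc 1 (mm (0, 1, 1, 0) ?A)" using st pe pf by (simp add: We)
    then have "conj_to ?A (0, 1, 1, 0)" using conj3[OF pq] conj_toI[OF W(1), of ?A "(0, 1, 1, 0)" 1] by simp
    then show ?thesis using card conj3[OF pq] by blast
  qed
qed

end

subsection \<open>Change of coordinate\<close>

lemma model_transc: "model A R bs \<Longrightarrow> transc R"
  by (simp add: model_def poly_fract_transc)

lemma model_transform:
  assumes m: "model A R bs" and z: "transc z" "gen {z} = UNIV"
  shows "model A (ev z R) (map (ev z) bs)"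
proof -
  have "z \<in> fibre R (ev z R)" using z by (simp add: fibre_def)
  note ms = model_spec[OF m this]
  show ?thesis using ms transc_nonrat[OF ms(1)] z(2) by (simp add: model_def o_def)
qed

lemma mm_adj: "mm A (adj A) = sc (dt A) (1, 0, 0, 1)" "mm (adj A) A = sc (dt A) (1, 0, 0, 1)"
  by (cases A; simp add: algebra_simps)+

lemma mob_adj:
  assumes "dt A \<noteq> 0"
  shows "ev (mob (adj A)) (mob A) = XX" "ev (mob A) (mob (adj A)) = XX"
proof -
  have d: "dt (adj A) \<noteq> 0" using assms by (cases A) (simp add: algebra_simps)
  have "mob (sc (dt A) (1, 0, 0, 1)) = XX" using mob_sc[OF assms, of "(1, 0, 0, 1)"] mob_XX by simp
  then show "ev (mob (adj A)) (mob A) = XX" "ev (mob A) (mob (adj A)) = XX"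
    using ev_mob_mob[OF assms d] ev_mob_mob[OF d assms] by (simp_all only: mm_adj)
qed

lemma dt_adj: "dt (adj A) = dt A" by (cases A) (simp add: algebra_simps)

lemma gen_mob: "dt A \<noteq> 0 \<Longrightarrow> gen {mob A} = UNIV"
proof -
  assume A: "dt A \<noteq> 0"
  have "XX = ev (mob A) (mob (adj A))" using mob_adj(2)[OF A] by simp
  then have "XX \<in> gen {mob A}" using gen_ev[of "mob A" "{mob A}"] by (metis gen.incl singletonI)
  then have "gen {XX} \<subseteq> gen {mob A}" by (intro gen_least) simp
  then show ?thesis unfolding gen_XX by (rule top.extremum_uniqueI)
qed

text \<open>R' is R composed with the inverse of A. The substitutions fixing R' are the conjugates A
  g A^-1 of those fixing R, so the size cannot grow, and the relation in \<open>conj_to\<close>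
  produces members of the new fibre.\<close>

lemma fibre_transform:
  assumes A: "dt A \<noteq> 0" and R: "transc R" and fin: "finite (fibre R R)"
  defines "R' \<equiv> ev (mob (adj A)) R"
  shows "card (fibre R' R') \<le> card (fibre R R)"
    and "g \<in> fibre R R \<Longrightarrow> transc n \<Longrightarrow> ev g (mob A) = ev (mob A) n \<Longrightarrow> n \<in> fibre R' R'"
proof -
  let ?y = "mob A" and ?z = "mob (adj A)"
  have y: "transc ?y" and z: "transc ?z" using mob_nonrat(2) A by (simp_all add: dt_adj)
  note zy = mob_adj(1)[OF A] and yz = mob_adj(2)[OF A]
  have evf: "transc (ev x w)" if "transc x" "transc w" for x w :: "rat poly fract"
    using transc_fhom[OF fhom_ev[OF that(1)]] that(2) by blast
  show "n \<in> fibre R' R'" if g: "g \<in> fibre R R" and n: "transc n" and e: "ev g ?y = ev ?y n"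
  proof -
    have tg: "transc g" and gR: "ev g R = R" using g by (auto simp: fibre_def)
    have zg: "transc (ev ?z g)" by (rule evf[OF z tg])
    have "ev (ev ?z g) ?y = ev ?z (ev g ?y)" by (rule ev_ev[OF z tg, symmetric])
    also have "\<dots> = ev (ev ?z ?y) n" unfolding e by (rule ev_ev[OF z y])
    finally have n': "ev (ev ?z g) ?y = n" unfolding zy ev_id .
    have "ev (ev (ev ?z g) ?y) ?z = ev (ev ?z g) (ev ?y ?z)" by (rule ev_ev[OF zg y, symmetric])
    also have "\<dots> = ev ?z g" unfolding yz by (rule ev_XX[OF zg])
    finally have nz: "ev n ?z = ev ?z g" unfolding n' .
    have "ev n R' = ev (ev n ?z) R" unfolding R'_def by (rule ev_ev[OF n z])
    also have "\<dots> = ev ?z (ev g R)" unfolding nz by (rule ev_ev[OF z tg, symmetric])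
    finally have "ev n R' = R'" unfolding gR R'_def .
    then show ?thesis using n unfolding fibre_def by blast
  qed
  \<comment> \<open>Conjugation back, n |-> A^-1 n A.\<close>
  let ?f = "\<lambda>n. ev ?y (ev n ?z)"
  show "card (fibre R' R') \<le> card (fibre R R)"
  proof (rule card_inj_on_le[of ?f])
    show "?f ` fibre R' R' \<subseteq> fibre R R"
    proof clarify
      fix n assume "n \<in> fibre R' R'"
      then have n: "transc n" "ev n R' = R'" by (auto simp: fibre_def)
      have tnz: "transc (ev n ?z)" by (rule evf[OF n(1) z])
      have "ev (?f n) R = ev ?y (ev (ev n ?z) R)" by (rule ev_ev[OF y tnz, symmetric])
      also have "ev (ev n ?z) R = R'" using ev_ev[OF n(1) z, of R] n(2) unfolding R'_def by (rule trans[OF sym])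
      also have "ev ?y R' = R" unfolding R'_def using ev_ev[OF y z, of R] unfolding yz ev_id .
      finally show "?f n \<in> fibre R R" using evf[OF y tnz] by (simp add: fibre_def)
    qed
    show "inj_on ?f (fibre R' R')"
    proof (rule inj_onI)
      have bk: "ev ?z (ev (?f k) ?y) = k" if "transc k" for k
      proof -
        have tnz: "transc (ev k ?z)" by (rule evf[OF that z])
        have "ev (?f k) ?y = ev ?y (ev (ev k ?z) ?y)" by (rule ev_ev[OF y tnz, symmetric])
        also have "ev (ev k ?z) ?y = k" using ev_ev[OF that z, of ?y] unfolding zy ev_XX[OF that] by (rule sym)
        finally have "ev (?f k) ?y = ev ?y k" .
        then show ?thesis using ev_ev[OF z y, of k] unfolding zy ev_id by simp
      qed
      fix n n' assume nn: "n \<in> fibre R' R'" "n' \<in> fibre R' R'" "?f n = ?f n'"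
      have "n = ev ?z (ev (?f n) ?y)" by (rule bk[symmetric]) (use nn(1) in \<open>simp add: fibre_def\<close>)
      also have "\<dots> = n'" unfolding nn(3) by (rule bk) (use nn(2) in \<open>simp add: fibre_def\<close>)
      finally show "n = n'" .
    qed
  qed (rule fin)
qed

subsection \<open>Invariants\<close>

lemma rdeg_Fract_le:
  assumes "q \<noteq> 0" "p \<noteq> 0" shows "rdeg (Fract p q) \<le> max (Polynomial.degree p) (Polynomial.degree q)"
proof -
  let ?x = "Fract p q"
  have "Fract (num ?x) (den ?x) = Fract p q" by (rule num_den)
  then have e: "num ?x * q = p * den ?x" using eq_fract(1)[OF num_den(2) assms(1)] by blast
  then have "num ?x dvd p" using num_den(3)[of ?x] by (metis coprime_dvd_mult_left_iff dvd_triv_left)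
  moreover have "den ?x dvd q" using e num_den(3)[of ?x] by (metis coprime_commute coprime_dvd_mult_right_iff dvd_triv_right)
  ultimately have "Polynomial.degree (num ?x) \<le> Polynomial.degree p" "Polynomial.degree (den ?x) \<le> Polynomial.degree q"
    using assms by (simp_all add: dvd_imp_degree_le)
  then show ?thesis unfolding rdeg_def by (rule max.mono)
qed

text \<open>Both fibre polynomials vanish on \<open>fibre R R\<close>, which has as many elements as
  their degree, so they are proportional. A quotient of two of their coefficients is a Moebius
  transform of R on one side and of J on the other.\<close>

lemma invariant_moebius:
  assumes R: "R \<notin> range of_rat" and J: "J \<notin> range of_rat"
    and fin: "finite (fibre R R)" and card: "card (fibre R R) = rdeg R"
    and sub: "fibre R R \<subseteq> fibre J J" and deg: "rdeg J \<le> rdeg R"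
  shows "\<exists>M. dt M \<noteq> 0 \<and> J = ev R (mob M)"
proof -
  have tR: "transc R" and tJ: "transc J" using R J poly_fract_transc by blast+
  let ?P = "fibre_poly R R" and ?Q = "fibre_poly J J"
  note P = fibre_poly_degree[OF R tR] and Q = fibre_poly_degree[OF J tJ]
  have root: "poly ?P g = 0 \<and> poly ?Q g = 0" if "g \<in> fibre R R" for g
    using that sub fibre_iff[OF tR] fibre_iff[OF tJ] by blast
  have small: "T = 0" if T: "\<And>g. g \<in> fibre R R \<Longrightarrow> poly T g = 0" "T = 0 \<or> Polynomial.degree T < rdeg R" for T
  proof (rule ccontr)
    assume T0: "T \<noteq> 0"
    have "card (fibre R R) \<le> card {x. poly T x = 0}"
      using T(1) poly_roots_finite[OF T0] by (intro card_mono) auto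
    also have "\<dots> \<le> Polynomial.degree T" by (rule card_poly_roots_bound[OF T0])
    finally show False using T(2) T0 card by simp
  qed
  have dQ: "Polynomial.degree ?Q = rdeg R"
  proof (rule ccontr)
    assume "\<not> ?thesis"
    then have "Polynomial.degree ?Q < rdeg R" using Q(1) deg by simp
    then have "?Q = 0" using small[of ?Q] root by blast
    then show False using Q(2) by simp
  qed
  define l l' where "l = lead_coeff ?P" and "l' = lead_coeff ?Q"
  have l: "l \<noteq> 0" "l' \<noteq> 0" using P(2) Q(2) by (simp_all add: l_def l'_def)
  let ?T = "Polynomial.smult l ?Q - Polynomial.smult l' ?P"
  have "?T = 0"
  proof (rule small)
    show "poly ?T g = 0" if "g \<in> fibre R R" for g using root[OF that] by simp
    have le: "Polynomial.degree ?T \<le> rdeg R" using P(1) dQ by (intro degree_diff_le) auto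
    have c: "Polynomial.coeff ?T (rdeg R) = 0" using P(1) dQ by (simp add: l_def l'_def)
    show "?T = 0 \<or> Polynomial.degree ?T < rdeg R"
    proof (cases "Polynomial.degree ?T = rdeg R")
      case True
      then have "lead_coeff ?T = 0" using c by simp
      then show ?thesis by (metis leading_coeff_0_iff)
    next
      case False then show ?thesis using le by simp
    qed
  qed
  then have "Polynomial.smult l ?Q = Polynomial.smult l' ?P" by (simp only: eq_iff_diff_eq_0[symmetric])
  then have prp: "l * Polynomial.coeff ?Q i = l' * Polynomial.coeff ?P i" for i
    by (simp only: coeff_smult[symmetric])
  \<comment> \<open>Two coefficient positions whose quotient is a nondegenerate transform of R exist
    because numerator and denominator are linearly independent.\<close>
  have "\<exists>i j. Polynomial.coeff (num R) i * Polynomial.coeff (den R) j - Polynomial.coeff (num R) j * Polynomial.coeff (den R) i \<noteq> 0"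
  proof (rule ccontr)
    assume c: "\<not> ?thesis"
    obtain j where j: "Polynomial.coeff (den R) j \<noteq> 0" using num_den(2) by (metis leading_coeff_0_iff)
    have "Polynomial.smult (Polynomial.coeff (den R) j) (num R) = Polynomial.smult (Polynomial.coeff (num R) j) (den R)"
      by (rule poly_eqI) (use c in \<open>simp add: mult.commute\<close>)
    then show False using num_den_indep[OF R] j by blast
  qed
  then obtain i j where ij: "Polynomial.coeff (num R) i * Polynomial.coeff (den R) j - Polynomial.coeff (num R) j * Polynomial.coeff (den R) i \<noteq> 0" by blast
  define M1 where "M1 = (- Polynomial.coeff (den R) i, Polynomial.coeff (num R) i, - Polynomial.coeff (den R) j, Polynomial.coeff (num R) j)"
  define M2 where "M2 = (- Polynomial.coeff (den J) i, Polynomial.coeff (num J) i, - Polynomial.coeff (den J) j, Polynomial.coeff (num J) j)"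
  have d1: "dt M1 \<noteq> 0" using ij by (simp add: M1_def algebra_simps)
  have lin: "of_rat (- Polynomial.coeff (den x) k) * x + of_rat (Polynomial.coeff (num x) k) = Polynomial.coeff (fibre_poly x x) k" for x k
    by (simp add: coeff_fibre_poly of_rat_minus mult.commute)
  have cd1: "- Polynomial.coeff (den R) j \<noteq> 0 \<or> Polynomial.coeff (num R) j \<noteq> 0" using ij by auto
  have Pj: "Polynomial.coeff ?P j \<noteq> 0" using of_rat_lin_nz[OF tR cd1] unfolding lin .
  have Qj: "Polynomial.coeff ?Q j \<noteq> 0" using prp[of j] Pj l by auto
  then have cd2: "- Polynomial.coeff (den J) j \<noteq> 0 \<or> Polynomial.coeff (num J) j \<noteq> 0" by (auto simp: coeff_fibre_poly)
  have e1: "ev R (mob M1) = Polynomial.coeff ?P i / Polynomial.coeff ?P j"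
    unfolding M1_def mob.simps ev_moebius[OF tR cd1] lin ..
  have e2: "ev J (mob M2) = Polynomial.coeff ?Q i / Polynomial.coeff ?Q j"
    unfolding M2_def mob.simps ev_moebius[OF tJ cd2] lin ..
  have e: "ev R (mob M1) = ev J (mob M2)"
  proof -
    have "Polynomial.coeff ?P i * Polynomial.coeff ?Q j * (l * l') = (l' * Polynomial.coeff ?P i) * (l * Polynomial.coeff ?Q j)"
      by (simp only: ac_simps)
    also have "\<dots> = Polynomial.coeff ?Q i * Polynomial.coeff ?P j * (l * l')"
      unfolding prp[of i, symmetric] prp[of j] by (simp only: ac_simps)
    finally have "Polynomial.coeff ?P i * Polynomial.coeff ?Q j = Polynomial.coeff ?Q i * Polynomial.coeff ?P j"
      using l by simp
    then show ?thesis unfolding e1 e2 frac_eq_eq[OF Pj Qj] .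
  qed
  have t1: "transc (ev R (mob M1))" using transc_fhom[OF fhom_ev[OF tR]] mob_nonrat(2)[OF d1] by blast
  \<comment> \<open>A degenerate M2 would make the quotient a rational constant, although it is a
    Moebius transform of the nonconstant R.\<close>
  have d2: "dt M2 \<noteq> 0"
  proof
    assume "dt M2 = 0"
    define c d where "c = - Polynomial.coeff (den J) j" and "d = Polynomial.coeff (num J) j"
    define a b where "a = - Polynomial.coeff (den J) i" and "b = Polynomial.coeff (num J) i"
    have z: "a * d = b * c" using \<open>dt M2 = 0\<close> by (simp add: M2_def a_def b_def c_def d_def)
    have "\<exists>r. a = r * c \<and> b = r * d"
    proof (cases "c = 0")
      case True
      then have "d \<noteq> 0" using cd2 by (simp add: c_def d_def)
      then show ?thesis using z True by (intro exI[of _ "b / d"]) simp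
    next
      case False
      then show ?thesis using z by (intro exI[of _ "a / c"]) (simp add: field_simps)
    qed
    then obtain r where r: "a = r * c" "b = r * d" by blast
    have "Polynomial.coeff ?Q i = of_rat r * Polynomial.coeff ?Q j"
      unfolding lin[symmetric] a_def[symmetric] b_def[symmetric] c_def[symmetric] d_def[symmetric] r
      by (simp add: of_rat_mult algebra_simps)
    then have "ev J (mob M2) = of_rat r" using Qj by (simp add: e2)
    then show False using t1 transc_nonrat e by (metis rangeI)
  qed
  have d2': "dt (adj M2) \<noteq> 0" using d2 by (simp add: dt_adj)
  have "J = ev J (ev (mob M2) (mob (adj M2)))" by (simp add: mob_adj(2)[OF d2] ev_XX[OF tJ])
  also have "\<dots> = ev (ev J (mob M2)) (mob (adj M2))" by (rule ev_ev[OF tJ mob_nonrat(2)[OF d2]])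
  also have "\<dots> = ev R (ev (mob M1) (mob (adj M2)))" unfolding e[symmetric] by (rule ev_ev[OF tR mob_nonrat(2)[OF d1], symmetric])
  also have "\<dots> = ev R (mob (mm (adj M2) M1))" by (simp only: ev_mob_mob[OF d2' d1])
  finally show ?thesis using d1 d2' by (intro exI[of _ "mm (adj M2) M1"]) (simp add: dt_mm)
qed

lemma XX_nz: "p \<noteq> 0 \<Longrightarrow> qev p XX \<noteq> 0"
  using transc_XX by (auto simp: transc_def)

lemma XX_facts: "XX \<noteq> 0" "XX + 1 \<noteq> 0" "1 + XX \<noteq> 0" "1 + XX + XX ^ 2 \<noteq> 0"
  using XX_nz[of "[:0, 1:]"] XX_nz[of "[:1, 1:]"] XX_nz[of "[:1, 1, 1:]"]
  by (simp_all add: rhom.mp_pCons[OF rhom_of_rat] add.commute power2_eq_square algebra_simps)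

definition J2 :: "rat poly fract" where "J2 = Fract [:0, 0, 1:] 1"
text \<open>The sum of the orbit of -X under X |-> -1/(1 + X).\<close>

definition J3 :: "rat poly fract" where "J3 = Fract [:1, 3, 0, - 1:] [:0, 1, 1:]"
text \<open>Up to sign and X |-> -X, the classical invariant (x^2 - x + 1)^3 / (x^2 (1 - x)^2) of
  the anharmonic group; \<open>ev_J6\<close> gives the factored form.\<close>

definition J6 :: "rat poly fract" where "J6 = Fract [:- 1, - 3, - 6, - 7, - 6, - 3, - 1:] [:0, 0, 1, 2, 1:]"

lemma ev_J2: "transc x \<Longrightarrow> ev x J2 = (x :: 'a::field_char_0) ^ 2"
  by (simp add: J2_def ev_Fract rhom.mp_pCons[OF rhom_of_rat] rhom.mp_1[OF rhom_of_rat] power2_eq_square)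

lemma ev_J3:
  assumes "transc (x :: 'a::field_char_0)" shows "ev x J3 = (1 + 3 * x - x ^ 3) / (x * (1 + x))"
proof -
  have "ev x J3 = (1 + x * (3 + x * (x * - 1))) / (x * (1 + x))"
    unfolding J3_def by (subst ev_Fract[OF assms]) (simp_all add: rhom.mp_pCons[OF rhom_of_rat] rhom.numeral[OF rhom_of_rat] rhom.neg[OF rhom_of_rat])
  then show ?thesis by (simp add: power3_eq_cube algebra_simps)
qed

lemma ev_J6:
  assumes "transc (x :: 'a::field_char_0)" shows "ev x J6 = - ((1 + x + x ^ 2) ^ 3) / (x * (1 + x)) ^ 2"
proof -
  have "ev x J6 = (- 1 + x * (- 3 + x * (- 6 + x * (- 7 + x * (- 6 + x * (- 3 + x * - 1)))))) / (x * (x * (1 + x * (2 + x))))"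
    unfolding J6_def by (subst ev_Fract[OF assms]) (simp_all add: rhom.mp_pCons[OF rhom_of_rat] rhom.numeral[OF rhom_of_rat] rhom.neg[OF rhom_of_rat])
  moreover have "- 1 + x * (- 3 + x * (- 6 + x * (- 7 + x * (- 6 + x * (- 3 + x * - 1))))) = - ((1 + x + x ^ 2) ^ 3)"
    by (simp add: power2_eq_square power3_eq_cube algebra_simps)
  moreover have "x * (x * (1 + x * (2 + x))) = (x * (1 + x)) ^ 2" by (simp add: power2_eq_square algebra_simps)
  ultimately show ?thesis by simp
qed

subsection \<open>The three families\<close>

lemma invJ:
  "ev (mob (- 1, 0, 0, 1)) J2 = J2" "ev (mob (0, - 1, 1, 1)) J3 = J3"
  "ev (mob (0, - 1, 1, 1)) J6 = J6" "ev (mob (0, 1, 1, 0)) J6 = J6"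
proof -
  note X = XX_facts
  have m: "mob (- 1, 0, 0, 1) = - XX" "mob (0, - 1, 1, 1) = - 1 / (1 + XX)" "mob (0, 1, 1, 0) = 1 / XX"
    by (simp_all add: moebius_fraction add.commute)
  have t: "transc (mob (- 1, 0, 0, 1))" "transc (mob (0, - 1, 1, 1))" "transc (mob (0, 1, 1, 0))"
    by (rule mob_nonrat(2), simp)+
  have J: "J2 = XX ^ 2" "J3 = (1 + 3 * XX - XX ^ 3) / (XX * (1 + XX))" "J6 = - ((1 + XX + XX ^ 2) ^ 3) / (XX * (1 + XX)) ^ 2"
    using ev_J2[OF transc_XX] ev_J3[OF transc_XX] ev_J6[OF transc_XX] by (simp_all add: ev_id)
  show "ev (mob (- 1, 0, 0, 1)) J2 = J2" unfolding ev_J2[OF t(1)] unfolding m J by simp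
  \<comment> \<open>In y = 1 + X the substitution is -1/y, and 1 - 1/y = (y - 1)/y, so only powers
    of y and y - 1 occur in denominators.\<close>
  define y where "y = 1 + XX"
  have x: "XX = y - 1" by (simp add: y_def)
  have y: "y \<noteq> 0" "y - 1 \<noteq> 0" using X by (simp_all add: y_def)
  have a: "1 + - 1 / y = (y - 1) / y" using y by (simp add: field_simps)
  have b: "1 + - 1 / y + (- 1 / y) ^ 2 = (1 + (y - 1) + (y - 1) ^ 2) / y ^ 2" using y by (simp add: field_simps power2_eq_square)
  have p: "(- 1 / y) * ((y - 1) / y) = - (y - 1) / y ^ 2"
    by (simp only: times_divide_times_eq power2_eq_square mult_minus_left mult_1_left)
  have c: "1 + 3 * (- 1 / y) - (- 1 / y) ^ 3 = (y ^ 3 - 3 * y ^ 2 + 1) / y ^ 3" using y by (simp add: field_simps power2_eq_square power3_eq_cube)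
  show "ev (mob (0, - 1, 1, 1)) J3 = J3"
  proof -
    have "(y ^ 3 - 3 * y ^ 2 + 1) / y ^ 3 / (- (y - 1) / y ^ 2) = - (y ^ 3 - 3 * y ^ 2 + 1) / ((y - 1) * y)"
      using y by (simp add: divide_simps) (simp add: power2_eq_square power3_eq_cube algebra_simps)
    moreover have "- (y ^ 3 - 3 * y ^ 2 + 1) = 1 + 3 * (y - 1) - (y - 1) ^ 3" by (simp add: power2_eq_square power3_eq_cube algebra_simps)
    ultimately show ?thesis unfolding ev_J3[OF t(2)] unfolding m J(2) y_def[symmetric] unfolding a p c unfolding x by simp
  qed
  show "ev (mob (0, - 1, 1, 1)) J6 = J6"
  proof -
    have "- (((1 + (y - 1) + (y - 1) ^ 2) / y ^ 2) ^ 3) / (- (y - 1) / y ^ 2) ^ 2 = - ((1 + (y - 1) + (y - 1) ^ 2) ^ 3) / ((y - 1) * y) ^ 2"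
    proof -
      define q where "q = 1 + (y - 1) + (y - 1) ^ 2"
      have "- ((q / y ^ 2) ^ 3) / (- (y - 1) / y ^ 2) ^ 2 = - (q ^ 3) / ((y - 1) * y) ^ 2"
        using y by (simp add: power_divide power_mult_distrib divide_simps flip: power_mult) (simp add: algebra_simps power_numeral_reduce)
      then show ?thesis by (simp only: q_def)
    qed
    then show ?thesis unfolding ev_J6[OF t(2)] unfolding m J(3) y_def[symmetric] unfolding b unfolding a p unfolding x by simp
  qed
  show "ev (mob (0, 1, 1, 0)) J6 = J6"
  proof -
    have "1 + 1 / XX + (1 / XX) ^ 2 = (1 + XX + XX ^ 2) / XX ^ 2" "1 / XX * (1 + 1 / XX) = (1 + XX) / XX ^ 2"
      using X(1) by (simp_all add: field_simps power2_eq_square)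
    moreover have "- ((q / XX ^ 2) ^ 3) / ((1 + XX) / XX ^ 2) ^ 2 = - (q ^ 3) / (XX * (1 + XX)) ^ 2" for q
      using X by (simp add: power_divide power_mult_distrib divide_simps flip: power_mult)
    ultimately show ?thesis unfolding ev_J6[OF t(3)] unfolding m J(3) by simp
  qed
qed

lemma rdeg_J: "rdeg J2 \<le> 2" "rdeg J3 \<le> 3" "rdeg J6 \<le> 6"
  using rdeg_Fract_le[of 1 "[:0, 0, 1:]"] rdeg_Fract_le[of "[:0, 1, 1:]" "[:1, 3, 0, - 1:]"]
    rdeg_Fract_le[of "[:0, 0, 1, 2, 1:]" "[:- 1, - 3, - 6, - 7, - 6, - 3, - 1:]"]
  by (simp_all add: J2_def J3_def J6_def)

lemma Fract_nonrat:
  fixes p q :: "rat poly"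
  assumes "q \<noteq> 0" "Polynomial.degree p > Polynomial.degree q" shows "Fract p q \<notin> range of_rat"
proof
  assume "Fract p q \<in> range of_rat"
  then obtain r where r: "Fract p q = of_rat r" by blast
  have "of_rat r = to_fract [:r:]" using to_fract_qev[of "[:r:]"] by (simp add: rhom.mp_pCons[OF rhom_of_rat])
  then have "Fract p q = Fract [:r:] 1" using r by (simp add: to_fract_def)
  then have "p = Polynomial.smult r q" using eq_fract(1)[OF assms(1), of 1 p "[:r:]"] by simp
  then show False using assms(2) degree_smult_le[of r q] by simp
qed

lemma J_nonrat: "J2 \<notin> range of_rat" "J3 \<notin> range of_rat" "J6 \<notin> range of_rat"
  unfolding J2_def J3_def J6_def by (rule Fract_nonrat; simp)+

lemma model_cubic:
  assumes R: "transc R" and e: "ev R (- \<mu>2) = a + b + c" "ev R \<mu>1 = a * b + a * c + b * c" "ev R (- \<mu>0) = a * b * c"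
    and g: "XX \<in> gen {a, b, c}"
  shows "model [:\<mu>0, \<mu>1, \<mu>2, 1:] R [a, b, c]"
proof -
  interpret fhom "ev R" by (rule fhom_ev[OF R])
  have "ev R \<mu>2 = - (a + b + c)" "ev R \<mu>0 = - (a * b * c)" using e neg[of \<mu>2] neg[of \<mu>0] by (simp_all add: eq_neg_iff_add_eq_0 minus_equation_iff)
  then have "map_poly (ev R) [:\<mu>0, \<mu>1, \<mu>2, 1:] = (\<Prod>b\<leftarrow>[a, b, c]. [:- b, 1:])"
    using e(2) by (simp add: algebra_simps)
  moreover have "gen (insert R (set [a, b, c])) = UNIV"
  proof -
    have "XX \<in> gen (insert R {a, b, c})" using g gen_mono[of "{a, b, c}" "insert R {a, b, c}"] by blast
    then have "gen {XX} \<subseteq> gen (insert R {a, b, c})" by (intro gen_least) simp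
    then show ?thesis unfolding gen_XX by (simp add: top.extremum_uniqueI)
  qed
  ultimately show ?thesis using transc_nonrat[OF R] by (simp add: model_def)
qed

text \<open>The orbit of -X under X |-> -1/(1 + X).\<close>

definition cs3 :: "rat poly fract list" where "cs3 = [- XX, 1 / (1 + XX), (1 + XX) / XX]"
text \<open>The roots are sought as y times X, 1 and -(1 + X), which sum to zero. With q = 1 + X +
  X^2 and s = X (1 + X) their symmetric functions are e_2 = -q y^2 and e_3 = -s y^3. The shape Y^3 +
  \<mu> Y + \<mu> requires e_2 = -e_3, so y = -q/s.\<close>

definition y6 :: "rat poly fract" where "y6 = - (1 + XX + XX ^ 2) / (XX * (1 + XX))"
definition cs6 :: "rat poly fract list" where "cs6 = [XX * y6, y6, - (1 + XX) * y6]"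

lemma model_families:
  assumes R: "transc R"
  shows "ev R \<mu> = J2 \<Longrightarrow> model [:- \<mu>, 0, 1:] R [XX, - XX]"
    and "ev R \<mu> = J3 \<Longrightarrow> model [:1, \<mu> - 3, - \<mu>, 1:] R cs3"
    and "ev R \<mu> = J6 \<Longrightarrow> model [:\<mu>, \<mu>, 0, 1:] R cs6"
proof -
  interpret fhom "ev R" by (rule fhom_ev[OF R])
  note X = XX_facts
  have J: "J2 = XX ^ 2" "J3 = (1 + 3 * XX - XX ^ 3) / (XX * (1 + XX))" "J6 = - ((1 + XX + XX ^ 2) ^ 3) / (XX * (1 + XX)) ^ 2"
    using ev_J2[OF transc_XX] ev_J3[OF transc_XX] ev_J6[OF transc_XX] by (simp_all add: ev_id)
  show "model [:- \<mu>, 0, 1:] R [XX, - XX]" if "ev R \<mu> = J2"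
  proof -
    have "map_poly (ev R) [:- \<mu>, 0, 1:] = (\<Prod>b\<leftarrow>[XX, - XX]. [:- b, 1:])"
      using that by (simp add: neg J power2_eq_square)
    moreover have "gen (insert R (set [XX, - XX])) = UNIV"
    proof -
      have "gen {XX} \<subseteq> gen (insert R (set [XX, - XX]))" by (rule gen_mono) simp
      then show ?thesis unfolding gen_XX by (rule top.extremum_uniqueI)
    qed
    ultimately show ?thesis using transc_nonrat[OF R] by (simp add: model_def)
  qed
  show "model [:1, \<mu> - 3, - \<mu>, 1:] R cs3" if "ev R \<mu> = J3"
    unfolding cs3_def
  proof (rule model_cubic[OF R])
    show "XX \<in> gen {- XX, 1 / (1 + XX), (1 + XX) / XX}"
      using gen.neg[OF gen.incl[of "- XX"]] by simp
    show "ev R (- (- \<mu>)) = - XX + 1 / (1 + XX) + (1 + XX) / XX"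
      using X by (simp add: that J divide_simps) (simp add: power3_eq_cube algebra_simps)
    show "ev R (\<mu> - 3) = - XX * (1 / (1 + XX)) + - XX * ((1 + XX) / XX) + 1 / (1 + XX) * ((1 + XX) / XX)"
      using X by (simp add: diff that J divide_simps) (simp add: power3_eq_cube algebra_simps)
    show "ev R (- 1) = - XX * (1 / (1 + XX)) * ((1 + XX) / XX)" using X by (simp add: neg)
  qed
  show "model [:\<mu>, \<mu>, 0, 1:] R cs6" if e: "ev R \<mu> = J6"
    unfolding cs6_def
  proof (rule model_cubic[OF R])
    define q s where "q = 1 + XX + XX ^ 2" and "s = XX * (1 + XX)"
    have qs: "q \<noteq> 0" "s \<noteq> 0" using X by (simp_all add: q_def s_def)
    have y: "y6 = - q / s" by (simp add: y6_def q_def s_def)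
    have Jq: "J6 = - (q ^ 3) / s ^ 2" by (simp add: J q_def s_def)
    have y0: "y6 \<noteq> 0" using qs by (simp add: y)
    have "XX * y6 / y6 \<in> gen {XX * y6, y6, - (1 + XX) * y6}" by (intro gen_divide gen.incl) simp_all
    then show "XX \<in> gen {XX * y6, y6, - (1 + XX) * y6}" using y0 by simp
    show "ev R (- 0) = XX * y6 + y6 + - (1 + XX) * y6" by (simp add: algebra_simps)
    have "XX * y6 * y6 + XX * y6 * (- (1 + XX) * y6) + y6 * (- (1 + XX) * y6) = - (q * y6 ^ 2)"
      by (simp add: q_def power2_eq_square algebra_simps)
    also have "\<dots> = J6" using qs by (simp add: y Jq power2_eq_square power3_eq_cube)
    finally show "ev R \<mu> = XX * y6 * y6 + XX * y6 * (- (1 + XX) * y6) + y6 * (- (1 + XX) * y6)" using e by simp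
    have "XX * y6 * y6 * (- (1 + XX) * y6) = - (s * y6 ^ 3)" by (simp add: s_def power3_eq_cube algebra_simps)
    also have "\<dots> = - J6" using qs by (simp add: y Jq power2_eq_square power3_eq_cube)
    finally show "ev R (- \<mu>) = XX * y6 * y6 * (- (1 + XX) * y6)" using e by (simp add: neg)
  qed
qed

text \<open>Once F is identified with Q(X) over Q(T), every model with the same R describes F. In
  this way the listed polynomial takes the place of P.\<close>

lemma model_splitting_field:
  fixes F :: "'f ring"
  assumes F: "field F" and f: "f \<in> ring_hom ring_of_type_algebra F" and r: "range f = carrier F"
    and i: "\<And>x. f (ev R x) = \<iota> x" and m: "model C R cs"
  shows "splitting_field QT F \<iota> (coeff_list C)"
proof -
  interpret F: field F by fact
  have tR: "transc R" by (rule model_transc[OF m])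
  have "(\<lambda>x. f (ev R x)) \<in> ring_hom QT F" using ring_hom_trans[OF fhom_ring_hom[OF fhom_ev[OF tR]] f] by (simp add: o_def)
  then have ih: "\<iota> \<in> ring_hom QT F" by (simp add: i)
  note mr = model_record[OF F f m]
  have l: "map \<iota> (coeff_list C) = F.lin_prod (map f cs)" using mr(1) by (simp add: i)
  have c: "set (map f cs) \<subseteq> carrier F" using r by auto
  have fR: "f R = \<iota> XX" using i[of XX] by (simp add: ev_XX[OF tR])
  have sub: "\<iota> ` carrier QT \<union> set (map f cs) \<subseteq> carrier F" using c ring_hom_closed[OF ih] by auto
  have "carrier F = generate_field F (insert (f R) (f ` set cs))" using mr(2) r by simp
  also have "\<dots> \<subseteq> generate_field F (\<iota> ` carrier QT \<union> set (map f cs))"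
    by (rule F.mono_generate_field) (use sub fR in auto)
  finally have "generate_field F (\<iota> ` carrier QT \<union> set (map f cs)) = carrier F"
    using F.generate_field_in_carrier[OF sub] by blast
  then show ?thesis unfolding splitting_field_def field_extension_def l
    using F ih field_from_type_algebra F.lin_prod_splitted[OF c] F.lin_prod(4)[OF c] by (simp only: set_mset_mset simp_thms)
qed

subsection \<open>The Galois group\<close>

text \<open>Each g with R(g) = R gives the automorphism X |-> g of F over Q(T), and distinct g give
  distinct automorphisms.\<close>

lemma card_fibre_le_galois:
  fixes F :: "'f ring" and G :: "'g monoid"
  assumes F: "field F" and f: "f \<in> ring_hom ring_of_type_algebra F" and r: "range f = carrier F"
    and i: "\<And>x. f (ev R x) = \<iota> x" and m: "model A R bs"
    and G: "galois_group QT F \<iota> \<cong> G" and fin: "finite (carrier G)"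
  shows "card (fibre R R) \<le> card (carrier G)"
proof -
  have tR: "transc R" by (rule model_transc[OF m])
  have inj: "inj f" using field_hom_inj_on[OF field_from_type_algebra F f] by simp
  have [simp]: "the_inv f (f x) = x" for x by (rule the_inv_f_f[OF inj])
  have feq: "f x = f y \<longleftrightarrow> x = y" for x y using inj by (simp add: inj_eq)
  define s where "s g = restrict (\<lambda>y. f (ev g (the_inv f y))) (carrier F)" for g
  have fc: "f x \<in> carrier F" for x using r by blast
  have sf: "s g (f x) = f (ev g x)" for g x by (simp add: s_def fc)
  have zs: "map_poly (ev R) A = (\<Prod>z\<leftarrow>bs. [:- z, 1:])" and gU: "gen (insert R (set bs)) = UNIV" using m by (simp_all add: model_def)
  have "s g \<in> carrier (galois_group QT F \<iota>)" if g: "g \<in> fibre R R" for g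
  proof -
    have tg: "transc g" and gR: "ev g R = R" using g by (auto simp: fibre_def)
    interpret g: fhom "ev g" by (rule fhom_ev[OF tg])
    \<comment> \<open>Surjectivity: every member of the fibre generates the same field, namely
      Q(X).\<close>
    have "gen {g} = UNIV" using model_fibre(3)[OF m tR zs g] gU by simp
    then have sur: "range (ev g) = UNIV" using gen_single[OF tg] by simp
    have "bij_betw (s g) (carrier F) (carrier F)"
      unfolding bij_betw_def
    proof
      show "inj_on (s g) (carrier F)" unfolding r[symmetric] by (rule inj_onI) (auto simp: sf feq)
      have "s g ` range f = range (\<lambda>x. f (ev g x))" by (auto simp: sf image_iff)
      also have "\<dots> = f ` range (ev g)" by blast
      finally show "s g ` carrier F = carrier F" by (simp add: sur r)
    qed
    then have "s g \<in> Bij (carrier F)" by (simp add: Bij_def s_def)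
    moreover have "s g \<in> ring_hom F F"
    proof (rule ring_hom_memI)
      fix x y assume "x \<in> carrier F" "y \<in> carrier F"
      then obtain x' y' where xy: "x = f x'" "y = f y'" using r by (metis imageE)
      show "s g x \<in> carrier F" by (simp add: xy sf fc)
      have sm: "s g (f a \<otimes>\<^bsub>F\<^esub> f b) = f (ev g (a * b))" "s g (f a \<oplus>\<^bsub>F\<^esub> f b) = f (ev g (a + b))" for a b
        using ring_hom_mult[OF f, of a b] ring_hom_add[OF f, of a b] sf[of g "a * b"] sf[of g "a + b"] by simp_all
      show "s g (x \<otimes>\<^bsub>F\<^esub> y) = s g x \<otimes>\<^bsub>F\<^esub> s g y"
        using ring_hom_mult[OF f, of "ev g x'" "ev g y'"] by (simp add: xy sf sm g.mult)
      show "s g (x \<oplus>\<^bsub>F\<^esub> y) = s g x \<oplus>\<^bsub>F\<^esub> s g y"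
        using ring_hom_add[OF f, of "ev g x'" "ev g y'"] by (simp add: xy sf sm g.add)
    next
      show "s g \<one>\<^bsub>F\<^esub> = \<one>\<^bsub>F\<^esub>" using ring_hom_one[OF f] sf[of g 1] by simp
    qed
    moreover have "s g (\<iota> x) = \<iota> x" for x
      using sf[of g "ev R x"] ev_ev[OF tg tR, of x] by (simp add: i gR)
    ultimately show ?thesis by (simp add: galois_group_def)
  qed
  moreover have "inj_on s (fibre R R)"
  proof (rule inj_onI)
    fix g h assume gh: "g \<in> fibre R R" "h \<in> fibre R R" "s g = s h"
    then have "f (ev g XX) = f (ev h XX)" using sf[of g XX] sf[of h XX] by simp
    then show "g = h" using gh by (simp add: feq ev_XX fibre_def)
  qed
  moreover have "card (carrier (galois_group QT F \<iota>)) = card (carrier G)" "finite (carrier (galois_group QT F \<iota>))"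
    using G fin unfolding is_iso_def iso_def by (auto simp: bij_betw_same_card bij_betw_finite)
  ultimately show ?thesis by (metis card_inj_on_le image_subsetI)
qed

text \<open>Let w be a root of R(w) = t in E_0. As t is fixed, \<open>act g w\<close> is again a
  root, and all roots generate the same subfield, so it is a rational function \<gamma> g of w with
  R(\<gamma> g) = R. The group acts faithfully on Q(w), and the bound on the fibre makes \<gamma>
  bijective.\<close>

lemma (in regular) fibre_action:
  assumes t: "t \<in> Fix" "transc t" and zs: "map_poly (\<lambda>p. qev p t) P = (\<Prod>z\<leftarrow>zs. [:- z, 1:])"
    and gn: "gen (Fix \<union> set zs) = UNIV" and m: "model (fract_poly P) R bs"
    and le: "card (fibre R R) \<le> card (carrier G)"
  shows "\<exists>w \<gamma>. transc w \<and> bij_betw \<gamma> (carrier G) (fibre R R) \<and> (\<forall>g\<in>carrier G. act g w = ev w (\<gamma> g)) \<and>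
    (\<forall>g\<in>carrier G. \<forall>h\<in>carrier G. \<gamma> (g \<otimes> h) = ev (\<gamma> g) (\<gamma> h))"
proof -
  have tR: "transc R" by (rule model_transc[OF m])
  have P0: "ev t 0 = 0" using fhom_ev[OF t(2)] by (simp add: fhom_def rhom.zero)
  have zs': "map_poly (ev t) (fract_poly P) = (\<Prod>z\<leftarrow>zs. [:- z, 1:])"
    unfolding zs[symmetric] by (rule poly_eqI) (simp add: coeff_map_poly P0 ev_to_fract[OF t(2)])
  note mf = model_fibre[OF m t(2) zs']
  have mR: "map_poly (ev R) (fract_poly P) = (\<Prod>z\<leftarrow>bs. [:- z, 1:])" using m by (simp add: model_def)
  note mfR = model_fibre[OF m tR mR]
  have "card (fibre R t) > 0" using mf(2) rdeg_pos[OF transc_nonrat[OF tR]] by simp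
  then have "fibre R t \<noteq> {}" by auto
  then obtain w where w: "w \<in> fibre R t" by blast
  have tw: "transc w" and wR: "ev w R = t" using w by (auto simp: fibre_def)
  interpret w: fhom "ev w" by (rule fhom_ev[OF tw])
  have gw: "gen {w} = gen (insert t (set zs))" using mf(3)[OF w] by blast
  have sw: "act g w \<in> fibre R t" if g: "g \<in> carrier G" for g
  proof -
    have "act g t = t" using t(1) g by (simp add: Fix_def)
    then have "ev (act g w) R = t" using fhom_evc[OF hom[OF g] tw, of R] unfolding wR by simp
    moreover have "transc (act g w)" using transc_fhom[OF hom[OF g]] tw by simp
    ultimately show ?thesis by (simp add: fibre_def)
  qed
  have "\<exists>x. act g w = ev w x" if g: "g \<in> carrier G" for g
  proof -
    have "act g w \<in> gen {act g w}" by (simp add: gen.incl)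
    also have "gen {act g w} = gen {w}" using mf(3)[OF sw[OF g]] gw by simp
    finally show ?thesis using gen_single[OF tw] by auto
  qed
  note ex = this
  define \<gamma> where "\<gamma> g = (SOME x. act g w = ev w x)" for g
  have \<gamma>: "act g w = ev w (\<gamma> g)" if "g \<in> carrier G" for g unfolding \<gamma>_def by (rule someI_ex[OF ex[OF that]])
  have t\<gamma>: "transc (\<gamma> g)" if g: "g \<in> carrier G" for g
    using sw[OF g] transc_fhom[OF fhom_ev[OF tw], of "\<gamma> g"] \<gamma>[OF g] by (simp add: fibre_def)
  have \<gamma>R: "\<gamma> g \<in> fibre R R" if g: "g \<in> carrier G" for g
  proof -
    have "ev w (ev (\<gamma> g) R) = ev (ev w (\<gamma> g)) R" by (rule ev_ev[OF tw t\<gamma>[OF g]])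
    also have "\<dots> = ev w R" using sw[OF g] \<gamma>[OF g] wR by (simp add: fibre_def)
    finally show ?thesis using t\<gamma>[OF g] by (simp add: fibre_def)
  qed
  \<comment> \<open>Agreement at w means agreement on the roots \<open>zs\<close>, which lie in Q(w)
    and generate E_0 together with the fixed field.\<close>
  have inj: "inj_on \<gamma> (carrier G)"
  proof (rule inj_onI)
    fix g h assume gh: "g \<in> carrier G" "h \<in> carrier G" "\<gamma> g = \<gamma> h"
    then have e: "act g w = act h w" using \<gamma>[of g] \<gamma>[of h] by simp
    have ag: "act g x = act h x" if "x \<in> gen {w}" for x
      by (rule gen_agree[OF hom[OF gh(1)] hom[OF gh(2)] _ that]) (use e in simp)
    have agf: "act g x = act h x" if "x \<in> Fix \<union> set zs" for x
      using that
    proof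
      assume "x \<in> Fix" then show ?thesis using gh by (simp add: Fix_def)
    next
      assume "x \<in> set zs"
      then show ?thesis by (intro ag) (simp add: gw gen.incl)
    qed
    have "act g (to_fract (mvar (\<phi> \<one>))) = act h (to_fract (mvar (\<phi> \<one>)))"
      by (rule gen_agree[OF hom[OF gh(1)] hom[OF gh(2)], where S = "Fix \<union> set zs"]) (erule agf, simp add: gn)
    then show "g = h" by (rule faithful[OF gh(1,2)])
  qed
  have sub: "\<gamma> ` carrier G \<subseteq> fibre R R" using \<gamma>R by blast
  have "card (\<gamma> ` carrier G) = card (fibre R R)"
    using le card_image[OF inj] card_mono[OF mfR(1) sub] by simp
  then have "\<gamma> ` carrier G = fibre R R" by (rule card_subset_eq[OF mfR(1) sub])
  then have bij: "bij_betw \<gamma> (carrier G) (fibre R R)" using inj by (simp add: bij_betw_def)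
  have "\<gamma> (g \<otimes> h) = ev (\<gamma> g) (\<gamma> h)" if gh: "g \<in> carrier G" "h \<in> carrier G" for g h
  proof -
    have "ev w (\<gamma> (g \<otimes> h)) = act g (act h w)" using \<gamma>[of "g \<otimes> h"] comp[OF gh, of w] gh by simp
    also have "\<dots> = ev (act g w) (\<gamma> h)" unfolding \<gamma>[OF gh(2)] by (rule fhom_evc[OF hom[OF gh(1)] tw])
    also have "\<dots> = ev w (ev (\<gamma> g) (\<gamma> h))" unfolding \<gamma>[OF gh(1)] by (rule ev_ev[OF tw t\<gamma>[OF gh(1)], symmetric])
    finally show ?thesis by simp
  qed
  then show ?thesis using tw bij \<gamma> by (intro exI[of _ w] exI[of _ \<gamma>]) simp
qed

subsection \<open>Groups of order 2, 3 and 6\<close>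

lemma prime_order_iso:
  fixes G :: "('g, 'm) monoid_scheme" (structure)
  assumes "group G" "finite (carrier G)" "card (carrier G) = n" "prime n"
  shows "G \<cong> integer_mod_group n"
proof -
  interpret group G by fact
  have n: "n > 1" using prime_gt_1_nat[OF assms(4)] .
  have "carrier G \<noteq> {\<one>}" using assms(3) n by auto
  then obtain g where g: "g \<in> carrier G" "g \<noteq> \<one>" by blast
  have "ord g dvd n" using ord_dvd_group_order[OF g(1)] assms(3) by (simp add: Coset.order_def)
  moreover have "ord g \<noteq> 1" using ord_eq_1[OF g(1)] g(2) by simp
  ultimately have o: "ord g = n" using assms(4) by (metis prime_nat_iff)
  have gn: "g [^] n = \<one>" using pow_ord_eq_1[OF g(1)] o by simp
  have pm: "g [^] (k mod n) = g [^] k" for k :: nat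
  proof -
    have "g [^] k = g [^] (n * (k div n) + k mod n)" by simp
    also have "\<dots> = (g [^] n) [^] (k div n) \<otimes> g [^] (k mod n)" using g(1) by (simp add: nat_pow_mult nat_pow_pow)
    finally show ?thesis using g(1) gn by simp
  qed
  let ?f = "\<lambda>i::int. g [^] (nat i)"
  let ?Z = "integer_mod_group n"
  have cZ: "carrier ?Z = {0..<int n}" using n by (simp add: carrier_integer_mod_group)
  have hm: "?f \<in> hom ?Z G"
  proof (rule homI)
    fix x y assume xy: "x \<in> carrier ?Z" "y \<in> carrier ?Z"
    then have "nat ((x + y) mod int n) = (nat x + nat y) mod n" by (simp add: cZ nat_mod_distrib nat_add_distrib)
    then show "?f (x \<otimes>\<^bsub>?Z\<^esub> y) = ?f x \<otimes> ?f y" using g(1) by (simp add: pm nat_pow_mult)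
  qed (use g in simp)
  have "inj_on ?f (carrier ?Z)"
  proof (rule inj_onI)
    fix x y assume xy: "x \<in> carrier ?Z" "y \<in> carrier ?Z" "?f x = ?f y"
    have "nat x \<in> {0..ord g - 1}" "nat y \<in> {0..ord g - 1}" using xy by (auto simp: cZ o)
    then have "nat x = nat y" using ord_inj[OF g(1)] xy(3) by (auto dest: inj_onD)
    then show "x = y" using xy by (simp add: cZ eq_nat_nat_iff)
  qed
  moreover have "?f ` carrier ?Z \<subseteq> carrier G" using g by auto
  ultimately have "?f ` carrier ?Z = carrier G"
    using card_image[of ?f "carrier ?Z"] assms(2,3) by (intro card_subset_eq) (auto simp: cZ)
  then have "?f \<in> iso ?Z G" using hm \<open>inj_on ?f _\<close> by (simp add: iso_def bij_betw_def)
  then have "?Z \<cong> G" by (rule is_isoI)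
  then show ?thesis by (rule group.iso_sym[OF group_integer_mod_group])
qed

text \<open>A faithful action on three points embeds the group into the symmetric group, and the
  orders agree.\<close>

lemma permutation_iso_sym3:
  fixes G :: "('g, 'm) monoid_scheme" and c :: "nat \<Rightarrow> 'e"
  assumes G: "group G" and card: "card (carrier G) = 6" and cinj: "inj_on c {1..3}"
    and perm: "\<And>g. g \<in> carrier G \<Longrightarrow> s g ` (c ` {1..3}) = c ` {1..3}"
    and mult: "\<And>g h x. g \<in> carrier G \<Longrightarrow> h \<in> carrier G \<Longrightarrow> x \<in> c ` {1..3} \<Longrightarrow> s (g \<otimes>\<^bsub>G\<^esub> h) x = s g (s h x)"
    and faith: "\<And>g h. g \<in> carrier G \<Longrightarrow> h \<in> carrier G \<Longrightarrow> (\<And>x. x \<in> c ` {1..3} \<Longrightarrow> s g x = s h x) \<Longrightarrow> g = h"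
  shows "G \<cong> sym_group 3"
proof -
  define p where "p g i = (if i \<in> {1..3} then the_inv_into {1..3} c (s g (c i)) else i)" for g and i :: nat
  have cp: "c (p g i) = s g (c i)" and pin: "p g i \<in> {1..3}" if "g \<in> carrier G" "i \<in> {1..3}" for g i
  proof -
    have "s g (c i) \<in> c ` {1..3}" using perm[OF that(1)] that(2) by blast
    then show "c (p g i) = s g (c i)" "p g i \<in> {1..3}"
      using that(2) f_the_inv_into_f[OF cinj, of "s g (c i)"] the_inv_into_into[OF cinj, of "s g (c i)" "{1..3}"]
      by (simp_all add: p_def del: atLeastAtMost_iff One_nat_def)
  qed
  have pp: "p g permutes {1..3}" if g: "g \<in> carrier G" for g
  proof (rule bij_imp_permutes)
    have sub: "p g ` {1..3} \<subseteq> {1..3}" using pin[OF g] by blast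
    have "c ` (p g ` {1..3}) = s g ` c ` {1..3}" unfolding image_image by (rule image_cong[OF refl cp[OF g]])
    then have "c ` (p g ` {1..3}) = c ` {1..3}" using perm[OF g] by simp
    then have im: "p g ` {1..3} = {1..3}" using inj_on_image_eq_iff[OF cinj sub subset_refl] by simp
    then show "bij_betw (p g) {1..3} {1..3}" by (simp add: bij_betw_def eq_card_imp_inj_on)
  qed (auto simp: p_def)
  have hm: "p \<in> hom G (sym_group 3)"
  proof (rule homI)
    fix g h assume gh: "g \<in> carrier G" "h \<in> carrier G"
    interpret group G by fact
    have "p (g \<otimes>\<^bsub>G\<^esub> h) i = p g (p h i)" for i
    proof (cases "i \<in> {1..3}")
      case True
      have "c (p (g \<otimes>\<^bsub>G\<^esub> h) i) = c (p g (p h i))"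
        using cp pin gh True mult by (simp add: m_closed)
      then show ?thesis using cinj pin gh True by (auto dest: inj_onD)
    qed (auto simp: p_def)
    then show "p (g \<otimes>\<^bsub>G\<^esub> h) = p g \<otimes>\<^bsub>sym_group 3\<^esub> p h" by (auto simp: sym_group_def)
  qed (use pp in \<open>simp add: sym_group_def\<close>)
  have inj: "inj_on p (carrier G)"
  proof (rule inj_onI)
    fix g h assume gh: "g \<in> carrier G" "h \<in> carrier G" "p g = p h"
    show "g = h" by (rule faith[OF gh(1,2)]) (metis cp gh image_iff)
  qed
  have "finite (carrier (sym_group 3))" using finite_permutations[of "{1..3::nat}"] by (simp add: sym_group_def)
  moreover have "card (p ` carrier G) = card (carrier (sym_group 3))"
    using card_image[OF inj] card sym_group_card_carrier[of 3] by (simp add: fact_numeral)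
  moreover have "p ` carrier G \<subseteq> carrier (sym_group 3)" using hm by (auto simp: hom_def)
  ultimately have "p ` carrier G = carrier (sym_group 3)" by (intro card_subset_eq)
  then show ?thesis using hm inj by (auto simp: is_iso_def iso_def bij_betw_def)
qed

subsection \<open>From generic to the three families\<close>

lemma model_fibre_generator:
  assumes m: "model A R bs"
  shows "finite (fibre R R)" "card (fibre R R) = rdeg R" "g \<in> fibre R R \<Longrightarrow> gen {g} = UNIV"
proof -
  have mR: "map_poly (ev R) A = (\<Prod>z\<leftarrow>bs. [:- z, 1:])" and gU: "gen (insert R (set bs)) = UNIV" using m by (simp_all add: model_def)
  note mf = model_fibre[OF m model_transc[OF m] mR]
  show "finite (fibre R R)" "card (fibre R R) = rdeg R" by (rule mf)+
  show "gen {g} = UNIV" if "g \<in> fibre R R" using mf(3)[OF that] gU by simp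
qed

text \<open>The involution axiom is inherited from E_0: a transformation of order two in the fibre
  is \<gamma> g for some g with g g = 1, and \<open>involution_fixed_point\<close> applies with x =
  w.\<close>

lemma (in regular) fibre_moebius_group:
  assumes m: "model A R bs" and w: "transc w" and bij: "bij_betw \<gamma> (carrier G) (fibre R R)"
    and act: "\<And>g. g \<in> carrier G \<Longrightarrow> act g w = ev w (\<gamma> g)"
    and mult: "\<And>g h. g \<in> carrier G \<Longrightarrow> h \<in> carrier G \<Longrightarrow> \<gamma> (g \<otimes> h) = ev (\<gamma> g) (\<gamma> h)"
  shows "moebius_group (fibre R R)"
proof
  interpret w: fhom "ev w" by (rule fhom_ev[OF w])
  show "finite (fibre R R)" by (rule model_fibre_generator(1)[OF m])
  show "XX \<in> fibre R R" by (simp add: fibre_def transc_XX ev_id)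
  show "\<exists>M. dt M \<noteq> 0 \<and> g = mob M" if g: "g \<in> fibre R R" for g
  proof -
    have "transc g" using g by (simp add: fibre_def)
    from generator_moebius[OF this model_fibre_generator(3)[OF m g]]
    obtain a b c d where "a * d - b * c \<noteq> 0" "g = moebius a b c d" by blast
    then show ?thesis by (intro exI[of _ "(a, b, c, d)"]) simp
  qed
  show "ev g h \<in> fibre R R" if gh: "g \<in> fibre R R" "h \<in> fibre R R" for g h
  proof -
    have t: "transc g" "transc h" and e: "ev g R = R" "ev h R = R" using gh by (simp_all add: fibre_def)
    have "ev (ev g h) R = R" using ev_ev[OF t, of R] by (simp add: e)
    then show ?thesis using transc_fhom[OF fhom_ev[OF t(1)], of h] t(2) by (simp add: fibre_def)
  qed
  show "\<exists>p q. (p, q) \<noteq> (0, 0) \<and> p * (c * p + d * q) = q * (a * p + b * q)"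
    if n: "a * d - b * c \<noteq> 0" and e: "moebius a b c d \<in> fibre R R" and s: "ev (moebius a b c d) (moebius a b c d) = XX" for a b c d
  proof -
    obtain g where g: "g \<in> carrier G" "\<gamma> g = moebius a b c d" using bij e by (metis bij_betw_imp_surj_on imageE)
    have "ev w (\<gamma> \<one>) = ev w XX" using act[of \<one>] one_id[of w] by (simp add: ev_XX[OF w])
    then have g1: "\<gamma> \<one> = XX" by simp
    have "\<gamma> (g \<otimes> g) = \<gamma> \<one>" using mult[OF g(1) g(1)] by (simp add: g(2) s g1)
    then have gg: "g \<otimes> g = \<one>" using bij_betw_imp_inj_on[OF bij] g(1) by (auto dest: inj_onD)
    have cd: "c \<noteq> 0 \<or> d \<noteq> 0" using n by auto
    have "act g w * (of_rat c * w + of_rat d) = of_rat a * w + of_rat b"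
      using act[OF g(1)] ev_moebius[OF w cd, of a b] of_rat_lin_nz[OF w cd] by (simp add: g(2))
    from involution_fixed_point[OF g(1) gg this] show ?thesis .
  qed
qed

text \<open>The k listed transformations exhaust the fibre, so J is invariant under all of it. The
  degree of J does not exceed that of R, and \<open>invariant_moebius\<close> applies.\<close>

lemma fibre_subset_J:
  assumes "\<And>N. N \<in> set Ns \<Longrightarrow> dt N \<noteq> 0 \<and> mob N \<in> fibre R R \<and> ev (mob N) J = J"
    and R: "R \<notin> range of_rat" and J: "J \<notin> range of_rat"
    and fin: "finite (fibre R R)" and card: "card (fibre R R) = rdeg R"
    and le: "card (fibre R R) \<le> k" and deg: "rdeg J \<le> k"
    and k: "distinct (map mob Ns)" "length Ns = k"
  shows "card (fibre R R) = k \<and> (\<exists>M. dt M \<noteq> 0 \<and> J = ev R (mob M))"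
proof -
  have c: "card (set (map mob Ns)) = k" using k distinct_card by (metis length_map)
  have sub: "set (map mob Ns) \<subseteq> fibre R R" using assms(1) by auto
  have cf: "card (fibre R R) = k" using card_mono[OF fin sub] c le by simp
  then have e: "set (map mob Ns) = fibre R R" using c by (intro card_subset_eq[OF fin sub]) simp
  have "fibre R R \<subseteq> fibre J J" unfolding e[symmetric] using assms(1) mob_nonrat(2) by (auto simp: fibre_def)
  then have "\<exists>M. dt M \<noteq> 0 \<and> J = ev R (mob M)"
    using invariant_moebius[OF R J fin card] deg card cf by simp
  then show ?thesis using cf by blast
qed

lemma invariant_comp:
  assumes "dt M \<noteq> 0" "dt N \<noteq> 0" "mob M \<in> fibre R R" "mob N \<in> fibre R R" "ev (mob M) J = J" "ev (mob N) J = J"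
  shows "mob (mm N M) \<in> fibre R R" "ev (mob (mm N M)) J = J"
proof -
  have d: "dt (mm N M) \<noteq> 0" using assms by (simp add: dt_mm)
  have "ev (mob (mm N M)) x = ev (mob M) (ev (mob N) x)" for x
    using ev_ev[OF mob_nonrat(2)[OF assms(1)] mob_nonrat(2)[OF assms(2)], of x] ev_mob_mob[OF assms(2,1)] by simp
  then show "mob (mm N M) \<in> fibre R R" "ev (mob (mm N M)) J = J"
    using assms mob_nonrat(2)[OF d] by (simp_all add: fibre_def)
qed

text \<open>The groups generated by -X, by -1/(1+X), and by -1/(1+X) with 1/X.\<close>

lemma distinct_mobs:
  "distinct (map mob [(1, 0, 0, 1), (- 1, 0, 0, 1)])"
  "distinct (map mob [(1, 0, 0, 1), (0, - 1, 1, 1), (- 1, - 1, 1, 0)])"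
  "distinct (map mob [(1, 0, 0, 1), (0, - 1, 1, 1), (- 1, - 1, 1, 0), (0, 1, 1, 0), (1, 1, 0, - 1), (1, 0, - 1, - 1)])"
  by (simp_all add: moebius_eq_iff)

text \<open>The coordinate change from \<open>normal_form\<close> puts the standard generators into
  the fibre of the new R'. Their products already reach the upper bound for its size, so the group
  is known exactly and \<open>fibre_subset_J\<close> compares R' with the standard
  invariant.\<close>

theorem normal_model:
  assumes m: "model A R bs" and mg: "moebius_group (fibre R R)" and ne: "fibre R R \<noteq> {XX}"
  shows "\<exists>R' bs' M. model A R' bs' \<and> dt M \<noteq> 0 \<and>
    (card (fibre R' R') = 2 \<and> ev R' (mob M) = J2 \<or> card (fibre R' R') = 3 \<and> ev R' (mob M) = J3 \<or>
     card (fibre R' R') = 6 \<and> ev R' (mob M) = J6)"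
proof -
  interpret moebius_group "fibre R R" by (rule mg)
  from normal_form[OF ne] obtain A' where A': "dt A' \<noteq> 0" and
    cs: "(card (fibre R R) \<le> 2 \<and> conj_to A' (- 1, 0, 0, 1)) \<or>
    (card (fibre R R) \<le> 3 \<and> conj_to A' (0, - 1, 1, 1)) \<or>
    (card (fibre R R) \<le> 6 \<and> conj_to A' (0, - 1, 1, 1) \<and> conj_to A' (0, 1, 1, 0))" by blast
  define R' where "R' = ev (mob (adj A')) R"
  have dA: "dt (adj A') \<noteq> 0" using A' by (simp add: dt_adj)
  have gA: "gen {mob (adj A')} = UNIV" by (rule gen_mob[OF dA])
  have m': "model A R' (map (ev (mob (adj A'))) bs)"
    unfolding R'_def by (rule model_transform[OF m mob_nonrat(2)[OF dA] gA])
  note mf = model_fibre_generator[OF m] and mf' = model_fibre_generator[OF m']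
  note ft = fibre_transform[OF A' model_transc[OF m] mf(1), folded R'_def]
  have cj: "mob N \<in> fibre R' R'" if "conj_to A' N" "dt N \<noteq> 0" for N
    using that(1) ft(2)[OF _ mob_nonrat(2)[OF that(2)]] unfolding conj_to_def by blast
  have nR: "R' \<notin> range of_rat" by (rule transc_nonrat[OF model_transc[OF m']])
  have i: "mob (1, 0, 0, 1) \<in> fibre R' R'" "ev (mob (1, 0, 0, 1)) x = x" for x
    unfolding mob_XX by (simp_all add: fibre_def transc_XX ev_id)
  have lel: "length [a, b :: mat2] = 2" "length [a, b, c :: mat2] = 3" "length [a, b, c, d, e, f :: mat2] = 6" for a b c d e f
    by simp_all
  note fs = fibre_subset_J[OF _ nR _ mf'(1,2)]
  from cs show ?thesis
  proof (elim disjE conjE)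
    assume c: "card (fibre R R) \<le> 2" "conj_to A' (- 1, 0, 0, 1)"
    have "card (fibre R' R') = 2 \<and> (\<exists>M. dt M \<noteq> 0 \<and> J2 = ev R' (mob M))"
      by (rule fs[OF _ J_nonrat(1) _ rdeg_J(1) distinct_mobs(1) lel(1)])
        (use c cj[OF c(2)] ft(1) i invJ(1) in \<open>auto simp del: mob.simps\<close>)
    then show ?thesis using m' by metis
  next
    assume c: "card (fibre R R) \<le> 3" "conj_to A' (0, - 1, 1, 1)"
    have D: "mob (0, - 1, 1, 1) \<in> fibre R' R'" using cj[OF c(2)] by simp
    have D2: "mob (- 1, - 1, 1, 0) \<in> fibre R' R'" "ev (mob (- 1, - 1, 1, 0)) J3 = J3"
      using invariant_comp[OF _ _ D D invJ(2) invJ(2)] by (simp_all del: mob.simps)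
    have "card (fibre R' R') = 3 \<and> (\<exists>M. dt M \<noteq> 0 \<and> J3 = ev R' (mob M))"
      by (rule fs[OF _ J_nonrat(2) _ rdeg_J(2) distinct_mobs(2) lel(2)])
        (use c D D2 ft(1) i invJ(2) in \<open>auto simp del: mob.simps\<close>)
    then show ?thesis using m' by metis
  next
    assume c: "card (fibre R R) \<le> 6" "conj_to A' (0, - 1, 1, 1)" "conj_to A' (0, 1, 1, 0)"
    have D: "mob (0, - 1, 1, 1) \<in> fibre R' R'" using cj[OF c(2)] by simp
    have T: "mob (0, 1, 1, 0) \<in> fibre R' R'" using cj[OF c(3)] by simp
    have D2: "mob (- 1, - 1, 1, 0) \<in> fibre R' R'" "ev (mob (- 1, - 1, 1, 0)) J6 = J6"
      using invariant_comp[OF _ _ D D invJ(3) invJ(3)] by (simp_all del: mob.simps)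
    have s: "mob (- 1, - 1, 0, 1) = mob (1, 1, 0, - 1)" "mob (0, 1, - 1, 0) = mob (0, 1, 1, 0) \<Longrightarrow> False"
      by (simp_all add: moebius_eq_iff)
    have T1: "mob (1, 1, 0, - 1) \<in> fibre R' R'" "ev (mob (1, 1, 0, - 1)) J6 = J6"
      using invariant_comp[OF _ _ D T invJ(3) invJ(4)] invariant_comp[OF _ _ T D invJ(4) invJ(3)]
        invariant_comp[OF _ _ D2(1) T D2(2) invJ(4)] invariant_comp[OF _ _ T D2(1) invJ(4) D2(2)] s(1)
      by (simp_all del: mob.simps)
    have T2: "mob (1, 0, - 1, - 1) \<in> fibre R' R'" "ev (mob (1, 0, - 1, - 1)) J6 = J6"
    proof -
      have "mob (- 1, 0, 1, 1) = mob (1, 0, - 1, - 1)" by (simp add: moebius_eq_iff)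
      then show "mob (1, 0, - 1, - 1) \<in> fibre R' R'" "ev (mob (1, 0, - 1, - 1)) J6 = J6"
        using invariant_comp[OF _ _ D T invJ(3) invJ(4)] invariant_comp[OF _ _ T D invJ(4) invJ(3)]
        by (simp_all del: mob.simps)
    qed
    have "card (fibre R' R') = 6 \<and> (\<exists>M. dt M \<noteq> 0 \<and> J6 = ev R' (mob M))"
      by (rule fs[OF _ J_nonrat(3) _ rdeg_J(3) distinct_mobs(3) lel(3)])
        (use c D T D2 T1 T2 ft(1) i invJ(3,4) in \<open>auto simp del: mob.simps\<close>)
    then show ?thesis using m' by metis
  qed
qed

lemma cs6_distinct: "inj_on (\<lambda>i. cs6 ! (i - 1)) {1..3}" "set cs6 = (\<lambda>i. cs6 ! (i - 1)) ` {1..3}" "y6 \<noteq> 0"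
proof -
  have q: "1 + XX + XX ^ 2 \<noteq> 0"
  proof
    assume "1 + XX + XX ^ 2 = (0 :: rat poly fract)"
    then have "qev [:1, 1, 1:] XX = 0" by (simp add: rhom.mp_pCons[OF rhom_of_rat] power2_eq_square algebra_simps)
    then show False using transc_XX by (auto simp: transc_def)
  qed
  then show y: "y6 \<noteq> 0" using XX_facts by (simp add: y6_def)
  have n: "of_rat c * XX + of_rat d \<noteq> 0" if "c \<noteq> 0 \<or> d \<noteq> 0" for c d by (rule of_rat_lin_nz[OF transc_XX that])
  have "XX \<noteq> 1" "XX \<noteq> - (1 + XX)" "1 \<noteq> - (1 + XX)"
    using n[of 1 "- 1"] n[of 2 1] n[of 1 2] by (auto simp: eq_neg_iff_add_eq_0 of_rat_minus algebra_simps)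
  then have d: "XX * y6 \<noteq> y6" "XX * y6 \<noteq> - (1 + XX) * y6" "y6 \<noteq> - (1 + XX) * y6"
    using y mult_right_cancel[OF y, of 1 "- (1 + XX)"] mult_right_cancel[OF y, of XX 1] mult_right_cancel[OF y, of XX "- (1 + XX)"] by simp_all
  have s: "{1..3 :: nat} = {1, 2, 3}" by auto
  show "inj_on (\<lambda>i. cs6 ! (i - 1)) {1..3}" unfolding s cs6_def
    using d by (simp add: inj_on_def eval_nat_numeral del: mult_minus_left)
  show "set cs6 = (\<lambda>i. cs6 ! (i - 1)) ` {1..3}" unfolding s cs6_def by (auto simp: eval_nat_numeral)
qed

lemma poly_lin_prod_eq_0: "poly (\<Prod>b\<leftarrow>bs. [:- b, 1:]) x = 0 \<longleftrightarrow> x \<in> set (bs :: 'a::idom list)"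
  by (induction bs) auto

lemma fhom_permutes_roots:
  fixes h :: "'a::field_char_0 \<Rightarrow> 'a"
  assumes h: "fhom h" and p: "map_poly h p = p" and r: "p = (\<Prod>b\<leftarrow>bs. [:- b, 1:])"
  shows "h ` set bs = set bs"
proof -
  interpret fhom h by (rule h)
  have s: "x \<in> set bs \<longleftrightarrow> poly p x = 0" for x unfolding r by (simp add: poly_lin_prod_eq_0)
  have "h ` set bs \<subseteq> set bs"
  proof
    fix y assume "y \<in> h ` set bs"
    then obtain x where x: "x \<in> set bs" "y = h x" by blast
    have "poly (map_poly h p) (h x) = h (poly p x)" by (simp add: poly_hom)
    then show "y \<in> set bs" using x s by (simp add: p zero)
  qed
  moreover have "inj_on h (set bs)" using inject by (rule inj_on_subset) simp
  ultimately show ?thesis by (intro card_subset_eq) (auto simp: card_image)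
qed

text \<open>The group permutes the three roots in \<open>cs6\<close>, faithfully because they
  generate Q(X) together with R.\<close>

lemma fibre_sym3:
  fixes G :: "('g, 'm) monoid_scheme"
  assumes G: "group G" and m: "model C R cs6" and bij: "bij_betw \<gamma> (carrier G) (fibre R R)" and c: "card (fibre R R) = 6"
    and mult: "\<And>g h. g \<in> carrier G \<Longrightarrow> h \<in> carrier G \<Longrightarrow> \<gamma> (g \<otimes>\<^bsub>G\<^esub> h) = ev (\<gamma> g) (\<gamma> h)"
  shows "G \<cong> sym_group 3"
proof (rule permutation_iso_sym3[where c = "\<lambda>i. cs6 ! (i - 1)" and s = "\<lambda>g. ev (\<gamma> g)"])
  have \<gamma>: "transc (\<gamma> g)" "ev (\<gamma> g) R = R" if "g \<in> carrier G" for g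
    using bij_betwE[OF bij] that by (auto simp: fibre_def)
  have mR: "map_poly (ev R) C = (\<Prod>z\<leftarrow>cs6. [:- z, 1:])" and gU: "gen (insert R (set cs6)) = UNIV" using m by (simp_all add: model_def)
  have tR: "transc R" by (rule model_transc[OF m])
  show "group G" by (rule G)
  show "card (carrier G) = 6" using bij_betw_same_card[OF bij] c by simp
  show "inj_on (\<lambda>i. cs6 ! (i - 1)) {1..3}" by (rule cs6_distinct)
  show "ev (\<gamma> g) ` (\<lambda>i. cs6 ! (i - 1)) ` {1..3} = (\<lambda>i. cs6 ! (i - 1)) ` {1..3}" if g: "g \<in> carrier G" for g
    unfolding cs6_distinct(2)[symmetric]
  proof (rule fhom_permutes_roots[OF fhom_ev[OF \<gamma>(1)[OF g]] _ mR])
    interpret a: fhom "ev (\<gamma> g)" by (rule fhom_ev[OF \<gamma>(1)[OF g]])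
    interpret b: fhom "ev R" by (rule fhom_ev[OF tR])
    have "ev (\<gamma> g) (ev R x) = ev R x" for x using ev_ev[OF \<gamma>(1)[OF g] tR, of x] \<gamma>(2)[OF g] by simp
    then show "map_poly (ev (\<gamma> g)) (map_poly (ev R) C) = map_poly (ev R) C"
      by (intro poly_eqI) (simp add: coeff_map_poly a.zero b.zero)
  qed
  show "ev (\<gamma> (g \<otimes>\<^bsub>G\<^esub> h)) x = ev (\<gamma> g) (ev (\<gamma> h) x)" if "g \<in> carrier G" "h \<in> carrier G" for g h x
    using ev_ev[OF \<gamma>(1)[OF that(1)] \<gamma>(1)[OF that(2)], of x] mult[OF that] by simp
  show "g = h" if gh: "g \<in> carrier G" "h \<in> carrier G"
    and e: "\<And>x. x \<in> (\<lambda>i. cs6 ! (i - 1)) ` {1..3} \<Longrightarrow> ev (\<gamma> g) x = ev (\<gamma> h) x" for g h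
  proof -
    have "ev (\<gamma> g) XX = ev (\<gamma> h) XX"
    proof (rule gen_agree[OF fhom_ev[OF \<gamma>(1)[OF gh(1)]] fhom_ev[OF \<gamma>(1)[OF gh(2)]], where S = "insert R (set cs6)"])
      fix x assume "x \<in> insert R (set cs6)"
      then show "ev (\<gamma> g) x = ev (\<gamma> h) x" using \<gamma>(2) gh e unfolding cs6_distinct(2) by auto
    qed (simp add: gU)
    then have "\<gamma> g = \<gamma> h" using \<gamma>(1) gh by (simp add: ev_XX)
    then show ?thesis using bij_betw_imp_inj_on[OF bij] gh by (auto dest: inj_onD)
  qed
qed

text \<open>For a constant t the polynomial P(t, Y) has rational coefficients, so its roots in E_0
  are algebraic, hence rational and fixed. The fixed field would then be all of E_0, and the group
  trivial.\<close>

lemma (in regular) nonconstant: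
  assumes lc: "lead_coeff P = 1" and nt: "carrier G \<noteq> {\<one>}" and t: "t \<in> Fix"
    and zs: "map_poly (\<lambda>p. qev p t) P = (\<Prod>z\<leftarrow>zs. [:- z, 1:])" and gn: "gen (Fix \<union> set zs) = UNIV"
  shows "t \<notin> range of_rat"
proof
  assume "t \<in> range of_rat"
  then obtain r where r: "t = of_rat r" by blast
  interpret rr: rhom "of_rat :: rat \<Rightarrow> mpf fract" by (rule rhom_of_rat)
  have q: "qev p t = of_rat (poly p r)" for p using rr.poly_hom[of p r] by (simp add: r)
  define Q where "Q = map_poly (\<lambda>p. poly p r) P"
  have "Polynomial.coeff Q (Polynomial.degree P) = 1" using lc by (simp add: Q_def coeff_map_poly)
  then have Q0: "Q \<noteq> 0" by auto
  have PQ: "map_poly (\<lambda>p. qev p t) P = map_poly of_rat Q"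
    by (rule poly_eqI) (simp add: Q_def coeff_map_poly q)
  have "z \<in> Fix" if z: "z \<in> set zs" for z
  proof -
    have "qev Q z = 0" unfolding PQ[symmetric] zs using z by (simp add: poly_lin_prod_eq_0)
    then have "\<not> transc z" using Q0 by (auto simp: transc_def)
    then have "z \<in> range of_rat" using transc_mpf by blast
    then show ?thesis using fhom_of_rat_comm[OF hom] by (auto simp: Fix_def)
  qed
  then have S: "x \<in> Fix" if "x \<in> Fix \<union> set zs" for x using that by blast
  have "act g (to_fract (mvar (\<phi> \<one>))) = to_fract (mvar (\<phi> \<one>))" if g: "g \<in> carrier G" for g
  proof (rule gen_fix[OF hom[OF g], where S = "Fix \<union> set zs"])
    show "act g x = x" if "x \<in> Fix \<union> set zs" for x using S[OF that] g by (simp add: Fix_def)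
  qed (simp add: gn)
  then have "g = \<one>" if "g \<in> carrier G" for g using faithful[OF that one_closed] that by (simp add: one_id)
  then show False using nt by blast
qed

theorem generic_families:
  fixes G :: "'g monoid" and P :: "rat poly poly" and F :: "'f ring"
  assumes inf: "infinite (UNIV :: 'l set)" and G: "group G" "finite (carrier G)" "carrier G \<noteq> {\<one>\<^bsub>G\<^esub>}"
    and lc: "lead_coeff P = 1" and sp: "splitting_field QT F \<iota> (coeff_list (fract_poly P))"
    and gal: "galois_group QT F \<iota> \<cong> G" and gp: "generic_poly TYPE('l) G P"
  shows "\<exists>a b c d :: rat. a * d - b * c \<noteq> 0 \<and>
      (let \<mu> = moebius a b c d in
        G \<cong> integer_mod_group 2 \<and> splitting_field QT F \<iota> (coeff_list [:- \<mu>, 0, 1:]) \<or>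
        G \<cong> integer_mod_group 3 \<and> splitting_field QT F \<iota> (coeff_list [:1, \<mu> - 3, - \<mu>, 1:]) \<or>
        G \<cong> sym_group 3 \<and> splitting_field QT F \<iota> (coeff_list [:\<mu>, \<mu>, 0, 1:]))"
proof -
  obtain \<phi> :: "'g \<Rightarrow> nat" where \<phi>: "inj_on \<phi> (carrier G)" using finite_imp_inj_to_nat_seg[OF G(2)] by blast
  interpret regular G \<phi> using G \<phi> by (simp add: regular_def regular_axioms_def)
  obtain i :: "nat \<Rightarrow> 'l" where i: "inj i" using infinite_countable_subset[OF inf] by blast
  \<comment> \<open>E_0 is countable, so an injection of the naturals into \<open>'l\<close> carries
    it along.\<close>
  have "inj (\<lambda>x :: mpf fract. i (to_nat_on UNIV x))"
    using inj_compose[OF i, of "to_nat_on UNIV"] inj_on_to_nat_on[OF countable_mpf_fract] by (simp add: o_def)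
  from generic_apply[OF gact_axioms this gp lc] obtain t zs where t: "t \<in> Fix"
    and zs: "map_poly (\<lambda>p. qev p t) P = (\<Prod>z\<leftarrow>zs. [:- z, 1:])" and gn: "gen (Fix \<union> set zs) = UNIV" by blast
  have tn: "t \<notin> range of_rat" by (rule nonconstant[OF lc G(3) t zs gn])
  have F: "field F" using sp by (simp add: splitting_field_def field_extension_def)
  have lcf: "lead_coeff (fract_poly P) = 1" using lc by (simp add: degree_map_poly coeff_map_poly)
  have iso: "\<exists>f \<in> ring_hom ring_of_type_algebra F. range f = carrier F \<and> (\<forall>x. f (ev R x) = \<iota> x)"
    if "model (fract_poly P) R bs" for R bs by (rule splitting_model_iso[OF that sp lcf])
  have H: "\<exists>w \<gamma>. transc w \<and> bij_betw \<gamma> (carrier G) (fibre R R) \<and> (\<forall>g\<in>carrier G. act g w = ev w (\<gamma> g)) \<and>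
      (\<forall>g\<in>carrier G. \<forall>h\<in>carrier G. \<gamma> (g \<otimes>\<^bsub>G\<^esub> h) = ev (\<gamma> g) (\<gamma> h))" if m: "model (fract_poly P) R bs" for R bs
  proof -
    from iso[OF m] obtain f where f: "f \<in> ring_hom ring_of_type_algebra F" "range f = carrier F" "\<And>x. f (ev R x) = \<iota> x" by blast
    show ?thesis by (rule fibre_action[OF t transc_mpf[OF tn] zs gn m card_fibre_le_galois[OF F f m gal G(2)]])
  qed
  from exists_model[OF tn zs] obtain R0 bs0 where m0: "model (fract_poly P) R0 bs0" by blast
  from H[OF m0] obtain w \<gamma> where w: "transc w" "bij_betw \<gamma> (carrier G) (fibre R0 R0)"
    "\<And>g. g \<in> carrier G \<Longrightarrow> act g w = ev w (\<gamma> g)"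
    "\<And>g h. g \<in> carrier G \<Longrightarrow> h \<in> carrier G \<Longrightarrow> \<gamma> (g \<otimes>\<^bsub>G\<^esub> h) = ev (\<gamma> g) (\<gamma> h)" by blast
  have mg: "moebius_group (fibre R0 R0)" by (rule fibre_moebius_group[OF m0 w])
  have ne: "fibre R0 R0 \<noteq> {XX}"
  proof
    assume "fibre R0 R0 = {XX}"
    then have "card (carrier G) = 1" using bij_betw_same_card[OF w(2)] by simp
    then obtain x where x: "carrier G = {x}" by (auto simp: card_1_singleton_iff)
    then show False using G(3) one_closed by auto
  qed
  from normal_model[OF m0 mg ne] obtain R bs M where m: "model (fract_poly P) R bs" and M: "dt M \<noteq> 0" and
    cs: "card (fibre R R) = 2 \<and> ev R (mob M) = J2 \<or> card (fibre R R) = 3 \<and> ev R (mob M) = J3 \<or>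
     card (fibre R R) = 6 \<and> ev R (mob M) = J6" by blast
  from H[OF m] obtain \<gamma> where bij: "bij_betw \<gamma> (carrier G) (fibre R R)"
    and mult: "\<And>g h. g \<in> carrier G \<Longrightarrow> h \<in> carrier G \<Longrightarrow> \<gamma> (g \<otimes>\<^bsub>G\<^esub> h) = ev (\<gamma> g) (\<gamma> h)" by blast
  have cG: "card (carrier G) = card (fibre R R)" by (rule bij_betw_same_card[OF bij])
  from iso[OF m] obtain f where f: "f \<in> ring_hom ring_of_type_algebra F" "range f = carrier F" "\<And>x. f (ev R x) = \<iota> x" by blast
  obtain a b c d where Me: "M = (a, b, c, d)" by (cases M)
  define \<mu> where "\<mu> = mob M"
  note mfam = model_families[OF model_transc[OF m], of \<mu>] and sf = model_splitting_field[OF F f]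
  have "G \<cong> integer_mod_group 2 \<and> splitting_field QT F \<iota> (coeff_list [:- \<mu>, 0, 1:]) \<or>
        G \<cong> integer_mod_group 3 \<and> splitting_field QT F \<iota> (coeff_list [:1, \<mu> - 3, - \<mu>, 1:]) \<or>
        G \<cong> sym_group 3 \<and> splitting_field QT F \<iota> (coeff_list [:\<mu>, \<mu>, 0, 1:])"
    using cs
  proof (elim disjE conjE)
    assume c: "card (fibre R R) = 2" "ev R (mob M) = J2"
    have "G \<cong> integer_mod_group 2" by (rule prime_order_iso[OF G(1,2)]) (simp_all add: cG c)
    then show ?thesis using sf[OF mfam(1)] c(2) by (simp add: \<mu>_def)
  next
    assume c: "card (fibre R R) = 3" "ev R (mob M) = J3"
    have "G \<cong> integer_mod_group 3" by (rule prime_order_iso[OF G(1,2)]) (simp_all add: cG c)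
    then show ?thesis using sf[OF mfam(2)] c(2) by (simp add: \<mu>_def)
  next
    assume c: "card (fibre R R) = 6" "ev R (mob M) = J6"
    have mm: "model [:\<mu>, \<mu>, 0, 1:] R cs6" using mfam(3) c(2) by (simp add: \<mu>_def)
    have "G \<cong> sym_group 3" by (rule fibre_sym3[OF G(1) mm bij c(1) mult])
    then show ?thesis using sf[OF mm] by simp
  qed
  then show ?thesis using M by (intro exI[of _ a] exI[of _ b] exI[of _ c] exI[of _ d]) (simp add: \<mu>_def Me Let_def)
qed

subsection \<open>Specializing at a point of a Galois extension\<close>

text \<open>The roots of A in F are read as elements of Q(X). When the listed polynomial has
  identified F with Q(X), this carries the parametrization R over to P.\<close>

lemma model_pullback:
  fixes F :: "'f ring"
  assumes F: "field F" and f: "f \<in> ring_hom ring_of_type_algebra F" and r: "range f = carrier F" and R: "transc R"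
    and i: "\<And>x. f (ev R x) = \<iota> x" and sp: "splitting_field QT F \<iota> (coeff_list A)" and lc: "lead_coeff A = 1"
  shows "\<exists>bs. model A R bs"
proof -
  have ih: "\<iota> \<in> ring_hom QT F" and spl: "ring.splitted F (map \<iota> (coeff_list A))"
    and gn: "generate_field F (\<iota> ` carrier QT \<union> set_mset (ring.roots F (map \<iota> (coeff_list A)))) = carrier F"
    using sp by (auto simp: splitting_field_def field_extension_def)
  interpret F: field F by fact
  let ?F = "map \<iota> (coeff_list A)"
  have A0: "A \<noteq> 0" using lc by auto
  have inz: "\<iota> x \<noteq> \<zero>\<^bsub>F\<^esub>" if "x \<noteq> 0" for x
    using field_hom_nonzero(1)[OF field_from_type_algebra F ih, of x] that by simp
  have ic: "\<iota> x \<in> carrier F" for x using ring_hom_closed[OF ih] by simp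
  have pF: "polynomial\<^bsub>F\<^esub> (carrier F) ?F" by (rule polynomial_map_coeff_list[OF F ic], rule inz) simp
  have hF: "hd ?F = \<one>\<^bsub>F\<^esub>" "?F \<noteq> []" using set_coeff_list[of A] A0 lc ring_hom_one[OF ih] by (auto simp: hd_map)
  obtain ys where ys: "set ys \<subseteq> carrier F" "?F = F.lin_prod ys"
    using F.splitted_lin_prod[OF pF hF spl] by blast
  have "\<exists>bs. ys = map f bs" using ys(1) unfolding r[symmetric] by (metis ex_map_conv image_iff subset_iff)
  then obtain bs where bs: "ys = map f bs" by blast
  interpret rs: rspec F "\<lambda>x y. y = f x" by (rule rspec_hom[OF F f])
  have l: "list_all2 (\<lambda>x y. y = f x) bs (map f bs)" by (simp add: list_all2_conv_all_nth)
  have fi: "inj f" using field_hom_inj_on[OF field_from_type_algebra F f] by simp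
  have i0: "\<iota> 0 = \<zero>\<^bsub>F\<^esub>" using rs.zero i[of 0] fhom_ev[OF R] by (simp add: fhom_def rhom.zero)
  have e0: "ev R 0 = 0" using fhom_ev[OF R] by (simp add: fhom_def rhom.zero)
  have "map_poly (ev R) A = (\<Prod>b\<leftarrow>bs. [:- b, 1:])"
  proof (rule poly_eqI)
    fix n
    have "f (Polynomial.coeff (\<Prod>b\<leftarrow>bs. [:- b, 1:]) n) = F.coeff ?F n"
      using rs.lin_prod_rel[OF l, of n] by (simp add: ys(2) bs)
    also have "\<dots> = \<iota> (Polynomial.coeff A n)" by (rule F.coeff_map_coeff_list[where f = \<iota>, OF i0])
    also have "\<dots> = f (Polynomial.coeff (map_poly (ev R) A) n)" by (simp add: coeff_map_poly e0 i)
    finally show "Polynomial.coeff (map_poly (ev R) A) n = Polynomial.coeff (\<Prod>b\<leftarrow>bs. [:- b, 1:]) n"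
      using fi by (simp add: inj_eq)
  qed
  moreover have "gen (insert R (set bs)) = UNIV"
  proof -
    have "f ` gen (insert R (set bs)) = generate_field F (f ` insert R (set bs))" by (rule gen_image_record[OF F f])
    moreover have "f ` insert R (set bs) = insert (\<iota> XX) (set ys)" using i[of XX] by (simp add: bs ev_XX[OF R])
    moreover have "generate_field F (insert (\<iota> XX) (set ys)) = carrier F"
    proof -
      let ?G = "generate_field F (insert (\<iota> XX) (set ys))"
      have ysc: "insert (\<iota> XX) (set ys) \<subseteq> carrier F" using ys(1) ic by auto
      have Gsub: "subfield ?G F" by (rule F.generate_field_is_subfield[OF ysc])
      have "\<iota> ` UNIV = generate_field F {\<iota> XX}"
        using gen_image_record[OF F ih, of "{XX}"] by (simp add: gen_XX)
      also have "\<dots> \<subseteq> ?G" by (rule F.mono_generate_field) (use ysc in auto)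
      finally have "\<iota> ` carrier QT \<union> set ys \<subseteq> ?G" by (auto intro: generate_field.incl)
      moreover have "set_mset (F.roots ?F) = set ys" using ys F.lin_prod(4)[OF ys(1)] by simp
      ultimately have "carrier F \<subseteq> ?G"
        using F.generate_field_min_subfield1[OF _ Gsub, of "\<iota> ` carrier QT \<union> set ys"] gn ys(1) ic by auto
      then show ?thesis using F.generate_field_in_carrier[OF ysc] by blast
    qed
    ultimately have "f ` gen (insert R (set bs)) = f ` UNIV" using r by simp
    then show ?thesis using fi by (simp add: inj_image_eq_iff)
  qed
  ultimately show ?thesis using transc_nonrat[OF R] by (auto simp: model_def)
qed

locale galois_ext =
  fixes L E :: "'l ring" and \<iota> :: "'l \<Rightarrow> 'l" and \<epsilon> :: "rat \<Rightarrow> 'l"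
  assumes ext: "finite_galois_extension L E \<iota>" and eps: "field_extension (ring_of_type_algebra :: rat ring) L \<epsilon>"
    and fin: "finite (carrier (galois_group L E \<iota>))"
begin

abbreviation \<Gamma> where "\<Gamma> \<equiv> carrier (galois_group L E \<iota>)"
abbreviation gm (infixl "\<bullet>" 70) where "gm \<equiv> monoid.mult (galois_group L E \<iota>)"
definition e :: "rat \<Rightarrow> 'l" where "e r = \<iota> (\<epsilon> r)"

lemma Lf: "field L" and Ef: "field E" and ih: "\<iota> \<in> ring_hom L E" and eh: "\<epsilon> \<in> ring_hom ring_of_type_algebra L"
  using ext eps by (auto simp: finite_galois_extension_def field_extension_def)

lemma eE: "e \<in> ring_hom ring_of_type_algebra E"
  using ring_hom_trans[OF eh ih] by (simp add: o_def e_def[abs_def])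

sublocale frec E e by (rule frecI[OF Ef eE])

text \<open>\<open>rl w x y\<close> says that the rational function x is defined at w with value y.
  It is only partial, because w may be algebraic over Q.\<close>

abbreviation rl where "rl w \<equiv> spec E (pev E e w)"

lemma rl_rspec: "w \<in> carrier E \<Longrightarrow> rspec E (rl w)"
  by (rule rspec_spec[OF Ef pev_hom])

lemma e_inj: "e r = e s \<longleftrightarrow> r = s"
  using field_hom_inj_on[OF field_from_type_algebra Ef eE] by (simp add: inj_eq)

lemma gal_hom: "\<rho> \<in> \<Gamma> \<Longrightarrow> \<rho> \<in> ring_hom E E"
  by (simp add: galois_group_def)

lemma gal_carr: "\<rho> \<in> \<Gamma> \<Longrightarrow> x \<in> carrier E \<Longrightarrow> \<rho> x \<in> carrier E"
  by (rule ring_hom_closed[OF gal_hom])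

lemma gal_inj: "\<rho> \<in> \<Gamma> \<Longrightarrow> x \<in> carrier E \<Longrightarrow> y \<in> carrier E \<Longrightarrow> \<rho> x = \<rho> y \<Longrightarrow> x = y"
  using field_hom_inj_on[OF Ef Ef gal_hom, of \<rho>] by (auto dest: inj_onD)

lemma gal_L: "\<rho> \<in> \<Gamma> \<Longrightarrow> x \<in> carrier L \<Longrightarrow> \<rho> (\<iota> x) = \<iota> x"
  by (simp add: galois_group_def)

lemma gal_e: "\<rho> \<in> \<Gamma> \<Longrightarrow> \<rho> (e r) = e r"
  using gal_L[of \<rho> "\<epsilon> r"] ring_hom_closed[OF eh, of r] by (simp add: e_def)

lemma gal_ext: "\<rho> \<in> \<Gamma> \<Longrightarrow> \<tau> \<in> \<Gamma> \<Longrightarrow> (\<And>x. x \<in> carrier E \<Longrightarrow> \<rho> x = \<tau> x) \<Longrightarrow> \<rho> = \<tau>"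
  by (rule extensionalityI[of _ "carrier E"]) (auto simp: galois_group_def Bij_def)

lemma gal_mult:
  assumes "\<rho> \<in> \<Gamma>" "\<tau> \<in> \<Gamma>"
  shows "\<rho> \<bullet> \<tau> \<in> \<Gamma>" "x \<in> carrier E \<Longrightarrow> (\<rho> \<bullet> \<tau>) x = \<rho> (\<tau> x)"
proof -
  have B: "\<rho> \<in> Bij (carrier E)" "\<tau> \<in> Bij (carrier E)" using assms by (simp_all add: galois_group_def)
  have m: "\<rho> \<bullet> \<tau> = compose (carrier E) \<rho> \<tau>" using B by (simp add: galois_group_def BijGroup_def)
  show v: "(\<rho> \<bullet> \<tau>) x = \<rho> (\<tau> x)" if "x \<in> carrier E" for x using that by (simp add: m compose_def)
  have "compose (carrier E) \<rho> \<tau> \<in> ring_hom E E"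
    by (rule ring_hom_memI)
      (use assms gal_carr[OF assms(1)] gal_carr[OF assms(2)] ring_hom_mult[OF gal_hom[OF assms(1)]] ring_hom_mult[OF gal_hom[OF assms(2)]]
        ring_hom_add[OF gal_hom[OF assms(1)]] ring_hom_add[OF gal_hom[OF assms(2)]]
        ring_hom_one[OF gal_hom[OF assms(1)]] ring_hom_one[OF gal_hom[OF assms(2)]] in \<open>simp_all add: compose_def\<close>)
  moreover have "compose (carrier E) \<rho> \<tau> (\<iota> x) = \<iota> x" if "x \<in> carrier L" for x
    using that gal_L[OF assms(1)] gal_L[OF assms(2)] ring_hom_closed[OF ih] by (simp add: compose_def)
  ultimately show "\<rho> \<bullet> \<tau> \<in> \<Gamma>" unfolding m using compose_Bij[OF B] by (simp add: galois_group_def)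
qed

lemma gal_idem: "\<rho> \<in> \<Gamma> \<Longrightarrow> \<rho> \<bullet> \<rho> = \<rho> \<Longrightarrow> x \<in> carrier E \<Longrightarrow> \<rho> x = x"
  using gal_mult(2)[of \<rho> \<rho> x] gal_inj[of \<rho> "\<rho> x" x] gal_carr by simp

lemma gal_fixed: "x \<in> carrier E \<Longrightarrow> (\<And>\<rho>. \<rho> \<in> \<Gamma> \<Longrightarrow> \<rho> x = x) \<Longrightarrow> x \<in> \<iota> ` carrier L"
  using ext by (auto simp: finite_galois_extension_def)

lemma gal_one: obtains u where "u \<in> \<Gamma>" "\<And>x. x \<in> carrier E \<Longrightarrow> u x = x"
proof
  show "restrict (\<lambda>x. x) (carrier E) \<in> \<Gamma>"
    using id_Bij[of "carrier E"] ring_hom_closed[OF ih] by (auto simp: galois_group_def intro!: ring_hom_memI)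
qed simp

lemma gal_pev: "\<rho> \<in> \<Gamma> \<Longrightarrow> w \<in> carrier E \<Longrightarrow> \<rho> (pev E e w p) = pev E e (\<rho> w) p"
proof (induction p)
  case (pCons a p)
  then show ?case using gal_carr[of \<rho> w] ring_hom_add[OF gal_hom, of \<rho> "e a" "w \<otimes>\<^bsub>E\<^esub> pev E e w p"]
      ring_hom_mult[OF gal_hom, of \<rho> w "pev E e w p"] gal_e[of \<rho> a] by (simp add: pev_pCons)
next
  case 0
  then show ?case using e_0 gal_e[of \<rho> 0] by simp
qed

lemma gal_rl:
  assumes "\<rho> \<in> \<Gamma>" "w \<in> carrier E" "rl w x y" shows "rl (\<rho> w) x (\<rho> y)"
proof -
  obtain a b where ab: "x = Fract a b" "pev E e w b \<noteq> \<zero>\<^bsub>E\<^esub>" "y = pev E e w a \<otimes>\<^bsub>E\<^esub> inv\<^bsub>E\<^esub> pev E e w b"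
    using assms(3) by (auto simp: spec_def)
  have b: "pev E e w b \<in> Units E" using ab(2) assms(2) by (simp add: field_Units)
  have "\<rho> (inv\<^bsub>E\<^esub> pev E e w b) = inv\<^bsub>E\<^esub> pev E e (\<rho> w) b" "pev E e (\<rho> w) b \<noteq> \<zero>\<^bsub>E\<^esub>"
    using field_hom_nonzero[OF Ef Ef gal_hom[OF assms(1)] pev_carr[OF assms(2)] ab(2)] gal_pev[OF assms(1,2)] by simp_all
  then have "\<rho> y = pev E e (\<rho> w) a \<otimes>\<^bsub>E\<^esub> inv\<^bsub>E\<^esub> pev E e (\<rho> w) b"
    using ring_hom_mult[OF gal_hom[OF assms(1)], of "pev E e w a" "inv\<^bsub>E\<^esub> pev E e w b"] b assms(2) gal_pev[OF assms(1,2)] by (simp add: ab(3))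
  then show ?thesis using \<open>pev E e (\<rho> w) b \<noteq> \<zero>\<^bsub>E\<^esub>\<close> ab(1) by (auto simp: spec_def)
qed

lemma rl_ev:
  assumes w: "w \<in> carrier E" and g: "transc g" "rl w g v" and x: "rl v x y" shows "rl w (ev g x) y"
proof -
  interpret rspec E "rl w" by (rule rl_rspec[OF w])
  interpret g: fhom "ev g" by (rule fhom_ev[OF g(1)])
  obtain a b where ab: "x = Fract a b" "pev E e v b \<noteq> \<zero>\<^bsub>E\<^esub>" "y = pev E e v a \<otimes>\<^bsub>E\<^esub> inv\<^bsub>E\<^esub> pev E e v b"
    using x by (auto simp: spec_def)
  have q: "rl w (qev p g) (pev E e v p)" for p by (rule qev_rel[OF eE g(2)])
  have "rl w (qev a g * inverse (qev b g)) y" unfolding ab(3) by (rule mult[OF q minv[OF q ab(2)]])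
  moreover have "ev g x = qev a g * inverse (qev b g)"
    by (simp add: ab(1) Fract_conv_to_fract g.mult g.inv ev_to_fract[OF g(1)] divide_inverse)
  ultimately show ?thesis by simp
qed

lemma gal_compose:
  assumes "\<rho> \<in> \<Gamma>" "\<tau> \<in> \<Gamma>" "w \<in> carrier E" "transc g" "rl w g (\<rho> w)" "rl w h (\<tau> w)"
  shows "rl w (ev g h) ((\<rho> \<bullet> \<tau>) w)"
  unfolding gal_mult(2)[OF assms(1,2,3)] by (rule rl_ev[OF assms(3,4,5)]) (rule gal_rl[OF assms(1,3,6)])

lemma pev_roots_finite:
  assumes "p \<noteq> 0" shows "finite {w \<in> carrier E. pev E e w p = \<zero>\<^bsub>E\<^esub>}"
proof -
  let ?p = "map e (coeff_list p)"
  have nz: "e x \<noteq> \<zero>\<^bsub>E\<^esub>" if "x \<noteq> 0" for x using e_inj[of x 0] that by simp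
  have "polynomial\<^bsub>E\<^esub> (carrier E) ?p" by (rule polynomial_map_coeff_list[OF Ef]) (use nz in auto)
  then have c: "?p \<in> carrier (poly_ring E)" by (simp add: univ_poly_carrier)
  have n: "?p \<noteq> []" using assms by (simp add: set_coeff_list)
  have "{w \<in> carrier E. pev E e w p = \<zero>\<^bsub>E\<^esub>} \<subseteq> {w. is_root ?p w}"
    using n by (auto simp: is_root_def eval_pev)
  then show ?thesis using finite_number_of_roots[OF c] by (rule finite_subset)
qed

lemma rl_val:
  assumes w: "w \<in> carrier E" and d: "pev E e w (den x) \<noteq> \<zero>\<^bsub>E\<^esub>"
  shows "rl w x (pev E e w (num x) \<otimes>\<^bsub>E\<^esub> inv\<^bsub>E\<^esub> pev E e w (den x))"
  unfolding spec_def by (intro exI[of _ "num x"] exI[of _ "den x"]) (simp add: d num_den(1)[symmetric])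

lemma rl_XX: "w \<in> carrier E \<Longrightarrow> rl w XX w"
  unfolding spec_def XX_def by (intro exI[of _ "[:0, 1:]"] exI[of _ "1 :: rat poly"]) (simp add: pev_pCons)

text \<open>Each operation that builds x from S commutes with evaluation at w, outside finitely many
  w.\<close>

lemma gen_spec:
  assumes "x \<in> gen S"
  shows "\<exists>B. finite B \<and> (\<forall>w \<in> carrier E - B. \<exists>y. rl w x y \<and> y \<in> generate_field E {z. \<exists>s\<in>S. rl w s z})"
  using assms
proof induction
  case one
  have "rl w 1 \<one>\<^bsub>E\<^esub>" if "w \<in> carrier E" for w by (rule rspec.one[OF rl_rspec[OF that]])
  then show ?case by (intro exI[of _ "{}"]) (auto intro: generate_field.one)
next
  case (incl x)
  show ?case
  proof (intro exI[of _ "{w \<in> carrier E. pev E e w (den x) = \<zero>\<^bsub>E\<^esub>}"] conjI ballI)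
    fix w assume w: "w \<in> carrier E - {w \<in> carrier E. pev E e w (den x) = \<zero>\<^bsub>E\<^esub>}"
    have v: "rl w x (pev E e w (num x) \<otimes>\<^bsub>E\<^esub> inv\<^bsub>E\<^esub> pev E e w (den x))" by (rule rl_val) (use w in auto)
    show "\<exists>y. rl w x y \<and> y \<in> generate_field E {z. \<exists>s\<in>S. rl w s z}"
      by (rule exI, rule conjI, rule v, rule generate_field.incl) (use v incl in blast)
  qed (rule pev_roots_finite[OF num_den(2)])
next
  case (neg x)
  then obtain B where B: "finite B" "\<forall>w \<in> carrier E - B. \<exists>y. rl w x y \<and> y \<in> generate_field E {z. \<exists>s\<in>S. rl w s z}" by blast
  then show ?case
  proof (intro exI[of _ B] conjI ballI)
    fix w assume w: "w \<in> carrier E - B"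
    then obtain y where y: "rl w x y" "y \<in> generate_field E {z. \<exists>s\<in>S. rl w s z}"
      using B(2) by blast
    then show "\<exists>y. rl w (- x) y \<and> y \<in> generate_field E {z. \<exists>s\<in>S. rl w s z}"
      by (intro exI[of _ "\<ominus>\<^bsub>E\<^esub> y"] conjI rspec.neg[OF rl_rspec y(1)] generate_field.a_inv[OF y(2)]) (use w in simp)
  qed (rule B(1))
next
  case (inv x)
  then obtain B where B: "finite B" "\<forall>w \<in> carrier E - B. \<exists>y. rl w x y \<and> y \<in> generate_field E {z. \<exists>s\<in>S. rl w s z}" by blast
  show ?case
  proof (cases "x = 0")
    case True
    then show ?thesis using B by (intro exI[of _ B]) simp
  next
    case False
    have n0: "num x \<noteq> 0"
    proof
      assume n: "num x = 0"
      have "x = Fract (num x) (den x)" by (rule num_den(1)[symmetric])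
      also have "\<dots> = 0" unfolding n by (simp add: fract_collapse)
      finally show False using False by simp
    qed
    \<comment> \<open>Besides its poles the zeros of x are excluded, so that its value can be
      inverted.\<close>
    let ?B = "B \<union> {w \<in> carrier E. pev E e w (num x) = \<zero>\<^bsub>E\<^esub>} \<union> {w \<in> carrier E. pev E e w (den x) = \<zero>\<^bsub>E\<^esub>}"
    have "\<exists>y. rl w (inverse x) y \<and> y \<in> generate_field E {z. \<exists>s\<in>S. rl w s z}" if w: "w \<in> carrier E - ?B" for w
    proof -
      interpret rspec E "rl w" using w by (intro rl_rspec) simp
      obtain y where y: "rl w x y" "y \<in> generate_field E {z. \<exists>s\<in>S. rl w s z}" using B(2) w by blast
      have wc: "w \<in> carrier E" and d: "pev E e w (den x) \<noteq> \<zero>\<^bsub>E\<^esub>" "pev E e w (num x) \<noteq> \<zero>\<^bsub>E\<^esub>" using w by auto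
      have "pev E e w (den x) \<in> Units E" using d(1) pev_carr[OF wc] by (simp add: field_Units)
      then have u: "inv\<^bsub>E\<^esub> pev E e w (den x) \<in> Units E" by (rule Units_inv_Units)
      have yv: "y = pev E e w (num x) \<otimes>\<^bsub>E\<^esub> inv\<^bsub>E\<^esub> pev E e w (den x)" by (rule unique[OF y(1) rl_val[OF wc d(1)]])
      have "y \<noteq> \<zero>\<^bsub>E\<^esub>" using integral[of "pev E e w (num x)" "inv\<^bsub>E\<^esub> pev E e w (den x)"] u d wc
        unfolding yv by (auto simp: field_Units)
      then show ?thesis by (intro exI[of _ "inv\<^bsub>E\<^esub> y"] conjI minv[OF y(1)] generate_field.m_inv[OF y(2)])
    qed
    moreover have "finite ?B" using B(1) pev_roots_finite[OF n0] pev_roots_finite[OF num_den(2)] by simp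
    ultimately show ?thesis by (intro exI[of _ ?B] conjI ballI)
  qed
next
  case (add x x')
  then obtain B B' where B: "finite B" "\<forall>w \<in> carrier E - B. \<exists>y. rl w x y \<and> y \<in> generate_field E {z. \<exists>s\<in>S. rl w s z}"
    "finite B'" "\<forall>w \<in> carrier E - B'. \<exists>y. rl w x' y \<and> y \<in> generate_field E {z. \<exists>s\<in>S. rl w s z}" by blast
  show ?case
  proof (intro exI[of _ "B \<union> B'"] conjI ballI)
    fix w assume w: "w \<in> carrier E - (B \<union> B')"
    have "w \<in> carrier E - B" "w \<in> carrier E - B'" and wc: "w \<in> carrier E" using w by auto
    then obtain y y' where y: "rl w x y" "y \<in> generate_field E {z. \<exists>s\<in>S. rl w s z}" "rl w x' y'" "y' \<in> generate_field E {z. \<exists>s\<in>S. rl w s z}"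
      using B(2,4) by meson
    show "\<exists>y. rl w (x + x') y \<and> y \<in> generate_field E {z. \<exists>s\<in>S. rl w s z}"
      by (intro exI[of _ "y \<oplus>\<^bsub>E\<^esub> y'"] conjI rspec.add[OF rl_rspec[OF wc] y(1,3)] generate_field.eng_add[OF y(2,4)])
  qed (use B in simp)
next
  case (mult x x')
  then obtain B B' where B: "finite B" "\<forall>w \<in> carrier E - B. \<exists>y. rl w x y \<and> y \<in> generate_field E {z. \<exists>s\<in>S. rl w s z}"
    "finite B'" "\<forall>w \<in> carrier E - B'. \<exists>y. rl w x' y \<and> y \<in> generate_field E {z. \<exists>s\<in>S. rl w s z}" by blast
  show ?case
  proof (intro exI[of _ "B \<union> B'"] conjI ballI)
    fix w assume w: "w \<in> carrier E - (B \<union> B')"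
    have "w \<in> carrier E - B" "w \<in> carrier E - B'" and wc: "w \<in> carrier E" using w by auto
    then obtain y y' where y: "rl w x y" "y \<in> generate_field E {z. \<exists>s\<in>S. rl w s z}" "rl w x' y'" "y' \<in> generate_field E {z. \<exists>s\<in>S. rl w s z}"
      using B(2,4) by meson
    show "\<exists>y. rl w (x * x') y \<and> y \<in> generate_field E {z. \<exists>s\<in>S. rl w s z}"
      by (intro exI[of _ "y \<otimes>\<^bsub>E\<^esub> y'"] conjI rspec.mult[OF rl_rspec[OF wc] y(1,3)] generate_field.eng_mult[OF y(2,4)])
  qed (use B in simp)
qed


text \<open>\<open>Q c\<close> says that the weighted trace of every v, the sum of all \<rho> v
  times c \<rho>, lies in S = L(w). The constant weight 1 qualifies, and multiplying a weight by
  \<rho> w - \<tau> w removes the term of \<tau>. When only the identity u is left, the sum is v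
  times c u, so v lies in S.\<close>

lemma primitive:
  fixes w defines "S \<equiv> generate_field E (\<iota> ` carrier L \<union> {w})"
  assumes w: "w \<in> carrier E" and cj: "\<And>\<rho>. \<rho> \<in> \<Gamma> \<Longrightarrow> \<rho> w \<in> S"
    and sep: "\<And>\<rho> x. \<rho> \<in> \<Gamma> \<Longrightarrow> \<rho> w = w \<Longrightarrow> x \<in> carrier E \<Longrightarrow> \<rho> x = x"
  shows "S = carrier E"
proof -
  define T where "T c v = (\<Oplus>\<^bsub>E\<^esub>\<rho>\<in>\<Gamma>. \<rho> v \<otimes>\<^bsub>E\<^esub> c \<rho>)" for c v
  define Q where "Q c \<longleftrightarrow> (\<forall>\<rho>\<in>\<Gamma>. c \<rho> \<in> carrier E) \<and> (\<forall>v\<in>carrier E. T c v \<in> S)" for c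
  have gc: "\<iota> ` carrier L \<union> {w} \<subseteq> carrier E" using w ring_hom_closed[OF ih] by auto
  have SE: "S \<subseteq> carrier E" using generate_field_in_carrier[OF gc] unfolding S_def by blast
  have Sadd: "x \<oplus>\<^bsub>E\<^esub> y \<in> S" "x \<otimes>\<^bsub>E\<^esub> y \<in> S" "\<ominus>\<^bsub>E\<^esub> x \<in> S" if "x \<in> S" "y \<in> S" for x y
    using generate_field.eng_add[of x E _ y] generate_field.eng_mult[of x E _ y] generate_field.a_inv[of x E] that
    unfolding S_def by simp_all
  have Sdiff: "x \<ominus>\<^bsub>E\<^esub> y \<in> S" if "x \<in> S" "y \<in> S" for x y using Sadd(1)[OF that(1) Sadd(3)[OF that(2,2)]] by (simp add: a_minus_def)
  have Q1: "Q (\<lambda>_. \<one>\<^bsub>E\<^esub>)"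
    unfolding Q_def
  proof (intro conjI ballI)
    fix v assume v: "v \<in> carrier E"
    have T1: "T (\<lambda>_. \<one>\<^bsub>E\<^esub>) v = (\<Oplus>\<^bsub>E\<^esub>\<rho>\<in>\<Gamma>. \<rho> v)"
      unfolding T_def by (rule finsum_cong') (use gal_carr v in auto)
    have "(\<Oplus>\<^bsub>E\<^esub>\<rho>\<in>\<Gamma>. \<rho> v) \<in> \<iota> ` carrier L"
    proof (rule gal_fixed)
      show "(\<Oplus>\<^bsub>E\<^esub>\<rho>\<in>\<Gamma>. \<rho> v) \<in> carrier E" by (rule finsum_closed) (use gal_carr v in auto)
      fix \<tau> assume \<tau>: "\<tau> \<in> \<Gamma>"
      interpret h: ring_hom_cring E E \<tau> using gal_hom[OF \<tau>] is_cring by (simp add: ring_hom_cring_def ring_hom_cring_axioms_def)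
      have inj: "inj_on (\<lambda>\<rho>. \<tau> \<bullet> \<rho>) \<Gamma>"
      proof (rule inj_onI)
        fix x y assume xy: "x \<in> \<Gamma>" "y \<in> \<Gamma>" "\<tau> \<bullet> x = \<tau> \<bullet> y"
        show "x = y"
        proof (rule gal_ext[OF xy(1,2)])
          fix z assume z: "z \<in> carrier E"
          have "\<tau> (x z) = \<tau> (y z)" using gal_mult(2)[OF \<tau> xy(1) z] gal_mult(2)[OF \<tau> xy(2) z] xy(3) by simp
          then show "x z = y z" by (rule gal_inj[OF \<tau> gal_carr[OF xy(1) z] gal_carr[OF xy(2) z]])
        qed
      qed
      have sub: "(\<lambda>\<rho>. \<tau> \<bullet> \<rho>) ` \<Gamma> \<subseteq> \<Gamma>" using gal_mult(1)[OF \<tau>] by blast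
      have im: "(\<lambda>\<rho>. \<tau> \<bullet> \<rho>) ` \<Gamma> = \<Gamma>" by (rule endo_inj_surj[OF fin sub inj])
      have "\<tau> (\<Oplus>\<^bsub>E\<^esub>\<rho>\<in>\<Gamma>. \<rho> v) = (\<Oplus>\<^bsub>E\<^esub>\<rho>\<in>\<Gamma>. \<tau> (\<rho> v))"
        using h.hom_finsum[of "\<lambda>\<rho>. \<rho> v" \<Gamma>] gal_carr v by (auto simp: o_def)
      also have "\<dots> = (\<Oplus>\<^bsub>E\<^esub>\<rho>\<in>\<Gamma>. (\<tau> \<bullet> \<rho>) v)"
        by (rule finsum_cong') (use gal_mult[OF \<tau>] gal_carr v in auto)
      also have "\<dots> = (\<Oplus>\<^bsub>E\<^esub>\<rho>\<in>(\<lambda>\<rho>. \<tau> \<bullet> \<rho>) ` \<Gamma>. \<rho> v)"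
        by (rule finsum_reindex[symmetric]) (use inj im gal_carr v in auto)
      finally show "\<tau> (\<Oplus>\<^bsub>E\<^esub>\<rho>\<in>\<Gamma>. \<rho> v) = (\<Oplus>\<^bsub>E\<^esub>\<rho>\<in>\<Gamma>. \<rho> v)" by (simp add: im)
    qed
    then show "T (\<lambda>_. \<one>\<^bsub>E\<^esub>) v \<in> S" unfolding T1 S_def by (auto intro: generate_field.incl)
  qed simp
  \<comment> \<open>The new weighted trace of v is the old one of v w minus \<tau> w times the old
    one of v, and \<tau> w lies in S.\<close>
  have step: "Q (\<lambda>\<rho>. (\<rho> w \<ominus>\<^bsub>E\<^esub> \<tau> w) \<otimes>\<^bsub>E\<^esub> c \<rho>)" if c: "Q c" and \<tau>: "\<tau> \<in> \<Gamma>" for c \<tau>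
    unfolding Q_def
  proof (intro conjI ballI)
    have cc: "c \<rho> \<in> carrier E" if "\<rho> \<in> \<Gamma>" for \<rho> using c that by (simp add: Q_def)
    note tw = gal_carr[OF \<tau> w]
    show "(\<rho> w \<ominus>\<^bsub>E\<^esub> \<tau> w) \<otimes>\<^bsub>E\<^esub> c \<rho> \<in> carrier E" if "\<rho> \<in> \<Gamma>" for \<rho> using that cc tw gal_carr[OF that w] by simp
    fix v assume v: "v \<in> carrier E"
    let ?c = "\<lambda>\<rho>. (\<rho> w \<ominus>\<^bsub>E\<^esub> \<tau> w) \<otimes>\<^bsub>E\<^esub> c \<rho>"
    have Tc: "T ?c v \<in> carrier E" "T c v \<in> carrier E" unfolding T_def by (rule finsum_closed; use gal_carr v w tw cc in auto)+
    have tm: "\<rho> v \<otimes>\<^bsub>E\<^esub> ?c \<rho> \<oplus>\<^bsub>E\<^esub> \<tau> w \<otimes>\<^bsub>E\<^esub> (\<rho> v \<otimes>\<^bsub>E\<^esub> c \<rho>) = \<rho> (v \<otimes>\<^bsub>E\<^esub> w) \<otimes>\<^bsub>E\<^esub> c \<rho>" if \<rho>: "\<rho> \<in> \<Gamma>" for \<rho>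
    proof -
      note cs = gal_carr[OF \<rho> v] gal_carr[OF \<rho> w] tw cc[OF \<rho>]
      have "a \<otimes>\<^bsub>E\<^esub> ((b \<ominus>\<^bsub>E\<^esub> d) \<otimes>\<^bsub>E\<^esub> k) \<oplus>\<^bsub>E\<^esub> d \<otimes>\<^bsub>E\<^esub> (a \<otimes>\<^bsub>E\<^esub> k) = (a \<otimes>\<^bsub>E\<^esub> b) \<otimes>\<^bsub>E\<^esub> k"
        if "a \<in> carrier E" "b \<in> carrier E" "d \<in> carrier E" "k \<in> carrier E" for a b d k
        using that by algebra
      from this[OF cs] show ?thesis using ring_hom_mult[OF gal_hom[OF \<rho>] v w] by simp
    qed
    have "T ?c v \<oplus>\<^bsub>E\<^esub> \<tau> w \<otimes>\<^bsub>E\<^esub> T c v = (\<Oplus>\<^bsub>E\<^esub>\<rho>\<in>\<Gamma>. \<rho> v \<otimes>\<^bsub>E\<^esub> ?c \<rho>) \<oplus>\<^bsub>E\<^esub> (\<Oplus>\<^bsub>E\<^esub>\<rho>\<in>\<Gamma>. \<tau> w \<otimes>\<^bsub>E\<^esub> (\<rho> v \<otimes>\<^bsub>E\<^esub> c \<rho>))"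
      unfolding T_def using finsum_rdistr[OF fin tw, of "\<lambda>\<rho>. \<rho> v \<otimes>\<^bsub>E\<^esub> c \<rho>"] gal_carr v cc by simp
    also have "\<dots> = (\<Oplus>\<^bsub>E\<^esub>\<rho>\<in>\<Gamma>. \<rho> v \<otimes>\<^bsub>E\<^esub> ?c \<rho> \<oplus>\<^bsub>E\<^esub> \<tau> w \<otimes>\<^bsub>E\<^esub> (\<rho> v \<otimes>\<^bsub>E\<^esub> c \<rho>))"
      by (rule finsum_addf[symmetric]) (use gal_carr v w tw cc in auto)
    also have "\<dots> = T c (v \<otimes>\<^bsub>E\<^esub> w)" unfolding T_def
      by (rule finsum_cong'[OF refl _ tm]) (use gal_carr v w cc in auto)
    finally have eq: "T ?c v \<oplus>\<^bsub>E\<^esub> \<tau> w \<otimes>\<^bsub>E\<^esub> T c v = T c (v \<otimes>\<^bsub>E\<^esub> w)" .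
    have "T ?c v = T c (v \<otimes>\<^bsub>E\<^esub> w) \<ominus>\<^bsub>E\<^esub> \<tau> w \<otimes>\<^bsub>E\<^esub> T c v"
      unfolding eq[symmetric] using Tc tw by (simp add: a_minus_def a_assoc r_neg)
    then show "T ?c v \<in> S" using Sdiff Sadd(2) cj[OF \<tau>] c v w by (simp add: Q_def)
  qed
  obtain u where u: "u \<in> \<Gamma>" "\<And>x. x \<in> carrier E \<Longrightarrow> u x = x" using gal_one by blast
  have ex: "\<exists>c. Q c \<and> (\<forall>\<rho>\<in>A. c \<rho> = \<zero>\<^bsub>E\<^esub>) \<and> c u \<in> S \<and> c u \<noteq> \<zero>\<^bsub>E\<^esub>" if A: "finite A" "A \<subseteq> \<Gamma> - {u}" for A
    using A
  proof (induction A rule: finite_induct)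
    case empty
    show ?case using Q1 unfolding S_def by (intro exI[of _ "\<lambda>_. \<one>\<^bsub>E\<^esub>"]) (simp add: generate_field.one)
  next
    case (insert \<tau> A)
    then obtain c where c: "Q c" "\<forall>\<rho>\<in>A. c \<rho> = \<zero>\<^bsub>E\<^esub>" "c u \<in> S" "c u \<noteq> \<zero>\<^bsub>E\<^esub>" by auto
    have \<tau>: "\<tau> \<in> \<Gamma>" "\<tau> \<noteq> u" using insert by auto
    have "\<tau> w \<noteq> w"
    proof
      assume "\<tau> w = w"
      then have "\<tau> = u" using gal_ext[OF \<tau>(1) u(1)] sep[OF \<tau>(1)] u(2) by simp
      then show False using \<tau>(2) by simp
    qed
    then have nz: "w \<ominus>\<^bsub>E\<^esub> \<tau> w \<noteq> \<zero>\<^bsub>E\<^esub>" using w gal_carr[OF \<tau>(1) w] by simp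
    have wS: "w \<in> S" using cj[OF u(1)] u(2)[OF w] by simp
    have AG: "\<rho> w \<in> carrier E" "c \<rho> \<in> carrier E" if "\<rho> \<in> \<Gamma>" for \<rho> using that gal_carr w c(1) by (simp_all add: Q_def)
    have AA: "\<rho> \<in> \<Gamma>" if "\<rho> \<in> A" for \<rho> using insert that by auto
    show ?case
    proof (intro exI[of _ "\<lambda>\<rho>. (\<rho> w \<ominus>\<^bsub>E\<^esub> \<tau> w) \<otimes>\<^bsub>E\<^esub> c \<rho>"] conjI ballI)
      show "Q (\<lambda>\<rho>. (\<rho> w \<ominus>\<^bsub>E\<^esub> \<tau> w) \<otimes>\<^bsub>E\<^esub> c \<rho>)" by (rule step[OF c(1) \<tau>(1)])
      fix \<rho> assume r: "\<rho> \<in> insert \<tau> A"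
      show "(\<rho> w \<ominus>\<^bsub>E\<^esub> \<tau> w) \<otimes>\<^bsub>E\<^esub> c \<rho> = \<zero>\<^bsub>E\<^esub>"
      proof (cases "\<rho> = \<tau>")
        case True then show ?thesis using AG[OF \<tau>(1)] by (simp add: a_minus_def r_neg)
      next
        case False
        then have "\<rho> \<in> A" using r by simp
        then show ?thesis using c(2) AA AG[of \<rho>] AG[OF \<tau>(1)] by simp
      qed
    next
      show "(u w \<ominus>\<^bsub>E\<^esub> \<tau> w) \<otimes>\<^bsub>E\<^esub> c u \<in> S" using u(2)[OF w] Sadd(2) Sdiff[OF wS cj[OF \<tau>(1)]] c(3) by simp
      show "(u w \<ominus>\<^bsub>E\<^esub> \<tau> w) \<otimes>\<^bsub>E\<^esub> c u \<noteq> \<zero>\<^bsub>E\<^esub>"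
        using u(2)[OF w] nz c(4) integral[of "w \<ominus>\<^bsub>E\<^esub> \<tau> w" "c u"] AG[OF u(1)] AG[OF \<tau>(1)] w by auto
    qed
  qed
  obtain c where c: "Q c" "\<forall>\<rho>\<in>\<Gamma> - {u}. c \<rho> = \<zero>\<^bsub>E\<^esub>" "c u \<in> S" "c u \<noteq> \<zero>\<^bsub>E\<^esub>" using ex[of "\<Gamma> - {u}"] fin by auto
  have cu: "c u \<in> Units E" using c SE by (auto simp: field_Units)
  have "v \<in> S" if v: "v \<in> carrier E" for v
  proof -
    have cc: "c \<rho> \<in> carrier E" if "\<rho> \<in> \<Gamma>" for \<rho> using c(1) that by (simp add: Q_def)
    have z: "\<rho> v \<otimes>\<^bsub>E\<^esub> c \<rho> = (if u = \<rho> then \<rho> v \<otimes>\<^bsub>E\<^esub> c \<rho> else \<zero>\<^bsub>E\<^esub>)" if "\<rho> \<in> \<Gamma>" for \<rho>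
      using c(2) that gal_carr[OF that v] by auto
    have "T c v = (\<Oplus>\<^bsub>E\<^esub>\<rho>\<in>\<Gamma>. if u = \<rho> then \<rho> v \<otimes>\<^bsub>E\<^esub> c \<rho> else \<zero>\<^bsub>E\<^esub>)"
      unfolding T_def by (rule finsum_cong'[OF refl _ z]) (use gal_carr v cc in auto)
    also have "\<dots> = u v \<otimes>\<^bsub>E\<^esub> c u" by (rule finsum_singleton[OF u(1) fin]) (use gal_carr v cc in auto)
    finally have "T c v = v \<otimes>\<^bsub>E\<^esub> c u" using u(2)[OF v] by simp
    moreover have "T c v \<in> S" using c(1) v by (simp add: Q_def)
    ultimately have "v \<otimes>\<^bsub>E\<^esub> c u \<in> S" by simp
    moreover have "inv\<^bsub>E\<^esub> c u \<in> S" using c(3,4) unfolding S_def by (rule generate_field.m_inv)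
    ultimately have "(v \<otimes>\<^bsub>E\<^esub> c u) \<otimes>\<^bsub>E\<^esub> inv\<^bsub>E\<^esub> c u \<in> S" by (rule Sadd(2))
    moreover have "(v \<otimes>\<^bsub>E\<^esub> c u) \<otimes>\<^bsub>E\<^esub> inv\<^bsub>E\<^esub> c u = v"
      using v Units_closed[OF cu] Units_inv_closed[OF cu] Units_r_inv[OF cu] by (simp add: m_assoc)
    ultimately show ?thesis by simp
  qed
  then show ?thesis using SE by blast
qed

end

section \<open>Specializing P at a general point\<close>

context galois_ext
begin

lemma pev_base: "t \<in> carrier L \<Longrightarrow> \<iota> (pev L \<epsilon> t p) = pev E e (\<iota> t) p"
proof (induction p)
  case (pCons a p)
  interpret l: frec L \<epsilon> by (rule frecI[OF Lf eh])
  show ?case using pCons ring_hom_closed[OF ih, of t] ring_hom_add[OF ih, of "\<epsilon> a" "t \<otimes>\<^bsub>L\<^esub> pev L \<epsilon> t p"]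
      ring_hom_mult[OF ih, of t "pev L \<epsilon> t p"] by (simp add: l.pev_pCons pev_pCons e_def[symmetric])
next
  case 0
  interpret l: frec L \<epsilon> by (rule frecI[OF Lf eh])
  have z: "\<iota> \<zero>\<^bsub>L\<^esub> = \<zero>\<^bsub>E\<^esub>" using e_0 unfolding e_def l.e_0 .
  show ?case unfolding l.pev_0 pev_0 by (rule z)
qed

lemma specialize_base:
  assumes "t \<in> carrier L" shows "map \<iota> (specialize L \<epsilon> P t) = map (pev E e (\<iota> t)) (coeff_list P)"
proof -
  interpret l: frec L \<epsilon> by (rule frecI[OF Lf eh])
  show ?thesis by (simp add: specialize_def l.eval_pev[OF assms] pev_base[OF assms])
qed

text \<open>For general w in W, t = R(w) is fixed by the Galois group, hence lies in L, and the
  roots of P(t, Y) are the values of \<open>bs\<close> at w. The conjugates of w are values of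
  rational functions at w and only the identity fixes w, so E = L(w). Since R and \<open>bs\<close>
  generate X, the roots and L generate w.\<close>

theorem specialize_model:
  assumes W: "infinite W" "W \<subseteq> carrier E" and m: "model (fract_poly P) R bs" and lc: "lead_coeff P = 1"
    and g: "\<And>s. s \<in> \<Gamma> \<Longrightarrow> \<exists>g. transc g \<and> ev g R = R \<and> (g = XX \<longrightarrow> (\<forall>x\<in>carrier E. s x = x)) \<and> (\<forall>w\<in>W. rl w g (s w))"
  shows "\<exists>t\<in>carrier L. splitting_field L E \<iota> (specialize L \<epsilon> P t)"
proof -
  have tR: "transc R" by (rule model_transc[OF m])
  have mR: "map_poly (ev R) (fract_poly P) = (\<Prod>z\<leftarrow>bs. [:- z, 1:])" and gU: "gen (insert R (set bs)) = UNIV" using m by (simp_all add: model_def)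
  obtain \<gamma> where \<gamma>: "\<And>s. s \<in> \<Gamma> \<Longrightarrow> transc (\<gamma> s)" "\<And>s. s \<in> \<Gamma> \<Longrightarrow> ev (\<gamma> s) R = R"
    "\<And>s x. s \<in> \<Gamma> \<Longrightarrow> \<gamma> s = XX \<Longrightarrow> x \<in> carrier E \<Longrightarrow> s x = x" "\<And>s w. s \<in> \<Gamma> \<Longrightarrow> w \<in> W \<Longrightarrow> rl w (\<gamma> s) (s w)"
  proof -
    have "\<forall>s\<in>\<Gamma>. \<exists>g. transc g \<and> ev g R = R \<and> (g = XX \<longrightarrow> (\<forall>x\<in>carrier E. s x = x)) \<and> (\<forall>w\<in>W. rl w g (s w))" using g by simp
    from bchoice[OF this] obtain f where f: "\<forall>s\<in>\<Gamma>. transc (f s) \<and> ev (f s) R = R \<and>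
      (f s = XX \<longrightarrow> (\<forall>x\<in>carrier E. s x = x)) \<and> (\<forall>w\<in>W. rl w (f s) (s w))" ..
    show ?thesis
    proof (rule that[of f])
      fix s assume s: "s \<in> \<Gamma>"
      note fs = bspec[OF f s]
      show "transc (f s)" by (rule conjunct1[OF fs])
      show "ev (f s) R = R" by (rule conjunct1[OF conjunct2[OF fs]])
      show "s x = x" if "f s = XX" "x \<in> carrier E" for x
        by (rule bspec[OF mp[OF conjunct1[OF conjunct2[OF conjunct2[OF fs]]] that(1)] that(2)])
      show "rl w (f s) (s w)" if "w \<in> W" for w by (rule bspec[OF conjunct2[OF conjunct2[OF conjunct2[OF fs]]] that])
    qed
  qed
  \<comment> \<open>A rational fixed-point polynomial: outside its zeros, w is not fixed by
    s.\<close>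
  let ?k = "\<lambda>s. den (\<gamma> s) * [:0, 1:] - num (\<gamma> s)"
  let ?Z = "\<lambda>p. {w \<in> carrier E. pev E e w p = \<zero>\<^bsub>E\<^esub>}"
  have k0: "?k s \<noteq> 0" if "\<gamma> s \<noteq> XX" for s
  proof
    assume "?k s = 0"
    then have n: "den (\<gamma> s) * [:0, 1:] = num (\<gamma> s)" by (simp only: right_minus_eq)
    have "Fract (num (\<gamma> s)) (den (\<gamma> s)) = Fract [:0, 1:] 1"
      unfolding eq_fract(1)[OF num_den(2) one_neq_zero] mult_1_right mult.commute[of "[:0, 1:]"] by (rule n[symmetric])
    then show False using that unfolding num_den(1) XX_def by contradiction
  qed
  have "XX \<in> gen (insert R (set bs))" by (simp add: gU)
  from gen_spec[OF this] obtain B where B0: "finite B \<and>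
    (\<forall>w\<in>carrier E - B. \<exists>y. rl w XX y \<and> y \<in> generate_field E {z. \<exists>s\<in>insert R (set bs). rl w s z})" ..
  note B = conjunct1[OF B0] bspec[OF conjunct2[OF B0] DiffI]
  \<comment> \<open>The poles of R and of the roots, and the fixed points of the nontrivial
    substitutions.\<close>
  define B1 B2 where "B1 = (\<Union>s\<in>insert R (set bs). ?Z (den s))" and "B2 = (\<Union>s\<in>{s \<in> \<Gamma>. \<gamma> s \<noteq> XX}. ?Z (?k s))"
  have "finite B1" unfolding B1_def by (rule finite_UN_I[OF _ pev_roots_finite[OF num_den(2)]]) simp
  moreover have "finite B2" unfolding B2_def
  proof (rule finite_UN_I)
    show "finite {s \<in> \<Gamma>. \<gamma> s \<noteq> XX}" using fin by simp
    show "finite (?Z (?k s))" if "s \<in> {s \<in> \<Gamma>. \<gamma> s \<noteq> XX}" for s using that by (intro pev_roots_finite k0) simp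
  qed
  ultimately have "finite (B \<union> B1 \<union> B2)" using B(1) by simp
  then have "W - (B \<union> B1 \<union> B2) \<noteq> {}" using W(1) finite_subset[of W "B \<union> B1 \<union> B2"] by auto
  then obtain w where w0: "w \<in> W - (B \<union> B1 \<union> B2)" by (meson all_not_in_conv)
  then have w: "w \<in> W" "w \<notin> B" "w \<notin> B1" "w \<notin> B2" by simp_all
  have wc: "w \<in> carrier E" using w(1) W(2) by (rule rev_subsetD)
  interpret r: rspec E "rl w" by (rule rl_rspec[OF wc])
  note wB = w(2)
  have dn: "pev E e w (den s) \<noteq> \<zero>\<^bsub>E\<^esub>" if "s \<in> insert R (set bs)" for s
  proof
    assume "pev E e w (den s) = \<zero>\<^bsub>E\<^esub>"
    then have "w \<in> B1" unfolding B1_def by (intro UN_I[OF that] CollectI conjI wc)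
    then show False using w(3) by contradiction
  qed
  have kn: "pev E e w (?k s) \<noteq> \<zero>\<^bsub>E\<^esub>" if "s \<in> \<Gamma>" "\<gamma> s \<noteq> XX" for s
  proof
    assume "pev E e w (?k s) = \<zero>\<^bsub>E\<^esub>"
    then have "w \<in> B2" unfolding B2_def using that wc by (intro UN_I[of s]) simp_all
    then show False using w(4) by contradiction
  qed
  define val where "val s = pev E e w (num s) \<otimes>\<^bsub>E\<^esub> inv\<^bsub>E\<^esub> pev E e w (den s)" for s
  have val: "rl w s (val s)" if "s \<in> insert R (set bs)" for s unfolding val_def by (rule rl_val[OF wc dn[OF that]])
  define t where "t = val R"
  have tt: "rl w R t" unfolding t_def by (rule val) simp
  have tc: "t \<in> carrier E" by (rule r.carr[OF tt])
  have "s t = t" if s: "s \<in> \<Gamma>" for s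
  proof -
    have "rl w (ev (\<gamma> s) R) (s t)" by (rule rl_ev[OF wc \<gamma>(1)[OF s] \<gamma>(4)[OF s w(1)] gal_rl[OF s wc tt]])
    then have "rl w R (s t)" unfolding \<gamma>(2)[OF s] .
    then show ?thesis by (rule r.unique[OF _ tt])
  qed
  then have "t \<in> \<iota> ` carrier L" by (rule gal_fixed[OF tc])
  then obtain t0 where t0: "t0 \<in> carrier L" "t = \<iota> t0" by (elim imageE)
  define ys where "ys = map val bs"
  have l2: "list_all2 (rl w) bs ys" unfolding ys_def list_all2_conv_all_nth by (simp add: val)
  have vc: "val s \<in> carrier E" if "s \<in> insert R (set bs)" for s by (rule r.carr[OF val[OF that]])
  have ysc: "set ys \<subseteq> carrier E" unfolding ys_def set_map by (rule image_subsetI) (simp add: vc)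
  have P0: "P \<noteq> 0" using lc by auto
  have sp: "map \<iota> (specialize L \<epsilon> P t0) = lin_prod ys"
    unfolding specialize_base[OF t0(1)] t0(2)[symmetric]
  proof (rule polynomial_eqI)
    show "polynomial\<^bsub>E\<^esub> (carrier E) (map (pev E e t) (coeff_list P))"
      by (rule polynomial_map_coeff_list[OF Ef]) (use lc tc in auto)
    show "polynomial\<^bsub>E\<^esub> (carrier E) (lin_prod ys)" by (rule lin_prod(1)[OF ysc])
    fix i
    have e0: "ev R 0 = 0" using fhom_ev[OF tR] by (simp add: fhom_def rhom.zero)
    have "Polynomial.coeff (\<Prod>z\<leftarrow>bs. [:- z, 1:]) i = qev (Polynomial.coeff P i) R"
      unfolding mR[symmetric] by (simp add: coeff_map_poly e0 ev_to_fract[OF tR])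
    then have "rl w (qev (Polynomial.coeff P i) R) (coeff (lin_prod ys) i)" using r.lin_prod_rel[OF l2, of i] by simp
    from r.unique[OF this r.qev_rel[OF eE tt]] have "coeff (lin_prod ys) i = pev E e t (Polynomial.coeff P i)" .
    moreover have "coeff (map (pev E e t) (coeff_list P)) i = pev E e t (Polynomial.coeff P i)"
      by (rule coeff_map_coeff_list) simp
    ultimately show "coeff (map (pev E e t) (coeff_list P)) i = coeff (lin_prod ys) i" by simp
  qed
  let ?S = "generate_field E (\<iota> ` carrier L \<union> {w})" and ?T = "generate_field E (\<iota> ` carrier L \<union> set ys)"
  have cL: "\<iota> ` carrier L \<subseteq> carrier E" using ring_hom_closed[OF ih] by auto
  have eS: "e x \<in> ?S" for x using ring_hom_closed[OF eh, of x] by (auto simp: e_def intro: generate_field.incl)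
  have pS: "pev E e w p \<in> ?S" for p
  proof (induction p)
    case 0
    show ?case using eS[of 0] by simp
  next
    case (pCons a p)
    have "w \<in> ?S" by (rule generate_field.incl) simp
    then show ?case unfolding pev_pCons[OF wc]
      by (intro generate_field.eng_add generate_field.eng_mult eS pCons)
  qed
  have S: "?S = carrier E"
  proof (rule primitive[OF wc])
    fix s assume s: "s \<in> \<Gamma>"
    from \<gamma>(4)[OF s w(1)] obtain a b where ab: "\<gamma> s = Fract a b" "pev E e w b \<noteq> \<zero>\<^bsub>E\<^esub>"
      "s w = pev E e w a \<otimes>\<^bsub>E\<^esub> inv\<^bsub>E\<^esub> pev E e w b" unfolding spec_def by blast
    show "s w \<in> ?S" unfolding ab(3) by (intro generate_field.eng_mult generate_field.m_inv pS ab(2))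
    fix x assume sw: "s w = w" and x: "x \<in> carrier E"
    have "\<gamma> s = XX"
    proof (rule ccontr)
      assume n: "\<gamma> s \<noteq> XX"
      have rw: "rl w (\<gamma> s) w" using \<gamma>(4)[OF s w(1)] sw by simp
      let ?n = "num (\<gamma> s)" and ?d = "den (\<gamma> s)"
      have q: "rl w (to_fract p) (pev E e w p)" for p
        using r.qev_rel[OF eE rl_XX[OF wc], of p] by (simp only: to_fract_qev)
      have "to_fract (?k s) = to_fract ?d * (XX - \<gamma> s)"
      proof -
        have q: "\<gamma> s = to_fract ?n / to_fract ?d" unfolding Fract_conv_to_fract[symmetric] by (rule num_den(1)[symmetric])
        have d0: "to_fract ?d \<noteq> 0" by (simp add: num_den(2))
        have "to_fract ?d * \<gamma> s = to_fract ?n"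
          using iffD1[OF nonzero_eq_divide_eq[OF d0] q] unfolding mult.commute[of "to_fract ?d"] .
        moreover have "XX = to_fract [:0, 1:]" by (simp add: XX_def to_fract_def)
        ultimately show ?thesis by (simp only: right_diff_distrib to_fract_diff to_fract_mult)
      qed
      moreover have "rl w (to_fract ?d * (XX + - \<gamma> s)) (pev E e w ?d \<otimes>\<^bsub>E\<^esub> (w \<oplus>\<^bsub>E\<^esub> \<ominus>\<^bsub>E\<^esub> w))"
        by (intro r.mult q r.add r.neg rl_XX[OF wc] rw)
      moreover have "pev E e w ?d \<otimes>\<^bsub>E\<^esub> (w \<oplus>\<^bsub>E\<^esub> \<ominus>\<^bsub>E\<^esub> w) = \<zero>\<^bsub>E\<^esub>" using wc by (simp add: r_neg)
      ultimately have "rl w (to_fract (?k s)) \<zero>\<^bsub>E\<^esub>" by (simp only: diff_conv_add_uminus)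
      from r.unique[OF this q] kn[OF s n] show False by simp
    qed
    then show "s x = x" by (rule \<gamma>(3)[OF s _ x])
  qed
  have "w \<in> ?T"
  proof -
    obtain y where y: "rl w XX y" "y \<in> generate_field E {z. \<exists>s\<in>insert R (set bs). rl w s z}" using B(2)[OF wc wB] by blast
    have "y = w" by (rule r.unique[OF y(1) rl_XX[OF wc]])
    moreover have "{z. \<exists>s\<in>insert R (set bs). rl w s z} \<subseteq> \<iota> ` carrier L \<union> set ys"
    proof
      fix z assume "z \<in> {z. \<exists>s\<in>insert R (set bs). rl w s z}"
      then obtain s where s: "s \<in> insert R (set bs)" "rl w s z" by blast
      have "z = val s" by (rule r.unique[OF s(2) val[OF s(1)]])
      then show "z \<in> \<iota> ` carrier L \<union> set ys" using s(1) t0 by (auto simp: ys_def t_def)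
    qed
    ultimately show ?thesis using y(2) mono_generate_field[of "{z. \<exists>s\<in>insert R (set bs). rl w s z}" "\<iota> ` carrier L \<union> set ys"] cL ysc by blast
  qed
  then have wT: "\<iota> ` carrier L \<union> {w} \<subseteq> ?T" by (auto intro: generate_field.incl)
  have cc: "\<iota> ` carrier L \<union> set ys \<subseteq> carrier E" using cL ysc by simp
  have "?S \<subseteq> ?T" by (rule generate_field_min_subfield1[OF _ generate_field_is_subfield[OF cc] wT]) (use cL wc in auto)
  moreover have "?T \<subseteq> carrier E" using generate_field_in_carrier[OF cc] by blast
  ultimately have "?T = carrier E" using S by blast
  then have "splitting_field L E \<iota> (specialize L \<epsilon> P t0)"
    unfolding splitting_field_def field_extension_def sp
    using Lf Ef ih lin_prod_splitted[OF ysc] lin_prod(4)[OF ysc] by (simp only: set_mset_mset simp_thms)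
  then show ?thesis using t0(1) by blast
qed

subsection \<open>Points with prescribed conjugates\<close>

lemma quot_eq:
  assumes "x \<in> carrier E" "b \<in> carrier E" "c \<in> carrier E" "c \<noteq> \<zero>\<^bsub>E\<^esub>" "x \<otimes>\<^bsub>E\<^esub> c = b" shows "x = b \<otimes>\<^bsub>E\<^esub> inv\<^bsub>E\<^esub> c"
proof -
  have "c \<in> Units E" using assms by (simp add: field_Units)
  then have "(x \<otimes>\<^bsub>E\<^esub> c) \<otimes>\<^bsub>E\<^esub> inv\<^bsub>E\<^esub> c = x" using assms(1,3) by (simp add: m_assoc)
  then show ?thesis unfolding assms(5) by (rule sym)
qed

text \<open>All rational multiples of u change sign together with u.\<close>

lemma quadratic_points:
  assumes u: "u \<in> carrier E" "u \<noteq> \<zero>\<^bsub>E\<^esub>"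
  shows "\<exists>W. infinite W \<and> W \<subseteq> carrier E \<and> (\<forall>s\<in>\<Gamma>. s u = \<ominus>\<^bsub>E\<^esub> u \<longrightarrow> (\<forall>w\<in>W. rl w (mob (- 1, 0, 0, 1)) (s w)))"
proof (intro exI[of _ "range (\<lambda>r. e r \<otimes>\<^bsub>E\<^esub> u)"] conjI ballI impI)
  have "inj (\<lambda>r. e r \<otimes>\<^bsub>E\<^esub> u)"
    by (rule injI) (use u e_inj m_rcancel in auto)
  then show "infinite (range (\<lambda>r. e r \<otimes>\<^bsub>E\<^esub> u))" using infinite_UNIV_char_0 finite_imageD by blast
  show "range (\<lambda>r. e r \<otimes>\<^bsub>E\<^esub> u) \<subseteq> carrier E" using u by auto
  fix s w assume s: "s \<in> \<Gamma>" "s u = \<ominus>\<^bsub>E\<^esub> u" and "w \<in> range (\<lambda>r. e r \<otimes>\<^bsub>E\<^esub> u)"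
  then obtain r where w: "w = e r \<otimes>\<^bsub>E\<^esub> u" by blast
  have wc: "w \<in> carrier E" using u by (simp add: w)
  have "s w = \<ominus>\<^bsub>E\<^esub> w" using ring_hom_mult[OF gal_hom[OF s(1)], of "e r" u] gal_e[OF s(1)] s(2) u by (simp add: w r_minus)
  moreover have "mob (- 1, 0, 0, 1) = - XX" by (simp add: moebius_fraction)
  ultimately show "rl w (mob (- 1, 0, 0, 1)) (s w)" using rspec.neg[OF rl_rspec[OF wc] rl_XX[OF wc]] by simp
qed

text \<open>With f(x) = x^2 + l x this is f(x) - f(y). The parameter l is there to produce
  infinitely many points from one triple of conjugates.\<close>

definition dd :: "'l \<Rightarrow> 'l \<Rightarrow> 'l \<Rightarrow> 'l" where
  "dd l x y = (x \<ominus>\<^bsub>E\<^esub> y) \<otimes>\<^bsub>E\<^esub> (l \<oplus>\<^bsub>E\<^esub> (x \<oplus>\<^bsub>E\<^esub> y))"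

text \<open>As differences f(x) - f(y) these are antisymmetric and sum to zero around a triangle.
  The last identity distinguishes the quotients that belong to different parameters.\<close>

lemma dd:
  assumes "l \<in> carrier E" "x \<in> carrier E" "y \<in> carrier E" "z \<in> carrier E"
  shows "dd l x y \<in> carrier E" "dd l y x = \<ominus>\<^bsub>E\<^esub> dd l x y" "dd l y z \<oplus>\<^bsub>E\<^esub> dd l z x = \<ominus>\<^bsub>E\<^esub> dd l x y"
    "l \<noteq> \<ominus>\<^bsub>E\<^esub> (x \<oplus>\<^bsub>E\<^esub> y) \<Longrightarrow> x \<noteq> y \<Longrightarrow> dd l x y \<noteq> \<zero>\<^bsub>E\<^esub>"
    "m \<in> carrier E \<Longrightarrow> dd l y z \<otimes>\<^bsub>E\<^esub> dd m z x \<ominus>\<^bsub>E\<^esub> dd m y z \<otimes>\<^bsub>E\<^esub> dd l z x =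
      ((y \<ominus>\<^bsub>E\<^esub> z) \<otimes>\<^bsub>E\<^esub> (z \<ominus>\<^bsub>E\<^esub> x)) \<otimes>\<^bsub>E\<^esub> ((l \<ominus>\<^bsub>E\<^esub> m) \<otimes>\<^bsub>E\<^esub> (x \<ominus>\<^bsub>E\<^esub> y))"
proof -
  show "dd l x y \<in> carrier E" using assms by (simp add: dd_def)
  show "dd l y x = \<ominus>\<^bsub>E\<^esub> dd l x y" unfolding dd_def using assms by algebra
  show "dd l y z \<oplus>\<^bsub>E\<^esub> dd l z x = \<ominus>\<^bsub>E\<^esub> dd l x y" unfolding dd_def using assms by algebra
  show "dd l x y \<noteq> \<zero>\<^bsub>E\<^esub>" if "l \<noteq> \<ominus>\<^bsub>E\<^esub> (x \<oplus>\<^bsub>E\<^esub> y)" "x \<noteq> y"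
  proof
    assume "dd l x y = \<zero>\<^bsub>E\<^esub>"
    then have z: "(x \<ominus>\<^bsub>E\<^esub> y) \<otimes>\<^bsub>E\<^esub> (l \<oplus>\<^bsub>E\<^esub> (x \<oplus>\<^bsub>E\<^esub> y)) = \<zero>\<^bsub>E\<^esub>" unfolding dd_def .
    have c: "x \<ominus>\<^bsub>E\<^esub> y \<in> carrier E" "l \<oplus>\<^bsub>E\<^esub> (x \<oplus>\<^bsub>E\<^esub> y) \<in> carrier E" using assms(1-3) by simp_all
    from integral[OF z c] show False
    proof
      assume "x \<ominus>\<^bsub>E\<^esub> y = \<zero>\<^bsub>E\<^esub>"
      then show False using that(2) assms(2,3) by simp
    next
      assume "l \<oplus>\<^bsub>E\<^esub> (x \<oplus>\<^bsub>E\<^esub> y) = \<zero>\<^bsub>E\<^esub>"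
      from minus_equality[OF this a_closed[OF assms(2,3)] assms(1)] show False using that(1) by simp
    qed
  qed
  show "dd l y z \<otimes>\<^bsub>E\<^esub> dd m z x \<ominus>\<^bsub>E\<^esub> dd m y z \<otimes>\<^bsub>E\<^esub> dd l z x =
      ((y \<ominus>\<^bsub>E\<^esub> z) \<otimes>\<^bsub>E\<^esub> (z \<ominus>\<^bsub>E\<^esub> x)) \<otimes>\<^bsub>E\<^esub> ((l \<ominus>\<^bsub>E\<^esub> m) \<otimes>\<^bsub>E\<^esub> (x \<ominus>\<^bsub>E\<^esub> y))" if m: "m \<in> carrier E"
  proof -
    have 1: "(A \<otimes>\<^bsub>E\<^esub> P) \<otimes>\<^bsub>E\<^esub> (B \<otimes>\<^bsub>E\<^esub> Q) \<ominus>\<^bsub>E\<^esub> (A \<otimes>\<^bsub>E\<^esub> P') \<otimes>\<^bsub>E\<^esub> (B \<otimes>\<^bsub>E\<^esub> Q') = (A \<otimes>\<^bsub>E\<^esub> B) \<otimes>\<^bsub>E\<^esub> (P \<otimes>\<^bsub>E\<^esub> Q \<ominus>\<^bsub>E\<^esub> P' \<otimes>\<^bsub>E\<^esub> Q')"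
      if "A \<in> carrier E" "B \<in> carrier E" "P \<in> carrier E" "Q \<in> carrier E" "P' \<in> carrier E" "Q' \<in> carrier E" for A B P Q P' Q'
      using that by (simp add: a_minus_def r_distr r_minus m_ac)
    have 2: "(l \<oplus>\<^bsub>E\<^esub> p) \<otimes>\<^bsub>E\<^esub> (m \<oplus>\<^bsub>E\<^esub> q) \<ominus>\<^bsub>E\<^esub> (m \<oplus>\<^bsub>E\<^esub> p) \<otimes>\<^bsub>E\<^esub> (l \<oplus>\<^bsub>E\<^esub> q) = (l \<ominus>\<^bsub>E\<^esub> m) \<otimes>\<^bsub>E\<^esub> (q \<ominus>\<^bsub>E\<^esub> p)"
      if "p \<in> carrier E" "q \<in> carrier E" for p q
      using assms(1) m that by algebra
    have 3: "(z \<oplus>\<^bsub>E\<^esub> x) \<ominus>\<^bsub>E\<^esub> (y \<oplus>\<^bsub>E\<^esub> z) = x \<ominus>\<^bsub>E\<^esub> y" using assms(2-4) by algebra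
    have c: "y \<ominus>\<^bsub>E\<^esub> z \<in> carrier E" "z \<ominus>\<^bsub>E\<^esub> x \<in> carrier E" "y \<oplus>\<^bsub>E\<^esub> z \<in> carrier E" "z \<oplus>\<^bsub>E\<^esub> x \<in> carrier E"
      using assms(2-4) by simp_all
    show ?thesis unfolding dd_def
      by (subst 1) (simp_all add: c m assms(1) 2[OF c(3,4)] 3)
  qed
qed

lemma gal_dd:
  assumes "s \<in> \<Gamma>" "x \<in> carrier E" "y \<in> carrier E"
  shows "s (dd (e r) x y) = dd (e r) (s x) (s y)"
proof -
  interpret h: ring_hom_cring E E s using gal_hom[OF assms(1)] is_cring by (simp add: ring_hom_cring_def ring_hom_cring_axioms_def)
  show ?thesis using assms gal_e[OF assms(1)] by (simp add: dd_def a_minus_def)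
qed

text \<open>The points are w = a/b, where a, b, c are the three cyclic differences, so a + b + c =
  0. A 3-cycle sends w to b/c = -1/(1 + w). Exchanging x and y sends a to -b and b to -a, hence w to
  1/w.\<close>

lemma cubic_points:
  assumes y: "x \<in> carrier E" "y \<in> carrier E" "z \<in> carrier E" and d: "x \<noteq> y" "y \<noteq> z" "z \<noteq> x"
  shows "\<exists>W. infinite W \<and> W \<subseteq> carrier E \<and>
    (\<forall>s\<in>\<Gamma>. s x = y \<longrightarrow> s y = z \<longrightarrow> s z = x \<longrightarrow> (\<forall>w\<in>W. rl w (mob (0, - 1, 1, 1)) (s w))) \<and>
    (\<forall>s\<in>\<Gamma>. s x = y \<longrightarrow> s y = x \<longrightarrow> s z = z \<longrightarrow> (\<forall>w\<in>W. rl w (mob (0, 1, 1, 0)) (s w)))"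
proof -
  define a b c where "a r = dd (e r) y z" and "b r = dd (e r) z x" and "c r = dd (e r) x y" for r
  define w where "w r = a r \<otimes>\<^bsub>E\<^esub> inv\<^bsub>E\<^esub> b r" for r
  \<comment> \<open>The rational parameters for which none of the three differences vanishes; at
    most three values are excluded.\<close>
  define N where "N = - (e -` {\<ominus>\<^bsub>E\<^esub> (y \<oplus>\<^bsub>E\<^esub> z), \<ominus>\<^bsub>E\<^esub> (z \<oplus>\<^bsub>E\<^esub> x), \<ominus>\<^bsub>E\<^esub> (x \<oplus>\<^bsub>E\<^esub> y)})"
  have ec: "e r \<in> carrier E" for r by simp
  have car: "a r \<in> carrier E" "b r \<in> carrier E" "c r \<in> carrier E" for r
    unfolding a_def b_def c_def using dd(1)[OF ec] y by blast+
  have nz: "a r \<noteq> \<zero>\<^bsub>E\<^esub>" "b r \<noteq> \<zero>\<^bsub>E\<^esub>" "c r \<noteq> \<zero>\<^bsub>E\<^esub>" if "r \<in> N" for r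
    unfolding a_def b_def c_def using that dd(4)[OF ec y(2,3) y(1) _ d(2)] dd(4)[OF ec y(3,1) y(1) _ d(3)] dd(4)[OF ec y(1,2) y(1) _ d(1)]
    by (auto simp: N_def)
  have bU: "b r \<in> Units E" if "r \<in> N" for r using nz[OF that] car by (simp add: field_Units)
  have wc: "w r \<in> carrier E" if "r \<in> N" for r unfolding w_def using bU[OF that] car by simp
  have wb: "w r \<otimes>\<^bsub>E\<^esub> b r = a r" if "r \<in> N" for r unfolding w_def using bU[OF that] car by (simp add: m_assoc)
  have ab: "a r \<oplus>\<^bsub>E\<^esub> b r = \<ominus>\<^bsub>E\<^esub> c r" for r unfolding a_def b_def c_def by (rule dd(3)[OF ec y])
  have inj: "inj_on w N"
  proof (rule inj_onI)
    fix r s assume rs: "r \<in> N" "s \<in> N" "w r = w s"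
    have "a r \<otimes>\<^bsub>E\<^esub> b s = a s \<otimes>\<^bsub>E\<^esub> b r"
      unfolding wb[OF rs(1), symmetric] wb[OF rs(2), symmetric] rs(3) using wc[OF rs(2)] car by (simp add: m_ac)
    then have z: "a r \<otimes>\<^bsub>E\<^esub> b s \<ominus>\<^bsub>E\<^esub> a s \<otimes>\<^bsub>E\<^esub> b r = \<zero>\<^bsub>E\<^esub>" using car by (simp add: a_minus_def r_neg)
    have "((y \<ominus>\<^bsub>E\<^esub> z) \<otimes>\<^bsub>E\<^esub> (z \<ominus>\<^bsub>E\<^esub> x)) \<otimes>\<^bsub>E\<^esub> ((e r \<ominus>\<^bsub>E\<^esub> e s) \<otimes>\<^bsub>E\<^esub> (x \<ominus>\<^bsub>E\<^esub> y)) = \<zero>\<^bsub>E\<^esub>"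
      using dd(5)[OF ec y ec, of r s] z by (simp add: a_def[symmetric] b_def[symmetric])
    then have "(y \<ominus>\<^bsub>E\<^esub> z) \<otimes>\<^bsub>E\<^esub> (z \<ominus>\<^bsub>E\<^esub> x) = \<zero>\<^bsub>E\<^esub> \<or> (e r \<ominus>\<^bsub>E\<^esub> e s) \<otimes>\<^bsub>E\<^esub> (x \<ominus>\<^bsub>E\<^esub> y) = \<zero>\<^bsub>E\<^esub>"
      by (rule integral) (use y in simp_all)
    then have "y \<ominus>\<^bsub>E\<^esub> z = \<zero>\<^bsub>E\<^esub> \<or> z \<ominus>\<^bsub>E\<^esub> x = \<zero>\<^bsub>E\<^esub> \<or> e r \<ominus>\<^bsub>E\<^esub> e s = \<zero>\<^bsub>E\<^esub> \<or> x \<ominus>\<^bsub>E\<^esub> y = \<zero>\<^bsub>E\<^esub>"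
      using integral[of "y \<ominus>\<^bsub>E\<^esub> z" "z \<ominus>\<^bsub>E\<^esub> x"] integral[of "e r \<ominus>\<^bsub>E\<^esub> e s" "x \<ominus>\<^bsub>E\<^esub> y"] y
      by (meson ec minus_closed)
    then have "e r = e s" using y d by simp
    then show "r = s" by (simp add: e_inj)
  qed
  have "finite (e -` {\<ominus>\<^bsub>E\<^esub> (y \<oplus>\<^bsub>E\<^esub> z), \<ominus>\<^bsub>E\<^esub> (z \<oplus>\<^bsub>E\<^esub> x), \<ominus>\<^bsub>E\<^esub> (x \<oplus>\<^bsub>E\<^esub> y)})"
    by (rule finite_vimageI) (auto simp: e_inj inj_on_def)
  then have "infinite N" unfolding N_def using infinite_UNIV_char_0[where 'a = rat] by (metis finite_compl)
  then have inf: "infinite (w ` N)" using finite_imageD[OF _ inj] by blast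
  have D: "rl (w r) (mob (0, - 1, 1, 1)) (s (w r))" if s: "s \<in> \<Gamma>" "s x = y" "s y = z" "s z = x" and r: "r \<in> N" for s r
  proof -
    interpret rr: rspec E "rl (w r)" by (rule rl_rspec[OF wc[OF r]])
    note W = wc[OF r]
    have "(\<one>\<^bsub>E\<^esub> \<oplus>\<^bsub>E\<^esub> w r) \<otimes>\<^bsub>E\<^esub> b r = \<ominus>\<^bsub>E\<^esub> c r"
      using wb[OF r] ab[of r] car[of r] W by (simp add: l_distr a_comm)
    have cU: "c r \<in> Units E" using nz[OF r] car by (simp add: field_Units)
    have "(\<one>\<^bsub>E\<^esub> \<oplus>\<^bsub>E\<^esub> w r) \<otimes>\<^bsub>E\<^esub> (\<ominus>\<^bsub>E\<^esub> (b r \<otimes>\<^bsub>E\<^esub> inv\<^bsub>E\<^esub> c r)) = \<ominus>\<^bsub>E\<^esub> (((\<one>\<^bsub>E\<^esub> \<oplus>\<^bsub>E\<^esub> w r) \<otimes>\<^bsub>E\<^esub> b r) \<otimes>\<^bsub>E\<^esub> inv\<^bsub>E\<^esub> c r)"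
      using W car cU by (simp add: r_minus m_assoc)
    also have "\<dots> = \<one>\<^bsub>E\<^esub>" unfolding \<open>(\<one>\<^bsub>E\<^esub> \<oplus>\<^bsub>E\<^esub> w r) \<otimes>\<^bsub>E\<^esub> b r = \<ominus>\<^bsub>E\<^esub> c r\<close> using car cU by (simp add: l_minus)
    finally have one: "(\<one>\<^bsub>E\<^esub> \<oplus>\<^bsub>E\<^esub> w r) \<otimes>\<^bsub>E\<^esub> (\<ominus>\<^bsub>E\<^esub> (b r \<otimes>\<^bsub>E\<^esub> inv\<^bsub>E\<^esub> c r)) = \<one>\<^bsub>E\<^esub>" .
    have iv: "inv\<^bsub>E\<^esub> (\<one>\<^bsub>E\<^esub> \<oplus>\<^bsub>E\<^esub> w r) = \<ominus>\<^bsub>E\<^esub> (b r \<otimes>\<^bsub>E\<^esub> inv\<^bsub>E\<^esub> c r)" by (rule comm_inv_char[OF _ _ one]) (use W car cU in auto)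
    have n1: "\<one>\<^bsub>E\<^esub> \<oplus>\<^bsub>E\<^esub> w r \<noteq> \<zero>\<^bsub>E\<^esub>"
    proof
      assume "\<one>\<^bsub>E\<^esub> \<oplus>\<^bsub>E\<^esub> w r = \<zero>\<^bsub>E\<^esub>"
      then show False using one car cU by simp
    qed
    have "rl (w r) (- inverse (1 + XX)) (\<ominus>\<^bsub>E\<^esub> (inv\<^bsub>E\<^esub> (\<one>\<^bsub>E\<^esub> \<oplus>\<^bsub>E\<^esub> w r)))"
      by (rule rr.neg[OF rr.minv[OF rr.add[OF rr.one rl_XX[OF W]] n1]])
    moreover have "\<ominus>\<^bsub>E\<^esub> (inv\<^bsub>E\<^esub> (\<one>\<^bsub>E\<^esub> \<oplus>\<^bsub>E\<^esub> w r)) = b r \<otimes>\<^bsub>E\<^esub> inv\<^bsub>E\<^esub> c r" unfolding iv using car cU by simp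
    moreover have "s (w r) = b r \<otimes>\<^bsub>E\<^esub> inv\<^bsub>E\<^esub> c r"
    proof (rule quot_eq[OF gal_carr[OF s(1) W]])
      have "s (w r) \<otimes>\<^bsub>E\<^esub> s (b r) = s (a r)" using ring_hom_mult[OF gal_hom[OF s(1)] W car(2)[of r]] wb[OF r] by simp
      moreover have "s (b r) = c r" "s (a r) = b r"
        unfolding a_def b_def c_def using gal_dd[OF s(1)] y s by simp_all
      ultimately show "s (w r) \<otimes>\<^bsub>E\<^esub> c r = b r" by simp
    qed (use car nz[OF r] in auto)
    moreover have "mob (0, - 1, 1, 1) = - inverse (1 + XX)" by (simp add: moebius_fraction add.commute divide_inverse of_rat_minus)
    ultimately show ?thesis by simp
  qed
  have T: "rl (w r) (mob (0, 1, 1, 0)) (s (w r))" if s: "s \<in> \<Gamma>" "s x = y" "s y = x" "s z = z" and r: "r \<in> N" for s r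
  proof -
    interpret rr: rspec E "rl (w r)" by (rule rl_rspec[OF wc[OF r]])
    note W = wc[OF r]
    have aU: "a r \<in> Units E" using nz[OF r] car by (simp add: field_Units)
    have "w r \<otimes>\<^bsub>E\<^esub> (b r \<otimes>\<^bsub>E\<^esub> inv\<^bsub>E\<^esub> a r) = (w r \<otimes>\<^bsub>E\<^esub> b r) \<otimes>\<^bsub>E\<^esub> inv\<^bsub>E\<^esub> a r" using W car aU by (simp add: m_assoc)
    also have "\<dots> = \<one>\<^bsub>E\<^esub>" unfolding wb[OF r] using aU by simp
    finally have one: "w r \<otimes>\<^bsub>E\<^esub> (b r \<otimes>\<^bsub>E\<^esub> inv\<^bsub>E\<^esub> a r) = \<one>\<^bsub>E\<^esub>" .
    have iv: "inv\<^bsub>E\<^esub> (w r) = b r \<otimes>\<^bsub>E\<^esub> inv\<^bsub>E\<^esub> a r" by (rule comm_inv_char[OF _ _ one]) (use W car aU in auto)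
    have n1: "w r \<noteq> \<zero>\<^bsub>E\<^esub>"
    proof
      assume "w r = \<zero>\<^bsub>E\<^esub>"
      then show False using one car aU by simp
    qed
    have "rl (w r) (inverse XX) (inv\<^bsub>E\<^esub> (w r))" by (rule rr.minv[OF rl_XX[OF W] n1])
    moreover have "s (w r) = b r \<otimes>\<^bsub>E\<^esub> inv\<^bsub>E\<^esub> a r"
    proof (rule quot_eq[OF gal_carr[OF s(1) W]])
      have "s (w r) \<otimes>\<^bsub>E\<^esub> s (b r) = s (a r)" using ring_hom_mult[OF gal_hom[OF s(1)] W car(2)[of r]] wb[OF r] by simp
      moreover have "s (b r) = \<ominus>\<^bsub>E\<^esub> a r" "s (a r) = \<ominus>\<^bsub>E\<^esub> b r"
        unfolding a_def b_def using gal_dd[OF s(1)] y s dd(2)[OF ec[of r] y(2,3) y(1)] dd(2)[OF ec[of r] y(3,1) y(1)] by simp_all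
      ultimately have "\<ominus>\<^bsub>E\<^esub> (s (w r) \<otimes>\<^bsub>E\<^esub> a r) = \<ominus>\<^bsub>E\<^esub> b r" using car gal_carr[OF s(1) W] by (simp add: r_minus)
      then show "s (w r) \<otimes>\<^bsub>E\<^esub> a r = b r" using car gal_carr[OF s(1) W] by (metis minus_minus m_closed)
    qed (use car nz[OF r] in auto)
    moreover have "mob (0, 1, 1, 0) = inverse XX" by (simp add: moebius_fraction divide_inverse)
    ultimately show ?thesis by (simp add: iv)
  qed
  show ?thesis
    by (rule exI[of _ "w ` N"]) (use inf wc D T in \<open>auto simp del: mob.simps\<close>)
qed

end

subsection \<open>From the three families to generic\<close>

definition fixes_rf :: "rat poly fract \<Rightarrow> rat poly fract \<Rightarrow> bool" where
  "fixes_rf R g \<longleftrightarrow> transc g \<and> ev g R = R"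

lemma fixes_rf_comp:
  assumes "fixes_rf R g" "fixes_rf R h" shows "fixes_rf R (ev g h)"
  using assms ev_ev[of g h R] transc_fhom[OF fhom_ev, of g h] by (simp add: fixes_rf_def)

lemma mob_not_XX:
  "mob (- 1, 0, 0, 1) \<noteq> XX" "mob (0, - 1, 1, 1) \<noteq> XX" "ev (mob (0, - 1, 1, 1)) (mob (0, - 1, 1, 1)) \<noteq> XX"
  "mob (0, 1, 1, 0) \<noteq> XX" "ev (mob (0, - 1, 1, 1)) (mob (0, 1, 1, 0)) \<noteq> XX"
  "ev (ev (mob (0, - 1, 1, 1)) (mob (0, - 1, 1, 1))) (mob (0, 1, 1, 0)) \<noteq> XX"
proof -
  have e: "ev (mob (0, - 1, 1, 1)) (mob (0, - 1, 1, 1)) = mob (- 1, - 1, 1, 0)"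
    "ev (mob (0, - 1, 1, 1)) (mob (0, 1, 1, 0)) = mob (1, 1, 0, - 1)"
    "ev (mob (- 1, - 1, 1, 0)) (mob (0, 1, 1, 0)) = mob (1, 0, - 1, - 1)"
    by (simp_all add: ev_mob_mob del: mob.simps)
  show "mob (- 1, 0, 0, 1) \<noteq> XX" "mob (0, - 1, 1, 1) \<noteq> XX" "ev (mob (0, - 1, 1, 1)) (mob (0, - 1, 1, 1)) \<noteq> XX"
    "mob (0, 1, 1, 0) \<noteq> XX" "ev (mob (0, - 1, 1, 1)) (mob (0, 1, 1, 0)) \<noteq> XX"
    "ev (ev (mob (0, - 1, 1, 1)) (mob (0, - 1, 1, 1))) (mob (0, 1, 1, 0)) \<noteq> XX"
    unfolding e mob_XX[symmetric] by (simp_all add: moebius_eq_iff)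
qed

text \<open>p is the cycle 1 |-> 2 |-> 3 |-> 1 and q exchanges 1 and 2; every element is a power of
  p, possibly followed on the right by q.\<close>

lemma sym3_elements:
  defines "q \<equiv> transpose (1 :: nat) 2" and "p \<equiv> transpose (1 :: nat) 2 \<circ> transpose 2 3"
  shows "carrier (sym_group 3) = {id, p, p \<circ> p, q, p \<circ> q, p \<circ> p \<circ> q}"
    "p \<circ> (p \<circ> p) = id" "q \<circ> q = id" "q \<circ> p = p \<circ> p \<circ> q" "p \<noteq> id" "q \<noteq> id"
proof -
  have pm: "q permutes {1..3}" "p permutes {1..3}"
    unfolding p_def q_def by (intro permutes_compose permutes_swap_id; simp)+
  have v: "p 1 = 2" "p 2 = 3" "p 3 = 1" "q 1 = 2" "q 2 = 1" "q 3 = 3"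
    unfolding p_def q_def by (simp_all add: transpose_def)
  have o: "p i = i" "q i = i" if "i \<notin> {1, 2, 3}" for i using that unfolding p_def q_def by (auto simp: transpose_def)
  have ext: "f = g" if "f 1 = g 1" "f 2 = g 2" "f 3 = g 3" "\<And>i. i \<notin> {1, 2, 3} \<Longrightarrow> f i = g i" for f g :: "nat \<Rightarrow> nat"
  proof
    fix i show "f i = g i" using that by (cases "i \<in> {1, 2, 3}") auto
  qed
  show "p \<circ> (p \<circ> p) = id" "q \<circ> q = id" "q \<circ> p = p \<circ> p \<circ> q" by (rule ext; simp add: v o del: One_nat_def)+
  have "distinct (map (\<lambda>f. (f 1, f 2)) [id, p, p \<circ> p, q, p \<circ> q, p \<circ> p \<circ> q])" by (simp add: v del: One_nat_def)
  then have d: "distinct [id, p, p \<circ> p, q, p \<circ> q, p \<circ> p \<circ> q]" unfolding distinct_map by (rule conjunct1)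
  then show "p \<noteq> id" "q \<noteq> id" by auto
  have sub: "set [id, p, p \<circ> p, q, p \<circ> q, p \<circ> p \<circ> q] \<subseteq> carrier (sym_group 3)"
    using pm by (simp add: sym_group_def permutes_id permutes_compose)
  have "finite (carrier (sym_group 3))" using finite_permutations[of "{1..3::nat}"] by (simp add: sym_group_def)
  moreover have "card (set [id, p, p \<circ> p, q, p \<circ> q, p \<circ> p \<circ> q]) = card (carrier (sym_group 3))"
    unfolding distinct_card[OF d] sym_group_card_carrier by (simp add: fact_numeral)
  ultimately have "set [id, p, p \<circ> p, q, p \<circ> q, p \<circ> p \<circ> q] = carrier (sym_group 3)"
    using sub by (intro card_subset_eq)
  then show "carrier (sym_group 3) = {id, p, p \<circ> p, q, p \<circ> q, p \<circ> p \<circ> q}" by simp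
qed

context galois_ext
begin

lemma gal_iso:
  assumes "is_iso (galois_group L E \<iota>) H"
  shows "\<exists>f. inj_on f \<Gamma> \<and> f ` \<Gamma> = carrier H \<and> (\<forall>s\<in>\<Gamma>. \<forall>t\<in>\<Gamma>. f (s \<bullet> t) = monoid.mult H (f s) (f t))"
proof -
  obtain f where "f \<in> iso (galois_group L E \<iota>) H" using assms by (auto simp: is_iso_def)
  then show ?thesis by (intro exI[of _ f]) (auto simp: iso_def hom_def bij_betw_def)
qed

text \<open>The identity of the Galois group belongs to the rational function X. Every other element
  comes with a different function, which is what makes it move a general w.\<close>

lemma specialize_param:
  assumes W: "infinite W" "W \<subseteq> carrier E" and m: "model (fract_poly P) R bs" and lc: "lead_coeff P = 1"
    and g: "\<And>s. s \<in> \<Gamma> \<Longrightarrow> (\<forall>x\<in>carrier E. s x = x) \<or> (\<exists>g. fixes_rf R g \<and> g \<noteq> XX \<and> (\<forall>w\<in>W. rl w g (s w)))"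
  shows "\<exists>t\<in>carrier L. splitting_field L E \<iota> (specialize L \<epsilon> P t)"
proof (rule specialize_model[OF W m lc])
  fix s assume "s \<in> \<Gamma>"
  from g[OF this] show "\<exists>g. transc g \<and> ev g R = R \<and> (g = XX \<longrightarrow> (\<forall>x\<in>carrier E. s x = x)) \<and> (\<forall>w\<in>W. rl w g (s w))"
  proof
    assume s: "\<forall>x\<in>carrier E. s x = x"
    have "rl w XX (s w)" if "w \<in> W" for w
    proof -
      have wc: "w \<in> carrier E" using that W(2) by blast
      then show ?thesis using rl_XX[OF wc] s by simp
    qed
    then show ?thesis using s by (intro exI[of _ XX]) (simp add: transc_XX ev_id)
  next
    assume "\<exists>g. fixes_rf R g \<and> g \<noteq> XX \<and> (\<forall>w\<in>W. rl w g (s w))"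
    then obtain g where g: "fixes_rf R g" "g \<noteq> XX" "\<forall>w\<in>W. rl w g (s w)" by (elim exE conjE)
    then show ?thesis by (intro exI[of _ g]) (simp add: fixes_rf_def)
  qed
qed

lemma gal_moves:
  assumes "s \<in> \<Gamma>" "t \<in> \<Gamma>" "s \<noteq> t" "\<And>x. x \<in> carrier E \<Longrightarrow> t x = x"
  obtains x where "x \<in> carrier E" "s x \<noteq> x"
  using gal_ext[OF assms(1,2)] assms(3,4) by metis

lemma specialize_order2:
  assumes X: "is_iso (galois_group L E \<iota>) (integer_mod_group 2)" and m: "model (fract_poly P) R bs" and lc: "lead_coeff P = 1"
    and R: "fixes_rf R (mob (- 1, 0, 0, 1))"
  shows "\<exists>t\<in>carrier L. splitting_field L E \<iota> (specialize L \<epsilon> P t)"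
proof -
  have c: "carrier (integer_mod_group 2) = {0, 1}" by (auto simp: carrier_integer_mod_group)
  from gal_iso[OF X] obtain f where f0: "inj_on f \<Gamma> \<and> f ` \<Gamma> = carrier (integer_mod_group 2) \<and>
    (\<forall>s\<in>\<Gamma>. \<forall>t\<in>\<Gamma>. f (s \<bullet> t) = monoid.mult (integer_mod_group 2) (f s) (f t))" ..
  then have f: "inj_on f \<Gamma>" "f ` \<Gamma> = {0, 1}" "\<And>s t. s \<in> \<Gamma> \<Longrightarrow> t \<in> \<Gamma> \<Longrightarrow> f (s \<bullet> t) = (f s + f t) mod 2"
    unfolding c by simp_all
  have eq: "s = t" if "s \<in> \<Gamma>" "t \<in> \<Gamma>" "f s = f t" for s t using f(1) that by (auto dest: inj_onD)
  have "0 \<in> f ` \<Gamma>" "1 \<in> f ` \<Gamma>" using f(2) by simp_all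
  then obtain u r where u: "u \<in> \<Gamma>" "f u = 0" and r: "r \<in> \<Gamma>" "f r = 1" by (metis imageE)
  have u1: "u x = x" if "x \<in> carrier E" for x
    by (rule gal_idem[OF u(1) _ that], rule eq) (use u f(3) gal_mult(1) in auto)
  have "r \<bullet> r = u" by (rule eq) (use u r f(3) gal_mult(1) in auto)
  then have rr: "r (r x) = x" if "x \<in> carrier E" for x using gal_mult(2)[OF r(1) r(1) that] u1[OF that] by simp
  have "r \<noteq> u" using u r by auto
  then obtain x where x: "x \<in> carrier E" "r x \<noteq> x" using gal_moves[OF r(1) u(1) _ u1] by metis
  note rx = gal_carr[OF r(1) x(1)]
  \<comment> \<open>Nonzero, and its sign is changed by r because r has order two.\<close>
  define v where "v = x \<ominus>\<^bsub>E\<^esub> r x"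
  have v: "v \<in> carrier E" "v \<noteq> \<zero>\<^bsub>E\<^esub>" unfolding v_def using x rx by auto
  interpret h: ring_hom_cring E E r using gal_hom[OF r(1)] is_cring by (simp add: ring_hom_cring_def ring_hom_cring_axioms_def)
  have rv: "r v = \<ominus>\<^bsub>E\<^esub> v" unfolding v_def using x(1) rx rr[OF x(1)] by (simp add: a_minus_def minus_add a_comm)
  from quadratic_points[OF v] obtain W where W: "infinite W" "W \<subseteq> carrier E"
    "\<forall>s\<in>\<Gamma>. s v = \<ominus>\<^bsub>E\<^esub> v \<longrightarrow> (\<forall>w\<in>W. rl w (mob (- 1, 0, 0, 1)) (s w))" by (elim exE conjE)
  show ?thesis
  proof (rule specialize_param[OF W(1,2) m lc])
    fix s assume s: "s \<in> \<Gamma>"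
    then have "f s = 0 \<or> f s = 1" using f(2) by blast
    then have "s = u \<or> s = r" using eq s u r by metis
    then show "(\<forall>x\<in>carrier E. s x = x) \<or> (\<exists>g. fixes_rf R g \<and> g \<noteq> XX \<and> (\<forall>w\<in>W. rl w g (s w)))"
    proof
      assume "s = r"
      then show ?thesis using W(3) r(1) rv R mob_not_XX(1) by (intro disjI2 exI[of _ "mob (- 1, 0, 0, 1)"]) (simp del: mob.simps)
    qed (simp add: u1)
  qed
qed

lemma specialize_order3:
  assumes X: "is_iso (galois_group L E \<iota>) (integer_mod_group 3)" and m: "model (fract_poly P) R bs" and lc: "lead_coeff P = 1"
    and R: "fixes_rf R (mob (0, - 1, 1, 1))"
  shows "\<exists>t\<in>carrier L. splitting_field L E \<iota> (specialize L \<epsilon> P t)"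
proof -
  have c: "carrier (integer_mod_group 3) = {0, 1, 2}" by (auto simp: carrier_integer_mod_group)
  from gal_iso[OF X] obtain f where f0: "inj_on f \<Gamma> \<and> f ` \<Gamma> = carrier (integer_mod_group 3) \<and>
    (\<forall>s\<in>\<Gamma>. \<forall>t\<in>\<Gamma>. f (s \<bullet> t) = monoid.mult (integer_mod_group 3) (f s) (f t))" ..
  then have f: "inj_on f \<Gamma>" "f ` \<Gamma> = {0, 1, 2}" "\<And>s t. s \<in> \<Gamma> \<Longrightarrow> t \<in> \<Gamma> \<Longrightarrow> f (s \<bullet> t) = (f s + f t) mod 3"
    unfolding c by simp_all
  have eq: "s = t" if "s \<in> \<Gamma>" "t \<in> \<Gamma>" "f s = f t" for s t using f(1) that by (auto dest: inj_onD)
  have "0 \<in> f ` \<Gamma>" "1 \<in> f ` \<Gamma>" using f(2) by simp_all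
  then obtain u r where u: "u \<in> \<Gamma>" "f u = 0" and r: "r \<in> \<Gamma>" "f r = 1" by (metis imageE)
  have u1: "u x = x" if "x \<in> carrier E" for x
    by (rule gal_idem[OF u(1) _ that], rule eq) (use u f(3) gal_mult(1) in auto)
  note r2 = gal_mult(1)[OF r(1) r(1)]
  have f2: "f (r \<bullet> r) = 2" using f(3)[OF r(1) r(1)] r by simp
  have "r \<bullet> (r \<bullet> r) = u" by (rule eq) (use u r r2 f2 f(3)[OF r(1) r2] gal_mult(1)[OF r(1) r2] in auto)
  then have r3: "r (r (r x)) = x" if "x \<in> carrier E" for x
    using gal_mult(2)[OF r(1) r2 that] gal_mult(2)[OF r(1) r(1) that] u1[OF that] by simp
  have "r \<noteq> u" using u r by auto
  then obtain x where x: "x \<in> carrier E" "r x \<noteq> x" using gal_moves[OF r(1) u(1) _ u1] by metis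
  note c1 = gal_carr[OF r(1) x(1)] and c2 = gal_carr[OF r(1) gal_carr[OF r(1) x(1)]]
  have d: "x \<noteq> r x" "r x \<noteq> r (r x)" "r (r x) \<noteq> x"
  proof -
    show "x \<noteq> r x" using x by simp
    show "r x \<noteq> r (r x)" using gal_inj[OF r(1) x(1) c1] x by metis
    show "r (r x) \<noteq> x" using r3[OF x(1)] x by metis
  qed
  from cubic_points[OF x(1) c1 c2 d] obtain W where W: "infinite W" "W \<subseteq> carrier E"
    "\<forall>s\<in>\<Gamma>. s x = r x \<longrightarrow> s (r x) = r (r x) \<longrightarrow> s (r (r x)) = x \<longrightarrow> (\<forall>w\<in>W. rl w (mob (0, - 1, 1, 1)) (s w))" by (elim exE conjE)
  let ?D = "mob (0, - 1, 1, 1)"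
  have D: "rl w ?D (r w)" if "w \<in> W" for w using W(3) r(1) r3[OF x(1)] that by blast
  have D2: "rl w (ev ?D ?D) ((r \<bullet> r) w)" if "w \<in> W" for w
    by (rule gal_compose[OF r(1) r(1)]) (use D that W(2) R in \<open>auto simp: fixes_rf_def simp del: mob.simps\<close>)
  show ?thesis
  proof (rule specialize_param[OF W(1,2) m lc])
    fix s assume s: "s \<in> \<Gamma>"
    then have "f s = 0 \<or> f s = 1 \<or> f s = 2" using f(2) by blast
    then have "s = u \<or> s = r \<or> s = r \<bullet> r" using eq s u r r2 f2 by metis
    then show "(\<forall>x\<in>carrier E. s x = x) \<or> (\<exists>g. fixes_rf R g \<and> g \<noteq> XX \<and> (\<forall>w\<in>W. rl w g (s w)))"
    proof (elim disjE)
      assume "s = r"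
      then show ?thesis using D R mob_not_XX(2) by (intro disjI2 exI[of _ ?D]) (simp del: mob.simps)
    next
      assume "s = r \<bullet> r"
      then show ?thesis using D2 fixes_rf_comp[OF R R] mob_not_XX(3) by (intro disjI2 exI[of _ "ev ?D ?D"]) (simp del: mob.simps)
    qed (simp add: u1)
  qed
qed

text \<open>Suppose everything fixed by t were fixed by r. For s with t s = -s the square of s is
  fixed by t, so r s = s or r s = -s. In the first case r also fixes all elements negated by t,
  hence everything; the second contradicts r^3 = 1.\<close>

lemma order6_element:
  assumes r: "r \<in> \<Gamma>" and t: "t \<in> \<Gamma>" and r3: "\<And>x. x \<in> carrier E \<Longrightarrow> r (r (r x)) = x" and t2: "\<And>x. x \<in> carrier E \<Longrightarrow> t (t x) = x"
    and rn: "\<exists>x\<in>carrier E. r x \<noteq> x" and tn: "\<exists>x\<in>carrier E. t x \<noteq> x"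
  shows "\<exists>y\<in>carrier E. t y = y \<and> r y \<noteq> y"
proof (rule ccontr)
  assume "\<not> (\<exists>y\<in>carrier E. t y = y \<and> r y \<noteq> y)"
  then have F: "r y = y" if "y \<in> carrier E" "t y = y" for y using that by blast
  interpret hr: ring_hom_cring E E r using gal_hom[OF r] is_cring by (simp add: ring_hom_cring_def ring_hom_cring_axioms_def)
  interpret ht: ring_hom_cring E E t using gal_hom[OF t] is_cring by (simp add: ring_hom_cring_def ring_hom_cring_axioms_def)
  have two: "x = \<zero>\<^bsub>E\<^esub>" if "x \<in> carrier E" "x \<oplus>\<^bsub>E\<^esub> x = \<zero>\<^bsub>E\<^esub>" for x
  proof -
    have "e 2 \<otimes>\<^bsub>E\<^esub> x = \<zero>\<^bsub>E\<^esub>" using e_add[of 1 1] that by (simp add: l_distr)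
    moreover have "e 2 \<noteq> \<zero>\<^bsub>E\<^esub>" using e_inj[of 2 0] by simp
    ultimately show ?thesis using integral[of "e 2" x] that by auto
  qed
  obtain x0 where x0: "x0 \<in> carrier E" "t x0 \<noteq> x0" using tn by blast
  define s where "s = x0 \<ominus>\<^bsub>E\<^esub> t x0"
  have tc: "t x \<in> carrier E" "r x \<in> carrier E" if "x \<in> carrier E" for x using gal_carr t r that by blast+
  have s: "s \<in> carrier E" "s \<noteq> \<zero>\<^bsub>E\<^esub>" unfolding s_def using x0 tc by auto
  have tm: "t (x \<ominus>\<^bsub>E\<^esub> t x) = \<ominus>\<^bsub>E\<^esub> (x \<ominus>\<^bsub>E\<^esub> t x)" if "x \<in> carrier E" for x
    using that tc t2[OF that] by (simp add: a_minus_def minus_add a_comm)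
  have ts: "t s = \<ominus>\<^bsub>E\<^esub> s" unfolding s_def by (rule tm[OF x0(1)])
  have prodF: "r a \<otimes>\<^bsub>E\<^esub> r b = a \<otimes>\<^bsub>E\<^esub> b" if "a \<in> carrier E" "b \<in> carrier E" "t a = \<ominus>\<^bsub>E\<^esub> a" "t b = \<ominus>\<^bsub>E\<^esub> b" for a b
    using F[of "a \<otimes>\<^bsub>E\<^esub> b"] that by (simp add: l_minus r_minus)
  have "(r s \<ominus>\<^bsub>E\<^esub> s) \<otimes>\<^bsub>E\<^esub> (r s \<oplus>\<^bsub>E\<^esub> s) = r s \<otimes>\<^bsub>E\<^esub> r s \<ominus>\<^bsub>E\<^esub> s \<otimes>\<^bsub>E\<^esub> s"
  proof -
    have "(a \<ominus>\<^bsub>E\<^esub> b) \<otimes>\<^bsub>E\<^esub> (a \<oplus>\<^bsub>E\<^esub> b) = a \<otimes>\<^bsub>E\<^esub> a \<ominus>\<^bsub>E\<^esub> b \<otimes>\<^bsub>E\<^esub> b" if "a \<in> carrier E" "b \<in> carrier E" for a b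
      using that by algebra
    then show ?thesis using tc(2)[OF s(1)] s(1) by blast
  qed
  also have "\<dots> = \<zero>\<^bsub>E\<^esub>" unfolding prodF[OF s(1) s(1) ts ts] using s by (simp add: a_minus_def r_neg)
  finally have z: "(r s \<ominus>\<^bsub>E\<^esub> s) \<otimes>\<^bsub>E\<^esub> (r s \<oplus>\<^bsub>E\<^esub> s) = \<zero>\<^bsub>E\<^esub>" .
  have c: "r s \<ominus>\<^bsub>E\<^esub> s \<in> carrier E" "r s \<oplus>\<^bsub>E\<^esub> s \<in> carrier E" using s tc by simp_all
  from integral[OF z c] show False
  proof
    assume "r s \<ominus>\<^bsub>E\<^esub> s = \<zero>\<^bsub>E\<^esub>"
    then have rs: "r s = s" using s tc by simp
    obtain x where x: "x \<in> carrier E" "r x \<noteq> x" using rn by blast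
    \<comment> \<open>The t-symmetric and t-antisymmetric parts of 2x. The first is fixed by
      assumption; the second because its product with s is fixed and r s = s.\<close>
    define a b where "a = x \<oplus>\<^bsub>E\<^esub> t x" and "b = x \<ominus>\<^bsub>E\<^esub> t x"
    have abc: "a \<in> carrier E" "b \<in> carrier E" unfolding a_def b_def using x tc by simp_all
    have "t a = a" unfolding a_def using x tc t2[OF x(1)] by (simp add: a_comm)
    then have ra: "r a = a" by (rule F[OF abc(1)])
    have "t b = \<ominus>\<^bsub>E\<^esub> b" unfolding b_def by (rule tm[OF x(1)])
    from prodF[OF abc(2) s(1) this ts] have "r b \<otimes>\<^bsub>E\<^esub> s = b \<otimes>\<^bsub>E\<^esub> s" by (simp add: rs)
    then have rb: "r b = b" using m_rcancel[OF s(2,1) tc(2)[OF abc(2)] abc(2)] by simp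
    have ab: "a \<oplus>\<^bsub>E\<^esub> b = x \<oplus>\<^bsub>E\<^esub> x" unfolding a_def b_def using x(1) tc(1)[OF x(1)] by algebra
    have "r (x \<oplus>\<^bsub>E\<^esub> x) = x \<oplus>\<^bsub>E\<^esub> x" unfolding ab[symmetric] using abc ra rb by simp
    then have e2: "r x \<oplus>\<^bsub>E\<^esub> r x = x \<oplus>\<^bsub>E\<^esub> x" using x by simp
    have "(p \<ominus>\<^bsub>E\<^esub> x) \<oplus>\<^bsub>E\<^esub> (p \<ominus>\<^bsub>E\<^esub> x) = (p \<oplus>\<^bsub>E\<^esub> p) \<ominus>\<^bsub>E\<^esub> (x \<oplus>\<^bsub>E\<^esub> x)" if "p \<in> carrier E" for p using that x(1) by algebra
    from this[OF tc(2)[OF x(1)]] have "(r x \<ominus>\<^bsub>E\<^esub> x) \<oplus>\<^bsub>E\<^esub> (r x \<ominus>\<^bsub>E\<^esub> x) = \<zero>\<^bsub>E\<^esub>"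
      unfolding e2 using x(1) by (simp add: a_minus_def r_neg)
    then have "r x \<ominus>\<^bsub>E\<^esub> x = \<zero>\<^bsub>E\<^esub>" by (rule two[rotated]) (use x tc in simp)
    then show False using x tc by simp
  next
    assume "r s \<oplus>\<^bsub>E\<^esub> s = \<zero>\<^bsub>E\<^esub>"
    from minus_equality[OF this s(1) tc(2)[OF s(1)]] have rs: "r s = \<ominus>\<^bsub>E\<^esub> s" by simp
    have "r (r (r s)) = \<ominus>\<^bsub>E\<^esub> s" using s by (simp add: rs)
    then have "s = \<ominus>\<^bsub>E\<^esub> s" using r3[OF s(1)] by simp
    then have "s \<oplus>\<^bsub>E\<^esub> s = \<zero>\<^bsub>E\<^esub>" using r_neg[OF s(1)] by simp
    then show False using two[OF s(1)] s(2) by simp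
  qed
qed

text \<open>An element fixed by the transposition t but not by r has three conjugates under the
  powers of r, and the group permutes them as the symmetric group does.\<close>

lemma specialize_sym3:
  assumes X: "is_iso (galois_group L E \<iota>) (sym_group 3)" and m: "model (fract_poly P) R bs" and lc: "lead_coeff P = 1"
    and R: "fixes_rf R (mob (0, - 1, 1, 1))" "fixes_rf R (mob (0, 1, 1, 0))"
  shows "\<exists>t\<in>carrier L. splitting_field L E \<iota> (specialize L \<epsilon> P t)"
proof -
  define p q where "p = transpose (1 :: nat) 2 \<circ> transpose 2 3" and "q = transpose (1 :: nat) 2"
  note pq = sym3_elements[folded p_def, folded q_def]
  from gal_iso[OF X] obtain f where f0: "inj_on f \<Gamma> \<and> f ` \<Gamma> = carrier (sym_group 3) \<and>
    (\<forall>s\<in>\<Gamma>. \<forall>t\<in>\<Gamma>. f (s \<bullet> t) = monoid.mult (sym_group 3) (f s) (f t))" ..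
  then have f: "inj_on f \<Gamma>" "f ` \<Gamma> = carrier (sym_group 3)"
    "\<And>s t. s \<in> \<Gamma> \<Longrightarrow> t \<in> \<Gamma> \<Longrightarrow> f (s \<bullet> t) = f s \<circ> f t" by (simp_all add: sym_group_def)
  have eq: "s = t" if "s \<in> \<Gamma>" "t \<in> \<Gamma>" "f s = f t" for s t using f(1) that by (auto dest: inj_onD)
  have im: "id \<in> f ` \<Gamma>" "p \<in> f ` \<Gamma>" "q \<in> f ` \<Gamma>" unfolding f(2) pq(1) by simp_all
  from im(1) obtain u where u: "u \<in> \<Gamma>" "f u = id" by (elim imageE) simp
  from im(2) obtain r where r: "r \<in> \<Gamma>" "f r = p" by (elim imageE) simp
  from im(3) obtain t where t: "t \<in> \<Gamma>" "f t = q" by (elim imageE) simp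
  have u1: "u x = x" if "x \<in> carrier E" for x
    by (rule gal_idem[OF u(1) _ that], rule eq) (use u f(3) gal_mult(1) in auto)
  note r2 = gal_mult(1)[OF r(1) r(1)] and rt = gal_mult(1)[OF r(1) t(1)] and rrt = gal_mult(1)[OF gal_mult(1)[OF r(1) r(1)] t(1)]
  have f2: "f (r \<bullet> r) = p \<circ> p" "f (r \<bullet> t) = p \<circ> q" using f(3) r t by simp_all
  have f3: "f (r \<bullet> r \<bullet> t) = p \<circ> p \<circ> q" using f(3)[OF r2 t(1)] f2 t by simp
  have "r \<bullet> (r \<bullet> r) = u" by (rule eq[OF gal_mult(1)[OF r(1) r2] u(1)]) (simp add: f(3)[OF r(1) r2] f2 r u pq(2))
  then have r3: "r (r (r x)) = x" if "x \<in> carrier E" for x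
    using gal_mult(2)[OF r(1) r2 that] gal_mult(2)[OF r(1) r(1) that] u1[OF that] by simp
  have "t \<bullet> t = u" by (rule eq[OF gal_mult(1)[OF t(1) t(1)] u(1)]) (simp add: f(3)[OF t(1) t(1)] t u pq(3))
  then have t2: "t (t x) = x" if "x \<in> carrier E" for x using gal_mult(2)[OF t(1) t(1) that] u1[OF that] by simp
  have "t \<bullet> r = r \<bullet> r \<bullet> t" by (rule eq[OF gal_mult(1)[OF t(1) r(1)] rrt]) (simp add: f(3)[OF t(1) r(1)] f3 t r pq(4))
  then have tr: "t (r x) = r (r (t x))" if "x \<in> carrier E" for x
    using gal_mult(2)[OF t(1) r(1) that] gal_mult(2)[OF r2 t(1) that] gal_mult(2)[OF r(1) r(1) gal_carr[OF t(1) that]] by simp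
  have nu: "r \<noteq> u" "t \<noteq> u" using u(2) r(2) t(2) pq(5,6) by metis+
  have "\<exists>x\<in>carrier E. r x \<noteq> x" by (rule gal_moves[OF r(1) u(1) nu(1) u1]) (assumption, erule (1) bexI[rotated])
  moreover have "\<exists>x\<in>carrier E. t x \<noteq> x" by (rule gal_moves[OF t(1) u(1) nu(2) u1]) (assumption, erule (1) bexI[rotated])
  ultimately obtain y where y: "y \<in> carrier E" "t y = y" "r y \<noteq> y"
    using order6_element[OF r(1) t(1) r3 t2] by blast
  note c1 = gal_carr[OF r(1) y(1)] and c2 = gal_carr[OF r(1) gal_carr[OF r(1) y(1)]]
  have d: "r y \<noteq> r (r y)" "r (r y) \<noteq> y" "y \<noteq> r y"
  proof -
    show "y \<noteq> r y" using y by simp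
    show "r y \<noteq> r (r y)" using gal_inj[OF r(1) y(1) c1] y by metis
    show "r (r y) \<noteq> y" using r3[OF y(1)] y by metis
  qed
  have ty: "t (r y) = r (r y)" "t (r (r y)) = r y"
    using tr[OF y(1)] y(2) t2[OF c1] by simp_all
  let ?D = "mob (0, - 1, 1, 1)" and ?T = "mob (0, 1, 1, 0)"
  \<comment> \<open>In the order r y, r r y, y the transposition t exchanges the first two and fixes
    the third, as \<open>cubic_points\<close> requires.\<close>
  from cubic_points[OF c1 c2 y(1) d] obtain W where W: "infinite W" "W \<subseteq> carrier E"
    "\<forall>s\<in>\<Gamma>. s (r y) = r (r y) \<longrightarrow> s (r (r y)) = y \<longrightarrow> s y = r y \<longrightarrow> (\<forall>w\<in>W. rl w ?D (s w))"
    "\<forall>s\<in>\<Gamma>. s (r y) = r (r y) \<longrightarrow> s (r (r y)) = r y \<longrightarrow> s y = y \<longrightarrow> (\<forall>w\<in>W. rl w ?T (s w))" by (elim exE conjE)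
  have D: "rl w ?D (r w)" if "w \<in> W" for w
    using bspec[OF W(3) r(1)] r3[OF y(1)] that by (simp del: mob.simps)
  have T: "rl w ?T (t w)" if "w \<in> W" for w
    using bspec[OF W(4) t(1)] ty y(2) that by (simp del: mob.simps)
  have tD: "transc ?D" using R(1) by (simp add: fixes_rf_def del: mob.simps)
  note RD = fixes_rf_comp[OF R(1) R(1)]
  have tDD: "transc (ev ?D ?D)" using RD by (simp add: fixes_rf_def del: mob.simps)
  have wc: "w \<in> carrier E" if "w \<in> W" for w using that W(2) by blast
  have D2: "rl w (ev ?D ?D) ((r \<bullet> r) w)" if "w \<in> W" for w
    by (rule gal_compose[OF r(1) r(1) wc[OF that] tD D[OF that] D[OF that]])
  have DT: "rl w (ev ?D ?T) ((r \<bullet> t) w)" if "w \<in> W" for w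
    by (rule gal_compose[OF r(1) t(1) wc[OF that] tD D[OF that] T[OF that]])
  have DDT: "rl w (ev (ev ?D ?D) ?T) ((r \<bullet> r \<bullet> t) w)" if "w \<in> W" for w
    by (rule gal_compose[OF r2 t(1) wc[OF that] tDD D2[OF that] T[OF that]])
  show ?thesis
  proof (rule specialize_param[OF W(1,2) m lc])
    fix s assume s: "s \<in> \<Gamma>"
    have "f s \<in> {id, p, p \<circ> p, q, p \<circ> q, p \<circ> p \<circ> q}" using s f(2) pq(1) by blast
    then show "(\<forall>x\<in>carrier E. s x = x) \<or> (\<exists>g. fixes_rf R g \<and> g \<noteq> XX \<and> (\<forall>w\<in>W. rl w g (s w)))"
    proof (elim insertE emptyE)
      assume "f s = id"
      then have "s = u" using eq[OF s u(1)] u(2) by simp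
      then show ?thesis by (simp add: u1)
    next
      assume "f s = p"
      then have "s = r" using eq[OF s r(1)] r(2) by simp
      then show ?thesis using D R(1) mob_not_XX(2) by (intro disjI2 exI[of _ ?D]) (simp del: mob.simps)
    next
      assume "f s = p \<circ> p"
      then have "s = r \<bullet> r" using eq[OF s r2] f2 by simp
      then show ?thesis using D2 RD mob_not_XX(3) by (intro disjI2 exI[of _ "ev ?D ?D"]) (simp del: mob.simps)
    next
      assume "f s = q"
      then have "s = t" using eq[OF s t(1)] t(2) by simp
      then show ?thesis using T R(2) mob_not_XX(4) by (intro disjI2 exI[of _ ?T]) (simp del: mob.simps)
    next
      assume "f s = p \<circ> q"
      then have "s = r \<bullet> t" using eq[OF s rt] f2 by simp
      then show ?thesis using DT fixes_rf_comp[OF R] mob_not_XX(5) by (intro disjI2 exI[of _ "ev ?D ?T"]) (simp del: mob.simps)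
    next
      assume "f s = p \<circ> p \<circ> q"
      then have "s = r \<bullet> r \<bullet> t" using eq[OF s rrt] f3 by simp
      then show ?thesis using DDT fixes_rf_comp[OF RD R(2)] mob_not_XX(6) by (intro disjI2 exI[of _ "ev (ev ?D ?D) ?T"]) (simp del: mob.simps)
    qed
  qed
qed

end

text \<open>R is the inverse of M applied to J: the image of T for which \<mu>(T) becomes J. It
  inherits all invariances of J.\<close>

lemma family_invariant:
  assumes J: "transc J" and M: "dt M \<noteq> 0"
  defines "R \<equiv> ev J (mob (adj M))"
  shows "transc R" "ev R (mob M) = J" "transc g \<Longrightarrow> ev g J = J \<Longrightarrow> fixes_rf R g"
proof -
  have t: "transc (mob (adj M))" using M by (intro mob_nonrat(2)) (simp add: dt_adj)
  show "transc R" unfolding R_def using transc_fhom[OF fhom_ev[OF J]] t by simp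
  show "ev R (mob M) = J" unfolding R_def using ev_ev[OF J t, of "mob M"] mob_adj(1)[OF M] by (simp add: ev_XX[OF J])
  show "fixes_rf R g" if "transc g" "ev g J = J" unfolding R_def fixes_rf_def using that ev_ev[OF that(1) J] by simp
qed

lemma generic_polyI:
  fixes G :: "'g monoid"
  assumes iso: "G \<cong> H" and fin: "finite (carrier G)"
    and sp: "\<And>(L :: 'l ring) E \<iota> \<epsilon>. galois_ext L E \<iota> \<epsilon> \<Longrightarrow> galois_group L E \<iota> \<cong> H \<Longrightarrow>
      \<exists>t\<in>carrier L. splitting_field L E \<iota> (specialize L \<epsilon> P t)"
  shows "generic_poly TYPE('l) G P"
  unfolding generic_poly_def parametric_poly_def
proof (intro allI impI, elim conjE)
  fix L E :: "'l ring" and \<epsilon> \<iota>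
  assume a: "field_extension (ring_of_type_algebra :: rat ring) L \<epsilon>" "finite_galois_extension L E \<iota>" "galois_group L E \<iota> \<cong> G"
  have "finite (carrier (galois_group L E \<iota>))" using a(3) fin by (auto simp: is_iso_def iso_def bij_betw_finite)
  then have "galois_ext L E \<iota> \<epsilon>" using a by (simp add: galois_ext_def)
  then show "\<exists>t\<in>carrier L. splitting_field L E \<iota> (specialize L \<epsilon> P t)" by (rule sp) (rule iso_trans[OF a(3) iso])
qed

text \<open>The listed polynomial has an explicit model, which identifies F with Q(X). Hence P has a
  model with the same R, and the invariance of R matches the points constructed for each of the
  three groups.\<close>

theorem families_generic:
  fixes G :: "'g monoid" and F :: "'f ring"
  assumes fin: "finite (carrier G)" and lc: "lead_coeff P = 1" and sp: "splitting_field QT F \<iota> (coeff_list (fract_poly P))"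
    and M: "dt M \<noteq> 0"
    and cs: "G \<cong> integer_mod_group 2 \<and> splitting_field QT F \<iota> (coeff_list [:- mob M, 0, 1:]) \<or>
        G \<cong> integer_mod_group 3 \<and> splitting_field QT F \<iota> (coeff_list [:1, mob M - 3, - mob M, 1:]) \<or>
        G \<cong> sym_group 3 \<and> splitting_field QT F \<iota> (coeff_list [:mob M, mob M, 0, 1:])"
  shows "generic_poly TYPE('l) G P"
proof -
  have F: "field F" using sp by (simp add: splitting_field_def field_extension_def)
  have lcf: "lead_coeff (fract_poly P) = 1" using lc by (simp add: degree_map_poly coeff_map_poly)
  \<comment> \<open>From a model of the listed polynomial to a model of P, through the common
    splitting field F.\<close>
  have pull: "\<exists>bs. model (fract_poly P) R bs"
    if "model C R cs" "splitting_field QT F \<iota> (coeff_list C)" "lead_coeff C = 1" for C R cs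
  proof -
    from splitting_model_iso[OF that] obtain f where "f \<in> ring_hom ring_of_type_algebra F" "range f = carrier F" "\<And>x. f (ev R x) = \<iota> x" by blast
    from model_pullback[OF F this(1,2) model_transc[OF that(1)] this(3) sp lcf] show ?thesis .
  qed
  have tJ: "transc J2" "transc J3" "transc J6" using J_nonrat poly_fract_transc by blast+
  note fi = family_invariant[OF _ M]
  from cs show ?thesis
  proof (elim disjE conjE)
    assume X: "G \<cong> integer_mod_group 2" and C: "splitting_field QT F \<iota> (coeff_list [:- mob M, 0, 1:])"
    from pull[OF model_families(1)[OF fi(1,2)[OF tJ(1)]] C] obtain bs where m: "model (fract_poly P) (ev J2 (mob (adj M))) bs" by auto
    have R: "fixes_rf (ev J2 (mob (adj M))) (mob (- 1, 0, 0, 1))" by (rule fi(3)[OF tJ(1) mob_nonrat(2) invJ(1)]) simp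
    show ?thesis by (rule generic_polyI[OF X fin]) (rule galois_ext.specialize_order2[OF _ _ m lc R])
  next
    assume X: "G \<cong> integer_mod_group 3" and C: "splitting_field QT F \<iota> (coeff_list [:1, mob M - 3, - mob M, 1:])"
    from pull[OF model_families(2)[OF fi(1,2)[OF tJ(2)]] C] obtain bs where m: "model (fract_poly P) (ev J3 (mob (adj M))) bs" by auto
    have R: "fixes_rf (ev J3 (mob (adj M))) (mob (0, - 1, 1, 1))" by (rule fi(3)[OF tJ(2) mob_nonrat(2) invJ(2)]) simp
    show ?thesis by (rule generic_polyI[OF X fin]) (rule galois_ext.specialize_order3[OF _ _ m lc R])
  next
    assume X: "G \<cong> sym_group 3" and C: "splitting_field QT F \<iota> (coeff_list [:mob M, mob M, 0, 1:])"
    from pull[OF model_families(3)[OF fi(1,2)[OF tJ(3)]] C] obtain bs where m: "model (fract_poly P) (ev J6 (mob (adj M))) bs" by auto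
    have R: "fixes_rf (ev J6 (mob (adj M))) (mob (0, - 1, 1, 1))" by (rule fi(3)[OF tJ(3) mob_nonrat(2) invJ(3)]) simp
    have R': "fixes_rf (ev J6 (mob (adj M))) (mob (0, 1, 1, 0))" by (rule fi(3)[OF tJ(3) mob_nonrat(2) invJ(4)]) simp
    show ?thesis by (rule generic_polyI[OF X fin]) (rule galois_ext.specialize_sym3[OF _ _ m lc R R'])
  qed
qed

theorem corollary1p3:
  fixes G :: "'g monoid" and P :: "rat poly poly"
    and F :: "'f ring" and \<iota> :: "rat poly fract \<Rightarrow> 'f"
  assumes "infinite (UNIV :: 'l set)"
    and "group G" and "finite (carrier G)" and "carrier G \<noteq> {\<one>\<^bsub>G\<^esub>}"
    and "lead_coeff P = 1" and "separable_poly (fract_poly P)"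
    and "splitting_field QT F \<iota> (coeff_list (fract_poly P))"
    and "galois_group QT F \<iota> \<cong> G"
  shows "generic_poly TYPE('l) G P \<longleftrightarrow>
    (\<exists>a b c d :: rat. a * d - b * c \<noteq> 0 \<and>
      (let \<mu> = moebius a b c d in
        G \<cong> integer_mod_group 2 \<and>
          splitting_field QT F \<iota> (coeff_list [:- \<mu>, 0, 1:]) \<or>
        G \<cong> integer_mod_group 3 \<and>
          splitting_field QT F \<iota> (coeff_list [:1, \<mu> - 3, - \<mu>, 1:]) \<or>
        G \<cong> sym_group 3 \<and>
          splitting_field QT F \<iota> (coeff_list [:\<mu>, \<mu>, 0, 1:])))"
    (is "?g \<longleftrightarrow> ?r")
proof
  assume ?g
  then show ?r by (rule generic_families[OF assms(1-5,7,8)])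
next
  assume ?r
  then obtain a b c d :: rat where M: "dt (a, b, c, d) \<noteq> 0"
    and cs: "G \<cong> integer_mod_group 2 \<and> splitting_field QT F \<iota> (coeff_list [:- mob (a, b, c, d), 0, 1:]) \<or>
        G \<cong> integer_mod_group 3 \<and> splitting_field QT F \<iota> (coeff_list [:1, mob (a, b, c, d) - 3, - mob (a, b, c, d), 1:]) \<or>
        G \<cong> sym_group 3 \<and> splitting_field QT F \<iota> (coeff_list [:mob (a, b, c, d), mob (a, b, c, d), 0, 1:])"
    unfolding Let_def by auto
  show ?g by (rule families_generic[OF assms(3,5,7) M cs])
qed

end
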